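(* For $j=1,2$, let $\boldsymbol{\varphi_j}=(\lambda_jx+a_{ji})_{i=1}^{m_j}$ be an iterated function system on $\mathbb{R}$ (with $0<|\lambda_j|<1$, $a_{ji}\in\mathbb{R}$) satisfying the strong separation condition, with $\frac{\log|\lambda_2|}{\log|\lambda_1|}\notin\mathbb{Q}$ and $\frac{\log m_1}{|\log|\lambda_1||}+\frac{\log m_2}{|\log|\lambda_2||}>1$. Let $\mu_j$ be a self-similar measure on $\boldsymbol{\varphi_j}$. For $p>1$ and $q\ge2p'$, let $$p_0=\frac{q(p-1)}{q(p-1)-p}$$ (which satisfies $p_0\le2$). If $D_{p_0}(\mu_1)+D_{p_0}(\mu_2)>1$, then there exists a set $E\subseteq\mathbb{R}$ of Hausdorff dimension zero such that for all $u\in\mathbb{R}\setminus E$ the estimate $$\|\widehat{f\,d\mu_1}\,\widehat{g\,dT_u\mu_2}\|_{L^q(\mathbb{R})}\lesssim\|f\|_{L^p(d\mu_1)}\|g\|_{L^p(dT_u\mu_2)}$$ holds for all $f\in L^p(d\mu_1)$, $g\in L^p(dT_u\mu_2)$, where $T_u(x)=ux$.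
   Context: For a finite Borel measure $\mu$ on $\mathbb{R}$ and $f\in L^1(\mu)$, $\widehat{f\,d\mu}(\xi)=\int f(x)e^{-2\pi ix\xi}\,d\mu(x)$. $p'$ is the Hölder conjugate of $p$. $A\lesssim B$ means $A\le CB$ for a constant $0<C<\infty$, here independent of $f,g$. $T_u\mu_2$ is the push-forward of $\mu_2$ under $T_u$. When $q=\infty$, $p_0$ is read as $1$. An iterated function system (IFS) on $\mathbb{R}$ of the form $(\varphi_i)_{i=1}^m$, $\varphi_i(x)=\lambda x+a_i$ with $0<|\lambda|<1$, has a unique non-empty compact attractor $K$ with $K=\bigcup_{i=1}^m\varphi_i(K)$. It satisfies the strong separation condition if $\varphi_i(K)\cap\varphi_j(K)=\varnothing$ whenever $i\ne j$. Given a probability vector $(p_i)_{i=1}^m$, the associated self-similar measure is the unique Borel probability measure $\mu$ on $K$ with $\mu=\sum_{i=1}^mp_i\,\varphi_i\mu$, where $\varphi_i\mu$ denotes push-forward. $L^s$-dimension (of a measure on $\mathbb{R}$): for $s>1$, $D_s(\mu)=\sup\big\{t\in[0,1]:\int\big(\int\frac{d\mu(y)}{|x-y|^t}\big)^{s-1}d\mu(x)<\infty\big\}$; equivalently, for $s\ge0$, $s\neq1$, $D_s(\mu)=\liminf_{r\to0}\frac{\log\int\mu(B(x,r))^{s-1}d\mu(x)}{(s-1)\log r}$; and $D_1(\mu)=\liminf_{r\to0}\frac{\int\log\mu(B(x,r))\,d\mu(x)}{\log r}$. *)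

theory Defs
  imports "HOL-Probability.Probability"
begin

section \<open>Homogeneous iterated function systems on the line\<close>

text \<open>
  A triple \<open>lam\<close>, \<open>a\<close>, \<open>m\<close> stands for the system of the maps
  \<open>x \<mapsto> lam * x + a i\<close> with \<open>i\<close> ranging over \<open>{1..m}\<close>; values of \<open>a\<close> outside this
  range are ignored.
\<close>

definition ifs_map :: "real \<Rightarrow> (nat \<Rightarrow> real) \<Rightarrow> nat \<Rightarrow> real \<Rightarrow> real" where
  "ifs_map lam a i x = lam * x + a i"

definition is_attractor :: "real \<Rightarrow> (nat \<Rightarrow> real) \<Rightarrow> nat \<Rightarrow> real set \<Rightarrow> bool" where
  "is_attractor lam a m K \<longleftrightarrow>
     compact K \<and> K \<noteq> {} \<and> K = (\<Union>i\<in>{1..m}. ifs_map lam a i ` K)"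

definition strong_separation :: "real \<Rightarrow> (nat \<Rightarrow> real) \<Rightarrow> nat \<Rightarrow> real set \<Rightarrow> bool" where
  "strong_separation lam a m K \<longleftrightarrow>
     (\<forall>i\<in>{1..m}. \<forall>j\<in>{1..m}. i \<noteq> j \<longrightarrow> ifs_map lam a i ` K \<inter> ifs_map lam a j ` K = {})"

definition self_similar_measure ::
  "real \<Rightarrow> (nat \<Rightarrow> real) \<Rightarrow> nat \<Rightarrow> real set \<Rightarrow> (nat \<Rightarrow> real) \<Rightarrow> real measure \<Rightarrow> bool" where
  "self_similar_measure lam a m K w \<mu> \<longleftrightarrow>
     sets \<mu> = sets borel \<and> prob_space \<mu> \<and> emeasure \<mu> (- K) = 0 \<and>
     (\<forall>A\<in>sets borel.
        emeasure \<mu> A =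
          (\<Sum>i=1..m. ennreal (w i) * emeasure (distr \<mu> borel (ifs_map lam a i)) A))"

definition prob_vector :: "nat \<Rightarrow> (nat \<Rightarrow> real) \<Rightarrow> bool" where
  "prob_vector m w \<longleftrightarrow> (\<forall>i\<in>{1..m}. 0 \<le> w i) \<and> (\<Sum>i=1..m. w i) = 1"


section \<open>Lebesgue spaces\<close>

text \<open>Only used for exponents \<open>a > 0\<close>.\<close>

definition ennpowr :: "ennreal \<Rightarrow> real \<Rightarrow> ennreal" where
  "ennpowr x a = (if x = \<infinity> then \<infinity> else ennreal (enn2real x powr a))"

definition Lp_norm :: "ennreal \<Rightarrow> 'a measure \<Rightarrow> ('a \<Rightarrow> complex) \<Rightarrow> ennreal" where
  "Lp_norm p M f =
     (if p = \<infinity> then esssup M (\<lambda>x. ennreal (cmod (f x)))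
      else ennpowr (\<integral>\<^sup>+ x. ennreal (cmod (f x) powr enn2real p) \<partial>M) (1 / enn2real p))"

definition Lp_space :: "ennreal \<Rightarrow> 'a measure \<Rightarrow> ('a \<Rightarrow> complex) set" where
  "Lp_space p M = {f \<in> borel_measurable M. Lp_norm p M f < \<infinity>}"

definition hoelder_conj :: "real \<Rightarrow> real" where
  "hoelder_conj p = p / (p - 1)"

text \<open>The Fourier transform of the complex measure with density \<open>f\<close> with respect to \<open>\<mu>\<close>.\<close>

definition fourier :: "real measure \<Rightarrow> (real \<Rightarrow> complex) \<Rightarrow> real \<Rightarrow> complex" where
  "fourier \<mu> f \<xi> = (\<integral>x. f x * exp (- 2 * of_real pi * \<i> * of_real x * of_real \<xi>) \<partial>\<mu>)"


section \<open>The dimensions \<open>D\<^sub>s\<close> of a measure\<close>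

text \<open>
  The kernel \<open>1 / \<bar>x - y\<bar> powr t\<close>, with value \<open>1\<close> for \<open>t = 0\<close> and value \<open>\<infinity>\<close>
  on the diagonal for \<open>t > 0\<close>. The case \<open>t = 0\<close> is separated because \<open>0 powr 0 = 0\<close>;
  for \<open>t > 0\<close> the division takes place in \<^typ>\<open>ennreal\<close>, where \<open>1 / 0 = \<infinity>\<close>.
\<close>

definition riesz_kernel :: "real \<Rightarrow> real \<Rightarrow> real \<Rightarrow> ennreal" where
  "riesz_kernel t x y = (if t = 0 then 1 else 1 / ennreal (\<bar>x - y\<bar> powr t))"

text \<open>
  For compactly supported probability measures the integrands in the cases \<open>s \<le> 1\<close> are
  integrable, so that the Bochner integral has its intended value there.
\<close>

definition Ls_dim :: "real \<Rightarrow> real measure \<Rightarrow> ereal" where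
  "Ls_dim s \<mu> =
     (if s > 1 then
        (SUP t\<in>{t\<in>{0..1}. (\<integral>\<^sup>+ x. ennpowr (\<integral>\<^sup>+ y. riesz_kernel t x y \<partial>\<mu>) (s - 1) \<partial>\<mu>) < \<infinity>}.
           ereal t)
      else if s = 1 then
        Liminf (at_right 0) (\<lambda>r. ereal ((\<integral>x. ln (measure \<mu> (ball x r)) \<partial>\<mu>) / ln r))
      else
        Liminf (at_right 0)
          (\<lambda>r. ereal (ln (\<integral>x. measure \<mu> (ball x r) powr (s - 1) \<partial>\<mu>) / ((s - 1) * ln r))))"

text \<open>The exponent \<open>p\<^sub>0 = q (p - 1) / (q (p - 1) - p)\<close>, read as \<open>1\<close> for \<open>q = \<infinity>\<close>.\<close>

definition crit_exponent :: "real \<Rightarrow> ennreal \<Rightarrow> real" where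
  "crit_exponent p q =
     (if q = \<infinity> then 1
      else enn2real q * (p - 1) / (enn2real q * (p - 1) - p))"

lemma crit_exponent_bounds:
  assumes "p > 1" and "q \<ge> ennreal (2 * hoelder_conj p)"
  shows "1 \<le> crit_exponent p q" and "crit_exponent p q \<le> 2"
proof -
  have "1 \<le> crit_exponent p q \<and> crit_exponent p q \<le> 2"
  proof (cases "q = \<infinity>")
    case True
    then show ?thesis by (simp add: crit_exponent_def)
  next
    case False
    define r where "r = enn2real q"
    have "q = ennreal r" "0 \<le> r"
      using False by (auto simp: r_def top.not_eq_extremum)
    then have "2 * (p / (p - 1)) \<le> r"
      using assms by (simp add: hoelder_conj_def)
    define t where "t = r * (p - 1)"
    have "2 * p \<le> t"
      using \<open>2 * (p / (p - 1)) \<le> r\<close> assms(1) unfolding t_def by (simp add: pos_divide_le_eq)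
    then have "t - p > 0" "p \<ge> 0" "t \<le> 2 * (t - p)"
      using assms(1) by auto
    then have "1 \<le> t / (t - p)" "t / (t - p) \<le> 2"
      by (simp_all add: pos_le_divide_eq pos_divide_le_eq)
    then show ?thesis
      using False unfolding crit_exponent_def r_def[symmetric] t_def by simp
  qed
  then show "1 \<le> crit_exponent p q" and "crit_exponent p q \<le> 2" by auto
qed


section \<open>Hausdorff dimension\<close>

definition hausdorff_pre_measure :: "real \<Rightarrow> real \<Rightarrow> 'a::metric_space set \<Rightarrow> ennreal" where
  "hausdorff_pre_measure s \<delta> E =
     (INF U\<in>{U :: nat \<Rightarrow> 'a set. E \<subseteq> (\<Union>n. U n) \<and> (\<forall>n. bounded (U n) \<and> diameter (U n) \<le> \<delta>)}.
        \<Sum>n. ennreal (diameter (U n) powr s))"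

definition hausdorff_measure :: "real \<Rightarrow> 'a::metric_space set \<Rightarrow> ennreal" where
  "hausdorff_measure s E = (SUP \<delta>\<in>{0<..}. hausdorff_pre_measure s \<delta> E)"

text \<open>
  Restricting to \<open>s > 0\<close> does not change the infimum and avoids the convention for
  \<open>diameter (U n) powr 0\<close>. The empty set has dimension zero.
\<close>

definition hausdorff_dim :: "'a::metric_space set \<Rightarrow> ennreal" where
  "hausdorff_dim E = (INF s\<in>{s. 0 < s \<and> hausdorff_measure s E = 0}. ennreal s)"

end

theory Submission
  imports Defs
begin

text \<open>
  Let \<open>\<mu>\<^sub>1\<close> be the law of \<open>\<Sum> \<lambda>\<^sub>1\<^sup>n A\<^sub>n\<close> with independent digits \<open>A\<^sub>n\<close>. Collecting the terms whose index is
  a multiple of a large \<open>k\<close> writes \<open>\<mu>\<^sub>1\<close> as a convolution \<open>\<mu>\<^sub>1' * \<nu>\<^sub>1\<close>, where \<open>\<nu>\<^sub>1\<close> is small and \<open>\<mu>\<^sub>1'\<close> has almost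
  the dimension of \<open>\<mu>\<^sub>1\<close>; likewise \<open>\<mu>\<^sub>2 = \<mu>\<^sub>2' * \<nu>\<^sub>2\<close>. Let \<open>S\<close> be multiplication by \<open>u \<noteq> 0\<close>.

  \<^item> The convolution of \<open>\<mu>\<^sub>1'\<close> and \<open>S \<mu>\<^sub>2'\<close> has full \<open>L\<^sup>q\<close> dimension for some \<open>q\<close> slightly larger than \<open>p\<^sub>0\<close>
    (\<open>q = 2\<close> if \<open>p\<^sub>0 = 2\<close>).
    Up to constants, the \<open>L\<^sup>q\<close> norms of its ball averages are submultiplicative along a renormalisation
    which rotates \<open>ln u\<close> by \<open>k ln \<bar>\<lambda>\<^sub>1\<bar>\<close> modulo \<open>k ln \<bar>\<lambda>\<^sub>2\<bar>\<close>. This is an irrational rotation, so the slopes met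
    equidistribute, and on average over the slope transversality gives the bound which the
    dimensions of the factors suggest.

  \<^item> Outside a set of \<open>u\<close> of dimension zero, the transform of the convolution of \<open>\<nu>\<^sub>1\<close> and \<open>S \<nu>\<^sub>2\<close> decays
    like a power. It is an infinite product with a factor bounded away from \<open>1\<close> whenever the current
    frequency, suitably scaled, is not close to an integer, and the \<open>u\<close> for which this happens too
    rarely are covered by few short intervals.

  The power decay improves full \<open>L\<^sup>q\<close> dimension to a bound, uniform in the scale, for the norms of
  exponent \<open>p\<^sub>0\<close> of the mollified convolution of \<open>\<mu>\<^sub>1\<close> and \<open>S \<mu>\<^sub>2\<close>. For nonnegative \<open>f\<close> and \<open>g\<close>, the product of the
  transforms is the transform of the convolution of \<open>f d\<mu>\<^sub>1\<close> and \<open>g dS\<mu>\<^sub>2\<close>, whose density is controlled by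
  Hoelder's inequality and the preceding bound; the Hausdorff--Young inequality concludes. The
  case \<open>q = \<infinity>\<close> is trivial.
\<close>

section \<open>Power means\<close>

text \<open>Full \<open>L\<^sup>q\<close> dimension bounds the mollified norms only up to a factor
  \<open>r powr - \<delta>\<close> for every \<delta> > 0, and the renormalisation does not remove
  this loss. It is beaten by a fixed power of the scale, and for that power
  \<open>\<nu>\<^sub>1\<close> and \<open>\<nu>\<^sub>2\<close> are set aside: however large k is,
  they keep some power decay, while the dimension lost by \<open>\<mu>\<^sub>1'\<close> and
  \<open>\<mu>\<^sub>2'\<close> tends to zero as k grows. The strict dimension hypothesis pays for
  that loss.

  The gain from decay is an \<open>L\<^sup>2\<close> statement. For \<open>p\<^sub>0 < 2\<close> a
  density is cut into a short and a tall part, and the tall part is small only if slightly more than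
  \<open>p\<^sub>0\<close>-integrability is known; hence the auxiliary exponent above
  \<open>p\<^sub>0\<close>. It can be raised because the hypothesis on energies is first turned into
  an inequality for sums of powers of the weights, which decrease in the exponent. The auxiliary
  exponent stays at most 2 because averaging over slopes uses that its excess over 1 is a concave
  and subadditive power.\<close>

lemma powr_mult_powr_le:
  fixes a b \<theta> :: real
  assumes "0 \<le> a" "0 \<le> b" "0 \<le> \<theta>" "\<theta> \<le> 1"
  shows "a powr \<theta> * b powr (1 - \<theta>) \<le> \<theta> * a + (1 - \<theta>) * b"
proof (cases "a = 0 \<or> b = 0")
  case True
  then show ?thesis using assms by (auto simp: mult_nonneg_nonneg)
next
  case False
  then show ?thesis using assms Youngs_inequality_0[of \<theta> "1 - \<theta>" a b] by auto
qed

text \<open>Normalising by the bounds \<open>A\<close> and \<open>B\<close> reduces Hoelder's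
  inequality to the weighted mean inequality at each point. The form suits interpolation, where the
  integrals of \<open>F\<close> and \<open>G\<close> are known only through upper bounds.\<close>

lemma nn_integral_powr_Hoelder:
  fixes F G :: "'a \<Rightarrow> real"
  assumes [measurable]: "F \<in> borel_measurable M" "G \<in> borel_measurable M"
    and F0: "\<And>x. 0 \<le> F x" and G0: "\<And>x. 0 \<le> G x"
    and \<theta>: "0 < \<theta>" "\<theta> < 1" and AB: "0 \<le> A" "0 \<le> B"
    and FA: "(\<integral>\<^sup>+x. ennreal (F x) \<partial>M) \<le> ennreal A"
    and GB: "(\<integral>\<^sup>+x. ennreal (G x) \<partial>M) \<le> ennreal B"
  shows "(\<integral>\<^sup>+x. ennreal (F x powr \<theta> * G x powr (1 - \<theta>)) \<partial>M) \<le> ennreal (A powr \<theta> * B powr (1 - \<theta>))"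
\<comment> \<open>If a bound vanishes, normalisation is impossible, but one of the factors is zero
  almost everywhere.\<close>
proof (cases "A = 0 \<or> B = 0")
  case True
  then have "(AE x in M. F x = 0) \<or> (AE x in M. G x = 0)"
  proof
    assume "A = 0"
    then have "(\<integral>\<^sup>+x. ennreal (F x) \<partial>M) = 0" using FA by auto
    then have "AE x in M. F x = 0"
      by (subst (asm) nn_integral_0_iff_AE) (auto elim!: eventually_mono simp: ennreal_eq_0_iff intro: antisym F0)
    then show ?thesis ..
  next
    assume "B = 0"
    then have "(\<integral>\<^sup>+x. ennreal (G x) \<partial>M) = 0" using GB by auto
    then have "AE x in M. G x = 0"
      by (subst (asm) nn_integral_0_iff_AE) (auto elim!: eventually_mono simp: ennreal_eq_0_iff intro: antisym G0)
    then show ?thesis ..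
  qed
  then have "AE x in M. ennreal (F x powr \<theta> * G x powr (1 - \<theta>)) = 0"
    by (auto elim!: eventually_mono)
  then have "(\<integral>\<^sup>+x. ennreal (F x powr \<theta> * G x powr (1 - \<theta>)) \<partial>M) = 0"
    by (subst nn_integral_0_iff_AE) auto
  then show ?thesis by simp
next
  case False
  then have pos: "A > 0" "B > 0" using AB by auto
  let ?c = "A powr \<theta> * B powr (1 - \<theta>)"
  have "F x powr \<theta> * G x powr (1 - \<theta>) \<le> ?c * (\<theta> * (F x / A)) + ?c * ((1 - \<theta>) * (G x / B))" for x
  proof -
    have "F x powr \<theta> * G x powr (1 - \<theta>) = ?c * ((F x / A) powr \<theta> * (G x / B) powr (1 - \<theta>))"
      using pos F0 G0 by (simp add: powr_divide)
    also have "\<dots> \<le> ?c * (\<theta> * (F x / A) + (1 - \<theta>) * (G x / B))"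
      using pos F0 G0 \<theta> by (intro mult_left_mono powr_mult_powr_le) auto
    finally show ?thesis by (simp add: algebra_simps)
  qed
  then have "(\<integral>\<^sup>+x. ennreal (F x powr \<theta> * G x powr (1 - \<theta>)) \<partial>M)
      \<le> (\<integral>\<^sup>+x. ennreal (?c * \<theta> / A) * ennreal (F x) + ennreal (?c * (1 - \<theta>) / B) * ennreal (G x) \<partial>M)"
    using pos F0 G0 \<theta> by (intro nn_integral_mono)
      (auto simp flip: ennreal_mult ennreal_plus intro!: ennreal_leI simp: mult.assoc mult_ac)
  also have "\<dots> = ennreal (?c * \<theta> / A) * (\<integral>\<^sup>+x. ennreal (F x) \<partial>M)
      + ennreal (?c * (1 - \<theta>) / B) * (\<integral>\<^sup>+x. ennreal (G x) \<partial>M)"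
    by (simp add: nn_integral_add nn_integral_cmult)
  also have "\<dots> \<le> ennreal (?c * \<theta> / A) * ennreal A + ennreal (?c * (1 - \<theta>) / B) * ennreal B"
    by (intro add_mono mult_left_mono FA GB) auto
  also have "\<dots> = ennreal (?c * \<theta> + ?c * (1 - \<theta>))"
    using pos \<theta> by (simp flip: ennreal_mult ennreal_plus)
  finally show ?thesis by (simp add: algebra_simps)
qed

text \<open>Hoelder's inequality against the constant 1. The total mass stays explicit because the
  measure may be a restriction to a ball, whose small mass is then the point of the
  estimate.\<close>

lemma powr_integral_le_nn_integral_powr:
  fixes \<phi> :: "'a \<Rightarrow> real"
  assumes "finite_measure M" and int: "integrable M \<phi>" and \<phi>0: "\<And>x. 0 \<le> \<phi> x" and q: "1 \<le> q"
  shows "ennreal ((\<integral>x. \<phi> x \<partial>M) powr q)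
    \<le> ennreal (measure M (space M) powr (q - 1)) * (\<integral>\<^sup>+x. ennreal (\<phi> x powr q) \<partial>M)"
proof -
  interpret finite_measure M by fact
  note [measurable] = borel_measurable_integrable[OF int]
  let ?m = "measure M (space M)"
  \<comment> \<open>Hoelder is applied with exponent \<open>1 / q\<close>, which must lie strictly
    below 1, and with a finite integral \<open>I\<close>; the first three cases are the degenerate
    ones.\<close>
  consider "?m = 0" | "?m > 0" "q = 1"
    | "?m > 0" "q > 1" "(\<integral>\<^sup>+x. ennreal (\<phi> x powr q) \<partial>M) = \<infinity>"
    | I where "?m > 0" "q > 1" "0 \<le> I" "(\<integral>\<^sup>+x. ennreal (\<phi> x powr q) \<partial>M) = ennreal I"
    using q measure_nonneg[of M "space M"]
    by (cases "\<integral>\<^sup>+x. ennreal (\<phi> x powr q) \<partial>M") (auto simp: less_le)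
  then show ?thesis
  proof cases
    case 1
    have "(\<integral>x. \<phi> x \<partial>M) = (\<integral>x. 0 \<partial>M)"
    proof (rule integral_cong_AE)
      have "emeasure M (space M) = 0" using 1 by (simp add: emeasure_eq_measure)
      then show "AE x in M. \<phi> x = 0"
        by (intro AE_I[of _ _ "space M"]) auto
    qed auto
    then show ?thesis by simp
  next
    case 2
    then show ?thesis using \<phi>0 by (simp add: nn_integral_eq_integral[OF int] integral_nonneg)
  next
    case 3
    then show ?thesis by (simp add: ennreal_mult_top)
  next
    case (4 I)
    have "(\<integral>\<^sup>+x. ennreal ((\<phi> x powr q) powr (1 / q) * 1 powr (1 - 1 / q)) \<partial>M)
      \<le> ennreal (I powr (1 / q) * ?m powr (1 - 1 / q))"
      using 4 by (intro nn_integral_powr_Hoelder) (auto simp: emeasure_eq_measure)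
    then have "ennreal (\<integral>x. \<phi> x \<partial>M) \<le> ennreal (I powr (1 / q) * ?m powr (1 - 1 / q))"
      using 4 \<phi>0 by (simp add: nn_integral_eq_integral[OF int] powr_powr)
    then have "(\<integral>x. \<phi> x \<partial>M) \<le> I powr (1 / q) * ?m powr (1 - 1 / q)"
      by (subst (asm) ennreal_le_iff) auto
    then have "(\<integral>x. \<phi> x \<partial>M) powr q \<le> (I powr (1 / q) * ?m powr (1 - 1 / q)) powr q"
      using q \<phi>0 by (intro powr_mono2 integral_nonneg) auto
    also have "\<dots> = ?m powr (q - 1) * I"
      using 4 by (simp add: powr_mult powr_powr left_diff_distrib)
    finally show ?thesis using 4 by (simp flip: ennreal_mult)
  qed
qed

lemma sum_powr_le_card_powr:
  fixes a :: "'i \<Rightarrow> real"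
  assumes "finite S" "\<And>i. i \<in> S \<Longrightarrow> 0 \<le> a i" "1 \<le> q"
  shows "(\<Sum>i\<in>S. a i) powr q \<le> real (card S) powr (q - 1) * (\<Sum>i\<in>S. a i powr q)"
proof -
  \<comment> \<open>The general inequality asks for nonnegativity at every point, hence the
    extension by zero outside \<open>S\<close>.\<close>
  let ?b = "\<lambda>i. if i \<in> S then a i else 0"
  have fin: "finite_measure (count_space S)"
    using assms(1) by (intro finite_measureI) (simp add: emeasure_count_space)
  have "ennreal ((\<integral>i. ?b i \<partial>count_space S) powr q)
      \<le> ennreal (measure (count_space S) (space (count_space S)) powr (q - 1))
         * (\<integral>\<^sup>+i. ennreal (?b i powr q) \<partial>count_space S)"
    using assms fin by (intro powr_integral_le_nn_integral_powr integrable_count_space) auto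
  also have "(\<integral>\<^sup>+i. ennreal (?b i powr q) \<partial>count_space S) = ennreal (\<Sum>i\<in>S. a i powr q)"
    using assms by (subst nn_integral_count_space_finite) (auto simp: sum_ennreal)
  also have "(\<integral>i. ?b i \<partial>count_space S) = (\<Sum>i\<in>S. a i)"
    using assms by (subst lebesgue_integral_count_space_finite) auto
  also have "measure (count_space S) (space (count_space S)) = real (card S)"
    using assms by (simp add: measure_def emeasure_count_space)
  also have "ennreal (real (card S) powr (q - 1)) * ennreal (\<Sum>i\<in>S. a i powr q)
      = ennreal (real (card S) powr (q - 1) * (\<Sum>i\<in>S. a i powr q))"
    by (simp add: ennreal_mult sum_nonneg)
  finally show ?thesis
    by (subst (asm) ennreal_le_iff) (auto intro!: mult_nonneg_nonneg sum_nonneg)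
qed

lemma add_powr_le:
  fixes a b :: real
  assumes "0 \<le> a" "0 \<le> b" "1 \<le> q"
  shows "(a + b) powr q \<le> 2 powr (q - 1) * (a powr q + b powr q)"
  using sum_powr_le_card_powr[of "{True, False}" "\<lambda>i. if i then a else b" q] assms by simp

lemma powr_sum_subadditive:
  fixes a :: "'i \<Rightarrow> real"
  assumes "finite S" "\<And>i. i \<in> S \<Longrightarrow> 0 \<le> a i" "0 < s" "s \<le> 1"
  shows "(\<Sum>i\<in>S. a i) powr s \<le> (\<Sum>i\<in>S. a i powr s)"
proof (cases "(\<Sum>i\<in>S. a i) = 0")
  case True
  then show ?thesis by (simp add: sum_nonneg)
next
  case False
  define T where "T = (\<Sum>i\<in>S. a i)"
  have T: "T > 0" using False assms sum_nonneg[of S a] unfolding T_def by force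
  have "a i / T * T powr s \<le> a i powr s" if "i \<in> S" for i
  proof (cases "a i = 0")
    case False
    have "a i \<le> T" unfolding T_def using assms that by (intro member_le_sum) auto
    then have "(a i / T) powr 1 \<le> (a i / T) powr s"
      using assms that T False by (intro powr_mono') auto
    then have "(a i / T) powr 1 * T powr s \<le> (a i / T) powr s * T powr s"
      by (intro mult_right_mono) auto
    then show ?thesis using T assms that False by (simp add: powr_divide)
  qed auto
  then have "(\<Sum>i\<in>S. a i / T * T powr s) \<le> (\<Sum>i\<in>S. a i powr s)" by (intro sum_mono)
  moreover have "(\<Sum>i\<in>S. a i / T * T powr s) = T powr s"
    using T by (simp add: T_def flip: sum_distrib_right sum_divide_distrib)
  ultimately show ?thesis by (simp add: T_def)
qed

text \<open>Concavity of the power \<open>s\<close>, obtained from the convex inequality for the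
  exponent \<open>1 / s\<close> applied to the numbers \<open>a i powr s\<close>.\<close>

lemma mean_powr_le_powr_mean:
  fixes a :: "'i \<Rightarrow> real"
  assumes "finite S" "S \<noteq> {}" "\<And>i. i \<in> S \<Longrightarrow> 0 \<le> a i" "0 < s" "s \<le> 1"
  shows "(\<Sum>i\<in>S. a i powr s) / card S \<le> ((\<Sum>i\<in>S. a i) / card S) powr s"
proof -
  have n: "real (card S) > 0" using assms by (simp add: card_gt_0_iff)
  have "(\<Sum>i\<in>S. a i powr s) powr (1 / s) \<le> real (card S) powr (1 / s - 1) * (\<Sum>i\<in>S. (a i powr s) powr (1 / s))"
    using assms by (intro sum_powr_le_card_powr) auto
  also have "(\<Sum>i\<in>S. (a i powr s) powr (1 / s)) = (\<Sum>i\<in>S. a i)"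
    using assms by (intro sum.cong) (auto simp: powr_powr)
  finally have "((\<Sum>i\<in>S. a i powr s) powr (1 / s)) powr s \<le> (real (card S) powr (1 / s - 1) * (\<Sum>i\<in>S. a i)) powr s"
    using assms by (intro powr_mono2) auto
  also have "\<dots> = real (card S) powr (1 - s) * (\<Sum>i\<in>S. a i) powr s"
    using assms by (simp add: powr_mult powr_powr sum_nonneg left_diff_distrib)
  finally have "(\<Sum>i\<in>S. a i powr s) \<le> real (card S) powr (1 - s) * (\<Sum>i\<in>S. a i) powr s"
    using assms by (simp add: powr_powr sum_nonneg)
  then show ?thesis using n assms
    by (simp add: powr_divide sum_nonneg powr_diff field_simps)
qed

lemma prod_le_mean_power:
  fixes a :: "'i \<Rightarrow> real"
  assumes "finite S" "S \<noteq> {}" "\<And>i. i \<in> S \<Longrightarrow> 0 \<le> a i"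
  shows "(\<Prod>i\<in>S. a i) \<le> ((\<Sum>i\<in>S. a i) / card S) ^ card S"
proof -
  have n: "card S > 0" using assms by (simp add: card_gt_0_iff)
  have "(\<Prod>i\<in>S. a i) powr (1 / card S) \<le> (\<Sum>i\<in>S. a i / card S)"
    using assms by (intro arith_geom_mean) auto
  then have "((\<Prod>i\<in>S. a i) powr (1 / card S)) ^ card S \<le> ((\<Sum>i\<in>S. a i) / card S) ^ card S"
    by (intro power_mono) (auto simp: sum_divide_distrib)
  also have "((\<Prod>i\<in>S. a i) powr (1 / card S)) ^ card S = (\<Prod>i\<in>S. a i)"
    using assms n by (cases "(\<Prod>i\<in>S. a i) = 0")
      (auto simp: powr_powr prod_nonneg simp flip: powr_realpow' powr_realpow)
  finally show ?thesis .
qed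

section \<open>Laws of linear combinations of independent variables\<close>

text \<open>The law of \<open>X + c * Y\<close> for independent \<open>X\<close> and
  \<open>Y\<close>. One operation covers convolution (\<open>c = 1\<close>), differences
  (\<open>c = -1\<close>), sums with a scaled copy, and self-similarity, which reads
  \<open>\<mu> = lcomb c D \<mu>\<close> with the digit law \<open>D\<close>.\<close>

definition lcomb :: "real \<Rightarrow> real measure \<Rightarrow> real measure \<Rightarrow> real measure" where
  "lcomb c A B = distr (A \<Otimes>\<^sub>M B) borel (\<lambda>(x, y). x + c * y)"

lemma sets_lcomb [simp, measurable_cong]: "sets (lcomb c A B) = sets borel"
  and space_lcomb [simp]: "space (lcomb c A B) = UNIV"
  by (simp_all add: lcomb_def)

context
  fixes A B :: "real measure"
  assumes A: "finite_borel_measure A" and B: "finite_borel_measure B"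
begin

interpretation A: finite_borel_measure A by (rule A)
interpretation B: finite_borel_measure B by (rule B)
interpretation AB: pair_sigma_finite A B ..

lemma measurable_lcomb_map: "(\<lambda>(x, y). x + c * y) \<in> A \<Otimes>\<^sub>M B \<rightarrow>\<^sub>M borel"
  using A.M_is_borel B.M_is_borel
  by (simp add: measurable_split_conv cong: measurable_cong_sets sets_pair_measure_cong)

lemma nn_integral_lcomb:
  assumes [measurable]: "f \<in> borel_measurable borel"
  shows "(\<integral>\<^sup>+z. f z \<partial>lcomb c A B) = (\<integral>\<^sup>+x. \<integral>\<^sup>+y. f (x + c * y) \<partial>B \<partial>A)"
  unfolding lcomb_def using measurable_lcomb_map
  by (simp add: nn_integral_distr B.nn_integral_fst[symmetric] measurable_split_conv)

lemma finite_borel_measure_lcomb: "finite_borel_measure (lcomb c A B)"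
proof -
  have "finite_measure (lcomb c A B)"
    unfolding lcomb_def using measurable_lcomb_map
    by (intro finite_measure.finite_measure_distr finite_measure_pair_measure)
       (auto intro: A.finite_measure_axioms B.finite_measure_axioms)
  then show ?thesis by (simp add: finite_borel_measure_def finite_borel_measure_axioms_def)
qed

lemma emeasure_lcomb_UNIV: "emeasure (lcomb c A B) UNIV = emeasure A UNIV * emeasure B UNIV"
  using nn_integral_lcomb[of "\<lambda>_. 1" c] A.borel_UNIV B.borel_UNIV by (simp add: mult.commute)

text \<open>Used together with \<open>Levy_uniqueness\<close>: identities between iterated
  convolutions are checked as products of characteristic functions, where rearranging is plain
  algebra.\<close>

lemma char_lcomb: "char (lcomb c A B) t = char A t * char B (c * t)"
proof -
  have "char (lcomb c A B) t = (\<integral>z. iexp (t * (fst z + c * snd z)) \<partial>(A \<Otimes>\<^sub>M B))"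
    unfolding char_def lcomb_def using measurable_lcomb_map
    by (subst integral_distr) (auto simp: case_prod_beta)
  also have "\<dots> = (\<integral>x. \<integral>y. iexp (t * (fst (x, y) + c * snd (x, y))) \<partial>B \<partial>A)"
  proof (rule AB.integral_fst'[symmetric])
    interpret P: finite_measure "A \<Otimes>\<^sub>M B"
      by (intro finite_measure_pair_measure A.finite_measure_axioms B.finite_measure_axioms)
    show "integrable (A \<Otimes>\<^sub>M B) (\<lambda>z. iexp (t * (fst z + c * snd z)))"
      by (rule P.integrable_const_bound[of _ 1]) (use A.M_is_borel B.M_is_borel in \<open>auto simp del: of_real_add of_real_mult cong: measurable_cong_sets sets_pair_measure_cong\<close>)
  qed
  also have "\<dots> = char A t * char B (c * t)"
    unfolding char_def by (simp add: algebra_simps exp_add)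
  finally show ?thesis .
qed

end

lemma real_distribution_imp_finite_borel: "real_distribution A \<Longrightarrow> finite_borel_measure A"
  by (rule real_distribution.finite_borel_measure_M)

lemma real_distribution_lcomb:
  assumes "real_distribution A" "real_distribution B"
  shows "real_distribution (lcomb c A B)"
proof -
  interpret A: real_distribution A by fact
  interpret B: real_distribution B by fact
  have "emeasure (lcomb c A B) UNIV = 1"
    using emeasure_lcomb_UNIV[OF A.finite_borel_measure_M B.finite_borel_measure_M, of c]
      A.emeasure_space_1 B.emeasure_space_1 by simp
  then show ?thesis
    by (intro real_distribution.intro real_distribution_axioms.intro prob_spaceI) auto
qed

lemma (in finite_borel_measure) cmod_char_le: "cmod (char M t) \<le> measure M UNIV"
proof -
  have "cmod (char M t) \<le> (\<integral>x. norm (iexp (t * x)) \<partial>M)"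
    unfolding char_def by (intro integral_norm_bound)
  also have "\<dots> = measure M UNIV" by (simp del: of_real_mult add: borel_UNIV)
  finally show ?thesis .
qed

section \<open>The Hausdorff--Young inequality\<close>

text \<open>The parameter \<open>a\<close> is the variance, so that convolving two Gaussian
  densities adds their parameters.\<close>

definition gauss :: "real \<Rightarrow> real \<Rightarrow> real" where
  "gauss a x = normal_density 0 (sqrt a) x"

lemma gauss_nonneg [simp]: "0 \<le> gauss a x"
  by (simp add: gauss_def)

lemma gauss_eq: "0 < a \<Longrightarrow> gauss a x = exp (- (x\<^sup>2 / (2 * a))) / sqrt (2 * pi * a)"
  by (simp add: gauss_def normal_density_def)

lemma borel_measurable_gauss [measurable]: "gauss a \<in> borel_measurable borel"
  unfolding gauss_def[abs_def] by measurable

lemma gauss_minus_commute: "gauss a (x - y) = gauss a (y - x)"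
  by (simp add: gauss_def normal_density_def power2_commute)

lemma gauss_le: "0 < a \<Longrightarrow> gauss a x \<le> 1 / sqrt (2 * pi * a)"
  by (simp add: gauss_eq divide_right_mono)

lemma nn_integral_gauss_shift:
  assumes "0 < a"
  shows "(\<integral>\<^sup>+x. ennreal (gauss a (x - s)) \<partial>lborel) = 1"
proof -
  have "(\<integral>\<^sup>+x. ennreal (gauss a x) \<partial>lborel) = 1"
    using assms unfolding gauss_def by (subst nn_integral_eq_integral) auto
  then show ?thesis
    using nn_integral_real_affine[of "\<lambda>x. ennreal (gauss a (x - s))" 1 s] by simp
qed

lemma nn_integral_gauss_mult_gauss:
  assumes "0 < a" "0 < b"
  shows "(\<integral>\<^sup>+x. ennreal (gauss a (x - s) * gauss b (x - s')) \<partial>lborel) = ennreal (gauss (a + b) (s - s'))"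
proof -
  have "(\<integral>\<^sup>+x. ennreal (gauss a (x - s) * gauss b (x - s')) \<partial>lborel)
     = (\<integral>\<^sup>+x. ennreal (gauss a (s' + x - s) * gauss b x) \<partial>lborel)"
    using nn_integral_real_affine[of "\<lambda>x. ennreal (gauss a (x - s) * gauss b (x - s'))" 1 s'] by simp
  also have "\<dots> = (\<integral>\<^sup>+x. ennreal (gauss a ((s - s') - x) * gauss b x) \<partial>lborel)"
    by (intro nn_integral_cong arg_cong[of _ _ ennreal] arg_cong2[of _ _ _ _ "(*)"])
       (auto simp: gauss_def normal_density_def power2_commute algebra_simps)
  also have "\<dots> = ennreal (gauss (a + b) (s - s'))"
    using conv_normal_density_zero_mean[of "sqrt a" "sqrt b", THEN fun_cong, of "s - s'"] assms
    by (simp add: gauss_def)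
  finally show ?thesis .
qed

lemma char_gauss:
  assumes "0 < a"
  shows "char (density lborel (gauss a)) t = of_real (exp (- (a * t\<^sup>2 / 2)))"
proof -
  have s: "sqrt a > 0" using assms by simp
  have "char (density lborel (gauss a)) t = (\<integral>x. gauss a x *\<^sub>R iexp (t * x) \<partial>lborel)"
    unfolding char_def by (subst integral_density) auto
  also have "\<dots> = \<bar>sqrt a\<bar> *\<^sub>R (\<integral>x. gauss a (0 + sqrt a * x) *\<^sub>R iexp (t * (0 + sqrt a * x)) \<partial>lborel)"
    using s by (intro lborel_integral_real_affine) auto
  also have "\<dots> = (\<integral>x. std_normal_density x *\<^sub>R iexp (t * sqrt a * x) \<partial>lborel)"
    using assms by (simp flip: integral_scaleR_right)
      (intro Bochner_Integration.integral_cong refl, simp add: gauss_eq std_normal_density_def real_sqrt_mult power_mult_distrib mult_ac)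
  also have "\<dots> = char std_normal_distribution (t * sqrt a)"
    unfolding char_def by (subst integral_density) auto
  also have "\<dots> = of_real (exp (- (a * t\<^sup>2 / 2)))"
    using assms by (simp add: char_std_normal_distribution power_mult_distrib mult.commute)
  finally show ?thesis .
qed

lemma real_distribution_gauss: "0 < a \<Longrightarrow> real_distribution (density lborel (gauss a))"
  using prob_space_normal_density[of "sqrt a" 0]
  by (auto simp: real_distribution_def real_distribution_axioms_def gauss_def[abs_def])

section \<open>Plancherel's theorem with Gaussian weights\<close>

lemma char_minus: "char \<tau> (- t) = cnj (char \<tau> t)"
proof -
  have "char \<tau> (- t) = (\<integral>x. cnj (iexp (t * x)) \<partial>\<tau>)"
    unfolding char_def by (intro Bochner_Integration.integral_cong refl) (simp add: exp_cnj)
  then show ?thesis by (simp add: char_def)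
qed

lemma (in finite_borel_measure) borel_measurable_char [measurable]: "char M \<in> borel_measurable borel"
proof -
  have [measurable_cong]: "sets M = sets borel" by (rule M_is_borel)
  show ?thesis unfolding char_def[abs_def] by measurable
qed

text \<open>Plancherel for a measure that may have no density. The weight is a multiple of the
  Gaussian density of variance \<open>1 / V\<close>, and the squared modulus of
  \<open>char \<tau>\<close> is the characteristic function of the convolution of
  \<open>\<tau>\<close> with its reflection; Fubini moves the transform from that measure to the
  Gaussian.\<close>

lemma nn_integral_char_gauss:
  assumes \<tau>: "finite_borel_measure \<tau>" and V: "0 < V"
  shows "(\<integral>\<^sup>+t. ennreal ((cmod (char \<tau> t))\<^sup>2 * exp (- (V * t\<^sup>2 / 2))) \<partial>lborel)
    = ennreal (2 * pi) * (\<integral>\<^sup>+s. \<integral>\<^sup>+s'. ennreal (gauss V (s - s')) \<partial>\<tau> \<partial>\<tau>)"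
proof -
  define \<rho> where "\<rho> = lcomb (-1) \<tau> \<tau>"
  define N where "N = density lborel (gauss (1 / V))"
  interpret \<tau>: finite_borel_measure \<tau> by fact
  interpret \<rho>: finite_borel_measure \<rho> unfolding \<rho>_def by (rule finite_borel_measure_lcomb[OF \<tau> \<tau>])
  interpret N: real_distribution N unfolding N_def using V by (intro real_distribution_gauss) simp
  interpret N\<rho>: pair_sigma_finite N \<rho> ..
  have [measurable_cong]: "sets \<rho> = sets borel" "sets N = sets borel" by (auto simp: \<rho>_def)
  have char_\<rho>: "char \<rho> t = of_real ((cmod (char \<tau> t))\<^sup>2)" for t
    unfolding \<rho>_def char_lcomb[OF \<tau> \<tau>] using char_minus[of \<tau> t]
    by (simp only: mult_minus1 complex_norm_square)
  have eq: "(\<integral>t. char \<rho> t \<partial>N) = (\<integral>x. char N x \<partial>\<rho>)"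
  proof -
    interpret P: finite_measure "N \<Otimes>\<^sub>M \<rho>"
      by (intro finite_measure_pair_measure N.finite_measure_axioms \<rho>.finite_measure_axioms)
    have "(\<integral>x. (\<integral>t. iexp (t * x) \<partial>N) \<partial>\<rho>) = (\<integral>t. (\<integral>x. iexp (t * x) \<partial>\<rho>) \<partial>N)"
      by (intro N\<rho>.Fubini_integral P.integrable_const_bound[of _ 1])
         (auto simp del: of_real_mult simp: measurable_split_conv)
    then show ?thesis unfolding char_def by (simp add: mult.commute)
  qed
  have bd: "(cmod (char \<tau> t))\<^sup>2 \<le> (measure \<tau> UNIV)\<^sup>2" for t
    by (intro power_mono \<tau>.cmod_char_le) auto
  have int: "integrable N (\<lambda>t. (cmod (char \<tau> t))\<^sup>2)"
    by (rule N.integrable_const_bound[of _ "(measure \<tau> UNIV)\<^sup>2"]) (auto simp: bd)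
  have "complex_of_real (\<integral>t. (cmod (char \<tau> t))\<^sup>2 \<partial>N) = (\<integral>t. char \<rho> t \<partial>N)"
    unfolding char_\<rho> by (rule integral_complex_of_real[symmetric])
  also have "\<dots> = of_real (\<integral>x. sqrt (2 * pi * V) * gauss V x \<partial>\<rho>)"
    unfolding eq integral_complex_of_real[symmetric]
  proof (intro Bochner_Integration.integral_cong refl)
    fix x
    have "char N x = of_real (exp (- (1 / V * x\<^sup>2 / 2)))"
      unfolding N_def using V by (intro char_gauss) simp
    then show "char N x = of_real (sqrt (2 * pi * V) * gauss V x)"
      using V by (simp add: gauss_eq[OF V] mult.commute)
  qed
  finally have eq2: "(\<integral>t. (cmod (char \<tau> t))\<^sup>2 \<partial>N) = (\<integral>x. sqrt (2 * pi * V) * gauss V x \<partial>\<rho>)"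
    by (simp only: of_real_eq_iff)
  have g: "gauss (1 / V) t * (sqrt (2 * pi) / sqrt V) = exp (- (V * t\<^sup>2 / 2))" for t
    using V by (simp add: gauss_eq real_sqrt_mult real_sqrt_divide)
  have "(\<integral>\<^sup>+t. ennreal ((cmod (char \<tau> t))\<^sup>2 * exp (- (V * t\<^sup>2 / 2))) \<partial>lborel)
      = (\<integral>\<^sup>+t. ennreal (gauss (1 / V) t) * (ennreal (sqrt (2 * pi) / sqrt V) * ennreal ((cmod (char \<tau> t))\<^sup>2)) \<partial>lborel)"
    using V unfolding g[symmetric] by (simp flip: ennreal_mult add: mult_ac)
  also have "\<dots> = ennreal (sqrt (2 * pi) / sqrt V) * (\<integral>\<^sup>+t. ennreal ((cmod (char \<tau> t))\<^sup>2) \<partial>N)"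
    unfolding N_def
    by (subst nn_integral_density) (auto simp: mult.left_commute simp flip: nn_integral_cmult)
  also have "(\<integral>\<^sup>+t. ennreal ((cmod (char \<tau> t))\<^sup>2) \<partial>N) = ennreal (\<integral>x. sqrt (2 * pi * V) * gauss V x \<partial>\<rho>)"
    by (subst nn_integral_eq_integral[OF int]) (auto simp: eq2)
  also have "\<dots> = (\<integral>\<^sup>+x. ennreal (sqrt (2 * pi * V) * gauss V x) \<partial>\<rho>)"
    using V by (intro nn_integral_eq_integral[symmetric] \<rho>.integrable_const_bound[of _ 1])
      (auto simp: gauss_eq)
  also have "\<dots> = ennreal (sqrt (2 * pi * V)) * (\<integral>\<^sup>+x. ennreal (gauss V x) \<partial>\<rho>)"
    using V by (simp add: ennreal_mult nn_integral_cmult)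
  also have "(\<integral>\<^sup>+x. ennreal (gauss V x) \<partial>\<rho>) = (\<integral>\<^sup>+s. \<integral>\<^sup>+s'. ennreal (gauss V (s - s')) \<partial>\<tau> \<partial>\<tau>)"
    unfolding \<rho>_def by (subst nn_integral_lcomb[OF \<tau> \<tau>]) auto
  also have "ennreal (sqrt (2 * pi) / sqrt V) * (ennreal (sqrt (2 * pi * V)) * X) = ennreal (2 * pi) * X" for X
  proof -
    have "sqrt (2 * pi) / sqrt V * sqrt (2 * pi * V) = 2 * pi"
      using V by (simp add: real_sqrt_mult field_simps)
    then show ?thesis using V by (simp flip: ennreal_mult mult.assoc)
  qed
  finally show ?thesis .
qed

lemma finite_borel_measure_density:
  assumes [measurable]: "F \<in> borel_measurable borel" and "(\<integral>\<^sup>+x. ennreal (F x) \<partial>lborel) < \<infinity>"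
  shows "finite_borel_measure (density lborel (\<lambda>x. ennreal (F x)))"
  using assms by (auto simp: finite_borel_measure_def finite_borel_measure_axioms_def
    emeasure_density intro!: finite_measureI)

text \<open>\<open>2ab \<le> a\<^sup>2 + b\<^sup>2\<close> replaces Young's convolution inequality here.\<close>

lemma nn_integral_gauss_density_le:
  fixes F :: "real \<Rightarrow> real"
  assumes [measurable]: "F \<in> borel_measurable borel" and F0: "\<And>x. 0 \<le> F x" and V: "0 < V"
  defines "\<tau> \<equiv> density lborel (\<lambda>x. ennreal (F x))"
  shows "(\<integral>\<^sup>+s. \<integral>\<^sup>+s'. ennreal (gauss V (s - s')) \<partial>\<tau> \<partial>\<tau>) \<le> (\<integral>\<^sup>+x. ennreal ((F x)\<^sup>2) \<partial>lborel)"
proof -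
  let ?I = "\<integral>\<^sup>+x. ennreal ((F x)\<^sup>2) \<partial>lborel"
  have "(\<integral>\<^sup>+s. \<integral>\<^sup>+s'. ennreal (gauss V (s - s')) \<partial>\<tau> \<partial>\<tau>)
      = (\<integral>\<^sup>+s. ennreal (F s) * (\<integral>\<^sup>+s'. ennreal (F s') * ennreal (gauss V (s - s')) \<partial>lborel) \<partial>lborel)"
    unfolding \<tau>_def by (simp add: nn_integral_density)
  also have "\<dots> = (\<integral>\<^sup>+s. \<integral>\<^sup>+s'. ennreal (F s * F s' * gauss V (s - s')) \<partial>lborel \<partial>lborel)"
    by (subst nn_integral_cmult[symmetric]) (auto intro!: nn_integral_cong simp: F0 ennreal_mult mult.assoc)
  also have "\<dots> \<le> (\<integral>\<^sup>+s. \<integral>\<^sup>+s'. ennreal ((F s)\<^sup>2 / 2) * ennreal (gauss V (s' - s))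
        + ennreal ((F s')\<^sup>2 / 2) * ennreal (gauss V (s - s')) \<partial>lborel \<partial>lborel)"
  proof (intro nn_integral_mono)
    fix s s' :: real
    have "F s * F s' * gauss V (s - s') \<le> ((F s)\<^sup>2 / 2 + (F s')\<^sup>2 / 2) * gauss V (s - s')"
      using sum_squares_bound[of "F s" "F s'"] by (intro mult_right_mono) auto
    then show "ennreal (F s * F s' * gauss V (s - s')) \<le> ennreal ((F s)\<^sup>2 / 2) * ennreal (gauss V (s' - s))
        + ennreal ((F s')\<^sup>2 / 2) * ennreal (gauss V (s - s'))"
      by (simp add: gauss_minus_commute[of V s' s] distrib_right ennreal_leI flip: ennreal_mult ennreal_plus)
  qed
  also have "\<dots> = (\<integral>\<^sup>+s. \<integral>\<^sup>+s'. ennreal ((F s)\<^sup>2 / 2) * ennreal (gauss V (s' - s)) \<partial>lborel \<partial>lborel)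
        + (\<integral>\<^sup>+s. \<integral>\<^sup>+s'. ennreal ((F s')\<^sup>2 / 2) * ennreal (gauss V (s - s')) \<partial>lborel \<partial>lborel)"
    by (simp add: nn_integral_add)
  also have "(\<integral>\<^sup>+s. \<integral>\<^sup>+s'. ennreal ((F s')\<^sup>2 / 2) * ennreal (gauss V (s - s')) \<partial>lborel \<partial>lborel)
     = (\<integral>\<^sup>+s'. \<integral>\<^sup>+s. ennreal ((F s')\<^sup>2 / 2) * ennreal (gauss V (s - s')) \<partial>lborel \<partial>lborel)"
    by (rule lborel_pair.Fubini') simp
  also have "(\<integral>\<^sup>+s. \<integral>\<^sup>+s'. ennreal ((F s)\<^sup>2 / 2) * ennreal (gauss V (s' - s)) \<partial>lborel \<partial>lborel)
     = (\<integral>\<^sup>+s. ennreal ((F s)\<^sup>2 / 2) \<partial>lborel)"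
    using V by (simp add: nn_integral_cmult nn_integral_gauss_shift)
  also have "(\<integral>\<^sup>+s. ennreal ((F s)\<^sup>2 / 2) \<partial>lborel) + (\<integral>\<^sup>+s. ennreal ((F s)\<^sup>2 / 2) \<partial>lborel) = ?I"
    by (subst nn_integral_add[symmetric]) (auto simp flip: ennreal_plus)
  finally show ?thesis .
qed

text \<open>\<open>nn_integral_char_gauss\<close> and \<open>nn_integral_gauss_density_le\<close>
  give the bound with a Gaussian weight, uniformly in its parameter; Fatou's lemma lets the
  parameter tend to 0.\<close>

lemma nn_integral_char_square_le:
  fixes F :: "real \<Rightarrow> real"
  assumes [measurable]: "F \<in> borel_measurable borel" and F0: "\<And>x. 0 \<le> F x"
    and fin: "(\<integral>\<^sup>+x. ennreal (F x) \<partial>lborel) < \<infinity>"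
  defines "\<tau> \<equiv> density lborel (\<lambda>x. ennreal (F x))"
  shows "(\<integral>\<^sup>+t. ennreal ((cmod (char \<tau> t))\<^sup>2) \<partial>lborel) \<le> ennreal (2 * pi) * (\<integral>\<^sup>+x. ennreal ((F x)\<^sup>2) \<partial>lborel)"
proof -
  have \<tau>: "finite_borel_measure \<tau>"
    unfolding \<tau>_def by (intro finite_borel_measure_density fin) auto
  interpret \<tau>: finite_borel_measure \<tau> by fact
  define V where "V n = 1 / real (Suc n)" for n
  define f where "f n t = ennreal ((cmod (char \<tau> t))\<^sup>2 * exp (- (V n * t\<^sup>2 / 2)))" for n t
  have V0: "V \<longlonglongrightarrow> 0"
    using LIMSEQ_inverse_real_of_nat unfolding V_def by (simp add: inverse_eq_divide)
  have "(\<lambda>n. f n t) \<longlonglongrightarrow> ennreal ((cmod (char \<tau> t))\<^sup>2)" for t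
  proof -
    have "(\<lambda>n. (cmod (char \<tau> t))\<^sup>2 * exp (- (V n * t\<^sup>2 / 2))) \<longlonglongrightarrow> (cmod (char \<tau> t))\<^sup>2 * exp (- (0 * t\<^sup>2 / 2))"
      by (intro tendsto_intros V0) auto
    then show ?thesis unfolding f_def by (intro tendsto_ennrealI) simp
  qed
  then have "ennreal ((cmod (char \<tau> t))\<^sup>2) = liminf (\<lambda>n. f n t)" for t
    by (intro lim_imp_Liminf[symmetric]) auto
  then have "(\<integral>\<^sup>+t. ennreal ((cmod (char \<tau> t))\<^sup>2) \<partial>lborel) = (\<integral>\<^sup>+t. liminf (\<lambda>n. f n t) \<partial>lborel)"
    by simp
  also have "\<dots> \<le> liminf (\<lambda>n. \<integral>\<^sup>+t. f n t \<partial>lborel)"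
    by (intro nn_integral_liminf) (auto simp: f_def)
  also have "\<dots> \<le> liminf (\<lambda>n. ennreal (2 * pi) * (\<integral>\<^sup>+x. ennreal ((F x)\<^sup>2) \<partial>lborel))"
  proof (intro Liminf_mono always_eventually allI)
    fix n
    have "V n > 0" by (simp add: V_def)
    then show "(\<integral>\<^sup>+t. f n t \<partial>lborel) \<le> ennreal (2 * pi) * (\<integral>\<^sup>+x. ennreal ((F x)\<^sup>2) \<partial>lborel)"
      unfolding f_def nn_integral_char_gauss[OF \<tau> \<open>V n > 0\<close>] unfolding \<tau>_def
      by (intro mult_left_mono nn_integral_gauss_density_le F0) auto
  qed
  also have "\<dots> = ennreal (2 * pi) * (\<integral>\<^sup>+x. ennreal ((F x)\<^sup>2) \<partial>lborel)"
    by (simp add: Liminf_const)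
  finally show ?thesis .
qed

section \<open>Marcinkiewicz interpolation\<close>

lemma char_density:
  assumes [measurable]: "F \<in> borel_measurable borel" and F0: "\<And>x. 0 \<le> F x"
  shows "char (density lborel (\<lambda>x. ennreal (F x))) t = (\<integral>x. F x *\<^sub>R iexp (t * x) \<partial>lborel)"
  unfolding char_def using F0 by (subst integral_density) auto

lemma nn_integral_powr_from_0:
  assumes "-1 < a" "0 \<le> c"
  shows "(\<integral>\<^sup>+t. ennreal (t powr a) * indicator {0..c} t \<partial>lborel) = ennreal (c powr (a + 1) / (a + 1))"
  using nn_integral_has_integral_lebesgue'[OF _ has_integral_powr_from_0[OF assms]] by simp

text \<open>Marcinkiewicz interpolation between \<open>L\<^sup>1 \<rightarrow> L\<^sup>\<infinity>\<close> and \<open>L\<^sup>2 \<rightarrow> L\<^sup>2\<close>: for each height \<open>t\<close> the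
  function is cut at the level where the tall part contributes at most \<open>t / 2\<close> to the transform.\<close>

theorem Hausdorff_Young:
  fixes F :: "real \<Rightarrow> real"
  assumes [measurable]: "F \<in> borel_measurable borel" and F0: "\<And>x. 0 \<le> F x"
    and fin: "(\<integral>\<^sup>+x. ennreal (F x) \<partial>lborel) < \<infinity>"
    and q: "2 < q" and r: "r = q / (q - 1)" and I0: "0 < I"
    and I: "(\<integral>\<^sup>+x. ennreal (F x powr r) \<partial>lborel) \<le> ennreal I"
  defines "\<tau> \<equiv> density lborel (\<lambda>x. ennreal (F x))"
  shows "(\<integral>\<^sup>+t. ennreal (cmod (char \<tau> t) powr q) \<partial>lborel)
    \<le> ennreal (8 * pi * q * 2 powr (q - 2) / (q - 2) * I powr (q - 1))"
proof -
  have r1: "1 < r" "(r - 1) * (q - 1) = 1" using q by (auto simp: r field_simps)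
  have \<tau>: "finite_borel_measure \<tau>"
    unfolding \<tau>_def by (intro finite_borel_measure_density fin) auto
  interpret \<tau>: finite_borel_measure \<tau> by fact
  define m where "m t = emeasure lborel {\<xi>. t < cmod (char \<tau> \<xi>)}" for t
  \<comment> \<open>For \<open>t > 0\<close> and where \<open>F\<close> is positive,
    \<open>lev t\<close> is the set on which \<open>F\<close> is at most
    \<open>(2 * I / t) powr (1 / (r - 1))\<close>, because \<open>1 - r\<close> is negative. Off it,
    \<open>F \<le> t / (2 * I) * F powr r\<close>, so the tall part has integral at most
    \<open>t / 2\<close>. Zeros of \<open>F\<close> also lie off it, since
    \<open>0 powr x = 0\<close>; they contribute to neither part.\<close>
  define lev where "lev t = {x. t \<le> 2 * I * F x powr (1 - r)}" for t
  have [measurable]: "lev t \<in> sets borel" for t unfolding lev_def by measurable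
  have m_le: "m t \<le> ennreal (8 * pi / t\<^sup>2) * (\<integral>\<^sup>+x. ennreal ((F x)\<^sup>2 * indicator (lev t) x) \<partial>lborel)"
    if t: "0 < t" for t
  proof -
    define F1 where "F1 x = F x * indicator (- lev t) x" for x
    define F2 where "F2 x = F x * indicator (lev t) x" for x
    have [measurable]: "F1 \<in> borel_measurable borel" "F2 \<in> borel_measurable borel"
      unfolding F1_def F2_def by measurable
    have F12: "F1 x \<ge> 0" "F2 x \<ge> 0" "F x = F1 x + F2 x" "F1 x \<le> F x" "F2 x \<le> F x" for x
      by (auto simp: F1_def F2_def F0 indicator_def)
    have int: "integrable lborel F"
      using fin F0 by (intro integrableI_nonneg) auto
    have int1: "integrable lborel F1" and int2: "integrable lborel F2"
      by (rule Bochner_Integration.integrable_bound[OF int]; use F12 F0 in auto)+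
    have ie: "integrable lborel (\<lambda>x. G x *\<^sub>R iexp (\<xi> * x))" if "integrable lborel G"
      for G :: "real \<Rightarrow> real" and \<xi>
      using borel_measurable_integrable[OF that]
      by (intro Bochner_Integration.integrable_bound[OF that]) (auto simp del: of_real_mult)
    let ?c1 = "\<lambda>\<xi>. \<integral>x. F1 x *\<^sub>R iexp (\<xi> * x) \<partial>lborel"
    let ?c2 = "char (density lborel (\<lambda>x. ennreal (F2 x)))"
    have sum: "char \<tau> \<xi> = ?c1 \<xi> + ?c2 \<xi>" for \<xi>
      unfolding \<tau>_def
      unfolding char_density[OF assms(1) F0] char_density[OF \<open>F2 \<in> borel_measurable borel\<close> F12(2)]
      unfolding Bochner_Integration.integral_add[OF ie[OF int1] ie[OF int2], symmetric]
      by (intro Bochner_Integration.integral_cong refl) (simp only: F12(3) scaleR_add_left)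
    have F1_le: "F1 x \<le> t / (2 * I) * F x powr r" for x
    proof (cases "x \<in> lev t \<or> F x = 0")
      case False
      then have "2 * I * F x powr (1 - r) < t" "F x > 0" using F0[of x] by (auto simp: lev_def)
      then have "F x powr r * (2 * I * F x powr (1 - r)) \<le> F x powr r * t"
        by (intro mult_left_mono) auto
      moreover have "F x powr r * F x powr (1 - r) = F x"
        using \<open>F x > 0\<close> by (simp flip: powr_add)
      ultimately have "2 * I * F x \<le> F x powr r * t" by (simp add: mult_ac)
      then have "F x \<le> t / (2 * I) * F x powr r" using I0 by (simp add: field_simps)
      then show ?thesis using F12(4)[of x] by linarith
    qed (use I0 t in \<open>auto simp: F1_def\<close>)
    have c1: "cmod (?c1 \<xi>) \<le> t / 2" for \<xi>
    proof -
      have "cmod (?c1 \<xi>) \<le> (\<integral>x. cmod (F1 x *\<^sub>R iexp (\<xi> * x)) \<partial>lborel)"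
        by (rule integral_norm_bound)
      also have "\<dots> = (\<integral>x. F1 x \<partial>lborel)" using F12 by (simp del: of_real_mult)
      finally have "ennreal (cmod (?c1 \<xi>)) \<le> ennreal (\<integral>x. F1 x \<partial>lborel)" by (rule ennreal_leI)
      also have "\<dots> = (\<integral>\<^sup>+x. ennreal (F1 x) \<partial>lborel)"
        using F12 by (intro nn_integral_eq_integral[symmetric] int1) auto
      also have "\<dots> \<le> (\<integral>\<^sup>+x. ennreal (t / (2 * I)) * ennreal (F x powr r) \<partial>lborel)"
        using I0 t by (intro nn_integral_mono) (auto simp flip: ennreal_mult simp del: times_divide_eq_left intro!: ennreal_leI F1_le)
      also have "\<dots> \<le> ennreal (t / (2 * I)) * ennreal I"
        using I by (subst nn_integral_cmult) (auto intro: mult_left_mono)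
      also have "\<dots> = ennreal (t / 2)" using I0 t by (simp flip: ennreal_mult)
      finally show ?thesis using t by (simp add: ennreal_le_iff)
    qed
    have fin2: "(\<integral>\<^sup>+x. ennreal (F2 x) \<partial>lborel) < \<infinity>"
      by (rule le_less_trans[OF _ fin]) (auto intro!: nn_integral_mono ennreal_leI F12)
    interpret c2: finite_borel_measure "density lborel (\<lambda>x. ennreal (F2 x))"
      by (intro finite_borel_measure_density fin2) auto
    have "m t = (\<integral>\<^sup>+\<xi>. indicator {\<xi>. t < cmod (char \<tau> \<xi>)} \<xi> \<partial>lborel)"
      unfolding m_def by simp
    \<comment> \<open>Where the transform exceeds \<open>t\<close>, the transform of the short part
      must be at least \<open>t / 2\<close>: Chebyshev for its square.\<close>
    also have "\<dots> \<le> (\<integral>\<^sup>+\<xi>. ennreal (4 / t\<^sup>2) * ennreal ((cmod (?c2 \<xi>))\<^sup>2) \<partial>lborel)"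
    proof (intro nn_integral_mono)
      fix \<xi>
      have "1 \<le> 4 / t\<^sup>2 * (cmod (?c2 \<xi>))\<^sup>2" if "t < cmod (char \<tau> \<xi>)"
      proof -
        have "t / 2 \<le> cmod (?c2 \<xi>)"
          using that c1[of \<xi>] norm_triangle_ineq[of "?c1 \<xi>" "?c2 \<xi>"] unfolding sum by linarith
        then have "(t / 2)\<^sup>2 \<le> (cmod (?c2 \<xi>))\<^sup>2" using t by (intro power_mono) auto
        then show ?thesis using t by (simp add: field_simps power_divide)
      qed
      then show "indicator {\<xi>. t < cmod (char \<tau> \<xi>)} \<xi> \<le> ennreal (4 / t\<^sup>2) * ennreal ((cmod (?c2 \<xi>))\<^sup>2)"
        by (auto simp: indicator_def simp flip: ennreal_mult ennreal_1 intro!: ennreal_leI)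
    qed
    also have "\<dots> = ennreal (4 / t\<^sup>2) * (\<integral>\<^sup>+\<xi>. ennreal ((cmod (?c2 \<xi>))\<^sup>2) \<partial>lborel)"
      by (intro nn_integral_cmult) auto
    also have "\<dots> \<le> ennreal (4 / t\<^sup>2) * (ennreal (2 * pi) * (\<integral>\<^sup>+x. ennreal ((F2 x)\<^sup>2) \<partial>lborel))"
      by (intro mult_left_mono nn_integral_char_square_le fin2 F12) auto
    also have "\<dots> = ennreal (8 * pi / t\<^sup>2) * (\<integral>\<^sup>+x. ennreal ((F x)\<^sup>2 * indicator (lev t) x) \<partial>lborel)"
    proof -
      have "(F2 x)\<^sup>2 = (F x)\<^sup>2 * indicator (lev t) x" for x by (simp add: F2_def indicator_def)
      then show ?thesis by (simp flip: mult.assoc ennreal_mult)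
    qed
    finally show ?thesis .
  qed
  \<comment> \<open>Layer cake: the derivative of \<open>t powr q\<close> integrated up to
    \<open>y\<close>. The open interval makes the indicator match the strict superlevel sets in
    \<open>m\<close>.\<close>
  have cake: "ennreal (y powr q) = (\<integral>\<^sup>+t. ennreal (q * t powr (q - 1)) * indicator {0<..<y} t \<partial>lborel)"
    if "0 \<le> y" for y
  proof -
    have "(\<integral>\<^sup>+t. ennreal (q * t powr (q - 1)) * indicator {0<..<y} t \<partial>lborel)
        = (\<integral>\<^sup>+t. ennreal q * (ennreal (t powr (q - 1)) * indicator {0..y} t) \<partial>lborel)"
    proof (intro nn_integral_cong_AE)
      have "AE t in lborel. t \<noteq> 0" "AE t in lborel. t \<noteq> y" by (rule AE_lborel_singleton)+
      then show "AE t in lborel. ennreal (q * t powr (q - 1)) * indicator {0<..<y} t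
          = ennreal q * (ennreal (t powr (q - 1)) * indicator {0..y} t)"
        by eventually_elim (use q in \<open>auto simp: indicator_def ennreal_mult\<close>)
    qed
    also have "\<dots> = ennreal q * ennreal (y powr (q - 1 + 1) / (q - 1 + 1))"
      using that q by (subst nn_integral_cmult) (auto simp: nn_integral_powr_from_0)
    also have "\<dots> = ennreal (y powr q)" using q by (simp flip: ennreal_mult)
    finally show ?thesis by simp
  qed
  have "(\<integral>\<^sup>+\<xi>. ennreal (cmod (char \<tau> \<xi>) powr q) \<partial>lborel)
      = (\<integral>\<^sup>+\<xi>. \<integral>\<^sup>+t. ennreal (q * t powr (q - 1)) * indicator {0<..} t * indicator {\<xi>. t < cmod (char \<tau> \<xi>)} \<xi> \<partial>lborel \<partial>lborel)"
    unfolding cake[OF norm_ge_zero] by (intro nn_integral_cong) (auto simp: indicator_def)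
  also have "\<dots> = (\<integral>\<^sup>+t. \<integral>\<^sup>+\<xi>. ennreal (q * t powr (q - 1)) * indicator {0<..} t * indicator {\<xi>. t < cmod (char \<tau> \<xi>)} \<xi> \<partial>lborel \<partial>lborel)"
    by (rule lborel_pair.Fubini') (simp add: measurable_split_conv indicator_def)
  also have "\<dots> = (\<integral>\<^sup>+t. ennreal (q * t powr (q - 1)) * indicator {0<..} t * m t \<partial>lborel)"
    unfolding m_def by (intro nn_integral_cong) (simp add: nn_integral_cmult)
  also have "\<dots> \<le> (\<integral>\<^sup>+t. \<integral>\<^sup>+x. ennreal (8 * pi * q * (F x)\<^sup>2) *
      (ennreal (t powr (q - 3)) * indicator {0..2 * I * F x powr (1 - r)} t) \<partial>lborel \<partial>lborel)"
  proof (intro nn_integral_mono)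
    fix t :: real
    show "ennreal (q * t powr (q - 1)) * indicator {0<..} t * m t
      \<le> (\<integral>\<^sup>+x. ennreal (8 * pi * q * (F x)\<^sup>2) *
      (ennreal (t powr (q - 3)) * indicator {0..2 * I * F x powr (1 - r)} t) \<partial>lborel)"
    proof (cases "0 < t")
      case True
      have "ennreal (q * t powr (q - 1)) * indicator {0<..} t * m t
        \<le> ennreal (q * t powr (q - 1)) * (ennreal (8 * pi / t\<^sup>2) * (\<integral>\<^sup>+x. ennreal ((F x)\<^sup>2 * indicator (lev t) x) \<partial>lborel))"
        using True m_le[OF True] by (auto intro!: mult_left_mono)
      also have "\<dots> = ennreal (8 * pi * q * t powr (q - 3)) * (\<integral>\<^sup>+x. ennreal ((F x)\<^sup>2 * indicator (lev t) x) \<partial>lborel)"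
      proof -
        have "q * t powr (q - 1) * (8 * pi / t\<^sup>2) = 8 * pi * q * t powr (q - 3)"
          using True powr_add[of t "q - 3" 2] by (simp add: field_simps flip: powr_numeral)
        then show ?thesis using q by (simp flip: mult.assoc ennreal_mult)
      qed
      also have "\<dots> = (\<integral>\<^sup>+x. ennreal (8 * pi * q * t powr (q - 3)) * ennreal ((F x)\<^sup>2 * indicator (lev t) x) \<partial>lborel)"
        by (simp add: nn_integral_cmult)
      also have "\<dots> = (\<integral>\<^sup>+x. ennreal (8 * pi * q * (F x)\<^sup>2) *
      (ennreal (t powr (q - 3)) * indicator {0..2 * I * F x powr (1 - r)} t) \<partial>lborel)"
        using True q by (intro nn_integral_cong)
          (auto simp: lev_def indicator_def mult_ac simp flip: ennreal_mult)
      finally show ?thesis .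
    qed auto
  qed
  also have "\<dots> = (\<integral>\<^sup>+x. \<integral>\<^sup>+t. ennreal (8 * pi * q * (F x)\<^sup>2) *
      (ennreal (t powr (q - 3)) * indicator {0..2 * I * F x powr (1 - r)} t) \<partial>lborel \<partial>lborel)"
    by (rule lborel_pair.Fubini') (simp add: measurable_split_conv indicator_def)
  \<comment> \<open>After the exchange, \<open>t\<close> runs over the heights for which
    \<open>x\<close> belongs to the short part. The exponent \<open>q - 3\<close> exceeds -1 because
    \<open>q > 2\<close>, and the integral produces the constant \<open>1 / (q - 2)\<close>.\<close>
  also have "\<dots> = (\<integral>\<^sup>+x. ennreal (8 * pi * q * (F x)\<^sup>2) * ennreal ((2 * I * F x powr (1 - r)) powr (q - 2) / (q - 2)) \<partial>lborel)"
  proof (intro nn_integral_cong)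
    fix x
    have "(\<integral>\<^sup>+t. ennreal (t powr (q - 3)) * indicator {0..2 * I * F x powr (1 - r)} t \<partial>lborel)
       = ennreal ((2 * I * F x powr (1 - r)) powr (q - 3 + 1) / (q - 3 + 1))"
      using q I0 by (intro nn_integral_powr_from_0) auto
    then show "(\<integral>\<^sup>+t. ennreal (8 * pi * q * (F x)\<^sup>2) *
      (ennreal (t powr (q - 3)) * indicator {0..2 * I * F x powr (1 - r)} t) \<partial>lborel) =
      ennreal (8 * pi * q * (F x)\<^sup>2) * ennreal ((2 * I * F x powr (1 - r)) powr (q - 2) / (q - 2))"
      by (subst nn_integral_cmult) auto
  qed
  also have "\<dots> = (\<integral>\<^sup>+x. ennreal (8 * pi * q * (2 * I) powr (q - 2) / (q - 2)) * ennreal (F x powr r) \<partial>lborel)"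
  proof (intro nn_integral_cong)
    fix x
    \<comment> \<open>The powers of \<open>F x\<close> combine to exactly \<open>r\<close> because
      \<open>r\<close> and \<open>q\<close> are conjugate, that is,
      \<open>(r - 1) * (q - 1) = 1\<close>.\<close>
    have "(F x)\<^sup>2 * (F x powr (1 - r)) powr (q - 2) = F x powr r"
    proof (cases "F x = 0")
      case False
      then have "F x > 0" using F0[of x] by auto
      moreover have "2 + (1 - r) * (q - 2) = r" using r1(2) by (simp add: algebra_simps)
      ultimately show ?thesis
        by (simp add: powr_powr flip: powr_numeral powr_add)
    qed simp
    then have "8 * pi * q * (F x)\<^sup>2 * ((2 * I * F x powr (1 - r)) powr (q - 2) / (q - 2))
      = 8 * pi * q * (2 * I) powr (q - 2) / (q - 2) * F x powr r"
      using I0 by (simp add: powr_mult)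
    then show "ennreal (8 * pi * q * (F x)\<^sup>2) * ennreal ((2 * I * F x powr (1 - r)) powr (q - 2) / (q - 2))
      = ennreal (8 * pi * q * (2 * I) powr (q - 2) / (q - 2)) * ennreal (F x powr r)"
      using q by (simp flip: ennreal_mult)
  qed
  also have "\<dots> \<le> ennreal (8 * pi * q * (2 * I) powr (q - 2) / (q - 2)) * ennreal I"
    using I by (subst nn_integral_cmult) (auto intro: mult_left_mono)
  also have "\<dots> = ennreal (8 * pi * q * 2 powr (q - 2) / (q - 2) * I powr (q - 1))"
    using I0 q powr_add[of I "q - 2" 1] by (simp add: powr_mult mult_ac flip: ennreal_mult)
  finally show ?thesis .
qed

section \<open>The Erdos--Kahane argument\<close>

text \<open>A Borel-Cantelli argument: the families \<open>W N\<close> with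
  \<open>N \<ge> N0\<close> together cover \<open>E\<close>, their diameters are eventually below
  any given bound, and the total cost is a tail of a convergent series.\<close>

lemma hausdorff_measure_limsup_eq_0:
  fixes E :: "'a::metric_space set" and W :: "nat \<Rightarrow> 'a set set"
  assumes fin: "\<And>N. finite (W N)"
    and bdd: "\<And>N U. U \<in> W N \<Longrightarrow> bounded U \<and> diameter U \<le> d N"
    and E: "\<And>x N0. x \<in> E \<Longrightarrow> \<exists>N\<ge>N0. x \<in> \<Union>(W N)"
    and d: "d \<longlonglongrightarrow> 0" and s: "0 < s"
    and sum: "summable (\<lambda>N. real (card (W N)) * d N powr s)"
  shows "hausdorff_measure s E = 0"
proof -
  define c where "c N = real (card (W N)) * d N powr s" for N
  have c0: "c N \<ge> 0" for N by (simp add: c_def)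
  have le_e: "hausdorff_pre_measure s \<delta> E \<le> 0 + ennreal e" if \<delta>: "\<delta> > 0" and e: "0 < e" for \<delta> e
  proof -
    have "eventually (\<lambda>N. d N < \<delta>) sequentially"
      using d \<delta> by (rule order_tendstoD)
    then have ev1: "eventually (\<lambda>k. \<forall>N\<ge>k. d N < \<delta>) sequentially"
      by (rule eventually_all_ge_at_top)
    have "(\<lambda>k. suminf (\<lambda>n. c (n + k))) \<longlonglongrightarrow> 0"
      using sum unfolding c_def[symmetric] by (rule suminf_exist_split2)
    then have ev2: "eventually (\<lambda>k. suminf (\<lambda>n. c (n + k)) < e) sequentially"
      using e by (rule order_tendstoD)
    from eventually_happens'[OF _ eventually_conj[OF ev1 ev2]] obtain k where k: "\<forall>N\<ge>k. d N < \<delta>" "suminf (\<lambda>n. c (n + k)) < e"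
      by auto
    have "\<exists>f. bij_betw f {0..<card (W N)} (W N)" for N
      using fin ex_bij_betw_nat_finite by blast
    then obtain f where f: "\<And>N. bij_betw (f N) {0..<card (W N)} (W N)" by metis
    have fW: "f N i \<in> W N" if "i < card (W N)" for N i
      using f[of N] that by (auto simp: bij_betw_def)
    \<comment> \<open>The pre-measure admits only sequences of sets, so the finite families are
      enumerated along pairs and padded with empty sets; these have diameter 0 and cost nothing
      because \<open>s > 0\<close>.\<close>
    define G where "G = (\<lambda>(N, i). if i < card (W (N + k)) then f (N + k) i else {})"
    define U where "U n = G (prod_decode n)" for n
    have "E \<subseteq> (\<Union>n. U n)"
    proof
      fix x assume "x \<in> E"
      then obtain N where N: "N \<ge> k" "x \<in> \<Union>(W N)" using E by blast
      then obtain A where A: "A \<in> W N" "x \<in> A" by auto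
      then obtain i where i: "i < card (W N)" "f N i = A"
        using f[of N] by (metis atLeast0LessThan bij_betw_imp_surj_on imageE lessThan_iff)
      have "x \<in> U (prod_encode (N - k, i))" using N A i by (simp add: U_def G_def)
      then show "x \<in> (\<Union>n. U n)" by blast
    qed
    moreover have "bounded (U n) \<and> diameter (U n) \<le> \<delta>" for n
    proof (cases "prod_decode n")
      case (Pair N i)
      show ?thesis
      proof (cases "i < card (W (N + k))")
        case True
        then show ?thesis using bdd[OF fW[OF True]] k(1)[rule_format, of "N + k"] Pair
          by (auto simp: U_def G_def)
      qed (use Pair \<delta> in \<open>auto simp: U_def G_def diameter_empty\<close>)
    qed
    ultimately have "hausdorff_pre_measure s \<delta> E \<le> (\<Sum>n. ennreal (diameter (U n) powr s))"
      unfolding hausdorff_pre_measure_def by (intro INF_lower) auto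
    also have "\<dots> = (\<Sum>N. \<Sum>i. ennreal (diameter (G (N, i)) powr s))"
      unfolding U_def by (rule suminf_ennreal_2dimen[of "\<lambda>N. \<Sum>i. ennreal (diameter (G (N, i)) powr s)" "\<lambda>p. ennreal (diameter (G p) powr s)"]) simp
    also have "\<dots> \<le> (\<Sum>N. ennreal (c (N + k)))"
    proof (intro suminf_le)
      fix N
      have "(\<Sum>i. ennreal (diameter (G (N, i)) powr s)) = (\<Sum>i<card (W (N + k)). ennreal (diameter (G (N, i)) powr s))"
        using s by (intro suminf_finite) (auto simp: G_def diameter_empty)
      also have "\<dots> \<le> (\<Sum>i<card (W (N + k)). ennreal (d (N + k) powr s))"
      proof (intro sum_mono ennreal_leI powr_mono2)
        fix i assume i: "i \<in> {..<card (W (N + k))}"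
        show "diameter (G (N, i)) \<le> d (N + k)" "0 \<le> diameter (G (N, i))"
          using bdd[OF fW[of i "N + k"]] i by (auto simp: G_def diameter_ge_0)
      qed (use s in auto)
      also have "\<dots> = ennreal (c (N + k))"
        by (simp add: c_def ennreal_mult ennreal_of_nat_eq_real_of_nat)
      finally show "(\<Sum>i. ennreal (diameter (G (N, i)) powr s)) \<le> ennreal (c (N + k))" .
    qed auto
    also have "\<dots> = ennreal (suminf (\<lambda>N. c (N + k)))"
      using sum unfolding c_def[symmetric] by (intro suminf_ennreal2) (auto simp: c0 summable_iff_shift)
    also have "\<dots> \<le> 0 + ennreal e" using k(2) by (auto intro: ennreal_leI)
    finally show ?thesis .
  qed
  then have "hausdorff_pre_measure s \<delta> E \<le> 0" if "\<delta> > 0" for \<delta>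
    by (rule ennreal_le_epsilon) (auto intro: le_e[of \<delta>, simplified] that)
  then show ?thesis
    unfolding hausdorff_measure_def by (intro antisym SUP_least) auto
qed

lemma hausdorff_measure_mono: "A \<subseteq> B \<Longrightarrow> hausdorff_measure s A \<le> hausdorff_measure s B"
proof -
  assume "A \<subseteq> B"
  then have "hausdorff_pre_measure s \<delta> A \<le> hausdorff_pre_measure s \<delta> B" for \<delta>
    unfolding hausdorff_pre_measure_def by (rule_tac INF_superset_mono) (blast, rule order.refl)
  then show ?thesis
    unfolding hausdorff_measure_def by (rule_tac SUP_mono) blast
qed

section \<open>Orbits of frequencies far from the integers\<close>

definition int_dist :: "real \<Rightarrow> real" where
  "int_dist x = \<bar>x - of_int (round x)\<bar>"

text \<open>At a bad index the frequency \<open>\<alpha> ^ j * z\<close> is far from the integers,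
  and the corresponding factor of the infinite product for a transform is bounded away from 1. Bad
  indices therefore produce decay.\<close>

definition bad_indices :: "real \<Rightarrow> real \<Rightarrow> real \<Rightarrow> nat \<Rightarrow> nat set" where
  "bad_indices \<rho> \<alpha> z N = {j. j \<le> N \<and> \<rho> \<le> int_dist (\<alpha> ^ j * z)}"

lemma finite_bad_indices [simp]: "finite (bad_indices \<rho> \<alpha> z N)"
  by (rule finite_subset[of _ "{..N}"]) (auto simp: bad_indices_def)

lemma card_bad_indices_Suc:
  "card (bad_indices \<rho> \<alpha> z (Suc N))
    = (if \<rho> \<le> int_dist z then 1 else 0) + card (bad_indices \<rho> \<alpha> (\<alpha> * z) N)"
proof -
  have "bad_indices \<rho> \<alpha> z (Suc N)
    = (if \<rho> \<le> int_dist z then {0} else {}) \<union> Suc ` bad_indices \<rho> \<alpha> (\<alpha> * z) N"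
  proof (intro set_eqI)
    fix j show "j \<in> bad_indices \<rho> \<alpha> z (Suc N) \<longleftrightarrow>
      j \<in> (if \<rho> \<le> int_dist z then {0} else {}) \<union> Suc ` bad_indices \<rho> \<alpha> (\<alpha> * z) N"
      by (cases j) (auto simp: bad_indices_def mult_ac image_iff)
  qed
  also have "card \<dots> = (if \<rho> \<le> int_dist z then 1 else 0) + card (Suc ` bad_indices \<rho> \<alpha> (\<alpha> * z) N)"
    by (subst card_Un_disjoint) auto
  finally show ?thesis by (simp add: card_image)
qed

text \<open>A point \<open>z\<close> whose contraction \<open>\<alpha> z\<close> is known up to an error \<open>2 \<rho>\<close> is determined up to the same
  error if it is close to an integer; otherwise boundedly many choices remain, and the bad index
  pays for them with a factor \<open>1 / \<tau>\<close>.\<close>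

lemma cover_few_bad_indices:
  fixes \<alpha> \<rho> \<tau> D :: real and K :: nat
  assumes \<alpha>: "0 < \<alpha>" "\<alpha> < 1" and \<rho>: "0 < \<rho>" "2 * \<rho> * (1 / \<alpha> + 1) < 1"
    and K: "1 / \<alpha> \<le> real K" and \<tau>: "0 < \<tau>" "\<tau> < 1" and D: "0 < D"
  shows "\<exists>n0>0. \<forall>N b. \<exists>X. finite X \<and> real (card X) \<le> n0 * (1 / \<tau>) ^ b * (1 + real K * \<tau>) ^ N \<and>
    {z. \<bar>z\<bar> \<le> D * (1 / \<alpha>) ^ N \<and> card (bad_indices \<rho> \<alpha> z N) \<le> b} \<subseteq> (\<Union>x\<in>X. {x..x + 2 * \<rho>})"
proof -
  \<comment> \<open>Starting at \<open>- D\<close>, \<open>k + 1\<close> intervals of length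
    \<open>2 * \<rho>\<close> reach beyond \<open>D\<close>.\<close>
  define k where "k = nat \<lceil>D / \<rho>\<rceil>"
  define n0 where "n0 = real (k + 1)"
  let ?A = "\<lambda>N b. {z. \<bar>z\<bar> \<le> D * (1 / \<alpha>) ^ N \<and> card (bad_indices \<rho> \<alpha> z N) \<le> b}"
  let ?cov = "\<lambda>X. \<Union>x\<in>X. {x..x + 2 * \<rho>}"
  have "\<exists>X. finite X \<and> real (card X) \<le> n0 * (1 / \<tau>) ^ b * (1 + real K * \<tau>) ^ N \<and> ?A N b \<subseteq> ?cov X" for N b
  proof (induction N arbitrary: b)
    case 0
    let ?X = "(\<lambda>i. - D + 2 * \<rho> * real i) ` {..k}"
    have "real (card ?X) \<le> real (card {..k})" by (intro of_nat_mono card_image_le) simp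
    also have "\<dots> \<le> n0 * (1 / \<tau>) ^ b"
      using \<tau> one_le_power[of "1 / \<tau>" b] mult_left_mono[of 1 "(1 / \<tau>) ^ b" n0] by (simp add: n0_def)
    finally have card: "real (card ?X) \<le> n0 * (1 / \<tau>) ^ b * (1 + real K * \<tau>) ^ 0" by simp
    have "?A 0 b \<subseteq> ?cov ?X"
    proof
      fix z assume "z \<in> ?A 0 b"
      then have z: "\<bar>z\<bar> \<le> D" by simp
      define i where "i = nat \<lfloor>(z + D) / (2 * \<rho>)\<rfloor>"
      have y0: "(z + D) / (2 * \<rho>) \<ge> 0" using z \<rho> by (intro divide_nonneg_pos) auto
      have "(z + D) / (2 * \<rho>) \<le> D / \<rho>" using z \<rho> by (simp add: field_simps)
      then have "\<lfloor>(z + D) / (2 * \<rho>)\<rfloor> \<le> \<lceil>D / \<rho>\<rceil>" by linarith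
      then have "i \<le> k" unfolding i_def k_def by simp
      moreover have "real i = \<lfloor>(z + D) / (2 * \<rho>)\<rfloor>" using y0 unfolding i_def by simp
      then have "real i \<le> (z + D) / (2 * \<rho>)" "(z + D) / (2 * \<rho>) \<le> real i + 1" by linarith+
      then have "2 * \<rho> * real i \<le> z + D" "z + D \<le> 2 * \<rho> * real i + 2 * \<rho>"
        using \<rho> by (auto simp: field_simps)
      ultimately show "z \<in> ?cov ?X" by (intro UN_I[of "- D + 2 * \<rho> * real i"]) auto
    qed
    with card show ?case by (intro exI[of _ ?X]) simp
  next
    case (Suc N)
    obtain X where X: "finite X" "real (card X) \<le> n0 * (1 / \<tau>) ^ b * (1 + real K * \<tau>) ^ N" "?A N b \<subseteq> ?cov X"
      using Suc.IH by blast
    obtain Y where Y: "finite Y" "real (card Y) * (1 / \<tau>) \<le> n0 * (1 / \<tau>) ^ b * (1 + real K * \<tau>) ^ N"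
      and Ycov: "b > 0 \<Longrightarrow> ?A N (b - 1) \<subseteq> ?cov Y" "b = 0 \<Longrightarrow> Y = {}"
    proof (cases "b = 0")
      case True
      then show ?thesis using that[of "{}"] \<tau> by (auto simp: n0_def)
    next
      case False
      obtain Y where Y: "finite Y" "real (card Y) \<le> n0 * (1 / \<tau>) ^ (b - 1) * (1 + real K * \<tau>) ^ N" "?A N (b - 1) \<subseteq> ?cov Y"
        using Suc.IH by blast
      have "real (card Y) * (1 / \<tau>) \<le> (n0 * (1 / \<tau>) ^ (b - 1) * (1 + real K * \<tau>) ^ N) * (1 / \<tau>)"
        using \<tau> by (intro mult_right_mono Y) auto
      also have "\<dots> = n0 * (1 / \<tau>) ^ b * (1 + real K * \<tau>) ^ N"
        using False by (cases b) (auto simp: mult_ac)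
      finally show ?thesis using that Y False by auto
    qed
    \<comment> \<open>The integer belonging to the interval at \<open>x\<close>. It does not depend
      on the choice: two candidates differ by at most \<open>2 * \<rho> / \<alpha>\<close>, so their
      nearby integers differ by less than
      \<open>2 * \<rho> * (1 / \<alpha> + 1) < 1\<close>.\<close>
    define g where "g x = (SOME m::int. \<exists>z. \<alpha> * z \<in> {x..x + 2 * \<rho>} \<and> \<bar>z - of_int m\<bar> < \<rho>)" for x
    \<comment> \<open>A bad \<open>z\<close> ranges over an interval of length
      \<open>2 * \<rho> / \<alpha>\<close>, which is cut into \<open>K\<close> pieces of the
      original length.\<close>
    define Z where "Z = (\<lambda>x. of_int (g x) - \<rho>) ` X \<union> (\<lambda>(x, i). x / \<alpha> + 2 * \<rho> * real i) ` (Y \<times> {..<K})"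
    have "real (card Z) \<le> real (card X) + real (card Y) * real K"
    proof -
      have "card Z \<le> card X + card (Y \<times> {..<K})"
        unfolding Z_def using X(1) Y(1)
        by (intro order.trans[OF card_Un_le] add_mono card_image_le) auto
      then show ?thesis by (metis card_cartesian_product card_lessThan of_nat_add of_nat_mono of_nat_mult)
    qed
    \<comment> \<open>One unit of budget is worth the factor \<open>1 / \<tau>\<close>, so the
      \<open>K\<close>-fold branching over \<open>Y\<close> enters only with the proportion
      \<open>K * \<tau>\<close>.\<close>
    also have "\<dots> \<le> n0 * (1 / \<tau>) ^ b * (1 + real K * \<tau>) ^ N + (n0 * (1 / \<tau>) ^ b * (1 + real K * \<tau>) ^ N * \<tau>) * real K"
      using X(2) Y(2) \<tau> by (intro add_mono mult_right_mono) (auto simp: field_simps)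
    also have "\<dots> = n0 * (1 / \<tau>) ^ b * (1 + real K * \<tau>) ^ Suc N"
      by (simp add: algebra_simps)
    finally have card: "real (card Z) \<le> n0 * (1 / \<tau>) ^ b * (1 + real K * \<tau>) ^ Suc N" .
    have "?A (Suc N) b \<subseteq> ?cov Z"
    proof
      fix z assume z: "z \<in> ?A (Suc N) b"
      have z': "\<bar>\<alpha> * z\<bar> \<le> D * (1 / \<alpha>) ^ N"
        using z \<alpha> by (simp add: abs_mult field_simps)
      show "z \<in> ?cov Z"
      proof (cases "\<rho> \<le> int_dist z")
        case True
        then have "b > 0" "\<alpha> * z \<in> ?A N (b - 1)" using z z' by (auto simp: card_bad_indices_Suc)
        then obtain x where x: "x \<in> Y" "\<alpha> * z \<in> {x..x + 2 * \<rho>}" using Ycov(1) by blast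
        define y where "y = (z - x / \<alpha>) / (2 * \<rho>)"
        have y0: "0 \<le> y" using x \<alpha> \<rho> by (auto simp: y_def field_simps)
        have "z \<le> x / \<alpha> + 2 * \<rho> * (1 / \<alpha>)"
          using x \<alpha> by (simp add: pos_le_divide_eq mult.commute flip: add_divide_distrib)
        then have "y \<le> 1 / \<alpha>" unfolding y_def using \<rho> by (simp add: pos_divide_le_eq mult.commute)
        then have yK: "y \<le> real K" using K by linarith
        have "K > 0" using K \<alpha> by (intro gr0I) (auto simp: field_simps)
        \<comment> \<open>The value \<open>y = K\<close> can occur at the right end, hence the cap
          at \<open>K - 1\<close>.\<close>
        define i where "i = min (nat \<lfloor>y\<rfloor>) (K - 1)"
        have i: "i < K" using \<open>K > 0\<close> by (auto simp: i_def)
        have "real i \<le> y" "y \<le> real i + 1"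
        proof -
          have "real (nat \<lfloor>y\<rfloor>) \<le> y" "y \<le> real (nat \<lfloor>y\<rfloor>) + 1" using y0 by linarith+
          then show "real i \<le> y" "y \<le> real i + 1"
            using yK \<open>K > 0\<close> unfolding i_def by (auto simp: min_def of_nat_diff)
        qed
        then have "2 * \<rho> * real i \<le> z - x / \<alpha>" "z - x / \<alpha> \<le> 2 * \<rho> * real i + 2 * \<rho>"
          using \<rho> by (auto simp: y_def field_simps)
        then show ?thesis using x(1) i
          by (intro UN_I[of "x / \<alpha> + 2 * \<rho> * real i"]) (auto simp: Z_def intro!: image_eqI[of _ _ "(x, i)"])
      next
        case False
        then have "\<alpha> * z \<in> ?A N b" using z z' by (auto simp: card_bad_indices_Suc)
        then obtain x where x: "x \<in> X" "\<alpha> * z \<in> {x..x + 2 * \<rho>}" using X(3) by blast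
        have good: "\<bar>z - of_int (round z)\<bar> < \<rho>" using False by (simp add: int_dist_def)
        have "\<exists>z'. \<alpha> * z' \<in> {x..x + 2 * \<rho>} \<and> \<bar>z' - of_int (g x)\<bar> < \<rho>"
          unfolding g_def by (rule someI[of _ "round z"]) (use x good in blast)
        then obtain z' where z'1: "\<alpha> * z' \<in> {x..x + 2 * \<rho>}" "\<bar>z' - of_int (g x)\<bar> < \<rho>" by blast
        have "\<alpha> * \<bar>z - z'\<bar> = \<bar>\<alpha> * z - \<alpha> * z'\<bar>"
          using \<alpha> by (simp add: abs_mult right_diff_distrib[symmetric])
        also have "\<dots> \<le> 2 * \<rho>" using x z'1 by auto
        finally have "\<bar>z - z'\<bar> \<le> 2 * \<rho> * (1 / \<alpha>)" using \<alpha> by (simp add: field_simps)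
        then have "\<bar>real_of_int (round z) - of_int (g x)\<bar> < 1"
          using good z'1(2) \<rho> by (simp add: distrib_left)
        then have "round z = g x" by linarith
        then show ?thesis using good x(1)
          by (intro UN_I[of "of_int (g x) - \<rho>"]) (auto simp: Z_def abs_less_iff)
      qed
    qed
    with card X(1) Y(1) show ?case by (intro exI[of _ Z]) (auto simp: Z_def)
  qed
  then show ?thesis by (intro exI[of _ n0]) (auto simp: n0_def)
qed

text \<open>Iterating the equation displays \<open>f t\<close> as the product of the factors
  \<open>P (\<alpha> ^ j * t)\<close> with \<open>j \<le> N\<close> and a remainder of modulus at
  most 1; every bad index contributes a factor \<open>\<theta>\<close>.\<close>

lemma norm_le_power_card_bad:
  fixes f P :: "real \<Rightarrow> complex"
  assumes f: "\<And>t. f t = P t * f (\<alpha> * t)" and f1: "\<And>t. cmod (f t) \<le> 1" and P1: "\<And>t. cmod (P t) \<le> 1"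
    and P: "\<And>t. \<rho> \<le> int_dist (\<Delta> * t) \<Longrightarrow> cmod (P t) \<le> \<theta>" and \<theta>: "0 \<le> \<theta>" "\<theta> \<le> 1"
  shows "cmod (f t) \<le> \<theta> ^ card (bad_indices \<rho> \<alpha> (\<Delta> * t) N)"
proof (induction N arbitrary: t)
  case 0
  have "cmod (f t) \<le> cmod (P t) * 1"
    by (subst f) (auto simp: norm_mult intro!: mult_left_le f1)
  moreover have "bad_indices \<rho> \<alpha> (\<Delta> * t) 0 = (if \<rho> \<le> int_dist (\<Delta> * t) then {0} else {})"
    by (auto simp: bad_indices_def)
  ultimately show ?case using P[of t] f1[of t] by auto
next
  case (Suc N)
  have "cmod (f t) = cmod (P t) * cmod (f (\<alpha> * t))" by (subst f) (simp add: norm_mult)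
  also have "\<dots> \<le> (if \<rho> \<le> int_dist (\<Delta> * t) then \<theta> else 1) * \<theta> ^ card (bad_indices \<rho> \<alpha> (\<Delta> * (\<alpha> * t)) N)"
    using P[of t] P1[of t] \<theta> by (intro mult_mono Suc.IH) auto
  finally have "cmod (f t) \<le> (if \<rho> \<le> int_dist (\<Delta> * t) then \<theta> else 1) * \<theta> ^ card (bad_indices \<rho> \<alpha> (\<Delta> * (\<alpha> * t)) N)" .
  moreover have "\<Delta> * (\<alpha> * t) = \<alpha> * (\<Delta> * t)" by simp
  ultimately show ?case by (auto simp: card_bad_indices_Suc split: if_splits)
qed

text \<open>\<open>f\<close> and \<open>g\<close> stand for characteristic functions of self-similar measures with ratios
  \<open>\<alpha>\<close>, \<open>\<beta>\<close> and digit distributions with characteristic functions \<open>P\<close>, \<open>Q\<close>.\<close>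

locale Erdos_Kahane =
  fixes f g P Q :: "real \<Rightarrow> complex" and \<alpha> \<beta> \<Delta>1 \<Delta>2 \<rho>1 \<rho>2 \<theta> :: real
  assumes \<alpha>: "0 < \<alpha>" "\<alpha> < 1" and \<beta>: "0 < \<beta>" "\<beta> < 1" and \<Delta>: "\<Delta>1 \<noteq> 0" "\<Delta>2 \<noteq> 0"
    and \<rho>1: "0 < \<rho>1" "2 * \<rho>1 * (1 / \<alpha> + 1) < 1" and \<rho>2: "0 < \<rho>2" "2 * \<rho>2 * (1 / \<beta> + 1) < 1"
    and f: "\<And>t. f t = P t * f (\<alpha> * t)" and g: "\<And>t. g t = Q t * g (\<beta> * t)"
    and f1: "\<And>t. cmod (f t) \<le> 1" and g1: "\<And>t. cmod (g t) \<le> 1"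
    and P1: "\<And>t. cmod (P t) \<le> 1" and Q1: "\<And>t. cmod (Q t) \<le> 1"
    and \<theta>: "0 < \<theta>" "\<theta> < 1"
    and P\<theta>: "\<And>t. \<rho>1 \<le> int_dist (\<Delta>1 * t) \<Longrightarrow> cmod (P t) \<le> \<theta>"
    and Q\<theta>: "\<And>t. \<rho>2 \<le> int_dist (\<Delta>2 * t) \<Longrightarrow> cmod (Q t) \<le> \<theta>"
begin

text \<open>\<open>f t * g (u * t)\<close> is the characteristic function of the convolution of the
  first measure with the image of the second under multiplication by \<open>u\<close>.\<close>

definition decays :: "real \<Rightarrow> bool" where
  "decays u \<longleftrightarrow> (\<exists>C \<sigma>. 0 < C \<and> 0 < \<sigma> \<and> (\<forall>t. t \<noteq> 0 \<longrightarrow> cmod (f t * g (u * t)) \<le> C * \<bar>t\<bar> powr - \<sigma>))"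

text \<open>If decay fails at \<open>u\<close>, then for infinitely many \<open>N\<close> some
  frequency \<open>t\<close> of size about \<open>(1 / \<alpha>) ^ N\<close> has few bad indices in
  both orbits. Then \<open>\<Delta>1 * t\<close> and \<open>\<Delta>2 * (u * t)\<close> lie in
  intervals of bounded length from two short lists, and their quotient determines \<open>u\<close>
  up to a multiple of \<open>N * \<alpha> ^ N\<close>. For few enough bad indices these sets of
  \<open>u\<close> have summable cost in exponent \<open>s\<close>.\<close>

lemma exists_exceptional_set:
  assumes s: "0 < s" "s \<le> 1"
  shows "\<exists>E. 0 \<in> E \<and> hausdorff_measure s E = 0 \<and> (\<forall>u. u \<notin> E \<longrightarrow> decays u)"
proof -
  \<comment> \<open>The second orbit is followed for \<open>c0 * N\<close> steps so that it spans
    the frequency \<open>u * t\<close>, where \<open>\<bar>u\<bar>\<close> may be as large as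
    \<open>N \<le> 2 ^ N\<close>; this is the factor 2 in \<open>2 / \<alpha>\<close>.\<close>
  obtain c0 :: nat where "2 / \<alpha> < (1 / \<beta>) ^ c0"
    using real_arch_pow[of "1 / \<beta>" "2 / \<alpha>"] \<beta> by auto
  then have c0: "2 / \<alpha> \<le> (1 / \<beta>) ^ c0" by simp
  obtain K :: nat where K: "1 / \<alpha> \<le> real K" "1 / \<beta> \<le> real K"
    by (metis linorder_le_cases order.trans real_arch_simple)
  define L where "L = ln (1 / \<alpha>)"
  have L: "L > 0" using \<alpha> by (simp add: L_def)
  \<comment> \<open>With this choice \<open>(\<alpha> ^ N) powr s = exp (- 4 * \<eta> * N)\<close>.
    Half of the exponent is spent on the number of intervals, one \<open>\<eta>\<close> in
    \<open>pow\<tau>\<close> and one in \<open>powK\<close>; the other half gives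
    summability.\<close>
  define \<eta> where "\<eta> = s * L / 4"
  have \<eta>: "\<eta> > 0" using s L by (simp add: \<eta>_def)
  \<comment> \<open>Small enough that the factors \<open>1 + K * \<tau>\<close> collected over
    \<open>(1 + c0) * N\<close> steps stay below \<open>exp (\<eta> * N)\<close>.\<close>
  define \<tau> where "\<tau> = min (1 / 2) (\<eta> / (real (1 + c0) * (1 + real K)))"
  have \<tau>: "0 < \<tau>" "\<tau> < 1" using \<eta> by (auto simp: \<tau>_def)
  have \<tau>\<eta>: "real (1 + c0) * (real K * \<tau>) \<le> \<eta>"
  proof -
    have "\<tau> \<le> \<eta> / (real (1 + c0) * (1 + real K))" by (simp add: \<tau>_def)
    then have "\<tau> * (real (1 + c0) * (1 + real K)) \<le> \<eta>"
      by (subst (asm) pos_le_divide_eq) (auto intro!: mult_pos_pos)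
    then have "real (1 + c0) * ((1 + real K) * \<tau>) \<le> \<eta>" by (simp only: mult_ac)
    moreover have "real (1 + c0) * (real K * \<tau>) \<le> real (1 + c0) * ((1 + real K) * \<tau>)"
      using \<tau> by (intro mult_left_mono mult_right_mono) auto
    ultimately show ?thesis by linarith
  qed
  define l where "l = ln (1 / \<tau>)"
  have l: "l > 0" using \<tau> by (simp add: l_def)
  \<comment> \<open>The permitted density of bad indices: two budgets of \<open>\<kappa> * N\<close>
    together cost \<open>(1 / \<tau>) powr (2 * \<kappa> * N) = exp (\<eta> * N)\<close>.\<close>
  define \<kappa> where "\<kappa> = \<eta> / (2 * l)"
  have \<kappa>: "\<kappa> > 0" using \<eta> l by (simp add: \<kappa>_def)
  define b where "b N = nat \<lfloor>\<kappa> * real N\<rfloor>" for N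
  have b_le: "real (b N) \<le> \<kappa> * real N" for N
    unfolding b_def using \<kappa> by simp
  have b_gt: "\<kappa> * real N \<le> real (Suc (b N))" for N
    unfolding b_def using \<kappa> by (simp) linarith
  have pow\<tau>: "(1 / \<tau>) ^ b N * (1 / \<tau>) ^ b N \<le> exp (\<eta> * real N)" for N
  proof -
    have "(1 / \<tau>) ^ b N * (1 / \<tau>) ^ b N = exp (l * (2 * real (b N)))"
      using \<tau> by (simp add: l_def powr_realpow[symmetric] powr_def mult_ac flip: exp_add)
    also have "l * (2 * real (b N)) \<le> l * (2 * (\<kappa> * real N))"
      using l b_le by (intro mult_left_mono) auto
    also have "\<dots> = \<eta> * real N" using l by (simp add: \<kappa>_def)
    finally show ?thesis by simp
  qed
  have powK: "(1 + real K * \<tau>) ^ N * (1 + real K * \<tau>) ^ (c0 * N) \<le> exp (\<eta> * real N)" for N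
  proof -
    have "(1 + real K * \<tau>) ^ N * (1 + real K * \<tau>) ^ (c0 * N) = (1 + real K * \<tau>) ^ ((1 + c0) * N)"
      by (simp flip: power_add)
    also have "\<dots> \<le> exp (real K * \<tau>) ^ ((1 + c0) * N)"
      using \<tau> by (intro power_mono exp_ge_add_one_self) auto
    also have "\<dots> = exp (real (1 + c0) * (real K * \<tau>) * real N)"
      by (simp flip: exp_of_nat_mult add: algebra_simps)
    also have "\<dots> \<le> exp (\<eta> * real N)" unfolding exp_le_cancel_iff
      using \<tau>\<eta> by (intro mult_right_mono) auto
    finally show ?thesis .
  qed
  define D1 where "D1 = \<bar>\<Delta>1\<bar> / \<alpha>"
  define D2 where "D2 = \<bar>\<Delta>2\<bar> / \<alpha>"
  have D: "D1 > 0" "D2 > 0" using \<alpha> \<Delta> by (auto simp: D1_def D2_def)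
  obtain n1 where n1: "n1 > 0" and ex1: "\<forall>N b. \<exists>X. finite X \<and> real (card X) \<le> n1 * (1 / \<tau>) ^ b * (1 + real K * \<tau>) ^ N \<and>
    {z. \<bar>z\<bar> \<le> D1 * (1 / \<alpha>) ^ N \<and> card (bad_indices \<rho>1 \<alpha> z N) \<le> b} \<subseteq> (\<Union>x\<in>X. {x..x + 2 * \<rho>1})"
    using cover_few_bad_indices[OF \<alpha> \<rho>1 K(1) \<tau> D(1)] by blast
  obtain n2 where n2: "n2 > 0" and ex2: "\<forall>N b. \<exists>X. finite X \<and> real (card X) \<le> n2 * (1 / \<tau>) ^ b * (1 + real K * \<tau>) ^ N \<and>
    {z. \<bar>z\<bar> \<le> D2 * (1 / \<beta>) ^ N \<and> card (bad_indices \<rho>2 \<beta> z N) \<le> b} \<subseteq> (\<Union>x\<in>X. {x..x + 2 * \<rho>2})"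
    using cover_few_bad_indices[OF \<beta> \<rho>2 K(2) \<tau> D(2)] by blast
  define cov1 where "cov1 N X \<longleftrightarrow> finite X \<and> real (card X) \<le> n1 * (1 / \<tau>) ^ b N * (1 + real K * \<tau>) ^ N \<and>
    {z. \<bar>z\<bar> \<le> D1 * (1 / \<alpha>) ^ N \<and> card (bad_indices \<rho>1 \<alpha> z N) \<le> b N} \<subseteq> (\<Union>x\<in>X. {x..x + 2 * \<rho>1})" for N X
  define cov2 where "cov2 N X \<longleftrightarrow> finite X \<and> real (card X) \<le> n2 * (1 / \<tau>) ^ b N * (1 + real K * \<tau>) ^ (c0 * N) \<and>
    {z. \<bar>z\<bar> \<le> D2 * (1 / \<beta>) ^ (c0 * N) \<and> card (bad_indices \<rho>2 \<beta> z (c0 * N)) \<le> b N} \<subseteq> (\<Union>x\<in>X. {x..x + 2 * \<rho>2})" for N X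
  have "\<forall>N. \<exists>X. cov1 N X" "\<forall>N. \<exists>X. cov2 N X"
    unfolding cov1_def cov2_def by (intro allI ex1[THEN spec, THEN spec] ex2[THEN spec, THEN spec])+
  then obtain X Y where XY: "\<And>N. cov1 N (X N)" "\<And>N. cov2 N (Y N)" by metis
  note X = XY(1)[unfolded cov1_def, THEN conjunct1] XY(1)[unfolded cov1_def, THEN conjunct2, THEN conjunct1]
    XY(1)[unfolded cov1_def, THEN conjunct2, THEN conjunct2]
  note Y = XY(2)[unfolded cov2_def, THEN conjunct1] XY(2)[unfolded cov2_def, THEN conjunct2, THEN conjunct1]
    XY(2)[unfolded cov2_def, THEN conjunct2, THEN conjunct2]
  define C1 where "C1 = 2 * \<rho>2 / \<bar>\<Delta>2\<bar> + 2 * \<rho>1 / \<bar>\<Delta>1\<bar>"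
  have C1: "C1 > 0" using \<rho>1 \<rho>2 \<Delta> by (auto simp: C1_def intro!: add_pos_pos divide_pos_pos)
  define d where "d N = C1 * real (Suc N) * \<alpha> ^ N" for N
  have d0: "d N \<ge> 0" for N using C1 \<alpha> by (simp add: d_def)
  \<comment> \<open>The cutoff \<open>\<bar>u\<bar> \<le> N\<close> makes each set bounded and, as
    \<open>N\<close> grows, eventually admits every \<open>u\<close>; its price is a factor
    \<open>N\<close> in the diameter.\<close>
  define V where "V N x y = {u. \<bar>u\<bar> \<le> real N \<and> (\<exists>t. (1 / \<alpha>) ^ N \<le> \<bar>t\<bar> \<and>
    \<Delta>1 * t \<in> {x..x + 2 * \<rho>1} \<and> \<Delta>2 * (u * t) \<in> {y..y + 2 * \<rho>2})}" for N x y
  \<comment> \<open>The extra set \<open>{0}\<close> puts 0 into \<open>E\<close>, so that slopes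
    outside \<open>E\<close> are nonzero.\<close>
  define W where "W N = insert {0} ((\<lambda>(x, y). V N x y) ` (X N \<times> Y N))" for N
  define E where "E = {u. \<forall>N0. \<exists>N\<ge>N0. u \<in> \<Union>(W N)}"
  have diamV: "\<bar>u - u'\<bar> \<le> d N" if uu: "u \<in> V N x y" "u' \<in> V N x y" for N x y u u'
  proof -
    obtain t where t: "(1 / \<alpha>) ^ N \<le> \<bar>t\<bar>" "\<Delta>1 * t \<in> {x..x + 2 * \<rho>1}" "\<Delta>2 * (u * t) \<in> {y..y + 2 * \<rho>2}"
      using uu(1) by (auto simp: V_def)
    obtain t' where t': "(1 / \<alpha>) ^ N \<le> \<bar>t'\<bar>" "\<Delta>1 * t' \<in> {x..x + 2 * \<rho>1}" "\<Delta>2 * (u' * t') \<in> {y..y + 2 * \<rho>2}"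
      using uu(2) by (auto simp: V_def)
    have u': "\<bar>u'\<bar> \<le> real N" using uu(2) by (auto simp: V_def)
    have "\<bar>\<Delta>1\<bar> * \<bar>t - t'\<bar> \<le> 2 * \<rho>1"
      using t(2) t'(2) by (auto simp flip: abs_mult simp: right_diff_distrib)
    then have tt: "\<bar>t - t'\<bar> \<le> 2 * \<rho>1 / \<bar>\<Delta>1\<bar>" using \<Delta> by (simp add: field_simps)
    have "\<bar>\<Delta>2\<bar> * \<bar>u * t - u' * t'\<bar> \<le> 2 * \<rho>2"
      using t(3) t'(3) by (auto simp flip: abs_mult simp: right_diff_distrib)
    then have st: "\<bar>u * t - u' * t'\<bar> \<le> 2 * \<rho>2 / \<bar>\<Delta>2\<bar>" using \<Delta> by (simp add: field_simps)
    \<comment> \<open>Both \<open>t\<close> and \<open>u * t\<close> are known up to constants;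
      dividing by \<open>\<bar>t\<bar> \<ge> (1 / \<alpha>) ^ N\<close> turns this into precision
      \<open>\<alpha> ^ N\<close> for \<open>u\<close>.\<close>
    have "\<bar>u - u'\<bar> * \<bar>t\<bar> = \<bar>(u * t - u' * t') - u' * (t - t')\<bar>"
      by (simp add: algebra_simps flip: abs_mult)
    also have "\<dots> \<le> 2 * \<rho>2 / \<bar>\<Delta>2\<bar> + real N * (2 * \<rho>1 / \<bar>\<Delta>1\<bar>)"
    proof -
      have "\<bar>u' * (t - t')\<bar> \<le> real N * (2 * \<rho>1 / \<bar>\<Delta>1\<bar>)"
        unfolding abs_mult using u' tt by (intro mult_mono) auto
      then show ?thesis using st by linarith
    qed
    also have "\<dots> \<le> C1 * real (Suc N)"
    proof -
      have *: "a + real N * b \<le> (a + b) * real (Suc N)" if "0 \<le> a" "0 \<le> b" for a b :: real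
        using that by (simp add: algebra_simps)
      show ?thesis unfolding C1_def by (rule *) (use \<rho>1 \<rho>2 in auto)
    qed
    finally have "\<bar>u - u'\<bar> * \<bar>t\<bar> \<le> C1 * real (Suc N)" .
    moreover have "\<bar>u - u'\<bar> * (1 / \<alpha>) ^ N \<le> \<bar>u - u'\<bar> * \<bar>t\<bar>" using t(1) by (intro mult_left_mono) auto
    ultimately have "\<bar>u - u'\<bar> * (1 / \<alpha>) ^ N \<le> C1 * real (Suc N)" by linarith
    then show ?thesis using \<alpha> by (simp add: d_def power_divide field_simps)
  qed
  have "hausdorff_measure s E = 0"
  proof (rule hausdorff_measure_limsup_eq_0)
    show "finite (W N)" for N using X Y by (auto simp: W_def)
    show "bounded U \<and> diameter U \<le> d N" if "U \<in> W N" for U N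
    proof (cases "U = {0}")
      case False
      then have "U \<in> (\<lambda>(x, y). V N x y) ` (X N \<times> Y N)" using that unfolding W_def by blast
      then obtain x y where U: "U = V N x y" by auto
      have "bounded U" unfolding U bounded_iff by (intro exI[of _ "real N"]) (auto simp: V_def)
      moreover have "diameter U \<le> d N" unfolding U using d0 diamV by (intro diameter_le) auto
      ultimately show ?thesis ..
    qed (simp add: d0)
    show "\<exists>N\<ge>N0. u \<in> \<Union>(W N)" if "u \<in> E" for u N0 using that by (auto simp: E_def)
    have lim: "(\<lambda>N. real (Suc N) * r ^ N) \<longlonglongrightarrow> 0" if "0 < r" "r < 1" for r :: real
    proof -
      have "(\<lambda>N. real N * r ^ N) \<longlonglongrightarrow> 0" using that by (intro powser_times_n_limit_0) auto
      moreover have "(\<lambda>N. r ^ N) \<longlonglongrightarrow> 0" using that by (intro LIMSEQ_realpow_zero) auto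
      ultimately have "(\<lambda>N. r ^ N + real N * r ^ N) \<longlonglongrightarrow> 0 + 0" by (rule tendsto_add[rotated])
      then show ?thesis by (simp add: algebra_simps)
    qed
    show "d \<longlonglongrightarrow> 0"
      using tendsto_mult_left[OF lim[OF \<alpha>], of C1] by (simp add: d_def[abs_def] mult.assoc)
    have cardW: "real (card (W N)) \<le> (1 + n1 * n2) * exp (2 * \<eta> * real N)" for N
    proof -
      have "real (card (W N)) \<le> 1 + real (card (X N)) * real (card (Y N))"
      proof -
        have "card (W N) \<le> Suc (card ((\<lambda>(x, y). V N x y) ` (X N \<times> Y N)))"
          unfolding W_def by (rule card_insert_le_m1) auto
        also have "\<dots> \<le> Suc (card (X N \<times> Y N))" using X Y by (intro Suc_le_mono[THEN iffD2] card_image_le) auto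
        finally show ?thesis by (simp flip: of_nat_mult of_nat_Suc add: card_cartesian_product)
      qed
      also have "\<dots> \<le> 1 + (n1 * (1 / \<tau>) ^ b N * (1 + real K * \<tau>) ^ N) * (n2 * (1 / \<tau>) ^ b N * (1 + real K * \<tau>) ^ (c0 * N))"
        using X Y n1 \<tau> by (intro add_mono mult_mono) auto
      also have "\<dots> = 1 + n1 * n2 * (((1 / \<tau>) ^ b N * (1 / \<tau>) ^ b N) * ((1 + real K * \<tau>) ^ N * (1 + real K * \<tau>) ^ (c0 * N)))"
        by (simp only: mult_ac)
      also have "\<dots> \<le> 1 + n1 * n2 * (exp (\<eta> * real N) * exp (\<eta> * real N))"
        using n1 n2 pow\<tau> powK \<tau> by (intro add_mono mult_left_mono mult_mono order.refl) auto
      also have "\<dots> = 1 + n1 * n2 * exp (2 * \<eta> * real N)" by (simp flip: exp_add add: algebra_simps)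
      also have "\<dots> \<le> exp (2 * \<eta> * real N) + n1 * n2 * exp (2 * \<eta> * real N)" using \<eta> by simp
      finally show ?thesis by (simp add: algebra_simps)
    qed
    have dpow: "d N powr s \<le> C1 powr s * (real (Suc N) * exp (- 4 * \<eta> * real N))" for N
    proof -
      have "(\<alpha> ^ N) powr s = exp (- 4 * \<eta> * real N)"
        using \<alpha> by (simp add: powr_def \<eta>_def L_def ln_realpow ln_div mult_ac)
      moreover have "real (Suc N) powr s \<le> real (Suc N) powr 1" using s by (intro powr_mono) auto
      ultimately show ?thesis using C1 \<alpha> by (simp add: d_def powr_mult mult.assoc mult_left_mono mult_right_mono)
    qed
    have le: "real (card (W N)) * d N powr s \<le> ((1 + n1 * n2) * C1 powr s) * (real (Suc N) * exp (- 2 * \<eta>) ^ N)" for N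
    proof -
      have "real (card (W N)) * d N powr s \<le> ((1 + n1 * n2) * exp (2 * \<eta> * real N)) * (C1 powr s * (real (Suc N) * exp (- 4 * \<eta> * real N)))"
        using n1 n2 by (intro mult_mono cardW dpow) auto
      also have "\<dots> = ((1 + n1 * n2) * C1 powr s) * (real (Suc N) * (exp (2 * \<eta> * real N) * exp (- 4 * \<eta> * real N)))"
        by (simp only: mult_ac)
      also have "exp (2 * \<eta> * real N) * exp (- 4 * \<eta> * real N) = exp (- 2 * \<eta>) ^ N"
        by (simp flip: exp_add exp_of_nat_mult add: algebra_simps)
      finally show ?thesis .
    qed
    have "summable (\<lambda>N. real (Suc N) * exp (- 2 * \<eta>) ^ N)"
    proof (rule summable_comparison_test_ev)
      have "(\<lambda>N. real (Suc N) * exp (- \<eta>) ^ N) \<longlonglongrightarrow> 0" using \<eta> by (intro lim) auto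
      then have "eventually (\<lambda>N. real (Suc N) * exp (- \<eta>) ^ N < 1) sequentially" by (rule order_tendstoD) simp
      then show "eventually (\<lambda>N. norm (real (Suc N) * exp (- 2 * \<eta>) ^ N) \<le> exp (- \<eta>) ^ N) sequentially"
      proof eventually_elim
        case (elim N)
        have "exp (- 2 * \<eta>) ^ N = exp (- \<eta>) ^ N * exp (- \<eta>) ^ N"
          by (simp flip: power_mult_distrib exp_add)
        then have "norm (real (Suc N) * exp (- 2 * \<eta>) ^ N) = (real (Suc N) * exp (- \<eta>) ^ N) * exp (- \<eta>) ^ N"
          by (simp add: abs_mult)
        also have "\<dots> \<le> 1 * exp (- \<eta>) ^ N" using elim by (intro mult_right_mono) auto
        finally show ?case by simp
      qed
      show "summable (\<lambda>N. exp (- \<eta>) ^ N)" using \<eta> by (intro summable_geometric) auto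
    qed
    then have "summable (\<lambda>N. ((1 + n1 * n2) * C1 powr s) * (real (Suc N) * exp (- 2 * \<eta>) ^ N))"
      by (rule summable_mult)
    then show "summable (\<lambda>N. real (card (W N)) * d N powr s)"
      by (rule summable_comparison_test'[of _ 0]) (use le d0 in auto)
  qed (rule s)
  moreover have "0 \<in> E" by (auto simp: E_def W_def)
  moreover have "decays u" if u: "u \<notin> E" for u
  proof -
    obtain N1 where N1: "\<And>N. N \<ge> N1 \<Longrightarrow> u \<notin> \<Union>(W N)" using u by (auto simp: E_def)
    obtain N2 :: nat where N2: "\<bar>u\<bar> \<le> real N2" using real_arch_simple by blast
    define N0 where "N0 = max N1 N2"
    \<comment> \<open>Chosen so that \<open>\<theta> powr (\<kappa> * N)\<close> is the power
      \<open>- \<sigma>\<close> of \<open>(1 / \<alpha>) ^ N\<close>.\<close>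
    define \<sigma> where "\<sigma> = \<kappa> * ln (1 / \<theta>) / L"
    have \<sigma>: "\<sigma> > 0" using \<kappa> \<theta> L by (simp add: \<sigma>_def)
    have \<alpha>\<sigma>: "(1 / \<alpha>) powr (- \<sigma> * x) = \<theta> powr (\<kappa> * x)" for x
      using \<alpha> \<theta> L by (simp add: powr_def \<sigma>_def L_def ln_div)
    have fg1: "cmod (f t * g (u * t)) \<le> 1" for t
      using f1 g1 by (auto simp: norm_mult intro!: mult_le_one)
    have main: "cmod (f t * g (u * t)) \<le> \<theta> powr (\<kappa> * real N)"
      if N: "N \<ge> N0" and t: "(1 / \<alpha>) ^ N \<le> \<bar>t\<bar>" "\<bar>t\<bar> \<le> (1 / \<alpha>) ^ Suc N" for t N
    proof -
      have uN: "\<bar>u\<bar> \<le> real N" using N N2 by (simp add: N0_def)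
      \<comment> \<open>Otherwise both frequencies would be covered and \<open>u\<close> would
        belong to a set of \<open>W N\<close>, contrary to the choice of \<open>N1\<close>.\<close>
      have cond: "b N < card (bad_indices \<rho>1 \<alpha> (\<Delta>1 * t) N) \<or> b N < card (bad_indices \<rho>2 \<beta> (\<Delta>2 * (u * t)) (c0 * N))"
      proof (rule ccontr)
        assume not: "\<not> ?thesis"
        have "\<bar>\<Delta>1 * t\<bar> \<le> D1 * (1 / \<alpha>) ^ N"
          using t(2) \<alpha> mult_left_mono[OF t(2), of "\<bar>\<Delta>1\<bar>"] by (simp add: abs_mult D1_def field_simps)
        then obtain x where x: "x \<in> X N" "\<Delta>1 * t \<in> {x..x + 2 * \<rho>1}" using X(3)[of N] not by fastforce
        have "\<bar>\<Delta>2 * (u * t)\<bar> \<le> D2 * (1 / \<beta>) ^ (c0 * N)"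
        proof -
          have "\<bar>\<Delta>2 * (u * t)\<bar> = \<bar>\<Delta>2\<bar> * (\<bar>u\<bar> * \<bar>t\<bar>)" by (simp add: abs_mult)
          also have "\<dots> \<le> \<bar>\<Delta>2\<bar> * (2 ^ N * (1 / \<alpha>) ^ Suc N)"
          proof (intro mult_left_mono mult_mono t(2))
            show "\<bar>u\<bar> \<le> 2 ^ N" using uN of_nat_less_two_power[of N, where 'a=real] by linarith
          qed auto
          also have "\<dots> = D2 * (2 / \<alpha>) ^ N" by (simp add: D2_def power_divide)
          also have "\<dots> \<le> D2 * ((1 / \<beta>) ^ c0) ^ N"
            using c0 \<alpha> D by (intro mult_left_mono power_mono) auto
          finally show ?thesis by (simp add: power_mult)
        qed
        then obtain y where y: "y \<in> Y N" "\<Delta>2 * (u * t) \<in> {y..y + 2 * \<rho>2}" using Y(3)[of N] not by fastforce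
        have "u \<in> V N x y" unfolding V_def using uN t x y by auto
        then have "u \<in> \<Union>(W N)" using x y by (auto simp: W_def)
        then show False using N1[of N] N by (simp add: N0_def)
      qed
      have less: "\<theta> ^ k \<le> \<theta> powr (\<kappa> * real N)" if "b N < k" for k
      proof -
        have "\<kappa> * real N \<le> real k" using b_gt[of N] that by linarith
        then have "\<theta> powr real k \<le> \<theta> powr (\<kappa> * real N)" using \<theta> by (intro powr_mono') auto
        then show ?thesis using \<theta> by (simp add: powr_realpow)
      qed
      have F: "cmod (f t) \<le> \<theta> ^ card (bad_indices \<rho>1 \<alpha> (\<Delta>1 * t) N)"
        by (rule norm_le_power_card_bad[where f=f and P=P and \<alpha>=\<alpha>, OF f f1 P1 P\<theta>]) (use \<theta> in auto)
      have G: "cmod (g (u * t)) \<le> \<theta> ^ card (bad_indices \<rho>2 \<beta> (\<Delta>2 * (u * t)) (c0 * N))"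
        by (rule norm_le_power_card_bad[where f=g and P=Q and \<alpha>=\<beta>, OF g g1 Q1 Q\<theta>]) (use \<theta> in auto)
      have "cmod (f t) \<le> \<theta> powr (\<kappa> * real N) \<or> cmod (g (u * t)) \<le> \<theta> powr (\<kappa> * real N)"
        using cond order.trans[OF F less] order.trans[OF G less] by blast
      then show ?thesis
      proof
        assume "cmod (f t) \<le> \<theta> powr (\<kappa> * real N)"
        then have "cmod (f t) * cmod (g (u * t)) \<le> \<theta> powr (\<kappa> * real N) * 1" by (intro mult_mono g1) auto
        then show ?thesis by (simp add: norm_mult)
      next
        assume "cmod (g (u * t)) \<le> \<theta> powr (\<kappa> * real N)"
        then have "cmod (f t) * cmod (g (u * t)) \<le> 1 * \<theta> powr (\<kappa> * real N)" by (intro mult_mono f1) auto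
        then show ?thesis by (simp add: norm_mult)
      qed
    qed
    define C where "C = (1 / \<alpha>) powr (\<sigma> * real (Suc N0))"
    have A1: "1 / \<alpha> > 1" using \<alpha> by simp
    have "cmod (f t * g (u * t)) \<le> C * \<bar>t\<bar> powr - \<sigma>" if t: "t \<noteq> 0" for t
    proof (cases "\<bar>t\<bar> < (1 / \<alpha>) ^ N0")
      case True
      have "1 = (1 / \<alpha>) powr (\<sigma> * real N0) * ((1 / \<alpha>) ^ N0) powr - \<sigma>"
        using \<alpha> by (simp add: powr_realpow[symmetric] powr_powr flip: powr_add)
      also have "\<dots> \<le> C * \<bar>t\<bar> powr - \<sigma>"
      proof (intro mult_mono)
        show "(1 / \<alpha>) powr (\<sigma> * real N0) \<le> C" unfolding C_def
          using A1 \<sigma> by (intro powr_mono mult_left_mono) auto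
        show "((1 / \<alpha>) ^ N0) powr - \<sigma> \<le> \<bar>t\<bar> powr - \<sigma>"
          using True t \<sigma> by (intro powr_mono2') auto
      qed (auto simp: C_def)
      finally show ?thesis using fg1[of t] by linarith
    next
      case False
      then have t1: "(1 / \<alpha>) ^ N0 \<le> \<bar>t\<bar>" by simp
      have "\<exists>n. \<bar>t\<bar> < (1 / \<alpha>) ^ n" using real_arch_pow[OF A1] by blast
      then obtain n where n: "\<bar>t\<bar> < (1 / \<alpha>) ^ n" "\<And>m. m < n \<Longrightarrow> \<not> \<bar>t\<bar> < (1 / \<alpha>) ^ m"
        using exists_least_iff[of "\<lambda>n. \<bar>t\<bar> < (1 / \<alpha>) ^ n"] by blast
      have "N0 < n"
      proof (rule ccontr)
        assume "\<not> N0 < n"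
        then have "(1 / \<alpha>) ^ n \<le> (1 / \<alpha>) ^ N0" using A1 by (intro power_increasing) auto
        then show False using n(1) t1 by linarith
      qed
      then obtain N where N: "n = Suc N" "N0 \<le> N" by (cases n) auto
      have lo: "(1 / \<alpha>) ^ N \<le> \<bar>t\<bar>" using n(2)[of N] N by simp
      have "cmod (f t * g (u * t)) \<le> \<theta> powr (\<kappa> * real N)"
        using n N lo by (intro main) auto
      also have "\<dots> = (1 / \<alpha>) powr \<sigma> * ((1 / \<alpha>) ^ Suc N) powr - \<sigma>"
        unfolding \<alpha>\<sigma>[symmetric] using \<alpha>
        by (simp add: powr_realpow[symmetric] powr_powr del: power_Suc flip: powr_add) (simp add: algebra_simps)
      also have "\<dots> \<le> C * \<bar>t\<bar> powr - \<sigma>"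
      proof (intro mult_mono)
        show "(1 / \<alpha>) powr \<sigma> \<le> C" unfolding C_def
          using A1 \<sigma> by (intro powr_mono) (auto simp: distrib_left)
        show "((1 / \<alpha>) ^ Suc N) powr - \<sigma> \<le> \<bar>t\<bar> powr - \<sigma>"
          using n N t \<sigma> by (intro powr_mono2') auto
      qed (auto simp: C_def)
      finally show ?thesis .
    qed
    moreover have "C > 0" using \<alpha> by (simp add: C_def)
    ultimately show ?thesis unfolding decays_def using \<sigma> by blast
  qed
  ultimately show ?thesis by blast
qed

text \<open>The property \<open>decays\<close> does not involve \<open>s\<close>, so the exceptional
  sets obtained for \<open>s = 1 / (m + 1)\<close> can be intersected; the intersection is null for
  each of these \<open>s\<close>.\<close>

theorem exists_hausdorff_dim_0: "\<exists>E. 0 \<in> E \<and> hausdorff_dim E = 0 \<and> (\<forall>u. u \<notin> E \<longrightarrow> decays u)"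
proof -
  have "\<forall>m::nat. \<exists>E. 0 \<in> E \<and> hausdorff_measure (1 / real (Suc m)) E = 0 \<and> (\<forall>u. u \<notin> E \<longrightarrow> decays u)"
    by (intro allI exists_exceptional_set) auto
  then obtain E where E: "\<And>m. 0 \<in> E m" "\<And>m. hausdorff_measure (1 / real (Suc m)) (E m) = 0"
    "\<And>m u. u \<notin> E m \<Longrightarrow> decays u" by metis
  define F where "F = (\<Inter>m. E m)"
  have "hausdorff_measure (1 / real (Suc m)) F \<le> hausdorff_measure (1 / real (Suc m)) (E m)" for m
    by (rule hausdorff_measure_mono) (auto simp: F_def)
  then have F0: "hausdorff_measure (1 / real (Suc m)) F = 0" for m unfolding E(2) by simp
  have le_e: "hausdorff_dim F \<le> 0 + ennreal e" if e: "0 < e" for e :: real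
  proof -
    obtain m where m: "inverse (real (Suc m)) < e" using reals_Archimedean[OF e] by auto
    have "hausdorff_dim F \<le> ennreal (1 / real (Suc m))"
      unfolding hausdorff_dim_def by (rule INF_lower) (use F0 in auto)
    also have "\<dots> \<le> 0 + ennreal e"
      using m by (simp add: inverse_eq_divide ennreal_leI)
    finally show ?thesis .
  qed
  have "hausdorff_dim F \<le> 0" by (rule ennreal_le_epsilon) (rule le_e)
  then have "hausdorff_dim F = 0" by simp
  moreover have "0 \<in> F" using E by (auto simp: F_def)
  moreover have "decays u" if "u \<notin> F" for u using that E(3) by (auto simp: F_def)
  ultimately show ?thesis by blast
qed

end

section \<open>Self-similar measures\<close>

context
  fixes A B :: "real measure"
  assumes A: "finite_borel_measure A" and B: "finite_borel_measure B"
begin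

interpretation A: finite_borel_measure A by (rule A)
interpretation B: finite_borel_measure B by (rule B)

lemma AE_lcomb_iff:
  assumes P: "{z. P z} \<in> sets borel"
  shows "(AE z in lcomb c A B. P z) \<longleftrightarrow> (AE x in A. AE y in B. P (x + c * y))"
proof -
  have [measurable_cong]: "sets A = sets borel" "sets B = sets borel"
    by (rule A.M_is_borel B.M_is_borel)+
  have N: "- {z. P z} \<in> sets borel" using P by simp
  define N where "N = - {z. P z}"
  have [measurable]: "N \<in> sets borel" using N by (simp add: N_def)
  have "(AE z in lcomb c A B. P z) \<longleftrightarrow> (AE z in lcomb c A B. indicator N z = (0::ennreal))"
    by (intro AE_cong) (simp add: N_def indicator_def)
  also have "\<dots> \<longleftrightarrow> (\<integral>\<^sup>+z. indicator N z \<partial>lcomb c A B) = 0"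
    by (subst nn_integral_0_iff_AE) auto
  also have "(\<integral>\<^sup>+z. indicator N z \<partial>lcomb c A B) = (\<integral>\<^sup>+x. \<integral>\<^sup>+y. indicator N (x + c * y) \<partial>B \<partial>A)"
    by (rule nn_integral_lcomb[OF A B]) auto
  also have "\<dots> = 0 \<longleftrightarrow> (AE x in A. (\<integral>\<^sup>+y. indicator N (x + c * y) \<partial>B) = 0)"
    by (subst nn_integral_0_iff_AE) auto
  also have "\<dots> \<longleftrightarrow> (AE x in A. AE y in B. P (x + c * y))"
  proof (intro AE_cong)
    fix x
    have "((\<integral>\<^sup>+y. indicator N (x + c * y) \<partial>B) = 0) \<longleftrightarrow> (AE y in B. indicator N (x + c * y) = (0::ennreal))"
      by (rule nn_integral_0_iff_AE) measurable
    then show "((\<integral>\<^sup>+y. indicator N (x + c * y) \<partial>B) = 0) \<longleftrightarrow> (AE y in B. P (x + c * y))"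
      by (simp add: N_def indicator_def)
  qed
  finally show ?thesis .
qed

end

section \<open>Ball measures and digit laws\<close>

lemma cball_in_borel [measurable, simp]: "cball x r \<in> sets (borel :: real measure)"
  by (simp add: borel_closed)

lemma borel_measurable_measure_cball [measurable]:
  assumes "finite_borel_measure \<theta>"
  shows "(\<lambda>y. measure \<theta> (cball y r)) \<in> borel_measurable borel"
proof -
  interpret finite_borel_measure \<theta> by fact
  have [measurable_cong]: "sets \<theta> = sets borel" by (rule M_is_borel)
  have "measure \<theta> (cball y r) = (\<integral>z. indicator {0..r} \<bar>y - z\<bar> \<partial>\<theta>)" for y
  proof -
    have "(\<integral>z. indicator {0..r} \<bar>y - z\<bar> \<partial>\<theta>) = (\<integral>z. indicator (cball y r) z \<partial>\<theta>)"
      by (intro Bochner_Integration.integral_cong) (auto simp: indicator_def dist_real_def)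
    also have "\<dots> = measure \<theta> (cball y r)" using M_is_borel by (simp add: borel_UNIV)
    finally show ?thesis by simp
  qed
  then show ?thesis by simp
qed

definition digit_law :: "real pmf \<Rightarrow> real measure" where
  "digit_law \<rho> = distr (measure_pmf \<rho>) borel (\<lambda>x. x)"

lemma real_distribution_digit_law: "real_distribution (digit_law \<rho>)"
  unfolding digit_law_def real_distribution_def real_distribution_axioms_def
  by (auto intro: measure_pmf.prob_space_distr)

lemma nn_integral_digit_law:
  assumes "finite (set_pmf \<rho>)" and [measurable]: "f \<in> borel_measurable borel"
  shows "(\<integral>\<^sup>+x. f x \<partial>digit_law \<rho>) = (\<Sum>d\<in>set_pmf \<rho>. ennreal (pmf \<rho> d) * f d)"
  unfolding digit_law_def using assms
  by (subst nn_integral_distr) (auto simp: nn_integral_measure_pmf_finite mult.commute)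

lemma AE_digit_law:
  assumes "\<And>d. d \<in> set_pmf \<rho> \<Longrightarrow> P d" and "{x. P x} \<in> sets borel"
  shows "AE d in digit_law \<rho>. P d"
  unfolding digit_law_def using assms by (subst AE_distr_iff) (auto simp: AE_measure_pmf_iff)

subsection \<open>Existence, uniqueness and support of self-similar measures\<close>

lemma borel_measurable_infdist [measurable]: "(\<lambda>x::real. infdist x A) \<in> borel_measurable borel"
  by (intro borel_measurable_continuous_onI continuous_intros)

text \<open>Truncating the distance at 1 keeps the integral finite without moment assumptions and
  moves the contraction into the slope \<open>s\<close>: if \<open>x \<mapsto> d + c * x\<close>
  sends \<open>A\<close> into \<open>B\<close>, the distance of the image from \<open>B\<close> is
  at most \<open>\<bar>c\<bar>\<close> times the distance of \<open>x\<close> from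
  \<open>A\<close>.\<close>

lemma nn_integral_infdist_lcomb_le:
  assumes D: "real_distribution D" and \<kappa>: "real_distribution \<kappa>" and s: "0 \<le> s"
    and A: "A \<noteq> {}" and AB: "AE d in D. \<forall>x\<in>A. d + c * x \<in> B"
  shows "(\<integral>\<^sup>+x. ennreal (min 1 (s * infdist x B)) \<partial>lcomb c D \<kappa>)
    \<le> (\<integral>\<^sup>+x. ennreal (min 1 (s * \<bar>c\<bar> * infdist x A)) \<partial>\<kappa>)"
proof -
  interpret D: real_distribution D by fact
  interpret \<kappa>: real_distribution \<kappa> by fact
  have le: "infdist (d + c * x) B \<le> \<bar>c\<bar> * infdist x A" if "\<forall>x\<in>A. d + c * x \<in> B" for d x
  proof (cases "c = 0")
    case True
    then have "d + c * x \<in> B" using that A by auto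
    then show ?thesis by (simp add: infdist_nonneg)
  next
    case False
    have "infdist (d + c * x) B / \<bar>c\<bar> \<le> infdist x A"
      unfolding infdist_notempty[OF A]
    proof (rule cINF_greatest[OF A])
      fix a assume "a \<in> A"
      then have "infdist (d + c * x) B \<le> dist (d + c * x) (d + c * a)"
        using that by (intro infdist_le) auto
      also have "\<dots> = \<bar>c\<bar> * dist x a"
        by (simp add: dist_real_def flip: abs_mult right_diff_distrib)
      finally show "infdist (d + c * x) B / \<bar>c\<bar> \<le> dist x a"
        using False by (simp add: field_simps)
    qed
    then show ?thesis using False by (simp add: field_simps)
  qed
  have "(\<integral>\<^sup>+x. ennreal (min 1 (s * infdist x B)) \<partial>lcomb c D \<kappa>)
    = (\<integral>\<^sup>+d. \<integral>\<^sup>+x. ennreal (min 1 (s * infdist (d + c * x) B)) \<partial>\<kappa> \<partial>D)"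
    by (subst nn_integral_lcomb) (auto intro: D.finite_borel_measure_M \<kappa>.finite_borel_measure_M)
  also have "\<dots> \<le> (\<integral>\<^sup>+d. (\<integral>\<^sup>+x. ennreal (min 1 (s * \<bar>c\<bar> * infdist x A)) \<partial>\<kappa>) \<partial>D)"
  proof (intro nn_integral_mono_AE)
    show "AE d in D. (\<integral>\<^sup>+x. ennreal (min 1 (s * infdist (d + c * x) B)) \<partial>\<kappa>)
      \<le> (\<integral>\<^sup>+x. ennreal (min 1 (s * \<bar>c\<bar> * infdist x A)) \<partial>\<kappa>)"
      using AB
    proof eventually_elim
      case (elim d)
      show ?case
      proof (intro nn_integral_mono ennreal_leI min.mono order.refl)
        fix x
        show "s * infdist (d + c * x) B \<le> s * \<bar>c\<bar> * infdist x A"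
          using le[OF elim, of x] s unfolding mult.assoc by (intro mult_left_mono) auto
      qed
    qed
  qed
  also have "\<dots> = (\<integral>\<^sup>+x. ennreal (min 1 (s * \<bar>c\<bar> * infdist x A)) \<partial>\<kappa>)"
    by (simp add: D.emeasure_space_1[simplified])
  finally show ?thesis .
qed

lemma AE_mem_if_nn_integral_infdist_0:
  assumes \<kappa>: "real_distribution \<kappa>" and A: "closed A" "A \<noteq> {}" and s: "0 < s"
    and 0: "(\<integral>\<^sup>+x. ennreal (min 1 (s * infdist x A)) \<partial>\<kappa>) = 0"
  shows "AE x in \<kappa>. x \<in> A"
proof -
  interpret \<kappa>: real_distribution \<kappa> by fact
  have "AE x in \<kappa>. ennreal (min 1 (s * infdist x A)) = 0"
    using 0 by (subst (asm) nn_integral_0_iff_AE) auto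
  then show ?thesis
  proof eventually_elim
    case (elim x)
    then have "infdist x A \<le> 0" using s infdist_nonneg[of x A]
      by (auto simp: ennreal_eq_0_iff min_def mult_le_0_iff split: if_splits)
    then have "infdist x A = 0" using infdist_nonneg[of x A] by linarith
    then show "x \<in> A" using A by (simp add: in_closed_iff_infdist_zero)
  qed
qed

text \<open>Iteration shrinks the slope to \<open>b ^ n\<close>, and dominated convergence with the
  bound 1 shows that the truncated distance integrates to 0. This locates the support of a law known
  only through a self-similarity equation.\<close>

lemma AE_mem_if_contracting:
  assumes \<kappa>: "real_distribution \<kappa>" and A: "closed A" "A \<noteq> {}" and b: "0 \<le> b" "b < 1"
    and le: "\<And>s. 0 \<le> s \<Longrightarrow> (\<integral>\<^sup>+x. ennreal (min 1 (s * infdist x A)) \<partial>\<kappa>)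
      \<le> (\<integral>\<^sup>+x. ennreal (min 1 (s * b * infdist x A)) \<partial>\<kappa>)"
  shows "AE x in \<kappa>. x \<in> A"
proof (rule AE_mem_if_nn_integral_infdist_0[OF \<kappa> A, of 1])
  interpret \<kappa>: real_distribution \<kappa> by fact
  let ?I = "\<lambda>s. \<integral>\<^sup>+x. ennreal (min 1 (s * infdist x A)) \<partial>\<kappa>"
  have "?I 1 \<le> ?I (b ^ n)" for n
  proof (induction n)
    case (Suc n)
    then show ?case using le[of "b ^ n"] b by (simp add: mult.commute)
  qed simp
  moreover have "(\<lambda>n. ?I (b ^ n)) \<longlonglongrightarrow> (\<integral>\<^sup>+x. 0 \<partial>\<kappa>)"
  proof (rule nn_integral_dominated_convergence[where w = "\<lambda>_. 1"])
    show "AE x in \<kappa>. (\<lambda>n. ennreal (min 1 (b ^ n * infdist x A))) \<longlonglongrightarrow> 0"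
    proof (intro AE_I2)
      fix x
      have "(\<lambda>n. b ^ n) \<longlonglongrightarrow> 0" using b by (intro LIMSEQ_realpow_zero) auto
      then have "(\<lambda>n. min 1 (b ^ n * infdist x A)) \<longlonglongrightarrow> min 1 (0 * infdist x A)"
        by (intro tendsto_min tendsto_mult tendsto_const)
      then show "(\<lambda>n. ennreal (min 1 (b ^ n * infdist x A))) \<longlonglongrightarrow> 0"
        using tendsto_ennrealI by fastforce
    qed
    show "AE x in \<kappa>. ennreal (min 1 (b ^ n * infdist x A)) \<le> 1" for n
      by (auto intro!: AE_I2 simp flip: ennreal_1 intro: ennreal_leI)
  qed (auto simp: \<kappa>.emeasure_space_1[simplified])
  ultimately have "?I 1 \<le> 0"
    by (intro LIMSEQ_le_const[where X = "\<lambda>n. ?I (b ^ n)"]) auto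
  then show "?I 1 = 0" by simp
qed simp

text \<open>The law of the random series \<open>\<Sum> c\<^sup>n A\<^sub>n\<close> on the space of
  digit sequences: putting an independent digit in front of a sequence preserves the product
  measure, and this invariance is the required equation.\<close>

lemma exists_self_similar:
  assumes D: "real_distribution D" and R: "AE x in D. \<bar>x\<bar> \<le> R" and c: "\<bar>c\<bar> < 1"
  shows "\<exists>\<mu>. real_distribution \<mu> \<and> \<mu> = lcomb c D \<mu> \<and> (AE x in \<mu>. \<bar>x\<bar> \<le> R / (1 - \<bar>c\<bar>))"
proof -
  interpret D: real_distribution D by fact
  interpret seq: sequence_space D ..
  define S where "S = Pi\<^sub>M (UNIV::nat set) (\<lambda>_. D)"
  have R0: "0 \<le> R"
  proof (rule ccontr)
    assume "\<not> 0 \<le> R"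
    then have "\<not> \<bar>x\<bar> \<le> R" for x :: real by linarith
    then show False using R by simp
  qed
  \<comment> \<open>Digits are clamped to \<open>{- R..R}\<close>, so that the series converges for
    every sequence and not only almost surely.\<close>
  define cl where "cl x = max (-R) (min R x)" for x
  have cl: "\<bar>cl x\<bar> \<le> R" for x using R0 by (auto simp: cl_def)
  have [measurable]: "cl \<in> borel_measurable borel" unfolding cl_def[abs_def] by measurable
  define X where "X \<omega> = (\<Sum>n. c ^ n * cl (\<omega> n))" for \<omega> :: "nat \<Rightarrow> real"
  have X_meas [measurable]: "X \<in> borel_measurable S"
    unfolding X_def[abs_def] S_def by measurable
  have summ: "summable (\<lambda>n. c ^ n * cl (\<omega> n))" for \<omega>
  proof (rule summable_comparison_test')
    show "summable (\<lambda>n. \<bar>c\<bar> ^ n * R)" using c by (intro summable_mult2 summable_geometric) auto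
    show "norm (c ^ n * cl (\<omega> n)) \<le> \<bar>c\<bar> ^ n * R" for n
      by (simp add: abs_mult power_abs mult_left_mono cl)
  qed
  have X_Cons: "X (case_nat s \<omega>) = cl s + c * X \<omega>" for s \<omega>
  proof -
    have "X (case_nat s \<omega>) = (\<Sum>n. c ^ Suc n * cl (\<omega> n)) + cl s"
      using suminf_split_head[OF summ[of "case_nat s \<omega>"]] by (simp add: X_def)
    also have "(\<Sum>n. c ^ Suc n * cl (\<omega> n)) = c * X \<omega>"
      unfolding X_def using suminf_mult[OF summ, of c \<omega>] by (simp add: mult.assoc)
    finally show ?thesis by simp
  qed
  have cons_meas: "(\<lambda>(s, \<omega>). case_nat s \<omega>) \<in> D \<Otimes>\<^sub>M S \<rightarrow>\<^sub>M S"
    unfolding S_def by measurable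
  interpret S: prob_space S unfolding S_def by (rule prob_space_PiM) (rule D.prob_space_axioms)
  define \<mu> where "\<mu> = distr S borel X"
  have \<mu>: "real_distribution \<mu>"
    unfolding \<mu>_def real_distribution_def real_distribution_axioms_def
    by (auto intro: S.prob_space_distr)
  interpret \<mu>: real_distribution \<mu> by fact
  interpret DS: pair_sigma_finite D S ..
  have Dfin: "finite_borel_measure D" and \<mu>fin: "finite_borel_measure \<mu>"
    by (rule D.finite_borel_measure_M \<mu>.finite_borel_measure_M)+
  have eq: "\<mu> = lcomb c D \<mu>"
  proof (rule measure_eqI)
    fix A assume "A \<in> sets \<mu>"
    then have [measurable]: "A \<in> sets borel" by simp
    have "emeasure \<mu> A = (\<integral>\<^sup>+x. indicator A x \<partial>\<mu>)" by simp
    also have "\<dots> = (\<integral>\<^sup>+\<omega>. indicator A (X \<omega>) \<partial>S)" unfolding \<mu>_def by (subst nn_integral_distr) auto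
    also have "\<dots> = (\<integral>\<^sup>+\<omega>. indicator A (X \<omega>) \<partial>distr (D \<Otimes>\<^sub>M S) S (\<lambda>(s, \<omega>). case_nat s \<omega>))"
      using seq.PiM_iter unfolding S_def by simp
    also have "\<dots> = (\<integral>\<^sup>+z. indicator A (X (case z of (s, \<omega>) \<Rightarrow> case_nat s \<omega>)) \<partial>(D \<Otimes>\<^sub>M S))"
    proof (rule nn_integral_distr[OF cons_meas])
      have "(\<lambda>\<omega>. indicator A (X \<omega>) :: ennreal) \<in> borel_measurable S" by measurable
      then show "(\<lambda>\<omega>. indicator A (X \<omega>) :: ennreal) \<in> borel_measurable (distr (D \<Otimes>\<^sub>M S) S (\<lambda>(s, \<omega>). case_nat s \<omega>))"
        by simp
    qed
    also have "\<dots> = (\<integral>\<^sup>+z. indicator A (cl (fst z) + c * X (snd z)) \<partial>(D \<Otimes>\<^sub>M S))"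
      by (intro nn_integral_cong) (auto simp: X_Cons)
    also have "\<dots> = (\<integral>\<^sup>+s. \<integral>\<^sup>+\<omega>. indicator A (cl s + c * X \<omega>) \<partial>S \<partial>D)"
      by (subst S.nn_integral_fst[symmetric]) auto
    also have "\<dots> = (\<integral>\<^sup>+s. \<integral>\<^sup>+x. indicator A (cl s + c * x) \<partial>\<mu> \<partial>D)"
      unfolding \<mu>_def by (intro nn_integral_cong) (subst nn_integral_distr, auto)
    also have "\<dots> = (\<integral>\<^sup>+s. \<integral>\<^sup>+x. indicator A (s + c * x) \<partial>\<mu> \<partial>D)"
      using R by (intro nn_integral_cong_AE) (auto elim!: eventually_mono simp: cl_def max_def min_def)
    also have "\<dots> = (\<integral>\<^sup>+x. indicator A x \<partial>lcomb c D \<mu>)"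
      by (subst nn_integral_lcomb[OF Dfin \<mu>fin]) auto
    finally show "emeasure \<mu> A = emeasure (lcomb c D \<mu>) A" by simp
  qed simp
  \<comment> \<open>A ball of this radius is mapped into itself by
    \<open>x \<mapsto> d + c * x\<close> whenever \<open>\<bar>d\<bar> \<le> R\<close>.\<close>
  let ?B = "cball 0 (R / (1 - \<bar>c\<bar>)) :: real set"
  have "0 \<le> R / (1 - \<bar>c\<bar>)" using R0 c by simp
  then have BR: "\<not> R / (1 - \<bar>c\<bar>) < 0" by (simp only: not_less)
  have "AE x in \<mu>. x \<in> ?B"
  proof (rule AE_mem_if_contracting[OF \<mu>, where b = "\<bar>c\<bar>"])
    show "(\<integral>\<^sup>+x. ennreal (min 1 (s * infdist x ?B)) \<partial>\<mu>)
      \<le> (\<integral>\<^sup>+x. ennreal (min 1 (s * \<bar>c\<bar> * infdist x ?B)) \<partial>\<mu>)" if "0 \<le> s" for s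
    proof (subst eq, rule nn_integral_infdist_lcomb_le[OF D \<mu> that])
      show "AE d in D. \<forall>x\<in>?B. d + c * x \<in> ?B"
        using R
      proof eventually_elim
        case (elim d)
        show ?case
        proof
          fix x assume "x \<in> ?B"
          then have "\<bar>x\<bar> \<le> R / (1 - \<bar>c\<bar>)" by (simp add: dist_real_def)
          then have "\<bar>c * x\<bar> \<le> \<bar>c\<bar> * (R / (1 - \<bar>c\<bar>))"
            unfolding abs_mult by (rule mult_left_mono) simp
          then have "\<bar>d + c * x\<bar> \<le> R + \<bar>c\<bar> * (R / (1 - \<bar>c\<bar>))"
            using elim by linarith
          also have "\<dots> = R / (1 - \<bar>c\<bar>)" using c by (simp add: field_simps)
          finally show "d + c * x \<in> ?B" by (simp add: dist_real_def)
        qed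
      qed
    qed (use R0 c BR in \<open>auto simp: not_less simp del: zero_le_divide_iff divide_nonneg_pos\<close>)
  qed (use R0 c BR in \<open>auto simp: not_less simp del: zero_le_divide_iff divide_nonneg_pos\<close>)
  then show ?thesis using \<mu> eq by (intro exI[of _ \<mu>]) (auto simp: dist_real_def)
qed

text \<open>The common factor \<open>P\<close> does not increase the difference of the two
  characteristic functions, so that difference is bounded by its value at \<open>c ^ n * t\<close>,
  which tends to 0 by continuity at the origin.\<close>

lemma real_distribution_eqI_char:
  assumes \<mu>: "real_distribution \<mu>" and \<nu>: "real_distribution \<nu>" and c: "\<bar>c\<bar> < 1"
    and P: "\<And>t. cmod (P t) \<le> 1"
    and eq: "\<And>t. char \<mu> t = P t * char \<mu> (c * t)" "\<And>t. char \<nu> t = P t * char \<nu> (c * t)"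
  shows "\<mu> = \<nu>"
proof (rule Levy_uniqueness[OF \<mu> \<nu>], rule ext)
  fix t
  interpret \<mu>: real_distribution \<mu> by fact
  interpret \<nu>: real_distribution \<nu> by fact
  have "cmod (char \<mu> t - char \<nu> t) \<le> cmod (char \<mu> (c ^ n * t) - char \<nu> (c ^ n * t))" for n
  proof (induction n)
    case (Suc n)
    have "cmod (char \<mu> (c ^ n * t) - char \<nu> (c ^ n * t))
        = cmod (P (c ^ n * t)) * cmod (char \<mu> (c ^ Suc n * t) - char \<nu> (c ^ Suc n * t))"
      using eq[of "c ^ n * t"] by (simp add: mult.assoc norm_mult flip: right_diff_distrib)
    also have "\<dots> \<le> 1 * cmod (char \<mu> (c ^ Suc n * t) - char \<nu> (c ^ Suc n * t))"
      by (intro mult_right_mono P) auto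
    finally show ?case using Suc by simp
  qed simp
  moreover have "(\<lambda>n. cmod (char \<mu> (c ^ n * t) - char \<nu> (c ^ n * t))) \<longlonglongrightarrow> cmod (char \<mu> 0 - char \<nu> 0)"
  proof -
    have "(\<lambda>n. c ^ n) \<longlonglongrightarrow> 0" using c by (intro LIMSEQ_power_zero) auto
    then have "(\<lambda>n. c ^ n * t) \<longlonglongrightarrow> 0" by (rule tendsto_mult_left_zero)
    then show ?thesis
      by (intro tendsto_norm tendsto_diff isCont_tendsto_compose[OF \<mu>.isCont_char] isCont_tendsto_compose[OF \<nu>.isCont_char])
  qed
  ultimately have "cmod (char \<mu> t - char \<nu> t) \<le> cmod (char \<mu> 0 - char \<nu> 0)"
    by (intro LIMSEQ_le_const) auto
  then show "char \<mu> t = char \<nu> t" by (simp add: \<mu>.char_zero \<nu>.char_zero)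
qed

subsection \<open>Moments of ball measures\<close>

text \<open>The integral in the definition of the \<open>L\<^sup>q\<close> dimension: decay like
  \<open>r powr (t * (q - 1))\<close> means dimension at least \<open>t\<close>.\<close>

definition ball_moment :: "real \<Rightarrow> real measure \<Rightarrow> real \<Rightarrow> ennreal" where
  "ball_moment q \<theta> r = (\<integral>\<^sup>+y. ennreal (measure \<theta> (cball y r) powr (q - 1)) \<partial>\<theta>)"

text \<open>For separated pieces this is the factor by which the ball moment changes when a digit is
  put in front and the radius is multiplied by the contraction ratio.\<close>

definition power_sum :: "real \<Rightarrow> real pmf \<Rightarrow> real" where
  "power_sum q \<rho> = (\<Sum>d\<in>set_pmf \<rho>. pmf \<rho> d powr q)"

lemma power_sum_nonneg [simp]: "0 \<le> power_sum q \<rho>"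
  by (simp add: power_sum_def sum_nonneg)

context
  fixes \<kappa> :: "real measure" and \<rho> :: "real pmf" and c :: real
  assumes \<kappa>: "real_distribution \<kappa>" and fin: "finite (set_pmf \<rho>)" and c: "c \<noteq> 0"
begin

interpretation \<kappa>: real_distribution \<kappa> by (rule \<kappa>)
interpretation \<kappa>': real_distribution "lcomb c (digit_law \<rho>) \<kappa>"
  by (intro real_distribution_lcomb real_distribution_digit_law \<kappa>)

lemma nn_integral_lcomb_digit_law:
  assumes [measurable]: "f \<in> borel_measurable borel"
  shows "(\<integral>\<^sup>+z. f z \<partial>lcomb c (digit_law \<rho>) \<kappa>)
    = (\<Sum>d\<in>set_pmf \<rho>. ennreal (pmf \<rho> d) * (\<integral>\<^sup>+x. f (d + c * x) \<partial>\<kappa>))"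
  using fin
  by (subst nn_integral_lcomb)
     (auto intro: real_distribution_digit_law \<kappa> real_distribution_imp_finite_borel simp: nn_integral_digit_law)

lemma emeasure_lcomb_cball:
  "emeasure (lcomb c (digit_law \<rho>) \<kappa>) (cball (d + c * x) (\<bar>c\<bar> * r))
    = (\<Sum>d'\<in>set_pmf \<rho>. ennreal (pmf \<rho> d') * emeasure \<kappa> {x'. \<bar>(d + c * x) - (d' + c * x')\<bar> \<le> \<bar>c\<bar> * r})"
proof -
  have "emeasure (lcomb c (digit_law \<rho>) \<kappa>) (cball (d + c * x) (\<bar>c\<bar> * r))
    = (\<integral>\<^sup>+z. indicator (cball (d + c * x) (\<bar>c\<bar> * r)) z \<partial>lcomb c (digit_law \<rho>) \<kappa>)"
    by simp
  also have "\<dots> = (\<Sum>d'\<in>set_pmf \<rho>. ennreal (pmf \<rho> d') * (\<integral>\<^sup>+x'. indicator (cball (d + c * x) (\<bar>c\<bar> * r)) (d' + c * x') \<partial>\<kappa>))"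
    by (rule nn_integral_lcomb_digit_law) measurable
  also have "\<dots> = (\<Sum>d'\<in>set_pmf \<rho>. ennreal (pmf \<rho> d') * (\<integral>\<^sup>+x'. indicator {x'. \<bar>(d + c * x) - (d' + c * x')\<bar> \<le> \<bar>c\<bar> * r} x' \<partial>\<kappa>))"
    by (intro sum.cong arg_cong2[of _ _ _ _ "(*)"] nn_integral_cong refl) (auto simp: indicator_def dist_real_def)
  finally show ?thesis by simp
qed

lemma same_digit: "{x'. \<bar>(d + c * x) - (d + c * x')\<bar> \<le> \<bar>c\<bar> * r} = cball x r"
proof -
  have "\<bar>(d + c * x) - (d + c * x')\<bar> = \<bar>c\<bar> * \<bar>x - x'\<bar>" for x'
    by (simp flip: abs_mult right_diff_distrib)
  then show ?thesis using c by (auto simp: dist_real_def)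
qed

text \<open>The ball around \<open>d + c * x\<close> contains the image of the ball around
  \<open>x\<close>, with weight \<open>pmf \<rho> d\<close>; the other pieces can only add
  mass.\<close>

lemma ball_moment_lcomb_ge:
  assumes "1 < q"
  shows "ennreal (power_sum q \<rho>) * ball_moment q \<kappa> r \<le> ball_moment q (lcomb c (digit_law \<rho>) \<kappa>) (\<bar>c\<bar> * r)"
proof -
  let ?m = "lcomb c (digit_law \<rho>) \<kappa>"
  note [measurable] = borel_measurable_measure_cball[OF \<kappa>.finite_borel_measure_M]
    borel_measurable_measure_cball[OF \<kappa>'.finite_borel_measure_M]
  have ge: "pmf \<rho> d * measure \<kappa> (cball x r) \<le> measure ?m (cball (d + c * x) (\<bar>c\<bar> * r))"
    if "d \<in> set_pmf \<rho>" for d x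
  proof -
    have "ennreal (pmf \<rho> d) * emeasure \<kappa> {x'. \<bar>(d + c * x) - (d + c * x')\<bar> \<le> \<bar>c\<bar> * r}
      \<le> emeasure ?m (cball (d + c * x) (\<bar>c\<bar> * r))"
      unfolding emeasure_lcomb_cball using that fin by (intro member_le_sum) auto
    then show ?thesis
      unfolding same_digit by (simp add: \<kappa>.emeasure_eq_measure \<kappa>'.emeasure_eq_measure flip: ennreal_mult)
  qed
  have "ennreal (power_sum q \<rho>) * ball_moment q \<kappa> r
    = (\<Sum>d\<in>set_pmf \<rho>. ennreal (pmf \<rho> d powr q) * ball_moment q \<kappa> r)"
    by (simp add: power_sum_def sum_distrib_right flip: sum_ennreal)
  also have "\<dots> = (\<Sum>d\<in>set_pmf \<rho>. ennreal (pmf \<rho> d) *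
      (\<integral>\<^sup>+x. ennreal ((pmf \<rho> d * measure \<kappa> (cball x r)) powr (q - 1)) \<partial>\<kappa>))"
  proof (intro sum.cong refl)
    fix d assume "d \<in> set_pmf \<rho>"
    then have "0 < pmf \<rho> d" by (simp add: pmf_positive)
    then have *: "pmf \<rho> d powr q = pmf \<rho> d * pmf \<rho> d powr (q - 1)"
      by (simp add: powr_diff)
    have "(\<integral>\<^sup>+x. ennreal ((pmf \<rho> d * measure \<kappa> (cball x r)) powr (q - 1)) \<partial>\<kappa>)
      = ennreal (pmf \<rho> d powr (q - 1)) * ball_moment q \<kappa> r"
      unfolding ball_moment_def
      by (subst nn_integral_cmult[symmetric])
         (auto simp: powr_mult ennreal_mult )
    then show "ennreal (pmf \<rho> d powr q) * ball_moment q \<kappa> r = ennreal (pmf \<rho> d) *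
      (\<integral>\<^sup>+x. ennreal ((pmf \<rho> d * measure \<kappa> (cball x r)) powr (q - 1)) \<partial>\<kappa>)"
      unfolding * by (simp add: ennreal_mult mult.assoc)
  qed
  also have "\<dots> \<le> (\<Sum>d\<in>set_pmf \<rho>. ennreal (pmf \<rho> d) *
      (\<integral>\<^sup>+x. ennreal (measure ?m (cball (d + c * x) (\<bar>c\<bar> * r)) powr (q - 1)) \<partial>\<kappa>))"
    using assms by (intro sum_mono mult_left_mono nn_integral_mono ennreal_leI powr_mono2 ge) auto
  also have "\<dots> = ball_moment q ?m (\<bar>c\<bar> * r)"
    unfolding ball_moment_def
    by (subst nn_integral_lcomb_digit_law) auto
  finally show ?thesis .
qed

text \<open>Separation means that the ball around a point of one piece misses all others, so its
  mass is exactly the weight of the piece times a ball mass of \<open>\<kappa>\<close>.\<close>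

lemma ball_moment_lcomb_le:
  assumes "1 < q" and K: "AE x in \<kappa>. x \<in> K"
    and sep: "\<And>d d' x x'. d \<in> set_pmf \<rho> \<Longrightarrow> d' \<in> set_pmf \<rho> \<Longrightarrow> d \<noteq> d' \<Longrightarrow> x \<in> K \<Longrightarrow> x' \<in> K \<Longrightarrow>
      \<bar>c\<bar> * r < \<bar>(d + c * x) - (d' + c * x')\<bar>"
  shows "ball_moment q (lcomb c (digit_law \<rho>) \<kappa>) (\<bar>c\<bar> * r) \<le> ennreal (power_sum q \<rho>) * ball_moment q \<kappa> r"
proof -
  let ?m = "lcomb c (digit_law \<rho>) \<kappa>"
  note [measurable] = borel_measurable_measure_cball[OF \<kappa>.finite_borel_measure_M]
    borel_measurable_measure_cball[OF \<kappa>'.finite_borel_measure_M]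
  have le: "measure ?m (cball (d + c * x) (\<bar>c\<bar> * r)) = pmf \<rho> d * measure \<kappa> (cball x r)"
    if d: "d \<in> set_pmf \<rho>" and x: "x \<in> K" for d x
  proof -
    have 0: "emeasure \<kappa> {x'. \<bar>(d + c * x) - (d' + c * x')\<bar> \<le> \<bar>c\<bar> * r} = 0"
      if "d' \<in> set_pmf \<rho>" "d' \<noteq> d" for d'
    proof -
      have "AE x' in \<kappa>. x' \<notin> {x'. \<bar>(d + c * x) - (d' + c * x')\<bar> \<le> \<bar>c\<bar> * r}"
        using K sep[of d d' x] d x that by (auto elim!: eventually_mono simp: not_le)
      then show ?thesis by (subst (asm) AE_iff_measurable[OF _ refl]) (auto simp: )
    qed
    have "emeasure ?m (cball (d + c * x) (\<bar>c\<bar> * r))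
      = (\<Sum>d'\<in>set_pmf \<rho>. if d' = d then ennreal (pmf \<rho> d) * emeasure \<kappa> (cball x r) else 0)"
      unfolding emeasure_lcomb_cball
    proof (intro sum.cong refl)
      fix d' assume d': "d' \<in> set_pmf \<rho>"
      show "ennreal (pmf \<rho> d') * emeasure \<kappa> {x'. \<bar>(d + c * x) - (d' + c * x')\<bar> \<le> \<bar>c\<bar> * r}
        = (if d' = d then ennreal (pmf \<rho> d) * emeasure \<kappa> (cball x r) else 0)"
      proof (cases "d' = d")
        case True
        then show ?thesis unfolding True same_digit by simp
      qed (use 0 d' in simp)
    qed
    then show ?thesis using d fin
      by (simp add: \<kappa>.emeasure_eq_measure \<kappa>'.emeasure_eq_measure flip: ennreal_mult)
  qed
  have "ball_moment q ?m (\<bar>c\<bar> * r) = (\<Sum>d\<in>set_pmf \<rho>. ennreal (pmf \<rho> d) *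
      (\<integral>\<^sup>+x. ennreal (measure ?m (cball (d + c * x) (\<bar>c\<bar> * r)) powr (q - 1)) \<partial>\<kappa>))"
    unfolding ball_moment_def
    by (subst nn_integral_lcomb_digit_law) auto
  also have "\<dots> = (\<Sum>d\<in>set_pmf \<rho>. ennreal (pmf \<rho> d powr q) * ball_moment q \<kappa> r)"
  proof (intro sum.cong refl)
    fix d assume d: "d \<in> set_pmf \<rho>"
    then have "0 < pmf \<rho> d" by (simp add: pmf_positive)
    then have *: "pmf \<rho> d powr q = pmf \<rho> d * pmf \<rho> d powr (q - 1)"
      by (simp add: powr_diff)
    have "(\<integral>\<^sup>+x. ennreal (measure ?m (cball (d + c * x) (\<bar>c\<bar> * r)) powr (q - 1)) \<partial>\<kappa>)
      = (\<integral>\<^sup>+x. ennreal (pmf \<rho> d powr (q - 1)) * ennreal (measure \<kappa> (cball x r) powr (q - 1)) \<partial>\<kappa>)"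
      using K by (intro nn_integral_cong_AE) (auto elim!: eventually_mono simp: le[OF d] powr_mult ennreal_mult)
    also have "\<dots> = ennreal (pmf \<rho> d powr (q - 1)) * ball_moment q \<kappa> r"
      unfolding ball_moment_def
      by (subst nn_integral_cmult) auto
    finally show "ennreal (pmf \<rho> d) * (\<integral>\<^sup>+x. ennreal (measure ?m (cball (d + c * x) (\<bar>c\<bar> * r)) powr (q - 1)) \<partial>\<kappa>)
      = ennreal (pmf \<rho> d powr q) * ball_moment q \<kappa> r"
      unfolding * by (simp add: ennreal_mult mult.assoc)
  qed
  also have "\<dots> = ennreal (power_sum q \<rho>) * ball_moment q \<kappa> r"
    by (simp add: power_sum_def sum_distrib_right flip: sum_ennreal)
  finally show ?thesis by simp
qed

end

lemma ball_moment_le_1: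
  assumes "real_distribution \<theta>" "1 \<le> q"
  shows "ball_moment q \<theta> r \<le> 1"
proof -
  interpret real_distribution \<theta> by fact
  note [measurable] = borel_measurable_measure_cball[OF finite_borel_measure_M]
  have "ball_moment q \<theta> r \<le> (\<integral>\<^sup>+y. 1 \<partial>\<theta>)"
    unfolding ball_moment_def using assms(2)
    by (intro nn_integral_mono) (auto simp flip: ennreal_1 intro!: ennreal_leI powr_le1)
  also have "\<dots> = 1" using emeasure_space_1 by simp
  finally show ?thesis .
qed

lemma ball_moment_mono:
  assumes "real_distribution \<theta>" "1 \<le> q" "r \<le> r'"
  shows "ball_moment q \<theta> r \<le> ball_moment q \<theta> r'"
proof -
  interpret real_distribution \<theta> by fact
  show ?thesis
    unfolding ball_moment_def using assms
    by (intro nn_integral_mono ennreal_leI powr_mono2 finite_measure_mono) auto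
qed

lemma ennpowr_ge:
  assumes "ennreal a \<le> x" "0 \<le> a" "0 \<le> b"
  shows "ennreal (a powr b) \<le> ennpowr x b"
proof (cases x)
  case (real y)
  then show ?thesis using assms by (auto simp: ennpowr_def intro!: ennreal_leI powr_mono2)
qed (simp add: ennpowr_def)

text \<open>On the ball of radius \<open>r\<close> the Riesz kernel is at least
  \<open>r powr - t\<close>, so the ball measure is controlled by the potential at its
  centre.\<close>

lemma ball_moment_le_energy:
  assumes \<mu>: "real_distribution \<mu>" and t: "0 \<le> t" and q: "1 < q" and r: "0 < r"
    and E: "(\<integral>\<^sup>+x. ennpowr (\<integral>\<^sup>+y. riesz_kernel t x y \<partial>\<mu>) (q - 1) \<partial>\<mu>) \<le> ennreal E" and E0: "0 \<le> E"
  shows "ball_moment q \<mu> r \<le> ennreal (E * r powr (t * (q - 1)))"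
proof -
  interpret \<mu>: real_distribution \<mu> by fact
  note [measurable] = borel_measurable_measure_cball[OF \<mu>.finite_borel_measure_M]
  have ker: "ennreal (r powr - t) * indicator (cball x r) y \<le> riesz_kernel t x y" for x y
  proof (cases "t = 0")
    case True
    then show ?thesis using r by (auto simp: riesz_kernel_def indicator_def)
  next
    case False
    show ?thesis
    proof (cases "y \<in> cball x r \<and> x \<noteq> y")
      case True
      then have "\<bar>x - y\<bar> powr t \<le> r powr t" using t by (intro powr_mono2) (auto simp: dist_real_def)
      then have "1 / r powr t \<le> 1 / \<bar>x - y\<bar> powr t" using True r by (intro divide_left_mono) auto
      then show ?thesis using True False r
        by (auto simp: riesz_kernel_def indicator_def powr_minus_divide simp flip: ennreal_1 intro!: ennreal_leI)
          (subst divide_ennreal, auto intro!: ennreal_leI)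
    qed (use False in \<open>auto simp: riesz_kernel_def indicator_def ennreal_divide_zero\<close>)
  qed
  have "ennreal (r powr - (t * (q - 1))) * ball_moment q \<mu> r
    = (\<integral>\<^sup>+x. ennreal (r powr - (t * (q - 1))) * ennreal (measure \<mu> (cball x r) powr (q - 1)) \<partial>\<mu>)"
    unfolding ball_moment_def by (subst nn_integral_cmult) auto
  also have "\<dots> \<le> (\<integral>\<^sup>+x. ennpowr (\<integral>\<^sup>+y. riesz_kernel t x y \<partial>\<mu>) (q - 1) \<partial>\<mu>)"
  proof (intro nn_integral_mono)
    fix x
    have "ennreal (r powr - t * measure \<mu> (cball x r)) = (\<integral>\<^sup>+y. ennreal (r powr - t) * indicator (cball x r) y \<partial>\<mu>)"
      by (subst nn_integral_cmult) (auto simp: \<mu>.emeasure_eq_measure ennreal_mult)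
    also have "\<dots> \<le> (\<integral>\<^sup>+y. riesz_kernel t x y \<partial>\<mu>)" by (intro nn_integral_mono ker)
    finally have "ennreal ((r powr - t * measure \<mu> (cball x r)) powr (q - 1)) \<le> ennpowr (\<integral>\<^sup>+y. riesz_kernel t x y \<partial>\<mu>) (q - 1)"
      using q by (intro ennpowr_ge) auto
    then show "ennreal (r powr - (t * (q - 1))) * ennreal (measure \<mu> (cball x r) powr (q - 1))
      \<le> ennpowr (\<integral>\<^sup>+y. riesz_kernel t x y \<partial>\<mu>) (q - 1)"
      by (simp add: powr_mult powr_powr flip: ennreal_mult)
  qed
  also note E
  finally have le: "ennreal (r powr - (t * (q - 1))) * ball_moment q \<mu> r \<le> ennreal E" .
  have "ball_moment q \<mu> r = ennreal (r powr (t * (q - 1))) * (ennreal (r powr - (t * (q - 1))) * ball_moment q \<mu> r)"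
    using r by (simp flip: mult.assoc ennreal_mult powr_add)
  also have "\<dots> \<le> ennreal (r powr (t * (q - 1))) * ennreal E" by (intro mult_left_mono le) auto
  finally show ?thesis using E0 by (simp add: mult.commute flip: ennreal_mult)
qed

section \<open>Separated self-similar measures\<close>

lemma exists_power_scale:
  fixes \<gamma> x :: real
  assumes "0 < \<gamma>" "\<gamma> < 1" "0 < x" "x \<le> 1"
  obtains n where "\<gamma> ^ Suc n < x" "x \<le> \<gamma> ^ n"
proof -
  obtain n0 where "\<gamma> ^ n0 < x" using real_arch_pow_inv[OF \<open>0 < x\<close> \<open>\<gamma> < 1\<close>] by blast
  then obtain n where n: "\<gamma> ^ n < x" "\<And>m. m < n \<Longrightarrow> \<not> \<gamma> ^ m < x"
    using exists_least_iff[of "\<lambda>n. \<gamma> ^ n < x"] by blast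
  then have "n \<noteq> 0" using assms by (intro notI) simp
  then obtain m where m: "n = Suc m" by (cases n) auto
  show ?thesis using that[of m] n(1) n(2)[of m] m by auto
qed

text \<open>A radius between two consecutive geometric scales is compared with the larger one by
  monotonicity. Above \<open>r0\<close> the trivial bound 1 suffices, since the right-hand side is
  at least 1 there.\<close>

lemma powr_bound_of_geometric_scales:
  fixes f :: "real \<Rightarrow> ennreal"
  assumes \<gamma>: "0 < \<gamma>" "\<gamma> < 1" and r0: "0 < r0" and b: "0 \<le> b"
    and mono: "\<And>r r'. r \<le> r' \<Longrightarrow> f r \<le> f r'" and f1: "\<And>r. f r \<le> 1"
    and f: "\<And>n. f (\<gamma> ^ n * r0) \<le> ennreal ((\<gamma> ^ n) powr b)" and r: "0 < r"
  shows "f r \<le> ennreal (\<gamma> powr - b * r0 powr - b * r powr b)"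
proof (cases "r \<le> r0")
  case True
  then obtain n where n: "\<gamma> ^ Suc n < r / r0" "r / r0 \<le> \<gamma> ^ n"
    using exists_power_scale[OF \<gamma>, of "r / r0"] r r0 by auto
  have "f r \<le> f (\<gamma> ^ n * r0)" using n(2) r0 by (intro mono) (simp add: field_simps)
  also have "\<dots> \<le> ennreal ((\<gamma> ^ n) powr b)" by (rule f)
  also have "(\<gamma> ^ n) powr b = \<gamma> powr - b * (\<gamma> ^ Suc n) powr b"
    using \<gamma> by (simp add: powr_mult powr_minus)
  also have "ennreal (\<gamma> powr - b * (\<gamma> ^ Suc n) powr b) \<le> ennreal (\<gamma> powr - b * (r / r0) powr b)"
    using n(1) \<gamma> b by (intro ennreal_leI mult_left_mono powr_mono2) auto
  also have "(r / r0) powr b = r0 powr - b * r powr b"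
    using r r0 by (simp add: powr_divide powr_minus field_simps)
  finally show ?thesis by (simp add: mult.assoc)
next
  case False
  have "1 \<le> \<gamma> powr - b" using \<gamma> b powr_le1[of b \<gamma>]
    by (simp add: powr_minus one_le_inverse_iff)
  moreover have "1 \<le> (r / r0) powr b" using False r0 b by (intro ge_one_powr_ge_zero) auto
  ultimately have "1 * 1 \<le> \<gamma> powr - b * (r / r0) powr b" by (intro mult_mono) auto
  also have "(r / r0) powr b = r0 powr - b * r powr b"
    using r r0 by (simp add: powr_divide powr_minus field_simps)
  finally have "1 \<le> ennreal (\<gamma> powr - b * r0 powr - b * r powr b)" by (simp add: mult.assoc)
  then show ?thesis using f1[of r] by (rule order.trans[rotated])
qed

lemma finite_uniform_positive:
  fixes P :: "'a \<Rightarrow> real \<Rightarrow> bool"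
  assumes "finite S" "\<And>s. s \<in> S \<Longrightarrow> \<exists>\<delta>>0. P s \<delta>"
    and "\<And>s \<delta> \<delta>'. P s \<delta> \<Longrightarrow> 0 < \<delta>' \<Longrightarrow> \<delta>' \<le> \<delta> \<Longrightarrow> P s \<delta>'"
  shows "\<exists>\<delta>>0. \<forall>s\<in>S. P s \<delta>"
  using assms(1,2)
proof (induction S)
  case empty
  show ?case by (auto intro: exI[of _ 1])
next
  case (insert s S)
  obtain \<delta> where \<delta>: "\<delta> > 0" "\<forall>s\<in>S. P s \<delta>" using insert by auto
  obtain \<delta>' where \<delta>': "\<delta>' > 0" "P s \<delta>'" using insert by auto
  show ?case using \<delta> \<delta>' assms(3)[of _ _ "min \<delta> \<delta>'"]
    by (intro exI[of _ "min \<delta> \<delta>'"]) (auto intro: assms(3))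
qed

lemma AE_bounded_lcomb:
  assumes A: "real_distribution A" and B: "real_distribution B"
    and "AE x in A. \<bar>x\<bar> \<le> a" "AE x in B. \<bar>x\<bar> \<le> b"
  shows "AE x in lcomb c A B. \<bar>x\<bar> \<le> a + \<bar>c\<bar> * b"
proof -
  have "AE x in A. AE y in B. \<bar>x + c * y\<bar> \<le> a + \<bar>c\<bar> * b"
    using assms(3)
  proof eventually_elim
    case (elim x)
    show ?case using assms(4)
    proof eventually_elim
      case (elim y)
      have "\<bar>c * y\<bar> \<le> \<bar>c\<bar> * b" unfolding abs_mult using elim by (rule mult_left_mono) simp
      then show ?case using \<open>\<bar>x\<bar> \<le> a\<close> by linarith
    qed
  qed
  then show ?thesis
    using A B by (subst AE_lcomb_iff) (auto intro: real_distribution_imp_finite_borel)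
qed

text \<open>Digits of weight zero are absent from \<open>set_pmf \<rho>\<close>, so invariance and
  disjointness are stated for pieces of positive weight. The ratio \<open>c\<close> may be
  negative.\<close>

locale separated_self_similar =
  fixes c :: real and K :: "real set" and \<rho> :: "real pmf" and \<mu> :: "real measure"
  assumes c: "0 < \<bar>c\<bar>" "\<bar>c\<bar> < 1" and \<mu>: "real_distribution \<mu>"
    and \<mu>_eq: "\<mu> = lcomb c (digit_law \<rho>) \<mu>"
    and fin: "finite (set_pmf \<rho>)" and K: "compact K" "K \<noteq> {}"
    and maps: "\<And>d x. d \<in> set_pmf \<rho> \<Longrightarrow> x \<in> K \<Longrightarrow> d + c * x \<in> K"
    and disj: "\<And>d d' x x'. d \<in> set_pmf \<rho> \<Longrightarrow> d' \<in> set_pmf \<rho> \<Longrightarrow> d \<noteq> d' \<Longrightarrow> x \<in> K \<Longrightarrow> x' \<in> K \<Longrightarrow>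
      d + c * x \<noteq> d' + c * x'"
begin

lemma separation:
  obtains \<delta> where "\<delta> > 0"
    "\<And>d d' x x'. d \<in> set_pmf \<rho> \<Longrightarrow> d' \<in> set_pmf \<rho> \<Longrightarrow> d \<noteq> d' \<Longrightarrow> x \<in> K \<Longrightarrow> x' \<in> K \<Longrightarrow>
      \<delta> \<le> \<bar>(d + c * x) - (d' + c * x')\<bar>"
proof -
  let ?S = "{(d, d'). d \<in> set_pmf \<rho> \<and> d' \<in> set_pmf \<rho> \<and> d \<noteq> d'}"
  have "\<exists>\<delta>>0. \<forall>s\<in>?S. \<forall>x\<in>K. \<forall>x'\<in>K. \<delta> \<le> \<bar>(fst s + c * x) - (snd s + c * x')\<bar>"
  proof (rule finite_uniform_positive)
    show "finite ?S" using fin by (rule_tac finite_subset[of _ "set_pmf \<rho> \<times> set_pmf \<rho>"]) auto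
    fix s assume "s \<in> ?S"
    then obtain d d' where s: "s = (d, d')" "d \<in> set_pmf \<rho>" "d' \<in> set_pmf \<rho>" "d \<noteq> d'" by auto
    let ?A = "(\<lambda>x. d + c * x) ` K" and ?B = "(\<lambda>x. d' + c * x) ` K"
    have "compact ?A" "compact ?B" by (intro compact_continuous_image K continuous_intros)+
    moreover have "?A \<inter> ?B = {}" using disj[of d d'] s by auto
    ultimately obtain \<delta> where "\<delta> > 0" "\<forall>x\<in>?A. \<forall>y\<in>?B. \<delta> \<le> dist x y"
      using separate_compact_closed[of ?A ?B] compact_imp_closed by blast
    then show "\<exists>\<delta>>0. \<forall>x\<in>K. \<forall>x'\<in>K. \<delta> \<le> \<bar>(fst s + c * x) - (snd s + c * x')\<bar>"
      by (intro exI[of _ \<delta>]) (auto simp: s dist_real_def)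
  next
    fix s :: "real \<times> real" and \<delta> \<delta>' :: real
    assume "\<forall>x\<in>K. \<forall>x'\<in>K. \<delta> \<le> \<bar>(fst s + c * x) - (snd s + c * x')\<bar>" "\<delta>' \<le> \<delta>"
    then show "\<forall>x\<in>K. \<forall>x'\<in>K. \<delta>' \<le> \<bar>(fst s + c * x) - (snd s + c * x')\<bar>"
      by (meson order.trans)
  qed
  then show ?thesis using that by force
qed

text \<open>At radius \<open>\<bar>c\<bar> ^ n * (2 * R)\<close>, self-similarity forces the ball
  moment to be at least the \<open>n\<close>-th power of the power sum, while finite energy bounds
  it by a constant times the \<open>n\<close>-th power of the right-hand side; letting
  \<open>n\<close> grow removes the constant. The energy hypothesis becomes a condition on the
  weights alone, which passes to larger exponents and to subsampled series.\<close>

lemma power_sum_le: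
  assumes E: "(\<integral>\<^sup>+x. ennpowr (\<integral>\<^sup>+y. riesz_kernel t x y \<partial>\<mu>) (q - 1) \<partial>\<mu>) < \<infinity>"
    and t: "0 \<le> t" and q: "1 < q" and \<mu>K: "AE x in \<mu>. x \<in> K"
  shows "power_sum q \<rho> \<le> \<bar>c\<bar> powr (t * (q - 1))"
proof -
  interpret \<mu>: real_distribution \<mu> by (rule \<mu>)
  obtain E where E0: "0 \<le> E" and E': "(\<integral>\<^sup>+x. ennpowr (\<integral>\<^sup>+y. riesz_kernel t x y \<partial>\<mu>) (q - 1) \<partial>\<mu>) \<le> ennreal E"
    using E by (cases "\<integral>\<^sup>+x. ennpowr (\<integral>\<^sup>+y. riesz_kernel t x y \<partial>\<mu>) (q - 1) \<partial>\<mu>") auto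
  obtain R where R: "R > 0" "\<And>x. x \<in> K \<Longrightarrow> \<bar>x\<bar> \<le> R"
    using compact_imp_bounded[OF K(1)] by (auto simp: bounded_pos)
  define w where "w = power_sum q \<rho>"
  define v where "v = \<bar>c\<bar> powr (t * (q - 1))"
  have v: "v > 0" using c by (simp add: v_def)
  have "ennreal (w ^ n) \<le> ball_moment q \<mu> (\<bar>c\<bar> ^ n * (2 * R))" for n
  proof (induction n)
    case 0
    \<comment> \<open>Any two points of \<open>K\<close> are within \<open>2 * R\<close> of each
      other, so at this radius the balls have full measure and the moment is 1.\<close>
    have "AE y in \<mu>. measure \<mu> (cball y (2 * R)) = 1"
      using \<mu>K
    proof eventually_elim
      case (elim y)
      have "AE x in \<mu>. x \<in> cball y (2 * R)"
        using \<mu>K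
      proof eventually_elim
        case (elim x)
        then show ?case using R(2)[of x] R(2)[OF \<open>y \<in> K\<close>] by (auto simp: dist_real_def)
      qed
      then show ?case by (subst \<mu>.prob_eq_1) auto
    qed
    then have "ball_moment q \<mu> (2 * R) = (\<integral>\<^sup>+y. 1 \<partial>\<mu>)"
      unfolding ball_moment_def by (intro nn_integral_cong_AE) (auto elim!: eventually_mono)
    then show ?case using \<mu>.emeasure_space_1 by simp
  next
    case (Suc n)
    have "ennreal (w ^ Suc n) = ennreal w * ennreal (w ^ n)"
      by (simp add: w_def ennreal_mult)
    also have "\<dots> \<le> ennreal w * ball_moment q \<mu> (\<bar>c\<bar> ^ n * (2 * R))"
      by (intro mult_left_mono Suc) auto
    also have "\<dots> \<le> ball_moment q (lcomb c (digit_law \<rho>) \<mu>) (\<bar>c\<bar> * (\<bar>c\<bar> ^ n * (2 * R)))"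
      unfolding w_def using c by (intro ball_moment_lcomb_ge \<mu> fin q) auto
    also have "\<dots> = ball_moment q \<mu> (\<bar>c\<bar> ^ Suc n * (2 * R))"
      using \<mu>_eq by (simp add: mult.assoc)
    finally show ?case .
  qed
  also have "ball_moment q \<mu> (\<bar>c\<bar> ^ n * (2 * R)) \<le> ennreal (E * (\<bar>c\<bar> ^ n * (2 * R)) powr (t * (q - 1)))" for n
    using c R by (intro ball_moment_le_energy[OF \<mu> t q _ E' E0]) auto
  finally have "w ^ n \<le> E * (\<bar>c\<bar> ^ n * (2 * R)) powr (t * (q - 1))" for n
    using E0 by (subst (asm) ennreal_le_iff) auto
  moreover have "(\<bar>c\<bar> ^ n * (2 * R)) powr (t * (q - 1)) = v ^ n * (2 * R) powr (t * (q - 1))" for n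
    using c R by (simp add: powr_mult v_def powr_powr mult_ac flip: powr_realpow)
  ultimately have bd: "w ^ n \<le> E * (2 * R) powr (t * (q - 1)) * v ^ n" for n by (simp add: mult_ac)
  have "w \<le> v"
  proof (rule ccontr)
    assume "\<not> w \<le> v"
    then have "1 < w / v" using v by simp
    then obtain n where "E * (2 * R) powr (t * (q - 1)) < (w / v) ^ n" using real_arch_pow by blast
    then show False using bd[of n] v by (simp add: power_divide field_simps)
  qed
  then show ?thesis by (simp add: w_def v_def)
qed

text \<open>The random series \<open>\<Sum> c\<^sup>n A\<^sub>n\<close> with law \<open>\<mu>\<close> is split into the terms with \<open>n\<close> not divisible by
  \<open>k\<close> (law \<open>\<mu>'\<close>) and those with \<open>n\<close> divisible by \<open>k\<close> (law \<open>\<nu>\<close>).\<close>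

theorem subsampling:
  assumes q: "1 < q" and a: "0 \<le> a" and W: "power_sum q \<rho> \<le> \<bar>c\<bar> powr a" and k: "1 \<le> k"
  shows "\<exists>\<mu>' \<nu> D' R C. real_distribution \<mu>' \<and> real_distribution \<nu> \<and> real_distribution D' \<and>
    (\<forall>t. char \<mu> t = char \<mu>' t * char \<nu> t) \<and> \<nu> = lcomb (c ^ k) (digit_law \<rho>) \<nu> \<and>
    \<mu>' = lcomb (c ^ k) D' \<mu>' \<and> (AE x in \<mu>'. \<bar>x\<bar> \<le> R) \<and> 0 < C \<and>
    (\<forall>r>0. ball_moment q \<mu>' r \<le> ennreal (C * r powr (a * real (k - 1) / real k)))"
proof -
  obtain m where m: "k = Suc m" using k by (cases k) auto
  define P where "P = char (digit_law \<rho>)"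
  \<comment> \<open>The digit that is always 0; it stands at the positions removed from the
    series.\<close>
  define D0 where "D0 = digit_law (return_pmf 0)"
  interpret D: real_distribution "digit_law \<rho>" by (rule real_distribution_digit_law)
  interpret D0: real_distribution D0 unfolding D0_def by (rule real_distribution_digit_law)
  have D0: "real_distribution D0" and D: "real_distribution (digit_law \<rho>)"
    unfolding D0_def by (rule real_distribution_digit_law)+
  have char_D0: "char D0 t = 1" for t
  proof -
    have "AE x in D0. iexp (t * x) = 1" unfolding D0_def by (intro AE_digit_law) auto
    then have "char D0 t = (\<integral>x. 1 \<partial>D0)" unfolding char_def by (intro integral_cong_AE) auto
    then show ?thesis using D0.prob_space by simp
  qed
  \<comment> \<open>\<open>ch X j\<close> is the law of the first \<open>j\<close> terms of the
    series plus \<open>c ^ j\<close> times an independent variable with law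
    \<open>X\<close>.\<close>
  define ch where "ch X j = rec_nat X (\<lambda>_. lcomb c (digit_law \<rho>)) j" for X and j :: nat
  have ch_simps: "ch X 0 = X" "ch X (Suc j) = lcomb c (digit_law \<rho>) (ch X j)" for X j
    by (simp_all add: ch_def)
  have ch_rd: "real_distribution (ch X j)" if "real_distribution X" for X j
    by (induction j) (auto simp: ch_simps that intro!: real_distribution_lcomb D)
  note char_lc = char_lcomb[OF real_distribution_imp_finite_borel real_distribution_imp_finite_borel]
  have char_ch: "char (ch X j) t = char (ch D0 j) t * char X (c ^ j * t)" if X: "real_distribution X" for X j t
  proof (induction j arbitrary: t)
    case (Suc j)
    show ?case using Suc.IH[of "c * t"]
      by (simp add: ch_simps char_lc[OF D ch_rd[OF X]] char_lc[OF D ch_rd[OF D0]] mult_ac)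
  qed (simp add: ch_simps char_D0)
  have char_\<mu>: "char \<mu> t = char (ch D0 j) t * char \<mu> (c ^ j * t)" for j t
  proof (induction j arbitrary: t)
    case (Suc j)
    have "char \<mu> t = P t * char \<mu> (c * t)"
      by (subst \<mu>_eq) (simp add: char_lc[OF D \<mu>] P_def)
    then show ?case using Suc.IH[of "c * t"]
      by (simp add: ch_simps char_lc[OF D ch_rd[OF D0]] mult_ac P_def)
  qed (simp add: ch_simps char_D0)
  have ck: "\<bar>c ^ k\<bar> < 1" using c k by (simp add: power_abs power_less_one_iff)
  obtain Rd where Rd: "AE x in digit_law \<rho>. \<bar>x\<bar> \<le> Rd"
  proof -
    obtain Rd where "\<And>d. d \<in> set_pmf \<rho> \<Longrightarrow> \<bar>d\<bar> \<le> Rd"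
      using finite_imp_bounded[OF fin] by (auto simp: bounded_iff)
    then have "AE x in digit_law \<rho>. \<bar>x\<bar> \<le> Rd" by (intro AE_digit_law) auto
    then show ?thesis by (rule that)
  qed
  have "\<exists>R. AE x in ch D0 j. \<bar>x\<bar> \<le> R" for j
  proof (induction j)
    case 0
    show ?case unfolding ch_simps D0_def by (intro exI[of _ 0] AE_digit_law) auto
  next
    case (Suc j)
    then show ?case using AE_bounded_lcomb[OF D ch_rd[OF D0] Rd] unfolding ch_simps by blast
  qed
  then obtain Rm where Rm: "AE x in ch D0 m. \<bar>x\<bar> \<le> Rm" by blast
  \<comment> \<open>One block of length \<open>k\<close>: a zero followed by
    \<open>m = k - 1\<close> genuine digits. Blocks repeat with ratio \<open>c ^ k\<close>.\<close>
  define D' where "D' = lcomb c D0 (ch D0 m)"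
  have D': "real_distribution D'" unfolding D'_def by (intro real_distribution_lcomb D0 ch_rd)
  have "AE x in D0. \<bar>x\<bar> \<le> 0" unfolding D0_def by (intro AE_digit_law) auto
  then have "AE x in D'. \<bar>x\<bar> \<le> 0 + \<bar>c\<bar> * Rm"
    unfolding D'_def by (intro AE_bounded_lcomb D0 ch_rd Rm)
  then obtain \<mu>' R where \<mu>': "real_distribution \<mu>'" and \<mu>'_eq: "\<mu>' = lcomb (c ^ k) D' \<mu>'"
    and R: "AE x in \<mu>'. \<bar>x\<bar> \<le> R"
    using exists_self_similar[OF D' _ ck] by blast
  obtain \<nu> where \<nu>: "real_distribution \<nu>" and \<nu>_eq: "\<nu> = lcomb (c ^ k) (digit_law \<rho>) \<nu>"
    using exists_self_similar[OF D Rd ck] by blast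
  interpret \<mu>': real_distribution \<mu>' by (rule \<mu>')
  have char_D': "char D' t = char (ch D0 m) (c * t)" for t
    unfolding D'_def char_lc[OF D0 ch_rd[OF D0]] by (simp add: char_D0)
  have char_\<mu>': "char \<mu>' t = char (ch D0 m) (c * t) * char \<mu>' (c ^ k * t)" for t
    by (subst \<mu>'_eq) (simp add: char_lc[OF D' \<mu>'] char_D')
  have char_\<nu>: "char \<nu> t = P t * char \<nu> (c ^ k * t)" for t
    by (subst \<nu>_eq) (simp add: char_lc[OF D \<nu>] P_def)
  have F: "real_distribution (lcomb 1 \<mu>' \<nu>)" by (intro real_distribution_lcomb \<mu>' \<nu>)
  interpret chk: real_distribution "ch D0 k" by (intro ch_rd D0)
  \<comment> \<open>Both laws satisfy the \<open>k\<close>-step equation of \<open>\<mu>\<close>,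
    whose solution is unique.\<close>
  have "\<mu> = lcomb 1 \<mu>' \<nu>"
  proof (rule real_distribution_eqI_char[OF \<mu> F ck chk.cmod_char_le_1])
    show "char \<mu> t = char (ch D0 k) t * char \<mu> (c ^ k * t)" for t by (rule char_\<mu>)
    show "char (lcomb 1 \<mu>' \<nu>) t = char (ch D0 k) t * char (lcomb 1 \<mu>' \<nu>) (c ^ k * t)" for t
      using char_\<mu>'[of t] char_\<nu>[of t]
      by (simp add: m char_lc[OF \<mu>' \<nu>] ch_simps char_lc[OF D ch_rd[OF D0]] P_def mult_ac)
  qed
  then have char_prod: "char \<mu> t = char \<mu>' t * char \<nu> t" for t
    by (simp add: char_lc[OF \<mu>' \<nu>])
  \<comment> \<open>The block equation of \<open>\<mu>'\<close> unrolled into \<open>k\<close>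
    single steps, to which the one-step moment bounds apply.\<close>
  have \<mu>'_ch: "\<mu>' = lcomb c D0 (ch \<mu>' m)"
  proof (rule Levy_uniqueness[OF \<mu>'], rule real_distribution_lcomb[OF D0 ch_rd[OF \<mu>']], rule ext)
    fix t
    show "char \<mu>' t = char (lcomb c D0 (ch \<mu>' m)) t"
      using char_\<mu>'[of t] by (simp add: char_lc[OF D0 ch_rd[OF \<mu>']] char_D0 char_ch[OF \<mu>'] m mult_ac)
  qed
  obtain d1 where d1: "d1 \<in> set_pmf \<rho>" using set_pmf_not_empty[of \<rho>] by blast
  \<comment> \<open>Filling the removed positions with the fixed digit \<open>d1\<close> adds the
    constant \<open>z\<close> to the series and yields points of \<open>K\<close>. So
    \<open>\<mu>'\<close> lives on \<open>K\<close> translated by \<open>- z\<close>, and after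
    \<open>j\<close> further digits the translation is \<open>- c ^ j * z\<close>.\<close>
  define z where "z = d1 / (1 - c ^ k)"
  have z: "z = d1 + c ^ k * z" using ck by (simp add: z_def field_simps abs_less_iff)
  define A where "A j = (\<lambda>x. x - c ^ j * z) ` K" for j
  have A: "closed (A j)" "A j \<noteq> {}" for j
    unfolding A_def by (auto intro!: compact_imp_closed compact_continuous_image K continuous_intros)
  have step: "AE d in digit_law \<rho>. \<forall>x\<in>A j. d + c * x \<in> A (Suc j)" for j
  proof (rule AE_digit_law)
    fix d assume d: "d \<in> set_pmf \<rho>"
    show "\<forall>x\<in>A j. d + c * x \<in> A (Suc j)"
    proof
      fix x assume "x \<in> A j"
      then obtain y where y: "y \<in> K" "x = y - c ^ j * z" by (auto simp: A_def)
      have "d + c * x = (d + c * y) - c ^ Suc j * z" unfolding y(2) by (simp add: algebra_simps)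
      then show "d + c * x \<in> A (Suc j)" using maps[OF d y(1)] by (auto simp: A_def)
    qed
  next
    show "{d. \<forall>x\<in>A j. d + c * x \<in> A (Suc j)} \<in> sets borel"
    proof -
      have "{d. \<forall>x\<in>A j. d + c * x \<in> A (Suc j)} = (\<Inter>x\<in>A j. (\<lambda>d. d + c * x) -` A (Suc j))" by auto
      moreover have "closed ((\<lambda>d. d + c * x) -` A (Suc j))" for x
        by (intro closed_vimage A continuous_intros)
      ultimately show ?thesis by (auto intro!: borel_closed closed_INT)
    qed
  qed
  have int_step: "(\<integral>\<^sup>+x. ennreal (min 1 (s * infdist x (A j))) \<partial>ch \<mu>' j)
      \<le> (\<integral>\<^sup>+x. ennreal (min 1 (s * \<bar>c\<bar> ^ j * infdist x (A 0))) \<partial>\<mu>')" if "0 \<le> s" for s j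
    using that
  proof (induction j arbitrary: s)
    case (Suc j)
    have "(\<integral>\<^sup>+x. ennreal (min 1 (s * infdist x (A (Suc j)))) \<partial>ch \<mu>' (Suc j))
      \<le> (\<integral>\<^sup>+x. ennreal (min 1 (s * \<bar>c\<bar> * infdist x (A j))) \<partial>ch \<mu>' j)"
      unfolding ch_simps by (intro nn_integral_infdist_lcomb_le D ch_rd \<mu>' Suc.prems A step)
    also have "\<dots> \<le> (\<integral>\<^sup>+x. ennreal (min 1 (s * \<bar>c\<bar> * \<bar>c\<bar> ^ j * infdist x (A 0))) \<partial>\<mu>')"
      using Suc.prems by (intro Suc.IH) auto
    finally show ?case by (simp add: mult_ac)
  qed (simp add: ch_simps)
  have last: "AE d in D0. \<forall>x\<in>A m. d + c * x \<in> A 0"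
    unfolding D0_def
  proof (rule AE_digit_law)
    fix d :: real assume "d \<in> set_pmf (return_pmf 0)"
    then have d: "d = 0" by simp
    show "\<forall>x\<in>A m. d + c * x \<in> A 0"
    proof
      fix x assume "x \<in> A m"
      then obtain y where y: "y \<in> K" "x = y - c ^ m * z" by (auto simp: A_def)
      have "d + c * x = (d1 + c * y) - (d1 + c ^ k * z)" unfolding y(2) by (simp add: d m algebra_simps)
      also have "d1 + c ^ k * z = c ^ 0 * z" using z by simp
      finally show "d + c * x \<in> A 0" using maps[OF d1 y(1)] unfolding A_def by blast
    qed
  next
    have "{d. \<forall>x\<in>A m. d + c * x \<in> A 0} = (\<Inter>x\<in>A m. (\<lambda>d. d + c * x) -` A 0)" by auto
    moreover have "closed ((\<lambda>d. d + c * x) -` A 0)" for x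
      by (intro closed_vimage A continuous_intros)
    ultimately show "{d. \<forall>x\<in>A m. d + c * x \<in> A 0} \<in> sets borel" by (auto intro!: borel_closed closed_INT)
  qed
  have \<mu>'A: "AE x in \<mu>'. x \<in> A 0"
  proof (rule AE_mem_if_contracting[OF \<mu>' A, where b = "\<bar>c\<bar> ^ k"])
    fix s :: real assume s: "0 \<le> s"
    have "(\<integral>\<^sup>+x. ennreal (min 1 (s * infdist x (A 0))) \<partial>\<mu>')
      \<le> (\<integral>\<^sup>+x. ennreal (min 1 (s * \<bar>c\<bar> * infdist x (A m))) \<partial>ch \<mu>' m)"
      by (subst \<mu>'_ch) (intro nn_integral_infdist_lcomb_le D0 ch_rd \<mu>' s A last)
    also have "\<dots> \<le> (\<integral>\<^sup>+x. ennreal (min 1 (s * \<bar>c\<bar> * \<bar>c\<bar> ^ m * infdist x (A 0))) \<partial>\<mu>')"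
      using s by (intro int_step) auto
    finally show "(\<integral>\<^sup>+x. ennreal (min 1 (s * infdist x (A 0))) \<partial>\<mu>')
      \<le> (\<integral>\<^sup>+x. ennreal (min 1 (s * \<bar>c\<bar> ^ k * infdist x (A 0))) \<partial>\<mu>')"
      by (simp add: m mult_ac)
  qed (use ck in \<open>auto simp: power_abs\<close>)
  have chA: "AE x in ch \<mu>' j. x \<in> A j" for j
  proof (rule AE_mem_if_nn_integral_infdist_0[OF ch_rd[OF \<mu>'] A, of 1])
    have "(\<integral>\<^sup>+x. ennreal (min 1 (1 * \<bar>c\<bar> ^ j * infdist x (A 0))) \<partial>\<mu>') = (\<integral>\<^sup>+x. 0 \<partial>\<mu>')"
      using \<mu>'A by (intro nn_integral_cong_AE) (auto elim!: eventually_mono)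
    then show "(\<integral>\<^sup>+x. ennreal (min 1 (1 * infdist x (A j))) \<partial>ch \<mu>' j) = 0"
      using int_step[of 1 j] by simp
  qed simp
  obtain \<delta> where \<delta>: "\<delta> > 0" and sep: "\<And>d d' x x'. d \<in> set_pmf \<rho> \<Longrightarrow> d' \<in> set_pmf \<rho> \<Longrightarrow> d \<noteq> d' \<Longrightarrow> x \<in> K \<Longrightarrow> x' \<in> K \<Longrightarrow>
      \<delta> \<le> \<bar>(d + c * x) - (d' + c * x')\<bar>" using separation by blast
  define W where "W = power_sum q \<rho>"
  have W0: "W \<ge> 0" by (simp add: W_def)
  have mom_step: "ball_moment q (ch \<mu>' j) (\<bar>c\<bar> ^ j * r) \<le> ennreal (W ^ j) * ball_moment q \<mu>' r"
    if r: "0 < r" "r \<le> \<delta> / 2" for j r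
  proof (induction j)
    case (Suc j)
    have "ball_moment q (ch \<mu>' (Suc j)) (\<bar>c\<bar> ^ Suc j * r) \<le> ennreal W * ball_moment q (ch \<mu>' j) (\<bar>c\<bar> ^ j * r)"
      unfolding ch_simps W_def power_Suc mult.assoc
    proof (rule ball_moment_lcomb_le[OF ch_rd[OF \<mu>'] fin _ q chA])
      fix d d' x x' assume d: "d \<in> set_pmf \<rho>" "d' \<in> set_pmf \<rho>" "d \<noteq> d'" and "x \<in> A j" "x' \<in> A j"
      then obtain y y' where y: "y \<in> K" "y' \<in> K" "x = y - c ^ j * z" "x' = y' - c ^ j * z" by (auto simp: A_def)
      have "\<bar>c\<bar> * (\<bar>c\<bar> ^ j * r) \<le> 1 * r" unfolding mult.assoc[symmetric] power_Suc[symmetric]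
        using c r by (intro mult_right_mono power_le_one) auto
      also have "\<dots> < \<delta>" using r \<delta> by simp
      also have "\<dots> \<le> \<bar>(d + c * y) - (d' + c * y')\<bar>" using d y by (intro sep)
      also have "(d + c * y) - (d' + c * y') = (d + c * x) - (d' + c * x')" by (simp add: y algebra_simps)
      finally show "\<bar>c\<bar> * (\<bar>c\<bar> ^ j * r) < \<bar>(d + c * x) - (d' + c * x')\<bar>" .
    qed (use c in auto)
    also have "\<dots> \<le> ennreal W * (ennreal (W ^ j) * ball_moment q \<mu>' r)" by (intro mult_left_mono Suc.IH) auto
    finally show ?case using W0 by (simp add: ennreal_mult mult.assoc)
  qed (simp add: ch_simps)
  \<comment> \<open>The radius shrinks by \<open>\<bar>c\<bar> ^ k\<close> while only
    \<open>m = k - 1\<close> factors \<open>W\<close> are gained, because the zero digit has power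
    sum 1. This is the loss \<open>(k - 1) / k\<close> in the exponent.\<close>
  have mom_cycle: "ball_moment q \<mu>' (\<bar>c\<bar> ^ k * r) \<le> ennreal (W ^ m) * ball_moment q \<mu>' r"
    if r: "0 < r" "r \<le> \<delta> / 2" for r
  proof -
    have "ball_moment q \<mu>' (\<bar>c\<bar> ^ k * r) = ball_moment q (lcomb c D0 (ch \<mu>' m)) (\<bar>c\<bar> * (\<bar>c\<bar> ^ m * r))"
      using \<mu>'_ch by (simp add: m mult.assoc)
    also have "\<dots> \<le> ennreal (power_sum q (return_pmf 0)) * ball_moment q (ch \<mu>' m) (\<bar>c\<bar> ^ m * r)"
      unfolding D0_def using c by (intro ball_moment_lcomb_le[OF ch_rd[OF \<mu>'] _ _ q chA]) auto
    also have "power_sum q (return_pmf 0) = 1" by (simp add: power_sum_def)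
    finally show ?thesis using mom_step[OF r, of m] by simp
  qed
  define \<gamma> where "\<gamma> = \<bar>c\<bar> ^ k"
  have \<gamma>: "0 < \<gamma>" "\<gamma> < 1" using c ck by (auto simp: \<gamma>_def power_abs)
  define b where "b = a * real (k - 1) / real k"
  have b0: "0 \<le> b" using a by (simp add: b_def)
  have mom_n: "ball_moment q \<mu>' (\<gamma> ^ n * (\<delta> / 2)) \<le> ennreal ((W ^ m) ^ n)" for n
  proof (induction n)
    case 0
    then show ?case using ball_moment_le_1[OF \<mu>', of q] q by simp
  next
    case (Suc n)
    have "\<gamma> ^ n * (\<delta> / 2) \<le> 1 * (\<delta> / 2)" using \<gamma> \<delta> by (intro mult_right_mono power_le_one) auto
    then have "ball_moment q \<mu>' (\<gamma> * (\<gamma> ^ n * (\<delta> / 2))) \<le> ennreal (W ^ m) * ball_moment q \<mu>' (\<gamma> ^ n * (\<delta> / 2))"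
      unfolding \<gamma>_def using \<gamma> \<delta> c by (intro mom_cycle) (auto simp: \<gamma>_def)
    also have "\<dots> \<le> ennreal (W ^ m) * ennreal ((W ^ m) ^ n)" by (intro mult_left_mono Suc) auto
    finally show ?case using W0 by (simp add: mult.assoc ennreal_mult)
  qed
  have "(W ^ m) ^ n \<le> (\<gamma> ^ n) powr b" for n
  proof -
    have "(W ^ m) ^ n \<le> ((\<bar>c\<bar> powr a) ^ m) ^ n"
      using W W0 unfolding W_def by (intro power_mono) auto
    also have "\<dots> = \<bar>c\<bar> powr (a * real m * real n)"
      using c by (simp add: powr_powr flip: powr_realpow)
    also have "a * real m * real n = (real k * real n) * b"
      using m by (simp add: b_def field_simps)
    also have "\<bar>c\<bar> powr ((real k * real n) * b) = (\<gamma> ^ n) powr b"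
      using c by (simp add: \<gamma>_def powr_powr[symmetric] powr_realpow flip: power_mult of_nat_mult)
    finally show ?thesis .
  qed
  then have "ball_moment q \<mu>' (\<gamma> ^ n * (\<delta> / 2)) \<le> ennreal ((\<gamma> ^ n) powr b)" for n
    using mom_n[of n] by (meson ennreal_leI order.trans)
  then have "ball_moment q \<mu>' r \<le> ennreal (\<gamma> powr - b * (\<delta> / 2) powr - b * r powr b)" if "0 < r" for r
    using that \<gamma> \<delta> b0 q
    by (intro powr_bound_of_geometric_scales) (auto intro: ball_moment_mono[OF \<mu>'] ball_moment_le_1[OF \<mu>'])
  moreover have "0 < \<gamma> powr - b * (\<delta> / 2) powr - b" using \<gamma> \<delta> by simp
  ultimately show ?thesis
    using \<mu>' \<nu> D' char_prod \<nu>_eq \<mu>'_eq R unfolding b_def by blast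
qed

end

section \<open>\<open>L\<^sup>q\<close> norms of ball measures\<close>

text \<open>Up to constants and doubling of the radius this is
  \<open>r * ball_moment q \<theta> r\<close>. Full dimension therefore means decay like
  \<open>r powr q\<close>, up to arbitrarily small losses in the exponent.\<close>

definition ball_Lq :: "real \<Rightarrow> real measure \<Rightarrow> real \<Rightarrow> ennreal" where
  "ball_Lq q \<theta> r = (\<integral>\<^sup>+x. ennreal (measure \<theta> (cball x r) powr q) \<partial>lborel)"

lemma nn_integral_lborel_shift:
  fixes f :: "real \<Rightarrow> ennreal"
  assumes [measurable]: "f \<in> borel_measurable borel"
  shows "(\<integral>\<^sup>+x. f (x + a) \<partial>lborel) = (\<integral>\<^sup>+x. f x \<partial>lborel)"
  using nn_integral_real_affine[of f 1 a] by (simp add: add.commute)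

context
  fixes \<theta> :: "real measure" and q :: real
  assumes \<theta>: "real_distribution \<theta>" and q: "1 < q"
begin

interpretation real_distribution \<theta> by (rule \<theta>)

lemma measurable_mcball: "(\<lambda>x. measure \<theta> (cball x r)) \<in> borel_measurable borel"
  by (rule borel_measurable_measure_cball[OF finite_borel_measure_M])

lemma ball_Lq_mono: "r \<le> r' \<Longrightarrow> ball_Lq q \<theta> r \<le> ball_Lq q \<theta> r'"
  unfolding ball_Lq_def using q
  by (intro nn_integral_mono ennreal_leI powr_mono2 finite_measure_mono) auto

text \<open>A ball of radius \<open>2 * r\<close> is covered by two balls of radius \<open>r\<close>
  whose centres are shifted by \<open>r\<close> to either side.\<close>

lemma ball_Lq_double: "ball_Lq q \<theta> (2 * r) \<le> ennreal (2 powr q) * ball_Lq q \<theta> r"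
proof -
  note [measurable] = measurable_mcball
  let ?m = "\<lambda>x. measure \<theta> (cball x r)"
  have "measure \<theta> (cball x (2 * r)) powr q \<le> 2 powr (q - 1) * ?m (x + - r) powr q + 2 powr (q - 1) * ?m (x + r) powr q" for x
  proof -
    have "measure \<theta> (cball x (2 * r)) \<le> measure \<theta> (cball (x + - r) r \<union> cball (x + r) r)"
      by (intro finite_measure_mono) (auto simp: dist_real_def)
    also have "\<dots> \<le> ?m (x + - r) + ?m (x + r)" by (intro measure_Un_le) auto
    finally have "measure \<theta> (cball x (2 * r)) powr q \<le> (?m (x + - r) + ?m (x + r)) powr q"
      using q by (intro powr_mono2) auto
    also have "\<dots> \<le> 2 powr (q - 1) * (?m (x + - r) powr q + ?m (x + r) powr q)"
      using q by (intro add_powr_le) auto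
    finally show ?thesis by (simp add: distrib_left)
  qed
  then have "ball_Lq q \<theta> (2 * r) \<le> (\<integral>\<^sup>+x. ennreal (2 powr (q - 1)) * ennreal (?m (x + - r) powr q)
      + ennreal (2 powr (q - 1)) * ennreal (?m (x + r) powr q) \<partial>lborel)"
    unfolding ball_Lq_def by (intro nn_integral_mono) (simp flip: ennreal_mult ennreal_plus add: ennreal_leI)
  also have "\<dots> = ennreal (2 powr (q - 1)) * (\<integral>\<^sup>+x. ennreal (?m (x + - r) powr q) \<partial>lborel)
      + ennreal (2 powr (q - 1)) * (\<integral>\<^sup>+x. ennreal (?m (x + r) powr q) \<partial>lborel)"
    by (subst nn_integral_add) (auto simp: nn_integral_cmult)
  also have "\<dots> = ennreal (2 powr (q - 1)) * ball_Lq q \<theta> r + ennreal (2 powr (q - 1)) * ball_Lq q \<theta> r"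
    unfolding ball_Lq_def
    using nn_integral_lborel_shift[of "\<lambda>x. ennreal (?m x powr q)" "-r"]
      nn_integral_lborel_shift[of "\<lambda>x. ennreal (?m x powr q)" r] by simp
  also have "\<dots> = ennreal (2 powr q) * ball_Lq q \<theta> r"
    by (simp flip: distrib_right ennreal_plus) (simp add: powr_diff)
  finally show ?thesis .
qed

lemma ball_Lq_power2: "ball_Lq q \<theta> (2 ^ n * r) \<le> ennreal ((2 powr q) ^ n) * ball_Lq q \<theta> r"
proof (induction n)
  case (Suc n)
  have "ball_Lq q \<theta> (2 ^ Suc n * r) \<le> ennreal (2 powr q) * ball_Lq q \<theta> (2 ^ n * r)"
    using ball_Lq_double[of "2 ^ n * r"] by (simp add: mult.assoc)
  also have "\<dots> \<le> ennreal (2 powr q) * (ennreal ((2 powr q) ^ n) * ball_Lq q \<theta> r)"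
    by (intro mult_left_mono Suc) auto
  finally show ?case by (simp add: ennreal_mult mult.assoc)
qed simp

text \<open>One factor of the ball mass is written as an integral against \<open>\<theta>\<close>.
  This mediates between centres distributed by Lebesgue measure and centres distributed by
  \<open>\<theta>\<close>.\<close>

lemma ball_Lq_eq:
  "ball_Lq q \<theta> r = (\<integral>\<^sup>+y. \<integral>\<^sup>+x. ennreal (measure \<theta> (cball x r) powr (q - 1)) * indicator (cball y r) x \<partial>lborel \<partial>\<theta>)"
proof -
  note [measurable] = measurable_mcball
  interpret P: pair_sigma_finite lborel \<theta> ..
  have ind: "indicator (cball x r) y = (indicator {.. r} (dist x y) :: ennreal)" for x y :: real
    by (auto simp: indicator_def)
  have "ball_Lq q \<theta> r = (\<integral>\<^sup>+x. ennreal (measure \<theta> (cball x r) powr (q - 1)) * emeasure \<theta> (cball x r) \<partial>lborel)"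
    unfolding ball_Lq_def
  proof (intro nn_integral_cong)
    fix x
    have "m powr q = m powr (q - 1) * m" if "0 \<le> m" for m :: real
      using that by (cases "m = 0") (auto simp: powr_diff)
    then show "ennreal (measure \<theta> (cball x r) powr q) = ennreal (measure \<theta> (cball x r) powr (q - 1)) * emeasure \<theta> (cball x r)"
      by (simp add: emeasure_eq_measure flip: ennreal_mult)
  qed
  also have "\<dots> = (\<integral>\<^sup>+x. \<integral>\<^sup>+y. ennreal (measure \<theta> (cball x r) powr (q - 1)) * indicator (cball x r) y \<partial>\<theta> \<partial>lborel)"
    by (intro nn_integral_cong, subst nn_integral_cmult) auto
  also have "\<dots> = (\<integral>\<^sup>+y. \<integral>\<^sup>+x. ennreal (measure \<theta> (cball x r) powr (q - 1)) * indicator (cball x r) y \<partial>lborel \<partial>\<theta>)"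
    by (rule P.Fubini'[symmetric]) (simp add: ind measurable_split_conv)
  also have "\<dots> = (\<integral>\<^sup>+y. \<integral>\<^sup>+x. ennreal (measure \<theta> (cball x r) powr (q - 1)) * indicator (cball y r) x \<partial>lborel \<partial>\<theta>)"
    by (simp add: indicator_def dist_commute)
  finally show ?thesis .
qed

lemma ball_moment_le_ball_Lq:
  assumes r: "0 \<le> r"
  shows "ennreal (2 * r) * ball_moment q \<theta> r \<le> ball_Lq q \<theta> (2 * r)"
proof -
  note [measurable] = measurable_mcball
  have "ennreal (2 * r) * ball_moment q \<theta> r = (\<integral>\<^sup>+y. ennreal (measure \<theta> (cball y r) powr (q - 1)) * ennreal (2 * r) \<partial>\<theta>)"
    unfolding ball_moment_def by (subst nn_integral_multc) (auto simp: mult.commute)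
  also have "\<dots> = (\<integral>\<^sup>+y. \<integral>\<^sup>+x. ennreal (measure \<theta> (cball y r) powr (q - 1)) * indicator (cball y r) x \<partial>lborel \<partial>\<theta>)"
    using r by (intro nn_integral_cong, subst nn_integral_cmult) (auto simp: cball_eq_atLeastAtMost)
  also have "\<dots> \<le> (\<integral>\<^sup>+y. \<integral>\<^sup>+x. ennreal (measure \<theta> (cball x (2 * r)) powr (q - 1)) * indicator (cball y (2 * r)) x \<partial>lborel \<partial>\<theta>)"
  proof (intro nn_integral_mono)
    fix x y
    show "ennreal (measure \<theta> (cball y r) powr (q - 1)) * indicator (cball y r) x
      \<le> ennreal (measure \<theta> (cball x (2 * r)) powr (q - 1)) * indicator (cball y (2 * r)) x"
    proof (cases "x \<in> cball y r")
      case True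
      then have "measure \<theta> (cball y r) \<le> measure \<theta> (cball x (2 * r))"
        by (intro finite_measure_mono) (auto simp: dist_real_def)
      then show ?thesis using True q r by (auto simp: indicator_def intro!: ennreal_leI powr_mono2)
    qed auto
  qed
  also have "\<dots> = ball_Lq q \<theta> (2 * r)" by (rule ball_Lq_eq[symmetric])
  finally show ?thesis .
qed

lemma ball_Lq_le_ball_moment:
  assumes r: "0 \<le> r"
  shows "ball_Lq q \<theta> r \<le> ennreal (2 * r) * ball_moment q \<theta> (2 * r)"
proof -
  note [measurable] = measurable_mcball
  have "ball_Lq q \<theta> r = (\<integral>\<^sup>+y. \<integral>\<^sup>+x. ennreal (measure \<theta> (cball x r) powr (q - 1)) * indicator (cball y r) x \<partial>lborel \<partial>\<theta>)"
    by (rule ball_Lq_eq)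
  also have "\<dots> \<le> (\<integral>\<^sup>+y. \<integral>\<^sup>+x. ennreal (measure \<theta> (cball y (2 * r)) powr (q - 1)) * indicator (cball y r) x \<partial>lborel \<partial>\<theta>)"
  proof (intro nn_integral_mono)
    fix x y
    show "ennreal (measure \<theta> (cball x r) powr (q - 1)) * indicator (cball y r) x
      \<le> ennreal (measure \<theta> (cball y (2 * r)) powr (q - 1)) * indicator (cball y r) x"
    proof (cases "x \<in> cball y r")
      case True
      then have "measure \<theta> (cball x r) \<le> measure \<theta> (cball y (2 * r))"
        by (intro finite_measure_mono) (auto simp: dist_real_def)
      then show ?thesis using True q r by (auto simp: indicator_def intro!: ennreal_leI powr_mono2)
    qed auto
  qed
  also have "\<dots> = (\<integral>\<^sup>+y. ennreal (measure \<theta> (cball y (2 * r)) powr (q - 1)) * ennreal (2 * r) \<partial>\<theta>)"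
    using r by (intro nn_integral_cong, subst nn_integral_cmult) (auto simp: cball_eq_atLeastAtMost)
  also have "\<dots> = ennreal (2 * r) * ball_moment q \<theta> (2 * r)"
    unfolding ball_moment_def by (subst nn_integral_multc) (auto simp: mult.commute)
  finally show ?thesis .
qed

lemma ball_Lq_le: "0 \<le> r \<Longrightarrow> ball_Lq q \<theta> r \<le> ennreal (2 * r)"
  using ball_Lq_le_ball_moment[of r] mult_left_mono[OF ball_moment_le_1[OF \<theta>, of q "2 * r"], of "ennreal (2 * r)"] q
  by simp

end

context
  fixes \<theta> \<kappa> :: "real measure" and q s R :: real
  assumes \<theta>: "real_distribution \<theta>" and \<kappa>: "real_distribution \<kappa>" and q: "1 < q"
    and s: "0 < s" and R: "AE z in \<kappa>. \<bar>z\<bar> \<le> R"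
begin

interpretation \<theta>: real_distribution \<theta> by (rule \<theta>)
interpretation \<kappa>: real_distribution \<kappa> by (rule \<kappa>)
interpretation \<eta>: real_distribution "lcomb s \<theta> \<kappa>" by (intro real_distribution_lcomb \<theta> \<kappa>)

lemma emeasure_lcomb_cball_scaled:
  "emeasure (lcomb s \<theta> \<kappa>) (cball x (s * r)) = (\<integral>\<^sup>+y. ennreal (measure \<kappa> (cball ((x - y) / s) r)) \<partial>\<theta>)"
proof -
  have "emeasure (lcomb s \<theta> \<kappa>) (cball x (s * r)) = (\<integral>\<^sup>+z. indicator (cball x (s * r)) z \<partial>lcomb s \<theta> \<kappa>)"
    by simp
  also have "\<dots> = (\<integral>\<^sup>+y. \<integral>\<^sup>+z. indicator (cball x (s * r)) (y + s * z) \<partial>\<kappa> \<partial>\<theta>)"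
    by (rule nn_integral_lcomb[OF \<theta>.finite_borel_measure_M \<kappa>.finite_borel_measure_M]) measurable
  also have "\<dots> = (\<integral>\<^sup>+y. ennreal (measure \<kappa> (cball ((x - y) / s) r)) \<partial>\<theta>)"
  proof (intro nn_integral_cong)
    fix y
    have "y + s * z \<in> cball x (s * r) \<longleftrightarrow> z \<in> cball ((x - y) / s) r" for z
    proof -
      have "\<bar>x - (y + s * z)\<bar> = s * \<bar>(x - y) / s - z\<bar>"
        using s by (simp add: abs_mult_pos' field_simps flip: abs_mult)
      then show ?thesis using s by (simp add: dist_real_def)
    qed
    then have "(\<integral>\<^sup>+z. indicator (cball x (s * r)) (y + s * z) \<partial>\<kappa>) = (\<integral>\<^sup>+z. indicator (cball ((x - y) / s) r) z \<partial>\<kappa>)"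
      by (simp add: indicator_def)
    then show "(\<integral>\<^sup>+z. indicator (cball x (s * r)) (y + s * z) \<partial>\<kappa>) = ennreal (measure \<kappa> (cball ((x - y) / s) r))"
      by (simp add: \<kappa>.emeasure_eq_measure)
  qed
  finally show ?thesis .
qed

text \<open>The mass of the ball at \<open>x\<close> is an average over \<open>\<theta>\<close> of
  ball masses of \<open>\<kappa>\<close>, to which only points within \<open>s * (R + 1)\<close> of
  \<open>x\<close> contribute. Hoelder on that ball produces its \<open>\<theta>\<close>-mass to the
  power \<open>q - 1\<close>, and integration in \<open>x\<close> separates the two
  measures.\<close>

lemma ball_Lq_lcomb_le:
  assumes r: "0 < r" "r \<le> 1"
  shows "ball_Lq q (lcomb s \<theta> \<kappa>) (s * r) \<le> ennreal s * ball_moment q \<theta> (2 * (s * (R + 1))) * ball_Lq q \<kappa> r"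
proof -
  define \<rho> where "\<rho> = s * (R + 1)"
  define \<phi> where "\<phi> x y = measure \<kappa> (cball ((x - y) / s) r)" for x y
  have mk [measurable]: "(\<lambda>x. measure \<kappa> (cball x r)) \<in> borel_measurable borel" for r
    by (rule measurable_mcball[OF \<kappa> q])
  have [measurable]: "(\<lambda>x. measure \<theta> (cball x r)) \<in> borel_measurable borel" for r
    by (rule measurable_mcball[OF \<theta> q])
  have phi_meas [measurable]: "(\<lambda>p. \<phi> (fst p) (snd p)) \<in> borel_measurable (borel \<Otimes>\<^sub>M borel)"
    unfolding \<phi>_def by (rule measurable_compose[OF _ mk]) measurable
  have phi_meas2 [measurable]: "\<phi> x \<in> borel_measurable borel" for x
    unfolding \<phi>_def by (rule measurable_compose[OF _ mk]) measurable
  have \<phi>0: "\<phi> x y = 0" if "y \<notin> cball x \<rho>" for x y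
  proof -
    have "AE z in \<kappa>. z \<notin> cball ((x - y) / s) r"
      using R
    proof eventually_elim
      case (elim z)
      show ?case
      proof
        assume "z \<in> cball ((x - y) / s) r"
        then have "\<bar>(x - y) / s\<bar> \<le> r + \<bar>z\<bar>" unfolding mem_cball dist_real_def by linarith
        then have "\<bar>(x - y) / s\<bar> \<le> R + 1" using elim r by linarith
        then have "\<bar>x - y\<bar> \<le> \<rho>" using s by (simp add: \<rho>_def field_simps)
        then show False using that by (simp add: dist_real_def)
      qed
    qed
    then have "\<kappa>.prob (cball ((x - y) / s) r) = 0" by (subst \<kappa>.prob_eq_0) auto
    then show ?thesis by (simp add: \<phi>_def)
  qed
  have point: "ennreal (measure (lcomb s \<theta> \<kappa>) (cball x (s * r)) powr q)
    \<le> (\<integral>\<^sup>+y. ennreal (measure \<theta> (cball y (2 * \<rho>)) powr (q - 1)) * ennreal (\<phi> x y powr q) \<partial>\<theta>)" for x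
  proof -
    define N where "N = density \<theta> (indicator (cball x \<rho>))"
    have [measurable_cong]: "sets N = sets borel" by (simp add: N_def)
    have emN: "emeasure N UNIV = ennreal (measure \<theta> (cball x \<rho>))"
      by (simp add: N_def emeasure_density \<theta>.emeasure_eq_measure)
    have spN: "space N = UNIV" by (simp add: N_def)
    interpret N: finite_measure N
      by (intro finite_measureI) (simp add: spN emN)
    have mN: "measure N (space N) = measure \<theta> (cball x \<rho>)"
      using emN by (simp add: spN measure_def)
    have int: "integrable N (\<phi> x)"
      by (intro N.integrable_const_bound[of _ 1]) (auto simp: \<phi>_def)
    have "emeasure (lcomb s \<theta> \<kappa>) (cball x (s * r)) = (\<integral>\<^sup>+y. ennreal (\<phi> x y) \<partial>\<theta>)"
      unfolding \<phi>_def by (rule emeasure_lcomb_cball_scaled)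
    also have "\<dots> = (\<integral>\<^sup>+y. ennreal (\<phi> x y) \<partial>N)"
      unfolding N_def by (subst nn_integral_density) (auto intro!: nn_integral_cong simp: indicator_def \<phi>0)
    also have "\<dots> = ennreal (\<integral>y. \<phi> x y \<partial>N)"
      by (rule nn_integral_eq_integral[OF int]) (auto simp: \<phi>_def)
    finally have "measure (lcomb s \<theta> \<kappa>) (cball x (s * r)) = (\<integral>y. \<phi> x y \<partial>N)"
      by (simp add: \<eta>.emeasure_eq_measure \<phi>_def)
    then have "ennreal (measure (lcomb s \<theta> \<kappa>) (cball x (s * r)) powr q)
      \<le> ennreal (measure \<theta> (cball x \<rho>) powr (q - 1)) * (\<integral>\<^sup>+y. ennreal (\<phi> x y powr q) \<partial>N)"
      using powr_integral_le_nn_integral_powr[OF N.finite_measure_axioms int, of q] q mN by (simp add: \<phi>_def)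
    also have "(\<integral>\<^sup>+y. ennreal (\<phi> x y powr q) \<partial>N) = (\<integral>\<^sup>+y. indicator (cball x \<rho>) y * ennreal (\<phi> x y powr q) \<partial>\<theta>)"
      unfolding N_def by (subst nn_integral_density) auto
    also have "ennreal (measure \<theta> (cball x \<rho>) powr (q - 1)) * \<dots>
      = (\<integral>\<^sup>+y. ennreal (measure \<theta> (cball x \<rho>) powr (q - 1)) * (indicator (cball x \<rho>) y * ennreal (\<phi> x y powr q)) \<partial>\<theta>)"
      by (rule nn_integral_cmult[symmetric]) auto
    \<comment> \<open>Recentring the ball of \<open>\<theta>\<close> at \<open>y\<close> removes its
      dependence on \<open>x\<close>, so that after Fubini the integral in \<open>x\<close> is the
      norm of \<open>\<kappa>\<close>.\<close>
    also have "\<dots> \<le> (\<integral>\<^sup>+y. ennreal (measure \<theta> (cball y (2 * \<rho>)) powr (q - 1)) * ennreal (\<phi> x y powr q) \<partial>\<theta>)"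
    proof (intro nn_integral_mono)
      fix y
      show "ennreal (measure \<theta> (cball x \<rho>) powr (q - 1)) * (indicator (cball x \<rho>) y * ennreal (\<phi> x y powr q))
        \<le> ennreal (measure \<theta> (cball y (2 * \<rho>)) powr (q - 1)) * ennreal (\<phi> x y powr q)"
      proof (cases "y \<in> cball x \<rho>")
        case True
        then have "measure \<theta> (cball x \<rho>) \<le> measure \<theta> (cball y (2 * \<rho>))"
          by (intro \<theta>.finite_measure_mono) (auto simp: dist_real_def)
        then show ?thesis using True q by (auto intro!: mult_right_mono ennreal_leI powr_mono2)
      qed auto
    qed
    finally show ?thesis .
  qed
  interpret P: pair_sigma_finite lborel \<theta> ..
  have "ball_Lq q (lcomb s \<theta> \<kappa>) (s * r)
    \<le> (\<integral>\<^sup>+x. \<integral>\<^sup>+y. ennreal (measure \<theta> (cball y (2 * \<rho>)) powr (q - 1)) * ennreal (\<phi> x y powr q) \<partial>\<theta> \<partial>lborel)"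
    unfolding ball_Lq_def by (intro nn_integral_mono point)
  also have "\<dots> = (\<integral>\<^sup>+y. \<integral>\<^sup>+x. ennreal (measure \<theta> (cball y (2 * \<rho>)) powr (q - 1)) * ennreal (\<phi> x y powr q) \<partial>lborel \<partial>\<theta>)"
    by (rule P.Fubini'[symmetric]) (simp add: measurable_split_conv)
  also have "\<dots> = (\<integral>\<^sup>+y. ennreal (measure \<theta> (cball y (2 * \<rho>)) powr (q - 1)) * (ennreal s * ball_Lq q \<kappa> r) \<partial>\<theta>)"
  proof (intro nn_integral_cong)
    fix y
    have [measurable]: "(\<lambda>x. \<phi> x y) \<in> borel_measurable borel"
      unfolding \<phi>_def by (rule measurable_compose[OF _ mk]) measurable
    have "(\<integral>\<^sup>+x. ennreal (\<phi> x y powr q) \<partial>lborel) = ennreal \<bar>s\<bar> * (\<integral>\<^sup>+x. ennreal (\<phi> (y + s * x) y powr q) \<partial>lborel)"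
      using s by (intro nn_integral_real_affine) auto
    also have "\<dots> = ennreal s * ball_Lq q \<kappa> r" using s by (simp add: \<phi>_def ball_Lq_def)
    finally show "(\<integral>\<^sup>+x. ennreal (measure \<theta> (cball y (2 * \<rho>)) powr (q - 1)) * ennreal (\<phi> x y powr q) \<partial>lborel)
      = ennreal (measure \<theta> (cball y (2 * \<rho>)) powr (q - 1)) * (ennreal s * ball_Lq q \<kappa> r)"
      by (subst nn_integral_cmult) auto
  qed
  also have "\<dots> = ball_moment q \<theta> (2 * \<rho>) * (ennreal s * ball_Lq q \<kappa> r)"
    unfolding ball_moment_def by (subst nn_integral_multc) auto
  finally show ?thesis by (simp add: \<rho>_def mult_ac)
qed

text \<open>Adding an independent \<open>s * z\<close> with \<open>\<bar>z\<bar> \<le> R\<close>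
  moves mass by at most \<open>s * R\<close>.\<close>

lemma ball_Lq_le_lcomb:
  assumes r: "0 < r"
  shows "ball_Lq q \<theta> r \<le> ball_Lq q (lcomb s \<theta> \<kappa>) (r + s * R)"
  unfolding ball_Lq_def
proof (intro nn_integral_mono ennreal_leI powr_mono2)
  fix x
  have "emeasure \<theta> (cball x r) = (\<integral>\<^sup>+y. indicator (cball x r) y \<partial>\<theta>)" by simp
  also have "\<dots> \<le> (\<integral>\<^sup>+y. \<integral>\<^sup>+z. indicator (cball x (r + s * R)) (y + s * z) \<partial>\<kappa> \<partial>\<theta>)"
  proof (intro nn_integral_mono)
    fix y
    show "indicator (cball x r) y \<le> (\<integral>\<^sup>+z. indicator (cball x (r + s * R)) (y + s * z) \<partial>\<kappa>)"
    proof (cases "y \<in> cball x r")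
      case True
      have "(\<integral>\<^sup>+z. indicator (cball x (r + s * R)) (y + s * z) \<partial>\<kappa>) = (\<integral>\<^sup>+z. 1 \<partial>\<kappa>)"
      proof (intro nn_integral_cong_AE)
        show "AE z in \<kappa>. indicator (cball x (r + s * R)) (y + s * z) = (1::ennreal)"
          using R
        proof eventually_elim
          case (elim z)
          have "\<bar>s * z\<bar> \<le> s * R" using elim s by (simp add: abs_mult)
          moreover have "\<bar>x - y\<bar> \<le> r" using True by (simp add: dist_real_def)
          ultimately have "\<bar>x - (y + s * z)\<bar> \<le> r + s * R" by linarith
          then show ?case by (simp add: indicator_def dist_real_def)
        qed
      qed
      then show ?thesis using True \<kappa>.emeasure_space_1 by simp
    qed simp
  qed
  also have "\<dots> = (\<integral>\<^sup>+z. indicator (cball x (r + s * R)) z \<partial>lcomb s \<theta> \<kappa>)"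
    by (rule nn_integral_lcomb[OF \<theta>.finite_borel_measure_M \<kappa>.finite_borel_measure_M, symmetric]) measurable
  finally show "measure \<theta> (cball x r) \<le> measure (lcomb s \<theta> \<kappa>) (cball x (r + s * R))"
    by (simp add: \<theta>.emeasure_eq_measure \<eta>.emeasure_eq_measure)
qed (use q in auto)

end

text \<open>At scale \<open>s\<close> the summand \<open>s * z\<close> is invisible up to constants,
  so the moment of \<open>\<theta>\<close> in \<open>ball_Lq_lcomb_le\<close> can be replaced by the
  norm of the whole sum. The constant depends only on \<open>q\<close> and \<open>R\<close>, so the
  inequality can be iterated with varying measures and scales.\<close>

theorem ball_Lq_submultiplicative:
  assumes q: "1 < q" and R0: "0 \<le> R"
  obtains C where "1 \<le> C" "\<And>\<theta> \<kappa> s r. real_distribution \<theta> \<Longrightarrow> real_distribution \<kappa> \<Longrightarrow> 0 < s \<Longrightarrow>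
    AE z in \<kappa>. \<bar>z\<bar> \<le> R \<Longrightarrow> 0 < r \<Longrightarrow> r \<le> 1 \<Longrightarrow>
    ball_Lq q (lcomb s \<theta> \<kappa>) (s * r) \<le> ennreal C * ball_Lq q (lcomb s \<theta> \<kappa>) s * ball_Lq q \<kappa> r"
proof -
  \<comment> \<open>The radius grows to \<open>4 * s * (R + 1) + s * R \<le> 5 * s * (R + 1)\<close>
    and is brought back to \<open>s\<close> by \<open>n\<close> halvings.\<close>
  obtain n :: nat where n: "5 * (R + 1) < 2 ^ n" using real_arch_pow[of 2 "5 * (R + 1)"] by auto
  show ?thesis
  proof (rule that[of "(2 powr q) ^ n"])
    show "1 \<le> (2 powr q) ^ n" using q by (intro one_le_power ge_one_powr_ge_zero) auto
    fix \<theta> \<kappa> :: "real measure" and s r :: real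
    assume \<theta>: "real_distribution \<theta>" and \<kappa>: "real_distribution \<kappa>" and s: "0 < s"
      and R: "AE z in \<kappa>. \<bar>z\<bar> \<le> R" and r: "0 < r" "r \<le> 1"
    have \<eta>: "real_distribution (lcomb s \<theta> \<kappa>)" by (intro real_distribution_lcomb \<theta> \<kappa>)
    define \<rho> where "\<rho> = s * (R + 1)"
    have "0 \<le> s * R" using s R0 by simp
    then have \<rho>: "s \<le> 4 * \<rho>" "0 < \<rho>" using s by (simp_all add: \<rho>_def distrib_left)
    have "ennreal s * ball_moment q \<theta> (2 * \<rho>) \<le> ennreal (2 * (2 * \<rho>)) * ball_moment q \<theta> (2 * \<rho>)"
      using \<rho> by (intro mult_right_mono ennreal_leI) auto
    also have "\<dots> \<le> ball_Lq q \<theta> (2 * (2 * \<rho>))"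
      using \<rho> by (intro ball_moment_le_ball_Lq \<theta> q) auto
    also have "\<dots> \<le> ball_Lq q (lcomb s \<theta> \<kappa>) (2 * (2 * \<rho>) + s * R)"
      using \<rho> by (intro ball_Lq_le_lcomb \<theta> \<kappa> q s R) auto
    also have "\<dots> \<le> ball_Lq q (lcomb s \<theta> \<kappa>) (2 ^ n * s)"
    proof (intro ball_Lq_mono[OF \<eta> q])
      have "2 * (2 * \<rho>) + s * R \<le> s * (5 * (R + 1))" using s by (simp add: \<rho>_def algebra_simps)
      also have "\<dots> \<le> s * 2 ^ n" using n s by (intro mult_left_mono) auto
      finally show "2 * (2 * \<rho>) + s * R \<le> 2 ^ n * s" by (simp add: mult.commute)
    qed
    also have "\<dots> \<le> ennreal ((2 powr q) ^ n) * ball_Lq q (lcomb s \<theta> \<kappa>) s"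
      by (rule ball_Lq_power2[OF \<eta> q])
    finally have "ennreal s * ball_moment q \<theta> (2 * \<rho>) * ball_Lq q \<kappa> r
      \<le> ennreal ((2 powr q) ^ n) * ball_Lq q (lcomb s \<theta> \<kappa>) s * ball_Lq q \<kappa> r"
      by (rule mult_right_mono) simp
    then show "ball_Lq q (lcomb s \<theta> \<kappa>) (s * r) \<le> ennreal ((2 powr q) ^ n) * ball_Lq q (lcomb s \<theta> \<kappa>) s * ball_Lq q \<kappa> r"
      using ball_Lq_lcomb_le[OF \<theta> \<kappa> q s R r] unfolding \<rho>_def by (rule order.trans[rotated])
  qed
qed

section \<open>Convolutions of measures with incommensurable contraction ratios\<close>

text \<open>Multiplication by \<open>Q\<close> sends the orbit, up to an error of at most 1, to the
  numbers \<open>j * h\<close> modulo \<open>Q\<close>, which are distinct for \<open>j < Q\<close>.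
  So the indices counted inject into the integers of an interval of length
  \<open>l * Q + 2\<close>.\<close>

lemma card_frac_interval_le:
  fixes \<omega> x0 c l :: real and h :: int and Q :: nat
  assumes cop: "coprime h (int Q)" and Q: "0 < Q" and app: "\<bar>\<omega> - of_int h / real Q\<bar> < 1 / (real Q)\<^sup>2"
    and l: "0 \<le> l"
  shows "real (card {j. j < Q \<and> frac (x0 + real j * \<omega>) \<in> {c..c + l}}) \<le> l * real Q + 3"
proof -
  define S where "S = {j. j < Q \<and> frac (x0 + real j * \<omega>) \<in> {c..c + l}}"
  define g where "g j = int j * h - \<lfloor>x0 + real j * \<omega>\<rfloor> * int Q" for j
  define Y where "Y = (c - x0) * real Q"
  have inj: "inj_on g S"
  proof (rule inj_onI)
    fix i j assume ij: "i \<in> S" "j \<in> S" "g i = g j"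
    then have "(int i - int j) * h = (\<lfloor>x0 + real i * \<omega>\<rfloor> - \<lfloor>x0 + real j * \<omega>\<rfloor>) * int Q"
      by (simp add: g_def algebra_simps)
    then have "int Q dvd (int i - int j) * h" by simp
    then have "int Q dvd int i - int j"
      using cop by (simp add: coprime_dvd_mult_left_iff coprime_commute)
    moreover have "\<bar>int i - int j\<bar> < int Q" using ij by (auto simp: S_def)
    ultimately have "int i - int j = 0" using dvd_imp_le_int[of "int i - int j" "int Q"] by linarith
    then show "i = j" by simp
  qed
  have sub: "g ` S \<subseteq> {\<lceil>Y - 1\<rceil>..\<lfloor>Y + l * real Q + 1\<rfloor>}"
  proof (intro image_subsetI)
    fix j assume j: "j \<in> S"
    define e where "e = real j * of_int h - real j * \<omega> * real Q"
    have "\<bar>e\<bar> = real j * (real Q * \<bar>\<omega> - of_int h / real Q\<bar>)"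
    proof -
      have "e = - (real j * (real Q * (\<omega> - of_int h / real Q)))"
        using Q by (simp add: e_def field_simps)
      then show ?thesis by (simp add: abs_mult)
    qed
    also have "\<dots> \<le> real Q * (real Q * (1 / (real Q)\<^sup>2))"
      using app j by (intro mult_mono) (auto simp: S_def)
    also have "\<dots> = 1" using Q by (simp add: power2_eq_square)
    finally have e: "\<bar>e\<bar> \<le> 1" .
    have "of_int (g j) = e + (frac (x0 + real j * \<omega>) - x0) * real Q"
      by (simp add: g_def e_def frac_def algebra_simps)
    moreover have "(c - x0) * real Q \<le> (frac (x0 + real j * \<omega>) - x0) * real Q"
      "(frac (x0 + real j * \<omega>) - x0) * real Q \<le> (c + l - x0) * real Q"
      using j by (auto simp: S_def intro!: mult_right_mono)
    ultimately have "Y - 1 \<le> of_int (g j)" "of_int (g j) \<le> Y + l * real Q + 1"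
      using e by (auto simp: Y_def algebra_simps abs_le_iff)
    then show "g j \<in> {\<lceil>Y - 1\<rceil>..\<lfloor>Y + l * real Q + 1\<rfloor>}"
      by (simp only: atLeastAtMost_iff ceiling_le_iff le_floor_iff)
  qed
  have "card S = card (g ` S)" using inj by (simp add: card_image)
  also have "\<dots> \<le> card {\<lceil>Y - 1\<rceil>..\<lfloor>Y + l * real Q + 1\<rfloor>}" by (intro card_mono sub) auto
  also have "\<dots> = nat (\<lfloor>Y + l * real Q + 1\<rfloor> + 1 - \<lceil>Y - 1\<rceil>)" by simp
  finally have "real (card S) \<le> real (nat (\<lfloor>Y + l * real Q + 1\<rfloor> + 1 - \<lceil>Y - 1\<rceil>))" by simp
  also have "\<dots> \<le> l * real Q + 3"
  proof -
    have "of_int (\<lfloor>Y + l * real Q + 1\<rfloor> + 1 - \<lceil>Y - 1\<rceil>) \<le> l * real Q + 3" by linarith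
    moreover have "0 \<le> l * real Q + 3" using l by simp
    ultimately show ?thesis by linarith
  qed
  finally show ?thesis by (simp add: S_def)
qed

text \<open>At most a proportion \<open>r / max \<bar>a\<bar> \<bar>b\<bar>\<close> of the well-spaced slopes \<open>w j\<close> satisfies
  \<open>\<bar>a + w j * b\<bar> \<le> r\<close>; the dyadic sum on the right majorises this quantity.\<close>

lemma transversality_dyadic:
  fixes w :: "nat \<Rightarrow> real" and a b r R C1 M :: real
  assumes M: "1 \<le> M" "\<And>j. j < Q \<Longrightarrow> \<bar>w j\<bar> \<le> M" and C1: "0 \<le> C1"
    and cnt: "\<And>x l. 0 \<le> l \<Longrightarrow> real (card {j. j < Q \<and> w j \<in> {x..x + l}}) \<le> C1 * (l + r) * real Q"
    and R: "2 \<le> R" "\<bar>a\<bar> \<le> R" "\<bar>b\<bar> \<le> R" and r: "0 < r" "r \<le> (1/2) ^ I" "(1/2) ^ Suc I < r"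
  shows "real (card {j. j < Q \<and> \<bar>a + w j * b\<bar> \<le> r})
    \<le> (\<Sum>i\<le>I. (2 + C1 * (4 * M + 1)) * real Q * (r * 2 ^ i) *
        (indicator {..R * (1/2) ^ i} \<bar>a\<bar> * indicator {..R * (1/2) ^ i} \<bar>b\<bar>))"
    (is "?card \<le> (\<Sum>i\<le>I. ?f i)")
proof -
  have f0: "0 \<le> ?f i" for i using M C1 r by simp
  have member: "?f i \<le> (\<Sum>i\<le>I. ?f i)" if "i \<le> I" for i
    using that f0 by (intro member_le_sum) auto
  define m where "m = max \<bar>a\<bar> \<bar>b\<bar>"
  show ?thesis
  proof (cases "m \<le> R * (1/2) ^ I")
    case True
    \<comment> \<open>At the smallest scale the trivial count \<open>Q\<close> suffices, because
      \<open>2 * (r * 2 ^ I) > 1\<close>.\<close>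
    have "?card \<le> real (card {..<Q})" by (intro of_nat_mono card_mono) auto
    also have "\<dots> = real Q * 1" by simp
    also have "\<dots> \<le> real Q * (2 * (r * 2 ^ I))"
      using r by (intro mult_left_mono) (auto simp: power_one_over field_simps)
    also have "\<dots> \<le> real Q * ((2 + C1 * (4 * M + 1)) * (r * 2 ^ I))"
      using C1 M r by (intro mult_left_mono mult_right_mono) auto
    also have "\<dots> = ?f I" using True by (simp add: m_def)
    also have "\<dots> \<le> (\<Sum>i\<le>I. ?f i)" by (rule member) simp
    finally show ?thesis .
  next
    case False
    have "0 < R * (1/2) ^ I" using R by (intro mult_pos_pos) auto
    then have mpos: "0 < m" using False by linarith
    have "m / R \<le> 1" using R by (simp add: m_def)
    then obtain i where i: "(1/2) ^ Suc i < m / R" "m / R \<le> (1/2) ^ i"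
      using exists_power_scale[of "1/2" "m / R"] mpos R by auto
    have mi: "m \<le> R * (1/2) ^ i" "R * (1/2) ^ Suc i < m"
      using i R by (auto simp: field_simps)
    have "i \<le> I"
    proof (rule ccontr)
      assume "\<not> i \<le> I"
      then have "(1/2::real) ^ i \<le> (1/2) ^ I" by (intro power_decreasing) auto
      then have "R * (1/2) ^ i \<le> R * (1/2) ^ I" using R by (intro mult_left_mono) auto
      then show False using False mi by linarith
    qed
    have "?card \<le> ?f i"
    proof (cases "{j. j < Q \<and> \<bar>a + w j * b\<bar> \<le> r} = {}")
      case True
      show ?thesis unfolding True using f0[of i] by (simp add: indicator_def)
    next
      case ne: False
      then obtain j where j: "j < Q" "\<bar>a + w j * b\<bar> \<le> r" by auto
      have rm: "r * 2 < m"
      proof -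
        have "r * R \<le> R * (1/2) ^ I" using r R by (simp add: mult.commute mult_left_mono)
        also have "\<dots> < m" using False by simp
        finally have "r * R < m" .
        moreover have "r * 2 \<le> r * R" using r R by simp
        ultimately show ?thesis by linarith
      qed
      have wb: "\<bar>w j * b\<bar> \<le> M * \<bar>b\<bar>" unfolding abs_mult using M j by (intro mult_right_mono) auto
      \<comment> \<open>If \<open>m = \<bar>a\<bar>\<close>, then
        \<open>\<bar>a + w j * b\<bar> \<le> r < m / 2\<close> forces
        \<open>M * \<bar>b\<bar> > m / 2\<close>. So \<open>\<bar>b\<bar>\<close> is comparable with
        \<open>m\<close>, and the admissible slopes fill an interval of length
        \<open>2 * r / \<bar>b\<bar>\<close>.\<close>
      have "m \<le> 2 * M * \<bar>b\<bar>"
      proof (cases "m = \<bar>b\<bar>")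
        case True
        have "1 * \<bar>b\<bar> \<le> (2 * M) * \<bar>b\<bar>" using M by (intro mult_right_mono) auto
        then show ?thesis using True by simp
      next
        case False
        then have "m = \<bar>a\<bar>" by (auto simp: m_def)
        then show ?thesis using j(2) wb rm by linarith
      qed
      then have mb: "m \<le> 2 * M * \<bar>b\<bar>" .
      then have bpos: "\<bar>b\<bar> > 0" using mpos by (cases "b = 0") auto
      have bm: "1 / \<bar>b\<bar> \<le> 2 * M / m" using mb bpos mpos by (simp add: field_simps)
      have "\<exists>x. {j. j < Q \<and> \<bar>a + w j * b\<bar> \<le> r} \<subseteq> {j. j < Q \<and> w j \<in> {x..x + 2 * r / \<bar>b\<bar>}}"
      proof (intro exI[of _ "- a / b - r / \<bar>b\<bar>"] subsetI)
        fix j assume "j \<in> {j. j < Q \<and> \<bar>a + w j * b\<bar> \<le> r}"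
        then have j: "j < Q" "\<bar>a + w j * b\<bar> \<le> r" by auto
        have "\<bar>w j - (- a / b)\<bar> * \<bar>b\<bar> = \<bar>a + w j * b\<bar>"
          using bpos by (simp add: algebra_simps flip: abs_mult)
        then have "\<bar>w j - (- a / b)\<bar> \<le> r / \<bar>b\<bar>" using j bpos by (simp add: field_simps)
        then have "w j - (- a / b) \<le> r / \<bar>b\<bar>" "- a / b - w j \<le> r / \<bar>b\<bar>" by linarith+
        then show "j \<in> {j. j < Q \<and> w j \<in> {- a / b - r / \<bar>b\<bar>..- a / b - r / \<bar>b\<bar> + 2 * r / \<bar>b\<bar>}}"
          using j by (simp add: add_divide_distrib[symmetric] field_simps)
      qed
      then obtain x where "{j. j < Q \<and> \<bar>a + w j * b\<bar> \<le> r} \<subseteq> {j. j < Q \<and> w j \<in> {x..x + 2 * r / \<bar>b\<bar>}}" by blast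
      then have "?card \<le> real (card {j. j < Q \<and> w j \<in> {x..x + 2 * r / \<bar>b\<bar>}})"
        by (intro of_nat_mono card_mono) auto
      also have "\<dots> \<le> C1 * (2 * r / \<bar>b\<bar> + r) * real Q" using r bpos by (intro cnt) auto
      also have "\<dots> \<le> C1 * ((4 * M + 1) * (r * 2 ^ i)) * real Q"
      proof (intro mult_right_mono mult_left_mono)
        have "1 / m \<le> 2 ^ Suc i / R"
          using mi(2) mpos R by (simp add: field_simps power_one_over)
        also have "\<dots> \<le> 2 ^ Suc i / 2" using R by (intro divide_left_mono) auto
        finally have m1: "1 / m \<le> 2 ^ i" by simp
        have "2 * r / \<bar>b\<bar> = 2 * r * (1 / \<bar>b\<bar>)" by simp
        also have "\<dots> \<le> 2 * r * (2 * M / m)" using r by (intro mult_left_mono bm) auto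
        also have "\<dots> = 4 * M * r * (1 / m)" by simp
        also have "\<dots> \<le> 4 * M * r * 2 ^ i" using M r m1 by (intro mult_left_mono) auto
        finally have "2 * r / \<bar>b\<bar> \<le> 4 * M * (r * 2 ^ i)" by simp
        moreover have "r * 1 \<le> r * 2 ^ i" using r by (intro mult_left_mono) auto
        ultimately show "2 * r / \<bar>b\<bar> + r \<le> (4 * M + 1) * (r * 2 ^ i)" by (simp add: algebra_simps)
      qed (use C1 in auto)
      also have "\<dots> \<le> (2 + C1 * (4 * M + 1)) * real Q * (r * 2 ^ i)"
        using r by (simp add: algebra_simps)
      also have "\<dots> = ?f i" using mi(1) by (simp add: m_def)
      finally show ?thesis .
    qed
    also have "\<dots> \<le> (\<Sum>i\<le>I. ?f i)" using \<open>i \<le> I\<close> by (rule member)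
    finally show ?thesis .
  qed
qed

text \<open>Transversality bounds the slope average of the ball masses by a dyadic sum of products
  of ball masses of \<open>A\<close> and \<open>B\<close>. Integrating its power
  \<open>q - 1\<close> gives products of moments, of order \<open>\<rho> i powr (b1 + b2)\<close> at
  scale \<open>i\<close>, and the assumption on \<open>b1 + b2\<close> makes the sum over scales
  converge.\<close>

lemma sum_ball_moment_lcomb_le:
  assumes A: "real_distribution A" and B: "real_distribution B"
    and bdA: "AE x in A. \<bar>x\<bar> \<le> R" and bdB: "AE x in B. \<bar>x\<bar> \<le> R" and R: "1 \<le> R"
    and q: "1 < q" "q \<le> 2" and M: "1 \<le> M" and C1: "0 \<le> C1"
    and CA: "0 \<le> CA" "\<And>r. 0 < r \<Longrightarrow> ball_moment q A r \<le> ennreal (CA * r powr b1)"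
    and CB: "0 \<le> CB" "\<And>r. 0 < r \<Longrightarrow> ball_moment q B r \<le> ennreal (CB * r powr b2)"
    and b12: "q - 1 < b1 + b2"
  obtains C where "0 < C" "\<And>Q w r. 0 < Q \<Longrightarrow> (\<And>j. j < Q \<Longrightarrow> \<bar>w j\<bar> \<le> M) \<Longrightarrow> 0 < r \<Longrightarrow> r \<le> 1 \<Longrightarrow>
    (\<And>x l. 0 \<le> l \<Longrightarrow> real (card {j. j < Q \<and> w j \<in> {x..x + l}}) \<le> C1 * (l + r) * real Q) \<Longrightarrow>
    (\<Sum>j<Q. ball_moment q (lcomb (w j) A B) r) \<le> ennreal (C * r powr (q - 1) * real Q)"
proof -
  interpret A: real_distribution A by fact
  interpret B: real_distribution B by fact
  note [measurable] = borel_measurable_measure_cball[OF A.finite_borel_measure_M]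
    borel_measurable_measure_cball[OF B.finite_borel_measure_M]
  have Af: "finite_borel_measure A" and Bf: "finite_borel_measure B"
    by (rule A.finite_borel_measure_M B.finite_borel_measure_M)+
  define C2 where "C2 = 2 + C1 * (4 * M + 1)"
  have C2: "C2 > 0" using C1 M by (auto simp: C2_def intro!: add_pos_nonneg)
  \<comment> \<open>The ratio of the contributions of consecutive dyadic scales; \<open>b12\<close>
    puts it below 1.\<close>
  define g where "g = 2 powr (q - 1 - (b1 + b2))"
  have g: "0 < g" "g < 1" using b12 by (auto simp: g_def powr_less_one)
  define C where "C = C2 powr (q - 1) * (CA * CB * (2 * R) powr (b1 + b2)) / (1 - g) + 1"
  show ?thesis
  proof (rule that[of C])
    show "0 < C" using g CA CB by (auto simp: C_def intro!: add_nonneg_pos)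
    fix Q :: nat and w :: "nat \<Rightarrow> real" and r :: real
    assume Q: "0 < Q" and w: "\<And>j. j < Q \<Longrightarrow> \<bar>w j\<bar> \<le> M" and r: "0 < r" "r \<le> 1"
      and cnt: "\<And>x l. 0 \<le> l \<Longrightarrow> real (card {j. j < Q \<and> w j \<in> {x..x + l}}) \<le> C1 * (l + r) * real Q"
    obtain I where I: "(1/2) ^ Suc I < r" "r \<le> (1/2) ^ I"
      using exists_power_scale[of "1/2" r] r by auto
    define \<rho> where "\<rho> i = 2 * R * (1/2) ^ i" for i :: nat
    have \<rho>: "\<rho> i > 0" for i using R by (simp add: \<rho>_def)
    define m where "m j a b = measure (lcomb (w j) A B) (cball (a + w j * b) r)" for j a b
    have m_eq: "ennreal (m j a b) = (\<integral>\<^sup>+a'. \<integral>\<^sup>+b'. ennreal (indicator {..r} \<bar>(a - a') + w j * (b - b')\<bar>) \<partial>B \<partial>A)" for j a b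
    proof -
      interpret \<eta>: real_distribution "lcomb (w j) A B" by (intro real_distribution_lcomb A B)
      have "ennreal (m j a b) = (\<integral>\<^sup>+z. indicator (cball (a + w j * b) r) z \<partial>lcomb (w j) A B)"
        by (simp add: m_def \<eta>.emeasure_eq_measure)
      also have "\<dots> = (\<integral>\<^sup>+a'. \<integral>\<^sup>+b'. indicator (cball (a + w j * b) r) (a' + w j * b') \<partial>B \<partial>A)"
        by (rule nn_integral_lcomb[OF Af Bf]) measurable
      also have "\<dots> = (\<integral>\<^sup>+a'. \<integral>\<^sup>+b'. ennreal (indicator {..r} \<bar>(a - a') + w j * (b - b')\<bar>) \<partial>B \<partial>A)"
        by (intro nn_integral_cong) (auto simp: indicator_def dist_real_def algebra_simps)
      finally show ?thesis .
    qed
    have m0: "0 \<le> m j a b" for j a b by (simp add: m_def)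
    \<comment> \<open>\<open>r * 2 ^ i\<close> stands for the proportion of slopes that bring two
      pairs of points at distance about \<open>\<rho> i\<close> within \<open>r\<close> of each
      other.\<close>
    define S where "S a b = (\<Sum>i\<le>I. (r * 2 ^ i) * (measure A (cball a (\<rho> i)) * measure B (cball b (\<rho> i))))" for a b
    have S0: "0 \<le> S a b" for a b using r by (auto simp: S_def intro!: sum_nonneg)
    have sum_m: "(\<Sum>j<Q. m j a b) \<le> C2 * real Q * S a b" if a: "\<bar>a\<bar> \<le> R" and b: "\<bar>b\<bar> \<le> R" for a b
    proof -
      let ?k = "\<lambda>i a' b'. ennreal (C2 * real Q * (r * 2 ^ i)) * (indicator (cball a (\<rho> i)) a' * indicator (cball b (\<rho> i)) b')"
      have "ennreal (\<Sum>j<Q. m j a b) = (\<Sum>j<Q. ennreal (m j a b))" using m0 by simp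
      also have "\<dots> = (\<integral>\<^sup>+a'. \<integral>\<^sup>+b'. (\<Sum>j<Q. ennreal (indicator {..r} \<bar>(a - a') + w j * (b - b')\<bar>)) \<partial>B \<partial>A)"
        unfolding m_eq by (simp add: nn_integral_sum del: sum_ennreal)
      also have "\<dots> \<le> (\<integral>\<^sup>+a'. \<integral>\<^sup>+b'. (\<Sum>i\<le>I. ?k i a' b') \<partial>B \<partial>A)"
      proof (rule nn_integral_mono_AE)
        show "AE a' in A. (\<integral>\<^sup>+b'. (\<Sum>j<Q. ennreal (indicator {..r} \<bar>(a - a') + w j * (b - b')\<bar>)) \<partial>B)
          \<le> (\<integral>\<^sup>+b'. (\<Sum>i\<le>I. ?k i a' b') \<partial>B)"
          using bdA
        proof eventually_elim
          case a': (elim a')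
          show ?case
          proof (rule nn_integral_mono_AE)
            show "AE b' in B. (\<Sum>j<Q. ennreal (indicator {..r} \<bar>(a - a') + w j * (b - b')\<bar>)) \<le> (\<Sum>i\<le>I. ?k i a' b')"
              using bdB
            proof eventually_elim
              case b': (elim b')
              have "(\<Sum>j<Q. indicator {..r} \<bar>(a - a') + w j * (b - b')\<bar>)
                = real (card {j. j < Q \<and> \<bar>(a - a') + w j * (b - b')\<bar> \<le> r})"
                by (simp add: indicator_def sum.If_cases Int_def of_bool_def)
              also have "\<dots> \<le> (\<Sum>i\<le>I. C2 * real Q * (r * 2 ^ i) *
                 (indicator {..2 * R * (1/2) ^ i} \<bar>a - a'\<bar> * indicator {..2 * R * (1/2) ^ i} \<bar>b - b'\<bar>))"
                unfolding C2_def
              proof (rule transversality_dyadic[OF M w C1 cnt])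
                show "\<bar>a - a'\<bar> \<le> 2 * R" "\<bar>b - b'\<bar> \<le> 2 * R" "2 \<le> 2 * R" using a a' b b' R by auto
              qed (use r I in auto)
              finally have "ennreal (\<Sum>j<Q. indicator {..r} \<bar>(a - a') + w j * (b - b')\<bar>)
                \<le> ennreal (\<Sum>i\<le>I. C2 * real Q * (r * 2 ^ i) *
                 (indicator {..2 * R * (1/2) ^ i} \<bar>a - a'\<bar> * indicator {..2 * R * (1/2) ^ i} \<bar>b - b'\<bar>))"
                by (rule ennreal_leI)
              also have "\<dots> = (\<Sum>i\<le>I. ennreal (C2 * real Q * (r * 2 ^ i) *
                 (indicator {..2 * R * (1/2) ^ i} \<bar>a - a'\<bar> * indicator {..2 * R * (1/2) ^ i} \<bar>b - b'\<bar>)))"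
                using C2 r by (intro sum_ennreal[symmetric]) auto
              also have "\<dots> = (\<Sum>i\<le>I. ?k i a' b')"
                using C2 r by (intro sum.cong refl) (auto simp: indicator_def \<rho>_def dist_real_def)
              finally show ?case by (simp add: sum_ennreal)
            qed
          qed
        qed
      qed
      also have "\<dots> = (\<Sum>i\<le>I. ennreal (C2 * real Q * (r * 2 ^ i)) * (emeasure A (cball a (\<rho> i)) * emeasure B (cball b (\<rho> i))))"
        by (simp add: nn_integral_sum nn_integral_cmult nn_integral_multc)
      also have "\<dots> = (\<Sum>i\<le>I. ennreal (C2 * real Q * ((r * 2 ^ i) * (measure A (cball a (\<rho> i)) * measure B (cball b (\<rho> i))))))"
        using C2 r by (intro sum.cong refl)
          (simp add: A.emeasure_eq_measure B.emeasure_eq_measure mult.assoc flip: ennreal_mult)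
      also have "\<dots> = ennreal (C2 * real Q * S a b)"
        using C2 r by (subst sum_ennreal) (auto simp: S_def sum_distrib_left)
      finally show ?thesis using C2 S0[of a b] by (simp add: ennreal_le_iff)
    qed
    define c where "c i = (2 ^ i) powr (q - 1)" for i :: nat
    have sum_powr: "(\<Sum>j<Q. m j a b powr (q - 1))
      \<le> real Q * (C2 * r) powr (q - 1) * (\<Sum>i\<le>I. c i * (measure A (cball a (\<rho> i)) powr (q - 1) * measure B (cball b (\<rho> i)) powr (q - 1)))"
      if a: "\<bar>a\<bar> \<le> R" and b: "\<bar>b\<bar> \<le> R" for a b
    proof -
      \<comment> \<open>Here \<open>q \<le> 2\<close> enters: the power \<open>q - 1\<close> is
        concave, so the average over slopes goes inside, and subadditive, so the dyadic sum comes
        out again.\<close>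
      have "(\<Sum>j<Q. m j a b powr (q - 1)) / card {..<Q} \<le> ((\<Sum>j<Q. m j a b) / card {..<Q}) powr (q - 1)"
        using Q q m0 by (intro mean_powr_le_powr_mean) auto
      also have "\<dots> \<le> (C2 * S a b) powr (q - 1)"
        using sum_m[OF a b] Q q m0 by (intro powr_mono2) (auto simp: field_simps sum_nonneg)
      also have "C2 * S a b = (\<Sum>i\<le>I. C2 * r * (2 ^ i * (measure A (cball a (\<rho> i)) * measure B (cball b (\<rho> i)))))"
        by (simp add: S_def sum_distrib_left mult.assoc)
      also have "\<dots> powr (q - 1) \<le> (\<Sum>i\<le>I. (C2 * r * (2 ^ i * (measure A (cball a (\<rho> i)) * measure B (cball b (\<rho> i))))) powr (q - 1))"
        using q C2 r by (intro powr_sum_subadditive) auto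
      also have "\<dots> = (C2 * r) powr (q - 1) * (\<Sum>i\<le>I. c i * (measure A (cball a (\<rho> i)) powr (q - 1) * measure B (cball b (\<rho> i)) powr (q - 1)))"
        using C2 r by (simp add: sum_distrib_left powr_mult c_def)
      finally show ?thesis using Q by (simp add: field_simps)
    qed
    have bm: "ball_moment q (lcomb (w j) A B) r = (\<integral>\<^sup>+a. \<integral>\<^sup>+b. ennreal (m j a b powr (q - 1)) \<partial>B \<partial>A)" for j
    proof -
      have "finite_borel_measure (lcomb (w j) A B)" by (intro finite_borel_measure_lcomb Af Bf)
      note [measurable] = borel_measurable_measure_cball[OF this]
      show ?thesis unfolding ball_moment_def m_def by (rule nn_integral_lcomb[OF Af Bf]) measurable
    qed
    have m_meas [measurable]: "(\<lambda>p. m j (fst p) (snd p)) \<in> borel_measurable (borel \<Otimes>\<^sub>M borel)" for j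
    proof -
      have "finite_borel_measure (lcomb (w j) A B)" by (intro finite_borel_measure_lcomb Af Bf)
      from borel_measurable_measure_cball[OF this, of r] show ?thesis
        unfolding m_def by (rule measurable_compose[rotated]) measurable
    qed
    have m_meas2 [measurable]: "m j a \<in> borel_measurable borel" for j a
    proof -
      have "finite_borel_measure (lcomb (w j) A B)" by (intro finite_borel_measure_lcomb Af Bf)
      from borel_measurable_measure_cball[OF this, of r] show ?thesis
        unfolding m_def by (rule measurable_compose[rotated]) measurable
    qed
    have [measurable]: "(\<lambda>a. \<integral>\<^sup>+b. ennreal (m j a b powr (q - 1)) \<partial>B) \<in> borel_measurable borel" for j
      by (rule B.borel_measurable_nn_integral) (simp add: measurable_split_conv)
    define K where "K = real Q * (C2 * r) powr (q - 1)"
    have K0: "0 \<le> K" by (simp add: K_def)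
    have "(\<Sum>j<Q. ball_moment q (lcomb (w j) A B) r) = (\<integral>\<^sup>+a. \<integral>\<^sup>+b. (\<Sum>j<Q. ennreal (m j a b powr (q - 1))) \<partial>B \<partial>A)"
      unfolding bm by (simp add: nn_integral_sum del: sum_ennreal)
    also have "\<dots> \<le> (\<integral>\<^sup>+a. \<integral>\<^sup>+b. (\<Sum>i\<le>I. ennreal (K * c i) * (ennreal (measure A (cball a (\<rho> i)) powr (q - 1)) * ennreal (measure B (cball b (\<rho> i)) powr (q - 1)))) \<partial>B \<partial>A)"
    proof (rule nn_integral_mono_AE)
      show "AE a in A. (\<integral>\<^sup>+b. (\<Sum>j<Q. ennreal (m j a b powr (q - 1))) \<partial>B)
        \<le> (\<integral>\<^sup>+b. (\<Sum>i\<le>I. ennreal (K * c i) * (ennreal (measure A (cball a (\<rho> i)) powr (q - 1)) * ennreal (measure B (cball b (\<rho> i)) powr (q - 1)))) \<partial>B)"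
        using bdA
      proof eventually_elim
        case a: (elim a)
        show ?case
        proof (rule nn_integral_mono_AE)
          show "AE b in B. (\<Sum>j<Q. ennreal (m j a b powr (q - 1)))
            \<le> (\<Sum>i\<le>I. ennreal (K * c i) * (ennreal (measure A (cball a (\<rho> i)) powr (q - 1)) * ennreal (measure B (cball b (\<rho> i)) powr (q - 1))))"
            using bdB
          proof eventually_elim
            case b: (elim b)
            have "(\<Sum>j<Q. ennreal (m j a b powr (q - 1))) = ennreal (\<Sum>j<Q. m j a b powr (q - 1))" by simp
            also have "\<dots> \<le> ennreal (K * (\<Sum>i\<le>I. c i * (measure A (cball a (\<rho> i)) powr (q - 1) * measure B (cball b (\<rho> i)) powr (q - 1))))"
              unfolding K_def using sum_powr[OF a b] by (rule ennreal_leI)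
            also have "\<dots> = (\<Sum>i\<le>I. ennreal (K * c i * (measure A (cball a (\<rho> i)) powr (q - 1) * measure B (cball b (\<rho> i)) powr (q - 1))))"
              using K0 by (subst sum_ennreal) (auto simp: sum_distrib_left mult.assoc c_def)
            also have "\<dots> = (\<Sum>i\<le>I. ennreal (K * c i) * (ennreal (measure A (cball a (\<rho> i)) powr (q - 1)) * ennreal (measure B (cball b (\<rho> i)) powr (q - 1))))"
              using K0 by (intro sum.cong refl) (simp add: c_def flip: ennreal_mult)
            finally show ?case .
          qed
        qed
      qed
    qed
    also have "\<dots> = (\<Sum>i\<le>I. ennreal (K * c i) * (ball_moment q A (\<rho> i) * ball_moment q B (\<rho> i)))"
      unfolding ball_moment_def by (simp add: nn_integral_sum nn_integral_cmult nn_integral_multc)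
    also have "\<dots> \<le> (\<Sum>i\<le>I. ennreal (K * c i) * (ennreal (CA * \<rho> i powr b1) * ennreal (CB * \<rho> i powr b2)))"
      by (intro sum_mono mult_left_mono mult_mono CA CB \<rho>) auto
    also have "\<dots> = (\<Sum>i\<le>I. ennreal (K * (CA * CB * (2 * R) powr (b1 + b2)) * g ^ i))"
    proof (intro sum.cong refl)
      fix i
      have "c i * (\<rho> i powr b1 * \<rho> i powr b2) = (2 * R) powr (b1 + b2) * g ^ i"
      proof -
        have "\<rho> i powr b1 * \<rho> i powr b2 = (2 * R) powr (b1 + b2) * ((1/2) ^ i) powr (b1 + b2)"
          unfolding powr_add[symmetric] \<rho>_def using R by (subst powr_mult) auto
        moreover have "c i * ((1/2) ^ i) powr (b1 + b2) = g ^ i"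
          by (simp add: c_def g_def powr_powr powr_diff powr_divide power_one_over
              power_divide powr_powr mult_ac flip: powr_realpow powr_minus)
        ultimately show ?thesis by (simp add: mult_ac)
      qed
      then have eq: "K * c i * ((CA * \<rho> i powr b1) * (CB * \<rho> i powr b2)) = K * (CA * CB * (2 * R) powr (b1 + b2)) * g ^ i"
        by (simp add: mult_ac)
      have "0 \<le> K * c i" using K0 by (simp add: c_def)
      then show "ennreal (K * c i) * (ennreal (CA * \<rho> i powr b1) * ennreal (CB * \<rho> i powr b2))
        = ennreal (K * (CA * CB * (2 * R) powr (b1 + b2)) * g ^ i)"
        unfolding eq[symmetric] using CA(1) CB(1) by (subst (1 2) ennreal_mult) (auto simp flip: ennreal_mult)
    qed
    also have "\<dots> = ennreal (K * (CA * CB * (2 * R) powr (b1 + b2)) * (\<Sum>i\<le>I. g ^ i))"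
      using K0 CA CB g by (subst sum_ennreal) (auto simp: sum_distrib_left)
    also have "\<dots> \<le> ennreal (C * r powr (q - 1) * real Q)"
    proof (rule ennreal_leI)
      have "(\<Sum>i\<le>I. g ^ i) \<le> 1 / (1 - g)"
        using g by (simp add: sum_gp0 divide_right_mono)
      then have "K * (CA * CB * (2 * R) powr (b1 + b2)) * (\<Sum>i\<le>I. g ^ i)
        \<le> K * (CA * CB * (2 * R) powr (b1 + b2)) * (1 / (1 - g))"
        using K0 CA CB by (intro mult_left_mono) auto
      also have "\<dots> = (C - 1) * (r powr (q - 1) * real Q)"
        using C2 r by (simp add: K_def C_def powr_mult)
      also have "\<dots> \<le> C * (r powr (q - 1) * real Q)" by (intro mult_right_mono) auto
      finally show "K * (CA * CB * (2 * R) powr (b1 + b2)) * (\<Sum>i\<le>I. g ^ i) \<le> C * r powr (q - 1) * real Q"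
        by (simp add: mult.assoc)
    qed
    finally show "(\<Sum>j<Q. ball_moment q (lcomb (w j) A B) r) \<le> ennreal (C * r powr (q - 1) * real Q)" .
  qed
qed

text \<open>\<open>\<theta>\<close> is the law of the first \<open>n\<close> terms of the series
  with law \<open>A\<close>; what remains is \<open>A\<close> scaled by
  \<open>\<alpha> ^ n\<close>.\<close>

lemma exists_level_law:
  assumes D: "real_distribution D" and A: "real_distribution A" and eq: "A = lcomb \<alpha> D A"
  shows "\<exists>\<theta>. real_distribution \<theta> \<and> (\<forall>t. char A t = char \<theta> t * char A (\<alpha> ^ n * t))"
proof (induction n)
  case 0
  have "real_distribution (digit_law (return_pmf 0))" by (rule real_distribution_digit_law)
  moreover have "char (digit_law (return_pmf 0)) t = 1" for t
  proof -
    interpret D0: real_distribution "digit_law (return_pmf 0)" by fact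
    have "AE x in digit_law (return_pmf 0). iexp (t * x) = 1" by (intro AE_digit_law) auto
    then have "char (digit_law (return_pmf 0)) t = (\<integral>x. 1 \<partial>digit_law (return_pmf 0))"
      unfolding char_def by (intro integral_cong_AE) auto
    then show ?thesis using D0.prob_space by simp
  qed
  ultimately show ?case by (intro exI[of _ "digit_law (return_pmf 0)"]) auto
next
  case (Suc n)
  then obtain \<theta> where \<theta>: "real_distribution \<theta>" "\<And>t. char A t = char \<theta> t * char A (\<alpha> ^ n * t)" by blast
  have "char A t = char (lcomb \<alpha> D \<theta>) t * char A (\<alpha> ^ Suc n * t)" for t
  proof -
    have "char A t = char (lcomb \<alpha> D A) t" using eq by simp
    also have "\<dots> = char D t * char A (\<alpha> * t)"
      by (intro char_lcomb real_distribution_imp_finite_borel D A)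
    also have "char A (\<alpha> * t) = char \<theta> (\<alpha> * t) * char A (\<alpha> ^ Suc n * t)"
      using \<theta>(2)[of "\<alpha> * t"] by (simp add: mult_ac)
    also have "char D t * (char \<theta> (\<alpha> * t) * char A (\<alpha> ^ Suc n * t)) = char (lcomb \<alpha> D \<theta>) t * char A (\<alpha> ^ Suc n * t)"
      by (subst char_lcomb[OF real_distribution_imp_finite_borel real_distribution_imp_finite_borel]) (auto intro: D \<theta>)
    finally show ?thesis .
  qed
  moreover have "real_distribution (lcomb \<alpha> D \<theta>)" by (intro real_distribution_lcomb D \<theta>(1))
  ultimately show ?case by blast
qed

text \<open>The exponents \<open>ln w / ln (1 / \<beta>)\<close> of the slopes met along the renormalisation form an orbit of
  an irrational rotation. Dirichlet's theorem makes a long piece of it well spaced, so the average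
  of the moments along the orbit is controlled by \<open>sum_ball_moment_lcomb_le\<close>, and the inequality
  between the arithmetic and the geometric mean turns this into a bound for the product.\<close>

theorem ball_Lq_convolution_bound:
  assumes \<alpha>: "0 < \<alpha>" "\<alpha> < 1" and \<beta>: "0 < \<beta>" "\<beta> < 1" and irr: "ln \<alpha> / ln \<beta> \<notin> \<rat>"
    and A: "real_distribution A" and DA: "real_distribution DA" and A_eq: "A = lcomb \<alpha> DA A"
    and B: "real_distribution B" and DB: "real_distribution DB" and B_eq: "B = lcomb \<beta> DB B"
    and bdA: "AE x in A. \<bar>x\<bar> \<le> R" and bdB: "AE x in B. \<bar>x\<bar> \<le> R" and R: "1 \<le> R"
    and q: "1 < q" "q \<le> 2"
    and CA: "0 \<le> CA" "\<And>r. 0 < r \<Longrightarrow> ball_moment q A r \<le> ennreal (CA * r powr b1)"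
    and CB: "0 \<le> CB" "\<And>r. 0 < r \<Longrightarrow> ball_moment q B r \<le> ennreal (CB * r powr b2)"
    and b12: "q - 1 < b1 + b2" and \<delta>: "0 < \<delta>" "\<delta> < q"
  shows "\<exists>C>0. \<forall>r. 0 < r \<longrightarrow> r \<le> 1 \<longrightarrow> ball_Lq q (lcomb 1 A B) r \<le> ennreal (C * r powr (q - \<delta>))"
proof -
  have Af: "finite_borel_measure A" and Bf: "finite_borel_measure B"
    by (intro real_distribution_imp_finite_borel A B)+
  define \<gamma> where "\<gamma> = ln \<alpha> / ln \<beta>"
  have \<gamma>0: "\<gamma> > 0" using \<alpha> \<beta> by (simp add: \<gamma>_def zero_less_divide_iff)
  \<comment> \<open>Slopes modulo powers of \<open>\<beta>\<close>, parametrised by the circle, with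
    values between 1 and \<open>1 / \<beta>\<close>. Bounded slopes keep the supports of all sums in
    one fixed ball.\<close>
  define W where "W x = \<beta> powr (- frac x)" for x
  define L where "L = ln (1 / \<beta>)"
  have L: "L > 0" using \<beta> by (simp add: L_def)
  define M where "M = 1 / \<beta>"
  have M: "1 \<le> M" using \<beta> by (simp add: M_def)
  have W1: "1 \<le> W x" "W x \<le> M" for x
  proof -
    have "\<beta> powr 0 \<le> \<beta> powr (- frac x)" using \<beta> frac_ge_0[of x] by (intro powr_mono') auto
    then show "1 \<le> W x" using \<beta> by (simp add: W_def)
    have "\<beta> powr (- frac x) \<le> \<beta> powr (- 1)" using \<beta> frac_lt_1[of x] by (intro powr_mono') auto
    then show "W x \<le> M" using \<beta> by (simp add: W_def M_def powr_minus divide_inverse)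
  qed
  have absW: "\<bar>W x\<bar> \<le> M" for x using W1[of x] by auto
  have \<eta>: "real_distribution (lcomb w A B)" for w by (intro real_distribution_lcomb A B)
  have bd\<eta>: "AE z in lcomb (W x) A B. \<bar>z\<bar> \<le> R + M * R" for x
  proof -
    have "AE z in lcomb (W x) A B. \<bar>z\<bar> \<le> R + \<bar>W x\<bar> * R" by (intro AE_bounded_lcomb A B bdA bdB)
    then show ?thesis
    proof eventually_elim
      case (elim z)
      have "\<bar>W x\<bar> * R \<le> M * R" using W1[of x] R by (intro mult_right_mono) auto
      then show ?case using elim by linarith
    qed
  qed
  have RM: "0 \<le> R + M * R" using R M by simp
  obtain C0 where C0: "1 \<le> C0" and sub: "\<And>\<theta> \<kappa> s r. real_distribution \<theta> \<Longrightarrow> real_distribution \<kappa> \<Longrightarrow> 0 < s \<Longrightarrow>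
    AE z in \<kappa>. \<bar>z\<bar> \<le> R + M * R \<Longrightarrow> 0 < r \<Longrightarrow> r \<le> 1 \<Longrightarrow>
    ball_Lq q (lcomb s \<theta> \<kappa>) (s * r) \<le> ennreal C0 * ball_Lq q (lcomb s \<theta> \<kappa>) s * ball_Lq q \<kappa> r"
    using ball_Lq_submultiplicative[OF q(1) RM] by blast
  define e where "e x r = enn2real (ball_Lq q (lcomb (W x) A B) r)" for x r
  have e0: "0 \<le> e x r" for x r by (simp add: e_def)
  have E_le: "ball_Lq q (lcomb (W x) A B) r \<le> ennreal (2 * r)" if "0 \<le> r" for x r
    using that by (intro ball_Lq_le \<eta> q)
  have E: "ball_Lq q (lcomb (W x) A B) r = ennreal (e x r)" if "0 \<le> r" for x r
    using E_le[OF that, of x] unfolding e_def by (subst ennreal_enn2real) (auto simp: top.not_eq_extremum intro: le_less_trans)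
  have e_le: "e x r \<le> 2 * r" if "0 \<le> r" for x r
    using E_le[OF that, of x] E[OF that, of x] that by (simp add: ennreal_le_iff)
  \<comment> \<open>Removing \<open>n\<close> levels of \<open>A\<close> and \<open>l\<close> levels
    of \<open>B\<close> leaves a sum of the same kind at scale \<open>\<alpha> ^ n\<close>, with
    slope multiplied by \<open>\<beta> ^ l / \<alpha> ^ n\<close>. With \<open>l\<close> the number
    of full turns, this is the value of \<open>W\<close> at the point moved by
    \<open>n * \<gamma>\<close>.\<close>
  have rec: "e x (\<alpha> ^ n * r) \<le> C0 * e x (\<alpha> ^ n) * e (x + real n * \<gamma>) r" if r: "0 < r" "r \<le> 1" for x n r
  proof -
    define l where "l = nat \<lfloor>frac x + real n * \<gamma>\<rfloor>"
    have l: "real l = of_int \<lfloor>frac x + real n * \<gamma>\<rfloor>"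
      using \<gamma>0 frac_ge_0[of x] by (simp add: l_def)
    have "x + real n * \<gamma> = (frac x + real n * \<gamma>) + of_int \<lfloor>x\<rfloor>" by (simp add: frac_def)
    then have "\<lfloor>x + real n * \<gamma>\<rfloor> = \<lfloor>frac x + real n * \<gamma>\<rfloor> + \<lfloor>x\<rfloor>" by (simp only: floor_add_int)
    then have fr: "frac (x + real n * \<gamma>) = frac x + real n * \<gamma> - real l"
      unfolding l by (simp add: frac_def)
    have "\<beta> powr (real n * \<gamma>) = \<alpha> ^ n"
      using \<alpha> \<beta> by (simp add: \<gamma>_def powr_def ln_realpow[symmetric] exp_of_nat_mult)
    moreover have "W (x + real n * \<gamma>) = \<beta> powr (- frac x) * \<beta> powr real l / \<beta> powr (real n * \<gamma>)"
      unfolding W_def fr by (simp add: powr_diff[symmetric] powr_add[symmetric] algebra_simps)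
    ultimately have W': "W (x + real n * \<gamma>) = W x * \<beta> ^ l / \<alpha> ^ n"
      using \<beta> by (simp add: W_def powr_realpow)
    obtain \<theta>A where \<theta>A: "real_distribution \<theta>A" "\<And>t. char A t = char \<theta>A t * char A (\<alpha> ^ n * t)"
      using exists_level_law[OF DA A A_eq] by blast
    obtain \<theta>B where \<theta>B: "real_distribution \<theta>B" "\<And>t. char B t = char \<theta>B t * char B (\<beta> ^ l * t)"
      using exists_level_law[OF DB B B_eq] by blast
    define \<theta> where "\<theta> = lcomb (W x) \<theta>A \<theta>B"
    have \<theta>: "real_distribution \<theta>" unfolding \<theta>_def by (intro real_distribution_lcomb \<theta>A \<theta>B)
    note fin = real_distribution_imp_finite_borel
    have split: "lcomb (W x) A B = lcomb (\<alpha> ^ n) \<theta> (lcomb (W (x + real n * \<gamma>)) A B)"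
    proof (rule Levy_uniqueness[OF \<eta> real_distribution_lcomb[OF \<theta> \<eta>]], rule ext)
      fix t
      have "char (lcomb (W x) A B) t = char A t * char B (W x * t)" by (rule char_lcomb[OF Af Bf])
      also have "\<dots> = char \<theta>A t * char A (\<alpha> ^ n * t) * (char \<theta>B (W x * t) * char B (\<beta> ^ l * (W x * t)))"
        by (subst \<theta>A(2), subst \<theta>B(2)) simp
      also have "\<beta> ^ l * (W x * t) = W (x + real n * \<gamma>) * (\<alpha> ^ n * t)"
        unfolding W' using \<alpha> by simp
      also have "char \<theta>A t * char A (\<alpha> ^ n * t) * (char \<theta>B (W x * t) * char B (W (x + real n * \<gamma>) * (\<alpha> ^ n * t)))
        = char \<theta> t * char (lcomb (W (x + real n * \<gamma>)) A B) (\<alpha> ^ n * t)"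
        unfolding \<theta>_def char_lcomb[OF fin[OF \<theta>A(1)] fin[OF \<theta>B(1)]] char_lcomb[OF Af Bf] by simp
      also have "\<dots> = char (lcomb (\<alpha> ^ n) \<theta> (lcomb (W (x + real n * \<gamma>)) A B)) t"
        by (rule char_lcomb[OF fin[OF \<theta>] fin[OF \<eta>], symmetric])
      finally show "char (lcomb (W x) A B) t = char (lcomb (\<alpha> ^ n) \<theta> (lcomb (W (x + real n * \<gamma>)) A B)) t" .
    qed
    have "ball_Lq q (lcomb (W x) A B) (\<alpha> ^ n * r)
      \<le> ennreal C0 * ball_Lq q (lcomb (W x) A B) (\<alpha> ^ n) * ball_Lq q (lcomb (W (x + real n * \<gamma>)) A B) r"
      using sub[OF \<theta> \<eta> _ bd\<eta> r, of "\<alpha> ^ n" "x + real n * \<gamma>"] \<alpha> unfolding split[symmetric] by simp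
    then show ?thesis
      using \<alpha> r C0 e0 by (simp add: E ennreal_le_iff mult_nonneg_nonneg flip: ennreal_mult)
  qed
  have rec_prod: "e x ((\<alpha> ^ n) ^ k) \<le> C0 ^ k * (\<Prod>j<k. e (x + real j * (real n * \<gamma>)) (\<alpha> ^ n)) * 2" for x n k
  proof (induction k arbitrary: x)
    case 0
    then show ?case using e_le[of 1 x] by simp
  next
    case (Suc k)
    have s: "0 < (\<alpha> ^ n) ^ k" "(\<alpha> ^ n) ^ k \<le> 1" using \<alpha> by (auto intro!: power_le_one)
    have "e x ((\<alpha> ^ n) ^ Suc k) \<le> C0 * e x (\<alpha> ^ n) * e (x + real n * \<gamma>) ((\<alpha> ^ n) ^ k)"
      using rec[OF s, of x n] by simp
    also have "\<dots> \<le> C0 * e x (\<alpha> ^ n) * (C0 ^ k * (\<Prod>j<k. e (x + real n * \<gamma> + real j * (real n * \<gamma>)) (\<alpha> ^ n)) * 2)"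
      using C0 e0 by (intro mult_left_mono Suc.IH) auto
    also have "\<dots> = C0 ^ Suc k * (e x (\<alpha> ^ n) * (\<Prod>j<k. e (x + real (Suc j) * (real n * \<gamma>)) (\<alpha> ^ n))) * 2"
      by (simp add: algebra_simps)
    also have "e x (\<alpha> ^ n) * (\<Prod>j<k. e (x + real (Suc j) * (real n * \<gamma>)) (\<alpha> ^ n)) = (\<Prod>j<Suc k. e (x + real j * (real n * \<gamma>)) (\<alpha> ^ n))"
      by (subst prod.lessThan_Suc_shift) simp
    finally show ?case .
  qed
  \<comment> \<open>Slopes are at least 1, so passing to their logarithms in units of
    \<open>L\<close> costs at most \<open>1 / L\<close>; the 3 absorbs the additive 3 of
    \<open>card_frac_interval_le\<close> once \<open>s * Q \<ge> 1\<close>.\<close>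
  define C1 where "C1 = max 3 (1 / L)"
  have C1: "0 \<le> C1" by (simp add: C1_def)
  obtain C3 where C3: "0 < C3" and mom: "\<And>Q w r. 0 < Q \<Longrightarrow> (\<And>j. j < Q \<Longrightarrow> \<bar>w j\<bar> \<le> M) \<Longrightarrow> 0 < r \<Longrightarrow> r \<le> 1 \<Longrightarrow>
    (\<And>x l. 0 \<le> l \<Longrightarrow> real (card {j. j < Q \<and> w j \<in> {x..x + l}}) \<le> C1 * (l + r) * real Q) \<Longrightarrow>
    (\<Sum>j<Q. ball_moment q (lcomb (w j) A B) r) \<le> ennreal (C3 * r powr (q - 1) * real Q)"
    using sum_ball_moment_lcomb_le[OF A B bdA bdB R q M C1 CA CB b12] by blast
  define C4 where "C4 = 2 * 2 powr (q - 1) * C3"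
  have C4: "0 < C4" using C3 by (simp add: C4_def)
  \<comment> \<open>Collects the constants of all steps: \<open>C0 * e x S\<close> will be bounded
    by \<open>(C5 * s powr q) ^ Q\<close>, and \<open>n\<close> is chosen so that
    \<open>C5 * s powr \<delta> < 1\<close>.\<close>
  define C5 where "C5 = 2 * C0 * C0 * C4"
  have C5: "0 < C5" using C0 C4 by (simp add: C5_def)
  have "(\<lambda>n. \<alpha> ^ n) \<longlonglongrightarrow> 0" using \<alpha> by (intro LIMSEQ_realpow_zero) auto
  then have "((\<lambda>n. (\<alpha> ^ n) powr \<delta>) \<longlongrightarrow> 0 powr \<delta>) sequentially"
    using \<delta> \<alpha> by (intro tendsto_powr') auto
  then have "eventually (\<lambda>n. (\<alpha> ^ n) powr \<delta> < 1 / C5) sequentially"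
    using C5 \<delta> by (intro order_tendstoD(2)[of _ 0]) auto
  moreover have "eventually (\<lambda>n. \<alpha> ^ n < 1 / 2) sequentially"
    using \<open>(\<lambda>n. \<alpha> ^ n) \<longlonglongrightarrow> 0\<close> by (rule order_tendstoD) simp
  moreover have "eventually (\<lambda>n::nat. 0 < n) sequentially" by (rule eventually_gt_at_top)
  ultimately have "eventually (\<lambda>n. (\<alpha> ^ n) powr \<delta> < 1 / C5 \<and> \<alpha> ^ n < 1 / 2 \<and> 0 < n) sequentially"
    by eventually_elim auto
  then obtain n where n: "(\<alpha> ^ n) powr \<delta> < 1 / C5" "\<alpha> ^ n < 1 / 2" "0 < n"
    by (auto simp: eventually_sequentially)
  define s where "s = \<alpha> ^ n"
  have s: "0 < s" "s < 1 / 2" using \<alpha> n by (auto simp: s_def)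
  define \<omega> where "\<omega> = real n * \<gamma>"
  have "\<omega> \<notin> \<rat>"
  proof
    assume "\<omega> \<in> \<rat>"
    then have "\<omega> / real n \<in> \<rat>" by (intro Rats_divide) auto
    then show False using irr n(3) by (simp add: \<omega>_def \<gamma>_def)
  qed
  \<comment> \<open>Infinitely many approximations include one with denominator above
    \<open>1 / s\<close>, so that the spacing \<open>1 / Q\<close> of the orbit is below the scale
    \<open>s\<close>.\<close>
  then have "infinite (approx_set \<omega>)" using rational_iff_finite_approx_set by blast
  from infinite_approx_set[OF this, of "\<lceil>1 / s\<rceil>"] obtain h k where hk: "(h, k) \<in> approx_set \<omega>" "\<lceil>1 / s\<rceil> < k" by blast
  define Q where "Q = nat k"
  have kQ: "k = int Q" "0 < Q" "coprime h (int Q)" "\<bar>\<omega> - of_int h / real Q\<bar> < 1 / (real Q)\<^sup>2"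
    using hk by (auto simp: Q_def approx_set_def)
  have Qs: "1 \<le> s * real Q"
  proof -
    have "1 / s \<le> real_of_int k" using hk(2) by linarith
    then show ?thesis using s kQ by (simp add: field_simps)
  qed
  have avg: "(\<Sum>j<Q. e (x + real j * \<omega>) s) / real Q \<le> C4 * s powr q" for x
  proof -
    have cnt: "real (card {j. j < Q \<and> W (x + real j * \<omega>) \<in> {y..y + l}}) \<le> C1 * (l + 2 * s) * real Q"
      if l: "0 \<le> l" for y l
    proof -
      define y' where "y' = max 1 y"
      have "{j. j < Q \<and> W (x + real j * \<omega>) \<in> {y..y + l}} \<subseteq> {j. j < Q \<and> frac (x + real j * \<omega>) \<in> {ln y' / L..ln y' / L + l / L}}"
      proof (intro subsetI CollectI)
        fix j assume "j \<in> {j. j < Q \<and> W (x + real j * \<omega>) \<in> {y..y + l}}"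
        then have j: "j < Q" "W (x + real j * \<omega>) \<in> {y..y + l}" by auto
        define v where "v = W (x + real j * \<omega>)"
        have v: "y' \<le> v" "v \<le> y' + l" "1 \<le> y'" using j(2) W1[of "x + real j * \<omega>"] by (auto simp: v_def y'_def)
        have lnv: "ln v = frac (x + real j * \<omega>) * L"
          using \<beta> by (simp add: v_def W_def L_def ln_powr ln_div)
        have "ln y' \<le> ln v" using v by simp
        moreover have "ln v \<le> ln y' + l"
        proof -
          have "ln v - ln y' = ln (v / y')" using v by (subst ln_div) auto
          also have "\<dots> \<le> v / y' - 1" using v by (intro ln_le_minus_one) auto
          also have "\<dots> = (v - y') / y'" using v by (simp add: field_simps)
          also have "\<dots> \<le> (v - y') / 1" using v by (intro divide_left_mono) auto
          finally show ?thesis using v by simp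
        qed
        ultimately have "ln y' / L \<le> frac (x + real j * \<omega>)" "frac (x + real j * \<omega>) \<le> ln y' / L + l / L"
          unfolding lnv using L by (auto simp: field_simps)
        then show "j < Q \<and> frac (x + real j * \<omega>) \<in> {ln y' / L..ln y' / L + l / L}" using j by auto
      qed
      then have "real (card {j. j < Q \<and> W (x + real j * \<omega>) \<in> {y..y + l}})
        \<le> real (card {j. j < Q \<and> frac (x + real j * \<omega>) \<in> {ln y' / L..ln y' / L + l / L}})"
        by (intro of_nat_mono card_mono) auto
      also have "\<dots> \<le> l / L * real Q + 3"
        using l L by (intro card_frac_interval_le[OF kQ(3,2,4)]) auto
      also have "\<dots> \<le> C1 * l * real Q + C1 * (2 * s * real Q)"
      proof (intro add_mono)
        have "l * (1 / L) \<le> l * C1" using l by (intro mult_left_mono) (auto simp: C1_def)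
        then show "l / L * real Q \<le> C1 * l * real Q" by (intro mult_right_mono) (auto simp: mult.commute)
        have "3 * 1 \<le> C1 * (2 * s * real Q)" using Qs s by (intro mult_mono) (auto simp: C1_def)
        then show "3 \<le> C1 * (2 * s * real Q)" by simp
      qed
      finally show ?thesis by (simp add: algebra_simps)
    qed
    have "(\<Sum>j<Q. ball_moment q (lcomb (W (x + real j * \<omega>)) A B) (2 * s)) \<le> ennreal (C3 * (2 * s) powr (q - 1) * real Q)"
      using kQ s absW by (intro mom cnt) auto
    then have "ennreal (2 * s) * (\<Sum>j<Q. ball_moment q (lcomb (W (x + real j * \<omega>)) A B) (2 * s))
      \<le> ennreal (2 * s) * ennreal (C3 * (2 * s) powr (q - 1) * real Q)"
      by (rule mult_left_mono) simp
    moreover have "(\<Sum>j<Q. ennreal (e (x + real j * \<omega>) s)) \<le> ennreal (2 * s) * (\<Sum>j<Q. ball_moment q (lcomb (W (x + real j * \<omega>)) A B) (2 * s))"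
      unfolding sum_distrib_left using s by (intro sum_mono) (auto simp: E[symmetric] intro!: ball_Lq_le_ball_moment \<eta> q)
    ultimately have "(\<Sum>j<Q. ennreal (e (x + real j * \<omega>) s)) \<le> ennreal (2 * s) * ennreal (C3 * (2 * s) powr (q - 1) * real Q)"
      by (rule order.trans[rotated])
    then have "ennreal (\<Sum>j<Q. e (x + real j * \<omega>) s) \<le> ennreal (2 * s * (C3 * (2 * s) powr (q - 1) * real Q))"
      using e0 s C3 by (simp add: ennreal_mult)
    then have "(\<Sum>j<Q. e (x + real j * \<omega>) s) \<le> 2 * s * (C3 * (2 * s) powr (q - 1) * real Q)"
      using s C3 by (subst (asm) ennreal_le_iff) auto
    also have "\<dots> = C4 * s powr q * real Q"
      using s by (simp add: C4_def powr_mult powr_diff)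
    finally show ?thesis using kQ by (simp add: field_simps)
  qed
  define S where "S = s ^ Q"
  have S: "0 < S" "S < 1" using s kQ by (auto simp: S_def power_less_one_iff)
  have eS: "C0 * e x S \<le> S powr (q - \<delta>)" for x
  proof -
    have "(\<Prod>j<Q. e (x + real j * \<omega>) s) \<le> ((\<Sum>j<Q. e (x + real j * \<omega>) s) / real (card {..<Q})) ^ card {..<Q}"
      using kQ e0 by (intro prod_le_mean_power) auto
    also have "\<dots> \<le> (C4 * s powr q) ^ Q"
      using avg[of x] e0 by (simp add: power_mono sum_nonneg)
    finally have "C0 ^ Q * (\<Prod>j<Q. e (x + real j * \<omega>) s) * 2 \<le> C0 ^ Q * (C4 * s powr q) ^ Q * 2"
      using C0 by (intro mult_right_mono mult_left_mono) auto
    then have "e x S \<le> C0 ^ Q * (C4 * s powr q) ^ Q * 2"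
      using rec_prod[of x n Q] unfolding S_def s_def \<omega>_def by linarith
    then have "C0 * e x S \<le> C0 * (C0 ^ Q * (C4 * s powr q) ^ Q * 2)"
      using C0 by (intro mult_left_mono) auto
    also have "\<dots> = (2 * C0) * (C0 ^ Q * (C4 * s powr q) ^ Q)" by simp
    \<comment> \<open>The single factor \<open>2 * C0\<close> is enlarged to its \<open>Q\<close>-th
      power, so that it fits into \<open>C5\<close>.\<close>
    also have "\<dots> \<le> (2 * C0) ^ Q * (C0 ^ Q * (C4 * s powr q) ^ Q)"
      using C0 C4 kQ self_le_power[of "2 * C0" Q] by (intro mult_right_mono) auto
    also have "\<dots> = (C5 * s powr q) ^ Q" by (simp add: C5_def power_mult_distrib mult_ac)
    also have "\<dots> \<le> (s powr (q - \<delta>)) ^ Q"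
    proof (intro power_mono)
      have "C5 * s powr \<delta> \<le> 1" using n(1) C5 by (simp add: s_def field_simps)
      then have "C5 * s powr \<delta> * s powr (q - \<delta>) \<le> 1 * s powr (q - \<delta>)" by (intro mult_right_mono) auto
      then show "C5 * s powr q \<le> s powr (q - \<delta>)" by (simp add: mult.assoc flip: powr_add)
    qed (use C5 in auto)
    also have "\<dots> = S powr (q - \<delta>)" using s by (simp add: S_def powr_powr mult.commute flip: powr_realpow)
    finally show ?thesis .
  qed
  have eSi: "e x (S ^ i) \<le> 2 * (S ^ i) powr (q - \<delta>)" for x i
  proof (induction i arbitrary: x)
    case 0
    show ?case using e_le[of 1 x] by simp
  next
    case (Suc i)
    \<comment> \<open>\<open>S\<close> is itself a power of \<open>\<alpha>\<close>, so
      \<open>rec\<close> applies with \<open>n * Q\<close> levels. Since \<open>eS\<close> already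
      contains \<open>C0\<close>, iterating over powers of \<open>S\<close> accumulates no
      constants.\<close>
    have Sn: "S = \<alpha> ^ (n * Q)" by (simp add: S_def s_def power_mult)
    have Si: "0 < S ^ i" "S ^ i \<le> 1" using S by (auto intro: power_le_one)
    have "e x (S ^ Suc i) \<le> C0 * e x S * e (x + real (n * Q) * \<gamma>) (S ^ i)"
      using rec[OF Si, of x "n * Q"] by (simp add: Sn[symmetric])
    also have "\<dots> \<le> S powr (q - \<delta>) * (2 * (S ^ i) powr (q - \<delta>))"
      using e0 C0 by (intro mult_mono eS Suc.IH) auto
    also have "\<dots> = 2 * (S ^ Suc i) powr (q - \<delta>)" using S by (simp add: powr_mult)
    finally show ?case .
  qed
  define C where "C = 2 * S powr - (q - \<delta>)"
  have "ball_Lq q (lcomb 1 A B) r \<le> ennreal (C * r powr (q - \<delta>))" if r: "0 < r" "r \<le> 1" for r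
  proof -
    obtain i where i: "S ^ Suc i < r" "r \<le> S ^ i" using exists_power_scale[OF S r] by blast
    have W0: "W 0 = 1" using \<beta> by (simp add: W_def)
    have "ball_Lq q (lcomb (W 0) A B) r \<le> ball_Lq q (lcomb (W 0) A B) (S ^ i)"
      by (rule ball_Lq_mono[OF \<eta> q(1) i(2)])
    also have "\<dots> \<le> ennreal (2 * (S ^ i) powr (q - \<delta>))"
      using S by (subst E) (auto intro!: ennreal_leI eSi)
    also have "2 * (S ^ i) powr (q - \<delta>) = C * (S ^ Suc i) powr (q - \<delta>)"
      using S by (simp add: C_def powr_mult mult.assoc flip: powr_add)
    also have "ennreal \<dots> \<le> ennreal (C * r powr (q - \<delta>))"
      using i(1) S \<delta> by (intro ennreal_leI mult_left_mono powr_mono2) (auto simp: C_def)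
    finally show ?thesis by (simp add: W0)
  qed
  moreover have "0 < C" using S by (simp add: C_def)
  ultimately show ?thesis by blast
qed

section \<open>Mollification by Gaussians\<close>

text \<open>The density of \<open>\<tau>\<close> convolved with a centred Gaussian of variance
  \<open>a\<close>: mollification at length \<open>sqrt a\<close>.\<close>

definition smooth :: "real \<Rightarrow> real measure \<Rightarrow> real \<Rightarrow> real" where
  "smooth a \<tau> x = (\<integral>s. gauss a (x - s) \<partial>\<tau>)"

lemma smooth_nonneg [simp]: "0 \<le> smooth a \<tau> x"
  by (simp add: smooth_def)

context
  fixes \<tau> :: "real measure"
  assumes \<tau>: "finite_borel_measure \<tau>"
begin

interpretation \<tau>: finite_borel_measure \<tau> by (rule \<tau>)

lemma ennreal_smooth:
  assumes "0 < a"
  shows "ennreal (smooth a \<tau> x) = (\<integral>\<^sup>+s. ennreal (gauss a (x - s)) \<partial>\<tau>)"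
proof -
  have [measurable_cong]: "sets \<tau> = sets borel" by (rule \<tau>.M_is_borel)
  have "integrable \<tau> (\<lambda>s. gauss a (x - s))"
    using assms gauss_le[OF assms] by (intro \<tau>.integrable_const_bound[of _ "1 / sqrt (2 * pi * a)"]) auto
  then show ?thesis unfolding smooth_def by (intro nn_integral_eq_integral[symmetric]) auto
qed

lemma borel_measurable_smooth: "smooth a \<tau> \<in> borel_measurable borel"
proof -
  have [measurable_cong]: "sets \<tau> = sets borel" by (rule \<tau>.M_is_borel)
  show ?thesis unfolding smooth_def[abs_def] by measurable
qed

lemma nn_integral_smooth_mult_smooth:
  assumes a: "0 < a" and b: "0 < b"
  shows "(\<integral>\<^sup>+x. ennreal (smooth a \<tau> x * smooth b \<tau> x) \<partial>lborel) = (\<integral>\<^sup>+s. \<integral>\<^sup>+s'. ennreal (gauss (a + b) (s - s')) \<partial>\<tau> \<partial>\<tau>)"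
proof -
  have [measurable_cong]: "sets \<tau> = sets borel" by (rule \<tau>.M_is_borel)
  interpret P: pair_sigma_finite lborel \<tau> ..
  have "(\<integral>\<^sup>+x. ennreal (smooth a \<tau> x * smooth b \<tau> x) \<partial>lborel)
    = (\<integral>\<^sup>+x. \<integral>\<^sup>+s. \<integral>\<^sup>+s'. ennreal (gauss a (x - s) * gauss b (x - s')) \<partial>\<tau> \<partial>\<tau> \<partial>lborel)"
    by (simp add: ennreal_mult ennreal_smooth[OF a] ennreal_smooth[OF b] nn_integral_cmult nn_integral_multc)
  also have "\<dots> = (\<integral>\<^sup>+s. \<integral>\<^sup>+x. \<integral>\<^sup>+s'. ennreal (gauss a (x - s) * gauss b (x - s')) \<partial>\<tau> \<partial>lborel \<partial>\<tau>)"
    by (rule P.Fubini'[symmetric]) measurable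
  also have "\<dots> = (\<integral>\<^sup>+s. \<integral>\<^sup>+s'. \<integral>\<^sup>+x. ennreal (gauss a (x - s) * gauss b (x - s')) \<partial>lborel \<partial>\<tau> \<partial>\<tau>)"
    by (intro nn_integral_cong P.Fubini'[symmetric]) measurable
  also have "\<dots> = (\<integral>\<^sup>+s. \<integral>\<^sup>+s'. ennreal (gauss (a + b) (s - s')) \<partial>\<tau> \<partial>\<tau>)"
    using a b by (simp add: nn_integral_gauss_mult_gauss)
  finally show ?thesis .
qed

lemma nn_integral_smooth:
  assumes "0 < a"
  shows "(\<integral>\<^sup>+x. ennreal (smooth a \<tau> x) \<partial>lborel) = emeasure \<tau> UNIV"
proof -
  have [measurable_cong]: "sets \<tau> = sets borel" by (rule \<tau>.M_is_borel)
  interpret P: pair_sigma_finite lborel \<tau> ..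
  have "(\<integral>\<^sup>+x. ennreal (smooth a \<tau> x) \<partial>lborel) = (\<integral>\<^sup>+s. \<integral>\<^sup>+x. ennreal (gauss a (x - s)) \<partial>lborel \<partial>\<tau>)"
    unfolding ennreal_smooth[OF assms] by (rule P.Fubini'[symmetric]) measurable
  then show ?thesis using assms by (simp add: nn_integral_gauss_shift \<tau>.borel_UNIV)
qed

lemma smooth_le: "0 < a \<Longrightarrow> smooth a \<tau> x \<le> measure \<tau> UNIV / sqrt (2 * pi * a)"
proof -
  assume a: "0 < a"
  have [measurable_cong]: "sets \<tau> = sets borel" by (rule \<tau>.M_is_borel)
  have "smooth a \<tau> x \<le> (\<integral>s. 1 / sqrt (2 * pi * a) \<partial>\<tau>)"
    unfolding smooth_def using a gauss_le[OF a]
    by (intro integral_mono \<tau>.integrable_const_bound[of _ "1 / sqrt (2 * pi * a)"]) auto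
  then show ?thesis by (simp add: \<tau>.borel_UNIV)
qed

lemma nn_integral_char_gauss_finite:
  assumes "0 < V"
  shows "(\<integral>\<^sup>+t. ennreal ((cmod (char \<tau> t))\<^sup>2 * exp (- (V * t\<^sup>2 / 2))) \<partial>lborel) < \<infinity>"
proof -
  have "(\<integral>\<^sup>+s. \<integral>\<^sup>+s'. ennreal (gauss V (s - s')) \<partial>\<tau> \<partial>\<tau>) \<le> (\<integral>\<^sup>+s. \<integral>\<^sup>+s'. ennreal (1 / sqrt (2 * pi * V)) \<partial>\<tau> \<partial>\<tau>)"
    by (intro nn_integral_mono ennreal_leI gauss_le assms)
  also have "\<dots> < \<infinity>" by (simp add: \<tau>.emeasure_eq_measure ennreal_mult_less_top)
  finally show ?thesis
    unfolding nn_integral_char_gauss[OF \<tau> assms] by (simp add: ennreal_mult_less_top)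
qed

text \<open>On expanding the squares, each of the products on the left is a Gaussian double
  integral, which \<open>nn_integral_char_gauss\<close> identifies with the corresponding term on
  the right.\<close>

lemma nn_integral_smooth_diff_square:
  assumes a: "0 < a" and b: "0 < b"
  shows "ennreal (2 * pi) * (\<integral>\<^sup>+x. ennreal ((smooth a \<tau> x - smooth b \<tau> x)\<^sup>2) \<partial>lborel)
    = (\<integral>\<^sup>+t. ennreal ((cmod (char \<tau> t))\<^sup>2 * (exp (- (a * t\<^sup>2 / 2)) - exp (- (b * t\<^sup>2 / 2)))\<^sup>2) \<partial>lborel)"
    (is "?L = ?R")
proof -
  note [measurable] = borel_measurable_smooth \<tau>.borel_measurable_char
  define G where "G V = (\<integral>\<^sup>+t. ennreal ((cmod (char \<tau> t))\<^sup>2 * exp (- (V * t\<^sup>2 / 2))) \<partial>lborel)" for V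
  have Gfin: "G (a + b) < \<infinity>" unfolding G_def using a b by (intro nn_integral_char_gauss_finite) auto
  have S: "ennreal (2 * pi) * (\<integral>\<^sup>+x. ennreal (smooth c \<tau> x * smooth d \<tau> x) \<partial>lborel) = G (c + d)"
    if "0 < c" "0 < d" for c d
    using that unfolding G_def by (subst nn_integral_char_gauss[OF \<tau>]) (auto simp: nn_integral_smooth_mult_smooth)
  \<comment> \<open>The cross term is added to both sides because subtraction of
    \<open>ennreal\<close> values truncates; finiteness of \<open>G (a + b)\<close> allows
    cancelling it at the end.\<close>
  have "?L + 2 * G (a + b) = ennreal (2 * pi) * (\<integral>\<^sup>+x. ennreal ((smooth a \<tau> x - smooth b \<tau> x)\<^sup>2)
      + 2 * ennreal (smooth a \<tau> x * smooth b \<tau> x) \<partial>lborel)"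
    by (simp add: nn_integral_add nn_integral_cmult distrib_left S[OF a b, symmetric] mult.left_commute)
  also have "\<dots> = ennreal (2 * pi) * (\<integral>\<^sup>+x. ennreal (smooth a \<tau> x * smooth a \<tau> x) + ennreal (smooth b \<tau> x * smooth b \<tau> x) \<partial>lborel)"
  proof (intro arg_cong[of _ _ "\<lambda>y. ennreal (2 * pi) * y"] nn_integral_cong)
    fix x
    have "2 * ennreal (smooth a \<tau> x * smooth b \<tau> x) = ennreal (2 * (smooth a \<tau> x * smooth b \<tau> x))"
      by (simp add: ennreal_mult)
    moreover have "ennreal ((smooth a \<tau> x - smooth b \<tau> x)\<^sup>2) + ennreal (2 * (smooth a \<tau> x * smooth b \<tau> x))
      = ennreal ((smooth a \<tau> x - smooth b \<tau> x)\<^sup>2 + 2 * (smooth a \<tau> x * smooth b \<tau> x))"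
      by (intro ennreal_plus[symmetric]) auto
    moreover have "(smooth a \<tau> x - smooth b \<tau> x)\<^sup>2 + 2 * (smooth a \<tau> x * smooth b \<tau> x)
      = smooth a \<tau> x * smooth a \<tau> x + smooth b \<tau> x * smooth b \<tau> x"
      by (simp add: power2_eq_square algebra_simps)
    ultimately show "ennreal ((smooth a \<tau> x - smooth b \<tau> x)\<^sup>2) + 2 * ennreal (smooth a \<tau> x * smooth b \<tau> x)
      = ennreal (smooth a \<tau> x * smooth a \<tau> x) + ennreal (smooth b \<tau> x * smooth b \<tau> x)"
      by simp
  qed
  also have "\<dots> = G (a + a) + G (b + b)"
    by (simp add: nn_integral_add distrib_left S a b)
  also have "\<dots> = (\<integral>\<^sup>+t. ennreal ((cmod (char \<tau> t))\<^sup>2 * exp (- ((a + a) * t\<^sup>2 / 2)))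
      + ennreal ((cmod (char \<tau> t))\<^sup>2 * exp (- ((b + b) * t\<^sup>2 / 2))) \<partial>lborel)"
    by (simp add: G_def nn_integral_add)
  also have "\<dots> = (\<integral>\<^sup>+t. ennreal ((cmod (char \<tau> t))\<^sup>2 * (exp (- (a * t\<^sup>2 / 2)) - exp (- (b * t\<^sup>2 / 2)))\<^sup>2)
      + 2 * ennreal ((cmod (char \<tau> t))\<^sup>2 * exp (- ((a + b) * t\<^sup>2 / 2))) \<partial>lborel)"
  proof (intro nn_integral_cong)
    fix t
    let ?c = "(cmod (char \<tau> t))\<^sup>2"
    have e: "exp (- ((c + d) * t\<^sup>2 / 2)) = exp (- (c * t\<^sup>2 / 2)) * exp (- (d * t\<^sup>2 / 2))" for c d
      by (simp add: exp_add[symmetric] algebra_simps add_divide_distrib)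
    show "ennreal (?c * exp (- ((a + a) * t\<^sup>2 / 2))) + ennreal (?c * exp (- ((b + b) * t\<^sup>2 / 2)))
      = ennreal (?c * (exp (- (a * t\<^sup>2 / 2)) - exp (- (b * t\<^sup>2 / 2)))\<^sup>2)
      + 2 * ennreal (?c * exp (- ((a + b) * t\<^sup>2 / 2)))"
    proof -
      have "ennreal (?c * exp (- ((a + a) * t\<^sup>2 / 2))) + ennreal (?c * exp (- ((b + b) * t\<^sup>2 / 2)))
        = ennreal (?c * exp (- ((a + a) * t\<^sup>2 / 2)) + ?c * exp (- ((b + b) * t\<^sup>2 / 2)))"
        by (intro ennreal_plus[symmetric]) auto
      also have "?c * exp (- ((a + a) * t\<^sup>2 / 2)) + ?c * exp (- ((b + b) * t\<^sup>2 / 2))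
        = ?c * (exp (- (a * t\<^sup>2 / 2)) - exp (- (b * t\<^sup>2 / 2)))\<^sup>2 + 2 * (?c * exp (- ((a + b) * t\<^sup>2 / 2)))"
        unfolding e by (simp add: power2_eq_square algebra_simps)
      also have "ennreal \<dots> = ennreal (?c * (exp (- (a * t\<^sup>2 / 2)) - exp (- (b * t\<^sup>2 / 2)))\<^sup>2) + ennreal (2 * (?c * exp (- ((a + b) * t\<^sup>2 / 2))))"
        by (intro ennreal_plus) auto
      finally show ?thesis by (simp add: ennreal_mult)
    qed
  qed
  also have "\<dots> = ?R + 2 * G (a + b)"
    by (simp add: G_def nn_integral_add nn_integral_cmult)
  finally have "2 * G (a + b) + ?L = 2 * G (a + b) + ?R" by (simp only: add.commute)
  moreover have "2 * G (a + b) \<noteq> \<infinity>" using Gfin by (auto simp: ennreal_mult_eq_top_iff)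
  ultimately show ?thesis by (simp only: ennreal_add_left_cancel) simp
qed

end

section \<open>Mollified convolutions of a density with a probability measure\<close>

lemma finite_borel_measure_density_bounded:
  assumes "g \<in> borel_measurable borel" "(\<integral>\<^sup>+x. ennreal (g x) \<partial>lborel) \<le> ennreal c"
  shows "finite_borel_measure (density lborel (\<lambda>x. ennreal (g x)))"
  using assms by (intro finite_borel_measure_density) (auto intro: le_less_trans)

context
  fixes g :: "real \<Rightarrow> real" and \<nu> :: "real measure" and c :: real
  assumes g_meas: "g \<in> borel_measurable borel" and g0: "\<And>x. 0 \<le> g x"
    and g_int: "(\<integral>\<^sup>+x. ennreal (g x) \<partial>lborel) \<le> ennreal c" and \<nu>: "real_distribution \<nu>"
begin

interpretation \<nu>: real_distribution \<nu> by (rule \<nu>)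
interpretation D: finite_borel_measure "density lborel (\<lambda>x. ennreal (g x))"
  by (rule finite_borel_measure_density_bounded[OF g_meas g_int])

text \<open>Displays the mollified convolution as an average of translates of \<open>g\<close> over
  a probability measure, to which convexity inequalities apply.\<close>

lemma ennreal_smooth_lcomb_density:
  assumes a: "0 < a"
  shows "ennreal (smooth a (lcomb 1 (density lborel (\<lambda>x. ennreal (g x))) \<nu>) x)
    = (\<integral>\<^sup>+w. ennreal (g (x - w)) \<partial>lcomb 1 \<nu> (density lborel (gauss a)))"
proof -
  note [measurable] = g_meas
  have N: "real_distribution (density lborel (gauss a))" using a by (rule real_distribution_gauss)
  have [simp]: "finite_borel_measure (lcomb 1 (density lborel (\<lambda>x. ennreal (g x))) \<nu>)"
    by (intro finite_borel_measure_lcomb D.finite_borel_measure_axioms \<nu>.finite_borel_measure_M)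
  interpret P: pair_sigma_finite lborel \<nu> ..
  have "ennreal (smooth a (lcomb 1 (density lborel (\<lambda>x. ennreal (g x))) \<nu>) x)
    = (\<integral>\<^sup>+y. ennreal (g y) * (\<integral>\<^sup>+z. ennreal (gauss a (x - (y + 1 * z))) \<partial>\<nu>) \<partial>lborel)"
    using a by (subst ennreal_smooth, simp, simp,
      subst nn_integral_lcomb[OF D.finite_borel_measure_axioms \<nu>.finite_borel_measure_M], simp,
      subst nn_integral_density) auto
  also have "\<dots> = (\<integral>\<^sup>+y. \<integral>\<^sup>+z. ennreal (g y) * ennreal (gauss a (x - (y + 1 * z))) \<partial>\<nu> \<partial>lborel)"
    by (simp add: nn_integral_cmult)
  also have "\<dots> = (\<integral>\<^sup>+z. \<integral>\<^sup>+y. ennreal (g y) * ennreal (gauss a (x - (y + 1 * z))) \<partial>lborel \<partial>\<nu>)"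
    by (rule P.Fubini'[symmetric]) measurable
  also have "\<dots> = (\<integral>\<^sup>+z. \<integral>\<^sup>+y. ennreal (gauss a y) * ennreal (g (x - (z + 1 * y))) \<partial>lborel \<partial>\<nu>)"
  proof (rule nn_integral_cong)
    fix z
    have "(\<integral>\<^sup>+y. ennreal (g y) * ennreal (gauss a (x - (y + 1 * z))) \<partial>lborel)
      = (\<integral>\<^sup>+y. ennreal (g ((x - z) + - 1 * y)) * ennreal (gauss a (x - (((x - z) + - 1 * y) + 1 * z))) \<partial>lborel)"
      using nn_integral_real_affine[of "\<lambda>y. ennreal (g y) * ennreal (gauss a (x - (y + 1 * z)))" "-1" "x - z"] by simp
    then show "(\<integral>\<^sup>+y. ennreal (g y) * ennreal (gauss a (x - (y + 1 * z))) \<partial>lborel)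
      = (\<integral>\<^sup>+y. ennreal (gauss a y) * ennreal (g (x - (z + 1 * y))) \<partial>lborel)"
      by (simp add: mult.commute algebra_simps)
  qed
  also have "\<dots> = (\<integral>\<^sup>+z. \<integral>\<^sup>+y. ennreal (g (x - (z + 1 * y))) \<partial>density lborel (gauss a) \<partial>\<nu>)"
    by (simp add: nn_integral_density)
  also have "\<dots> = (\<integral>\<^sup>+w. ennreal (g (x - w)) \<partial>lcomb 1 \<nu> (density lborel (gauss a)))"
    by (rule nn_integral_lcomb[symmetric]) (auto intro: real_distribution_imp_finite_borel \<nu> N)
  finally show ?thesis .
qed

lemma nn_integral_smooth_powr_le:
  assumes a: "0 < a" and q: "1 \<le> q" and bdd: "\<And>x. g x \<le> b"
  shows "(\<integral>\<^sup>+x. ennreal (smooth a (lcomb 1 (density lborel (\<lambda>x. ennreal (g x))) \<nu>) x powr q) \<partial>lborel)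
    \<le> (\<integral>\<^sup>+x. ennreal (g x powr q) \<partial>lborel)"
proof -
  note [measurable] = g_meas
  define \<pi> where "\<pi> = lcomb 1 \<nu> (density lborel (gauss a))"
  have \<pi>: "real_distribution \<pi>" unfolding \<pi>_def by (intro real_distribution_lcomb \<nu> real_distribution_gauss a)
  interpret \<pi>: real_distribution \<pi> by (rule \<pi>)
  interpret P: pair_sigma_finite lborel \<pi> ..
  let ?s = "smooth a (lcomb 1 (density lborel (\<lambda>x. ennreal (g x))) \<nu>)"
  have "ennreal (?s x powr q) \<le> (\<integral>\<^sup>+w. ennreal (g (x - w) powr q) \<partial>\<pi>)" for x
  proof -
    have int: "integrable \<pi> (\<lambda>w. g (x - w))"
      using g0 bdd by (intro \<pi>.integrable_const_bound[of _ b]) auto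
    have "ennreal (?s x) = ennreal (\<integral>w. g (x - w) \<partial>\<pi>)"
      unfolding ennreal_smooth_lcomb_density[OF a] \<pi>_def[symmetric]
      using g0 by (intro nn_integral_eq_integral int) auto
    then have "?s x = (\<integral>w. g (x - w) \<partial>\<pi>)" using g0 by (simp add: integral_nonneg)
    then show ?thesis
      using powr_integral_le_nn_integral_powr[OF \<pi>.finite_measure_axioms int, of q] g0 q \<pi>.prob_space by simp
  qed
  then have "(\<integral>\<^sup>+x. ennreal (?s x powr q) \<partial>lborel) \<le> (\<integral>\<^sup>+x. \<integral>\<^sup>+w. ennreal (g (x - w) powr q) \<partial>\<pi> \<partial>lborel)"
    by (intro nn_integral_mono)
  also have "\<dots> = (\<integral>\<^sup>+w. \<integral>\<^sup>+x. ennreal (g (x - w) powr q) \<partial>lborel \<partial>\<pi>)"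
    by (rule P.Fubini'[symmetric]) measurable
  also have "\<dots> = (\<integral>\<^sup>+w. (\<integral>\<^sup>+x. ennreal (g x powr q) \<partial>lborel) \<partial>\<pi>)"
  proof (rule nn_integral_cong)
    fix w
    show "(\<integral>\<^sup>+x. ennreal (g (x - w) powr q) \<partial>lborel) = (\<integral>\<^sup>+x. ennreal (g x powr q) \<partial>lborel)"
      using nn_integral_lborel_shift[of "\<lambda>x. ennreal (g x powr q)" "-w"] by simp
  qed
  also have "\<dots> = (\<integral>\<^sup>+x. ennreal (g x powr q) \<partial>lborel)" using \<pi>.emeasure_space_1 by simp
  finally show ?thesis .
qed

text \<open>The high frequency gain: \<open>\<kappa>\<close> bounds the Fourier multiplier \<open>char \<nu> t * \<psi> t\<close>, where
  \<open>exp (- a t\<^sup>2 / 4) * \<psi> t\<close> is the transform of the difference of the two Gaussians.\<close>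

lemma nn_integral_smooth_diff_le:
  assumes a: "0 < a"
    and \<kappa>: "\<And>t. cmod (char \<nu> t) * (exp (- (a * t\<^sup>2 / 4)) - exp (- (5 * a * t\<^sup>2 / 4))) \<le> \<kappa>"
  defines "\<tau> \<equiv> lcomb 1 (density lborel (\<lambda>x. ennreal (g x))) \<nu>"
  shows "(\<integral>\<^sup>+x. ennreal ((smooth a \<tau> x - smooth (3 * a) \<tau> x)\<^sup>2) \<partial>lborel) \<le> ennreal (\<kappa>\<^sup>2) * (\<integral>\<^sup>+x. ennreal ((g x)\<^sup>2) \<partial>lborel)"
proof -
  define \<theta> where "\<theta> = density lborel (\<lambda>x. ennreal (g x))"
  have \<theta>: "finite_borel_measure \<theta>" unfolding \<theta>_def by (rule D.finite_borel_measure_axioms)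
  have \<tau>: "finite_borel_measure \<tau>"
    unfolding \<tau>_def by (intro finite_borel_measure_lcomb D.finite_borel_measure_axioms \<nu>.finite_borel_measure_M)
  interpret \<theta>: finite_borel_measure \<theta> by (rule \<theta>)
  note [measurable] = \<theta>.borel_measurable_char
  have char_\<tau>: "char \<tau> t = char \<theta> t * char \<nu> t" for t
    unfolding \<tau>_def \<theta>_def by (subst char_lcomb[OF D.finite_borel_measure_axioms \<nu>.finite_borel_measure_M]) simp
  let ?I = "\<integral>\<^sup>+x. ennreal ((smooth a \<tau> x - smooth (3 * a) \<tau> x)\<^sup>2) \<partial>lborel"
  have "ennreal (2 * pi) * ?I
    = (\<integral>\<^sup>+t. ennreal ((cmod (char \<tau> t))\<^sup>2 * (exp (- (a * t\<^sup>2 / 2)) - exp (- (3 * a * t\<^sup>2 / 2)))\<^sup>2) \<partial>lborel)"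
    using a by (intro nn_integral_smooth_diff_square \<tau>) auto
  also have "\<dots> \<le> (\<integral>\<^sup>+t. ennreal (\<kappa>\<^sup>2) * ennreal ((cmod (char \<theta> t))\<^sup>2 * exp (- (a * t\<^sup>2 / 2))) \<partial>lborel)"
  proof (intro nn_integral_mono)
    fix t
    define \<psi> where "\<psi> = exp (- (a * t\<^sup>2 / 4)) - exp (- (5 * a * t\<^sup>2 / 4))"
    have \<psi>0: "0 \<le> \<psi>" using a by (simp add: \<psi>_def)
    have "exp (- (a * t\<^sup>2 / 2)) - exp (- (3 * a * t\<^sup>2 / 2)) = exp (- (a * t\<^sup>2 / 4)) * \<psi>"
      by (simp add: \<psi>_def right_diff_distrib flip: exp_add)
    then have "(cmod (char \<tau> t))\<^sup>2 * (exp (- (a * t\<^sup>2 / 2)) - exp (- (3 * a * t\<^sup>2 / 2)))\<^sup>2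
      = (cmod (char \<nu> t) * \<psi>)\<^sup>2 * ((cmod (char \<theta> t))\<^sup>2 * (exp (- (a * t\<^sup>2 / 4)))\<^sup>2)"
      by (simp add: char_\<tau> norm_mult power_mult_distrib)
    also have "(exp (- (a * t\<^sup>2 / 4)))\<^sup>2 = exp (- (a * t\<^sup>2 / 2))"
      by (simp add: power2_eq_square flip: exp_add)
    also have "(cmod (char \<nu> t) * \<psi>)\<^sup>2 * ((cmod (char \<theta> t))\<^sup>2 * exp (- (a * t\<^sup>2 / 2)))
      \<le> \<kappa>\<^sup>2 * ((cmod (char \<theta> t))\<^sup>2 * exp (- (a * t\<^sup>2 / 2)))"
      using \<kappa>[of t] \<psi>0 unfolding \<psi>_def[symmetric] by (intro mult_right_mono power_mono) auto
    finally show "ennreal ((cmod (char \<tau> t))\<^sup>2 * (exp (- (a * t\<^sup>2 / 2)) - exp (- (3 * a * t\<^sup>2 / 2)))\<^sup>2)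
      \<le> ennreal (\<kappa>\<^sup>2) * ennreal ((cmod (char \<theta> t))\<^sup>2 * exp (- (a * t\<^sup>2 / 2)))"
      by (simp add: ennreal_leI flip: ennreal_mult)
  qed
  also have "\<dots> = ennreal (\<kappa>\<^sup>2) * (\<integral>\<^sup>+t. ennreal ((cmod (char \<theta> t))\<^sup>2 * exp (- (a * t\<^sup>2 / 2))) \<partial>lborel)"
    by (rule nn_integral_cmult) measurable
  also have "\<dots> = ennreal (\<kappa>\<^sup>2) * (ennreal (2 * pi) * (\<integral>\<^sup>+s. \<integral>\<^sup>+s'. ennreal (gauss a (s - s')) \<partial>\<theta> \<partial>\<theta>))"
    by (subst nn_integral_char_gauss[OF \<theta> a]) simp
  also have "\<dots> \<le> ennreal (\<kappa>\<^sup>2) * (ennreal (2 * pi) * (\<integral>\<^sup>+x. ennreal ((g x)\<^sup>2) \<partial>lborel))"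
    unfolding \<theta>_def by (intro mult_left_mono nn_integral_gauss_density_le g_meas g0 a) auto
  finally have le: "ennreal (2 * pi) * ?I \<le> ennreal (2 * pi) * (ennreal (\<kappa>\<^sup>2) * (\<integral>\<^sup>+x. ennreal ((g x)\<^sup>2) \<partial>lborel))"
    by (simp add: mult_ac)
  have "?I = ennreal (1 / (2 * pi)) * (ennreal (2 * pi) * ?I)"
    by (simp flip: mult.assoc ennreal_mult)
  also have "\<dots> \<le> ennreal (1 / (2 * pi)) * (ennreal (2 * pi) * (ennreal (\<kappa>\<^sup>2) * (\<integral>\<^sup>+x. ennreal ((g x)\<^sup>2) \<partial>lborel)))"
    by (intro mult_left_mono le) auto
  also have "\<dots> = ennreal (\<kappa>\<^sup>2) * (\<integral>\<^sup>+x. ennreal ((g x)\<^sup>2) \<partial>lborel)"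
    by (simp flip: mult.assoc ennreal_mult)
  finally show ?thesis .
qed

lemma nn_integral_abs_smooth_diff_le:
  assumes a: "0 < a"
  defines "\<tau> \<equiv> lcomb 1 (density lborel (\<lambda>x. ennreal (g x))) \<nu>"
  shows "(\<integral>\<^sup>+x. ennreal \<bar>smooth a \<tau> x - smooth (3 * a) \<tau> x\<bar> \<partial>lborel) \<le> 2 * (\<integral>\<^sup>+x. ennreal (g x) \<partial>lborel)"
proof -
  have \<tau>: "finite_borel_measure \<tau>"
    unfolding \<tau>_def by (intro finite_borel_measure_lcomb D.finite_borel_measure_axioms \<nu>.finite_borel_measure_M)
  note [measurable] = borel_measurable_smooth[OF \<tau>] g_meas
  have "emeasure \<tau> UNIV = (\<integral>\<^sup>+x. ennreal (g x) \<partial>lborel)"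
    unfolding \<tau>_def emeasure_lcomb_UNIV[OF D.finite_borel_measure_axioms \<nu>.finite_borel_measure_M]
    using \<nu>.emeasure_space_1 by (simp add: emeasure_density)
  moreover have "(\<integral>\<^sup>+x. ennreal \<bar>smooth a \<tau> x - smooth (3 * a) \<tau> x\<bar> \<partial>lborel)
    \<le> (\<integral>\<^sup>+x. ennreal (smooth a \<tau> x) + ennreal (smooth (3 * a) \<tau> x) \<partial>lborel)"
  proof (intro nn_integral_mono)
    fix x
    have "\<bar>smooth a \<tau> x - smooth (3 * a) \<tau> x\<bar> \<le> smooth a \<tau> x + smooth (3 * a) \<tau> x"
      using smooth_nonneg[of a \<tau> x] smooth_nonneg[of "3 * a" \<tau> x] by linarith
    then show "ennreal \<bar>smooth a \<tau> x - smooth (3 * a) \<tau> x\<bar> \<le> ennreal (smooth a \<tau> x) + ennreal (smooth (3 * a) \<tau> x)"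
      by (simp flip: ennreal_plus add: ennreal_leI)
  qed
  ultimately show ?thesis
    using a by (simp add: nn_integral_add nn_integral_smooth[OF \<tau>] mult_2)
qed

end

text \<open>Moving the centre of a Gaussian by at most \<open>sqrt a\<close> costs a constant if the
  variance is enlarged to \<open>4 * a\<close>. The mollified measure is thus at most a constant
  times a Gaussian average of ball masses divided by \<open>sqrt a\<close>, and Hoelder takes the
  power inside that average.\<close>

lemma nn_integral_smooth_powr_le_ball_Lq:
  assumes \<eta>: "real_distribution \<eta>" and a: "0 < a" and q: "1 < q"
  shows "(\<integral>\<^sup>+x. ennreal (smooth a \<eta> x powr q) \<partial>lborel)
    \<le> ennreal ((exp (1/4) / sqrt a) powr q) * ball_Lq q \<eta> (sqrt a)"
proof -
  interpret \<eta>: real_distribution \<eta> by (rule \<eta>)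
  have \<eta>f: "finite_borel_measure \<eta>" by (rule \<eta>.finite_borel_measure_M)
  note [measurable] = borel_measurable_measure_cball[OF \<eta>f]
  let ?m = "\<lambda>y. measure \<eta> (cball y (sqrt a))"
  have a4: "0 < 4 * a" using a by simp
  interpret P: pair_sigma_finite lborel \<eta> ..
  have ga: "gauss a (x - s) \<le> 2 * exp (1/4) * gauss (4 * a) (x - y)" if "\<bar>y - s\<bar> \<le> sqrt a" for x y s
  proof -
    have "(y - s)\<^sup>2 \<le> a" using that a by (metis abs_le_square_iff abs_of_nonneg real_sqrt_ge_zero less_imp_le real_sqrt_pow2)
    moreover have "(x - y)\<^sup>2 \<le> 2 * (x - s)\<^sup>2 + 2 * (y - s)\<^sup>2"
      using sum_squares_ge_zero[of "(x - s) + (y - s)" 0] by (simp add: power2_eq_square algebra_simps)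
    ultimately have "(x - y)\<^sup>2 \<le> 4 * (x - s)\<^sup>2 + 2 * a" using zero_le_power2[of "x - s"] by linarith
    then have "(x - y)\<^sup>2 / (2 * (4 * a)) \<le> (4 * (x - s)\<^sup>2 + 2 * a) / (2 * (4 * a))"
      using a by (intro divide_right_mono) auto
    also have "\<dots> = (x - s)\<^sup>2 / (2 * a) + 1/4" using a by (simp add: field_simps)
    finally have "exp (- ((x - s)\<^sup>2 / (2 * a))) \<le> exp (1/4) * exp (- ((x - y)\<^sup>2 / (2 * (4 * a))))"
      by (simp flip: exp_add)
    then have "exp (- ((x - s)\<^sup>2 / (2 * a))) / sqrt (2 * pi * a)
      \<le> exp (1/4) * exp (- ((x - y)\<^sup>2 / (2 * (4 * a)))) / sqrt (2 * pi * a)"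
      using a by (intro divide_right_mono) auto
    moreover have "sqrt (2 * pi * (4 * a)) = 2 * sqrt (2 * pi * a)"
    proof -
      have "sqrt (2 * pi * (4 * a)) = sqrt (2\<^sup>2 * (2 * pi * a))" by (simp add: mult_ac)
      also have "\<dots> = 2 * sqrt (2 * pi * a)" unfolding real_sqrt_mult[of "2\<^sup>2"] by simp
      finally show ?thesis .
    qed
    ultimately show ?thesis using a by (simp add: gauss_eq)
  qed
  have point: "ennreal (smooth a \<eta> x) \<le> ennreal (exp (1/4) / sqrt a) * (\<integral>\<^sup>+y. ennreal (gauss (4 * a) (x - y)) * ennreal (?m y) \<partial>lborel)" for x
  proof -
    have ind: "indicator (cball s (sqrt a)) y = (indicator {..sqrt a} (dist s y) :: ennreal)" for s y :: real
      by (auto simp: indicator_def)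
    have "ennreal (smooth a \<eta> x) = (\<integral>\<^sup>+s. ennreal (gauss a (x - s)) \<partial>\<eta>)" by (rule ennreal_smooth[OF \<eta>f a])
    also have "\<dots> = (\<integral>\<^sup>+s. ennreal (1 / (2 * sqrt a)) * (\<integral>\<^sup>+y. ennreal (gauss a (x - s)) * indicator (cball s (sqrt a)) y \<partial>lborel) \<partial>\<eta>)"
    proof (intro nn_integral_cong)
      fix s
      have "(\<integral>\<^sup>+y. ennreal (gauss a (x - s)) * indicator (cball s (sqrt a)) y \<partial>lborel) = ennreal (gauss a (x - s)) * ennreal (2 * sqrt a)"
        using a by (subst nn_integral_cmult) (auto simp: cball_eq_atLeastAtMost)
      then show "ennreal (gauss a (x - s)) = ennreal (1 / (2 * sqrt a)) * (\<integral>\<^sup>+y. ennreal (gauss a (x - s)) * indicator (cball s (sqrt a)) y \<partial>lborel)"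
        using a by (simp flip: ennreal_mult)
    qed
    also have "\<dots> \<le> (\<integral>\<^sup>+s. ennreal (1 / (2 * sqrt a)) * (\<integral>\<^sup>+y. ennreal (2 * exp (1/4) * gauss (4 * a) (x - y)) * indicator (cball s (sqrt a)) y \<partial>lborel) \<partial>\<eta>)"
    proof (intro nn_integral_mono mult_left_mono)
      fix s y
      show "ennreal (gauss a (x - s)) * indicator (cball s (sqrt a)) y
        \<le> ennreal (2 * exp (1/4) * gauss (4 * a) (x - y)) * indicator (cball s (sqrt a)) y"
        using ga[of y s x] by (auto simp: indicator_def dist_real_def abs_minus_commute intro!: ennreal_leI)
    qed simp
    also have "\<dots> = (\<integral>\<^sup>+s. \<integral>\<^sup>+y. ennreal (exp (1/4) / sqrt a) * ennreal (gauss (4 * a) (x - y)) * indicator (cball s (sqrt a)) y \<partial>lborel \<partial>\<eta>)"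
    proof (intro nn_integral_cong)
      fix s
      have "ennreal (1 / (2 * sqrt a)) * (ennreal (2 * exp (1/4) * gauss (4 * a) (x - y)) * indicator (cball s (sqrt a)) y)
        = ennreal (exp (1/4) / sqrt a) * ennreal (gauss (4 * a) (x - y)) * indicator (cball s (sqrt a)) y" for y
        using a by (simp flip: ennreal_mult mult.assoc)
      then show "ennreal (1 / (2 * sqrt a)) * (\<integral>\<^sup>+y. ennreal (2 * exp (1/4) * gauss (4 * a) (x - y)) * indicator (cball s (sqrt a)) y \<partial>lborel)
        = (\<integral>\<^sup>+y. ennreal (exp (1/4) / sqrt a) * ennreal (gauss (4 * a) (x - y)) * indicator (cball s (sqrt a)) y \<partial>lborel)"
        by (subst nn_integral_cmult[symmetric]) auto
    qed
    also have "\<dots> = (\<integral>\<^sup>+y. \<integral>\<^sup>+s. ennreal (exp (1/4) / sqrt a) * ennreal (gauss (4 * a) (x - y)) * indicator (cball s (sqrt a)) y \<partial>\<eta> \<partial>lborel)"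
      unfolding ind by (rule P.Fubini') measurable
    also have "\<dots> = (\<integral>\<^sup>+y. ennreal (exp (1/4) / sqrt a) * (ennreal (gauss (4 * a) (x - y)) * ennreal (?m y)) \<partial>lborel)"
    proof (intro nn_integral_cong)
      fix y
      have "(\<integral>\<^sup>+s. indicator (cball s (sqrt a)) y \<partial>\<eta>) = (\<integral>\<^sup>+s. indicator (cball y (sqrt a)) s \<partial>\<eta>)"
        by (simp add: indicator_def dist_commute)
      then have "(\<integral>\<^sup>+s. indicator (cball s (sqrt a)) y \<partial>\<eta>) = ennreal (?m y)" by (simp add: \<eta>.emeasure_eq_measure)
      then show "(\<integral>\<^sup>+s. ennreal (exp (1/4) / sqrt a) * ennreal (gauss (4 * a) (x - y)) * indicator (cball s (sqrt a)) y \<partial>\<eta>)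
        = ennreal (exp (1/4) / sqrt a) * (ennreal (gauss (4 * a) (x - y)) * ennreal (?m y))"
        unfolding ind by (subst nn_integral_cmult) (auto simp: mult.assoc)
    qed
    also have "\<dots> = ennreal (exp (1/4) / sqrt a) * (\<integral>\<^sup>+y. ennreal (gauss (4 * a) (x - y)) * ennreal (?m y) \<partial>lborel)"
      by (rule nn_integral_cmult) measurable
    finally show ?thesis .
  qed
  have "ennreal (smooth a \<eta> x powr q) \<le> ennreal ((exp (1/4) / sqrt a) powr q) * (\<integral>\<^sup>+y. ennreal (gauss (4 * a) (x - y)) * ennreal (?m y powr q) \<partial>lborel)" for x
  proof -
    define N where "N = density lborel (\<lambda>y. ennreal (gauss (4 * a) (y - x)))"
    have [measurable_cong]: "sets N = sets borel" by (simp add: N_def)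
    have spN: "space N = UNIV" by (simp add: N_def)
    have emN: "emeasure N UNIV = 1" by (simp add: N_def emeasure_density nn_integral_gauss_shift[OF a4])
    interpret N: prob_space N by (intro prob_spaceI) (simp add: spN emN)
    have int: "integrable N ?m" by (intro N.integrable_const_bound[of _ 1]) auto
    have "(\<integral>\<^sup>+y. ennreal (gauss (4 * a) (x - y)) * ennreal (?m y) \<partial>lborel) = (\<integral>\<^sup>+y. ennreal (?m y) \<partial>N)"
      unfolding N_def by (subst nn_integral_density) (auto simp: gauss_minus_commute[of _ x])
    also have "\<dots> = ennreal (\<integral>y. ?m y \<partial>N)" by (intro nn_integral_eq_integral int) auto
    finally have "ennreal (smooth a \<eta> x) \<le> ennreal (exp (1/4) / sqrt a * (\<integral>y. ?m y \<partial>N))"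
      using point[of x] a by (subst ennreal_mult) (auto intro!: integral_nonneg)
    then have "smooth a \<eta> x \<le> exp (1/4) / sqrt a * (\<integral>y. ?m y \<partial>N)"
      using a by (subst (asm) ennreal_le_iff) (auto intro!: mult_nonneg_nonneg integral_nonneg)
    then have "smooth a \<eta> x powr q \<le> (exp (1/4) / sqrt a * (\<integral>y. ?m y \<partial>N)) powr q"
      using q by (intro powr_mono2) auto
    also have "\<dots> = (exp (1/4) / sqrt a) powr q * (\<integral>y. ?m y \<partial>N) powr q"
      by (rule powr_mult)
    finally have "ennreal (smooth a \<eta> x powr q) \<le> ennreal ((exp (1/4) / sqrt a) powr q) * ennreal ((\<integral>y. ?m y \<partial>N) powr q)"
      by (simp add: ennreal_leI flip: ennreal_mult)
    also have "\<dots> \<le> ennreal ((exp (1/4) / sqrt a) powr q) * (\<integral>\<^sup>+y. ennreal (?m y powr q) \<partial>N)"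
      using powr_integral_le_nn_integral_powr[OF N.finite_measure_axioms int, of q] q N.prob_space
      by (intro mult_left_mono) auto
    also have "(\<integral>\<^sup>+y. ennreal (?m y powr q) \<partial>N) = (\<integral>\<^sup>+y. ennreal (gauss (4 * a) (x - y)) * ennreal (?m y powr q) \<partial>lborel)"
      unfolding N_def by (subst nn_integral_density) (auto simp: gauss_minus_commute[of _ x])
    finally show ?thesis .
  qed
  then have "(\<integral>\<^sup>+x. ennreal (smooth a \<eta> x powr q) \<partial>lborel)
    \<le> (\<integral>\<^sup>+x. ennreal ((exp (1/4) / sqrt a) powr q) * (\<integral>\<^sup>+y. ennreal (gauss (4 * a) (x - y)) * ennreal (?m y powr q) \<partial>lborel) \<partial>lborel)"
    by (intro nn_integral_mono)
  also have "\<dots> = ennreal ((exp (1/4) / sqrt a) powr q) * (\<integral>\<^sup>+x. \<integral>\<^sup>+y. ennreal (gauss (4 * a) (x - y)) * ennreal (?m y powr q) \<partial>lborel \<partial>lborel)"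
    by (rule nn_integral_cmult) measurable
  also have "(\<integral>\<^sup>+x. \<integral>\<^sup>+y. ennreal (gauss (4 * a) (x - y)) * ennreal (?m y powr q) \<partial>lborel \<partial>lborel)
    = (\<integral>\<^sup>+y. \<integral>\<^sup>+x. ennreal (gauss (4 * a) (x - y)) * ennreal (?m y powr q) \<partial>lborel \<partial>lborel)"
    by (rule lborel_pair.Fubini') measurable
  also have "\<dots> = ball_Lq q \<eta> (sqrt a)"
    unfolding ball_Lq_def by (simp add: nn_integral_multc nn_integral_gauss_shift[OF a4])
  finally show ?thesis .
qed

text \<open>Variances of Gaussians add, and smoothing commutes with convolution by
  \<open>\<nu>\<close>. Part of the variance can thus be spent beforehand on turning
  \<open>\<eta>\<close> into a bounded density.\<close>

lemma smooth_semigroup: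
  assumes \<eta>: "real_distribution \<eta>" and \<nu>: "real_distribution \<nu>" and a: "0 < a" and b: "0 < b"
  shows "smooth b (lcomb 1 (density lborel (\<lambda>x. ennreal (smooth a \<eta> x))) \<nu>) x = smooth (a + b) (lcomb 1 \<eta> \<nu>) x"
proof -
  interpret \<eta>: real_distribution \<eta> by (rule \<eta>)
  interpret \<nu>: real_distribution \<nu> by (rule \<nu>)
  have \<eta>f: "finite_borel_measure \<eta>" and \<nu>f: "finite_borel_measure \<nu>"
    by (rule \<eta>.finite_borel_measure_M \<nu>.finite_borel_measure_M)+
  note [measurable] = borel_measurable_smooth[OF \<eta>f]
  let ?g = "smooth a \<eta>"
  have g: "(\<integral>\<^sup>+x. ennreal (?g x) \<partial>lborel) \<le> ennreal 1"
    using nn_integral_smooth[OF \<eta>f a] \<eta>.emeasure_space_1 by simp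
  have df: "finite_borel_measure (density lborel (\<lambda>x. ennreal (?g x)))"
    by (intro finite_borel_measure_density_bounded[OF _ g]) simp
  interpret P: pair_sigma_finite lborel \<nu> ..
  interpret P': pair_sigma_finite lborel \<eta> ..
  interpret P'': pair_sigma_finite \<eta> \<nu> ..
  have "ennreal (smooth b (lcomb 1 (density lborel (\<lambda>x. ennreal (?g x))) \<nu>) x)
    = (\<integral>\<^sup>+y. ennreal (?g y) * (\<integral>\<^sup>+z. ennreal (gauss b (x - (y + 1 * z))) \<partial>\<nu>) \<partial>lborel)"
    by (subst ennreal_smooth[OF finite_borel_measure_lcomb[OF df \<nu>f] b], subst nn_integral_lcomb[OF df \<nu>f], simp,
        subst nn_integral_density) auto
  also have "\<dots> = (\<integral>\<^sup>+y. \<integral>\<^sup>+z. ennreal (?g y) * ennreal (gauss b (x - (y + 1 * z))) \<partial>\<nu> \<partial>lborel)"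
    by (simp add: nn_integral_cmult)
  also have "\<dots> = (\<integral>\<^sup>+z. \<integral>\<^sup>+y. ennreal (?g y) * ennreal (gauss b (x - (y + 1 * z))) \<partial>lborel \<partial>\<nu>)"
    by (rule P.Fubini'[symmetric]) measurable
  also have "\<dots> = (\<integral>\<^sup>+z. \<integral>\<^sup>+s. ennreal (gauss (a + b) (x - (s + 1 * z))) \<partial>\<eta> \<partial>\<nu>)"
  proof (rule nn_integral_cong)
    fix z
    have "(\<integral>\<^sup>+y. ennreal (?g y) * ennreal (gauss b (x - (y + 1 * z))) \<partial>lborel)
      = (\<integral>\<^sup>+y. \<integral>\<^sup>+s. ennreal (gauss a (y - s) * gauss b (y - (x - z))) \<partial>\<eta> \<partial>lborel)"
    proof (rule nn_integral_cong)
      fix y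
      have "gauss b (x - (y + 1 * z)) = gauss b (y - (x - z))"
        using gauss_minus_commute[of b "x - z" y] by (simp add: algebra_simps)
      then show "ennreal (?g y) * ennreal (gauss b (x - (y + 1 * z))) = (\<integral>\<^sup>+s. ennreal (gauss a (y - s) * gauss b (y - (x - z))) \<partial>\<eta>)"
        by (simp add: ennreal_smooth[OF \<eta>f a] ennreal_mult nn_integral_multc)
    qed
    also have "\<dots> = (\<integral>\<^sup>+s. \<integral>\<^sup>+y. ennreal (gauss a (y - s) * gauss b (y - (x - z))) \<partial>lborel \<partial>\<eta>)"
      by (rule P'.Fubini'[symmetric]) measurable
    also have "\<dots> = (\<integral>\<^sup>+s. ennreal (gauss (a + b) (x - (s + 1 * z))) \<partial>\<eta>)"
    proof (rule nn_integral_cong)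
      fix s
      have "gauss (a + b) (s - (x - z)) = gauss (a + b) (x - (s + 1 * z))"
        using gauss_minus_commute[of "a + b" s "x - z"] by (simp add: algebra_simps)
      then show "(\<integral>\<^sup>+y. ennreal (gauss a (y - s) * gauss b (y - (x - z))) \<partial>lborel) = ennreal (gauss (a + b) (x - (s + 1 * z)))"
        using a b by (simp add: nn_integral_gauss_mult_gauss)
    qed
    finally show "(\<integral>\<^sup>+y. ennreal (?g y) * ennreal (gauss b (x - (y + 1 * z))) \<partial>lborel)
      = (\<integral>\<^sup>+s. ennreal (gauss (a + b) (x - (s + 1 * z))) \<partial>\<eta>)" .
  qed
  also have "\<dots> = (\<integral>\<^sup>+s. \<integral>\<^sup>+z. ennreal (gauss (a + b) (x - (s + 1 * z))) \<partial>\<nu> \<partial>\<eta>)"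
    by (rule P''.Fubini') measurable
  also have "\<dots> = ennreal (smooth (a + b) (lcomb 1 \<eta> \<nu>) x)"
  proof -
    have ab: "0 < a + b" using a b by simp
    show ?thesis unfolding ennreal_smooth[OF finite_borel_measure_lcomb[OF \<eta>f \<nu>f] ab]
      by (rule nn_integral_lcomb[OF \<eta>f \<nu>f, symmetric]) measurable
  qed
  finally show ?thesis by simp
qed

lemma smooth_lcomb_density_add:
  assumes g: "g1 \<in> borel_measurable borel" "g2 \<in> borel_measurable borel" "\<And>x. 0 \<le> g1 x" "\<And>x. 0 \<le> g2 x"
    and int: "(\<integral>\<^sup>+x. ennreal (g1 x + g2 x) \<partial>lborel) \<le> ennreal c" and \<nu>: "real_distribution \<nu>" and a: "0 < a"
  shows "smooth a (lcomb 1 (density lborel (\<lambda>x. ennreal (g1 x + g2 x))) \<nu>) x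
    = smooth a (lcomb 1 (density lborel (\<lambda>x. ennreal (g1 x))) \<nu>) x + smooth a (lcomb 1 (density lborel (\<lambda>x. ennreal (g2 x))) \<nu>) x"
proof -
  note [measurable] = g(1,2)
  have int1: "(\<integral>\<^sup>+x. ennreal (g1 x) \<partial>lborel) \<le> ennreal c" and int2: "(\<integral>\<^sup>+x. ennreal (g2 x) \<partial>lborel) \<le> ennreal c"
    using g(3,4) by (intro order.trans[OF nn_integral_mono int] ennreal_leI; simp)+
  have N: "real_distribution (lcomb 1 \<nu> (density lborel (gauss a)))"
    by (intro real_distribution_lcomb \<nu> real_distribution_gauss a)
  interpret N: real_distribution "lcomb 1 \<nu> (density lborel (gauss a))" by (rule N)
  have sum_nn: "g1 x + g2 x \<ge> 0" for x using g(3,4)[of x] by simp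
  have "ennreal (smooth a (lcomb 1 (density lborel (\<lambda>x. ennreal (g1 x + g2 x))) \<nu>) x)
    = (\<integral>\<^sup>+w. ennreal (g1 (x - w) + g2 (x - w)) \<partial>lcomb 1 \<nu> (density lborel (gauss a)))"
    by (rule ennreal_smooth_lcomb_density[OF _ _ int \<nu> a]) (auto simp: sum_nn)
  also have "\<dots> = (\<integral>\<^sup>+w. ennreal (g1 (x - w)) \<partial>lcomb 1 \<nu> (density lborel (gauss a)))
      + (\<integral>\<^sup>+w. ennreal (g2 (x - w)) \<partial>lcomb 1 \<nu> (density lborel (gauss a)))"
    using g(3,4) by (subst nn_integral_add[symmetric]) auto
  also have "\<dots> = ennreal (smooth a (lcomb 1 (density lborel (\<lambda>x. ennreal (g1 x))) \<nu>) x)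
      + ennreal (smooth a (lcomb 1 (density lborel (\<lambda>x. ennreal (g2 x))) \<nu>) x)"
    using g by (simp add: ennreal_smooth_lcomb_density[OF _ _ int1 \<nu> a] ennreal_smooth_lcomb_density[OF _ _ int2 \<nu> a])
  finally show ?thesis
    by (simp flip: ennreal_plus)
qed

text \<open>The density is cut at height \<open>1 / \<kappa>\<close>: the tall part is small in \<open>L\<^sup>1\<close>, and on the bounded part
  the \<open>L\<^sup>2\<close> gain \<open>\<kappa>\<close> is available.\<close>

lemma nn_integral_smooth_diff_powr_le:
  fixes g :: "real \<Rightarrow> real"
  assumes g_meas: "g \<in> borel_measurable borel" and g0: "\<And>x. 0 \<le> g x" and gb: "\<And>x. g x \<le> b"
    and g_int: "(\<integral>\<^sup>+x. ennreal (g x) \<partial>lborel) \<le> ennreal 1" and \<nu>: "real_distribution \<nu>"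
    and a: "0 < a" and \<kappa>0: "0 < \<kappa>" "\<kappa> \<le> 1"
    and \<kappa>: "\<And>t. cmod (char \<nu> t) * (exp (- (a * t\<^sup>2 / 4)) - exp (- (5 * a * t\<^sup>2 / 4))) \<le> \<kappa>"
    and p: "1 < p" "p \<le> 2" and q: "p < q \<and> q \<le> 2 \<or> p = 2 \<and> q = 2"
    and A: "1 \<le> A" "(\<integral>\<^sup>+x. ennreal (g x powr q) \<partial>lborel) \<le> ennreal A"
  defines "\<tau> \<equiv> lcomb 1 (density lborel (\<lambda>x. ennreal (g x))) \<nu>"
    and "e \<equiv> (if p = 2 then 1 else min (q - p) (p - 1))"
  shows "(\<integral>\<^sup>+x. ennreal (\<bar>smooth a \<tau> x - smooth (3 * a) \<tau> x\<bar> powr p) \<partial>lborel) \<le> ennreal (12 * \<kappa> powr e * A)"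
\<comment> \<open>For \<open>p = 2\<close> the gain applies to the whole of \<open>g\<close>;
  otherwise the room between \<open>p\<close> and \<open>q\<close> is used.\<close>
proof (cases "p = 2")
  case True
  then have q2: "q = 2" using q by auto
  have "(\<integral>\<^sup>+x. ennreal (\<bar>smooth a \<tau> x - smooth (3 * a) \<tau> x\<bar> powr p) \<partial>lborel)
    = (\<integral>\<^sup>+x. ennreal ((smooth a \<tau> x - smooth (3 * a) \<tau> x)\<^sup>2) \<partial>lborel)"
    using True by (intro nn_integral_cong) simp
  also have "\<dots> \<le> ennreal (\<kappa>\<^sup>2) * (\<integral>\<^sup>+x. ennreal ((g x)\<^sup>2) \<partial>lborel)"
    unfolding \<tau>_def by (rule nn_integral_smooth_diff_le[OF g_meas g0 g_int \<nu> a \<kappa>])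
  also have "(\<integral>\<^sup>+x. ennreal ((g x)\<^sup>2) \<partial>lborel) = (\<integral>\<^sup>+x. ennreal (g x powr q) \<partial>lborel)"
    using g0 q2 by (intro nn_integral_cong) simp
  also have "ennreal (\<kappa>\<^sup>2) * \<dots> \<le> ennreal (\<kappa>\<^sup>2) * ennreal A" by (intro mult_left_mono A) auto
  also have "\<dots> \<le> ennreal (12 * \<kappa> powr e * A)"
  proof -
    have "\<kappa>\<^sup>2 * A \<le> \<kappa> * A" using \<kappa>0 A by (intro mult_right_mono) (auto simp: power2_eq_square mult_left_le)
    also have "\<dots> \<le> 12 * \<kappa> powr e * A" using True \<kappa>0 A by (simp add: e_def)
    finally show ?thesis using A by (simp flip: ennreal_mult add: ennreal_leI)
  qed
  finally show ?thesis .
next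
  case False
  then have q': "p < q" "q \<le> 2" "p < 2" using p q by auto
  define lev where "lev = {x. 1 / \<kappa> < g x}"
  note [measurable] = g_meas
  have lev [measurable]: "lev \<in> sets borel" unfolding lev_def by measurable
  define g1 where "g1 x = g x * indicator lev x" for x
  define g2 where "g2 x = g x * indicator (- lev) x" for x
  have [measurable]: "g1 \<in> borel_measurable borel" "g2 \<in> borel_measurable borel"
    unfolding g1_def g2_def by measurable
  have g12: "0 \<le> g1 x" "0 \<le> g2 x" "g x = g1 x + g2 x" "g1 x \<le> b" "g2 x \<le> b" "g1 x \<le> g x" "g2 x \<le> g x" for x
    using g0[of x] gb[of x] by (auto simp: g1_def g2_def indicator_def)
  have int1: "(\<integral>\<^sup>+x. ennreal (g1 x) \<partial>lborel) \<le> ennreal 1" and int2: "(\<integral>\<^sup>+x. ennreal (g2 x) \<partial>lborel) \<le> ennreal 1"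
    using g12 by (intro order.trans[OF nn_integral_mono g_int] ennreal_leI; simp)+
  define \<tau>1 where "\<tau>1 = lcomb 1 (density lborel (\<lambda>x. ennreal (g1 x))) \<nu>"
  define \<tau>2 where "\<tau>2 = lcomb 1 (density lborel (\<lambda>x. ennreal (g2 x))) \<nu>"
  have \<tau>f: "finite_borel_measure \<tau>1" "finite_borel_measure \<tau>2"
    unfolding \<tau>1_def \<tau>2_def
    by (intro finite_borel_measure_lcomb real_distribution_imp_finite_borel[OF \<nu>]
        finite_borel_measure_density_bounded[OF _ int1] finite_borel_measure_density_bounded[OF _ int2]; simp)+
  note [measurable] = borel_measurable_smooth[OF \<tau>f(1)] borel_measurable_smooth[OF \<tau>f(2)]
  define h1 where "h1 x = \<bar>smooth a \<tau>1 x - smooth (3 * a) \<tau>1 x\<bar>" for x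
  define h2 where "h2 x = \<bar>smooth a \<tau>2 x - smooth (3 * a) \<tau>2 x\<bar>" for x
  have [measurable]: "h1 \<in> borel_measurable borel" "h2 \<in> borel_measurable borel"
    unfolding h1_def h2_def by measurable
  have h0: "0 \<le> h1 x" "0 \<le> h2 x" for x by (auto simp: h1_def h2_def)
  have geq: "(\<lambda>x. ennreal (g x)) = (\<lambda>x. ennreal (g1 x + g2 x))" by (rule ext) (simp only: g12(3))
  have gint': "(\<integral>\<^sup>+x. ennreal (g1 x + g2 x) \<partial>lborel) \<le> ennreal 1" using g_int by (simp only: geq)
  have smooth_split: "smooth c \<tau> x = smooth c \<tau>1 x + smooth c \<tau>2 x" if "0 < c" for c x
    unfolding \<tau>_def \<tau>1_def \<tau>2_def geq
    by (rule smooth_lcomb_density_add[OF _ _ g12(1) g12(2) gint' \<nu> that]) simp_all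
  have h_le: "\<bar>smooth a \<tau> x - smooth (3 * a) \<tau> x\<bar> powr p \<le> 2 * (h1 x powr p) + 2 * (h2 x powr p)" for x
  proof -
    have "\<bar>smooth a \<tau> x - smooth (3 * a) \<tau> x\<bar> \<le> h1 x + h2 x"
      using a by (simp add: smooth_split h1_def h2_def)
    then have "\<bar>smooth a \<tau> x - smooth (3 * a) \<tau> x\<bar> powr p \<le> (h1 x + h2 x) powr p"
      using p by (intro powr_mono2) auto
    also have "\<dots> \<le> 2 powr (p - 1) * (h1 x powr p + h2 x powr p)"
      using p h0 by (intro add_powr_le) auto
    also have "\<dots> \<le> 2 powr 1 * (h1 x powr p + h2 x powr p)"
      using p by (intro mult_right_mono powr_mono) auto
    finally show ?thesis by simp
  qed
  \<comment> \<open>Above the level \<open>1 / \<kappa>\<close> one has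
    \<open>1 \<le> (\<kappa> * g x) powr (q - 1)\<close>, so smallness in \<open>L\<^sup>1\<close>
    is bought with the \<open>L\<^sup>q\<close> bound.\<close>
  have tall1: "(\<integral>\<^sup>+x. ennreal (h1 x) \<partial>lborel) \<le> ennreal (2 * (\<kappa> powr (q - 1) * A))"
  proof -
    have "(\<integral>\<^sup>+x. ennreal (h1 x) \<partial>lborel) \<le> 2 * (\<integral>\<^sup>+x. ennreal (g1 x) \<partial>lborel)"
      unfolding h1_def \<tau>1_def by (rule nn_integral_abs_smooth_diff_le[OF _ g12(1) int1 \<nu> a]) simp
    also have "(\<integral>\<^sup>+x. ennreal (g1 x) \<partial>lborel) \<le> (\<integral>\<^sup>+x. ennreal (\<kappa> powr (q - 1)) * ennreal (g x powr q) \<partial>lborel)"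
    proof (rule nn_integral_mono)
      fix x
      have "g1 x \<le> \<kappa> powr (q - 1) * g x powr q"
      proof (cases "x \<in> lev")
        case True
        then have gx: "1 / \<kappa> < g x" by (simp add: lev_def)
        then have gp: "g x > 0" using \<kappa>0 by (smt (verit) divide_pos_pos)
        have "1 \<le> (\<kappa> * g x) powr (q - 1)"
          using gx \<kappa>0 q' p by (intro ge_one_powr_ge_zero) (auto simp: field_simps)
        then have "g x * 1 \<le> g x * ((\<kappa> * g x) powr (q - 1))" using gp by (intro mult_left_mono) auto
        also have "\<dots> = \<kappa> powr (q - 1) * g x powr q"
          using gp \<kappa>0 by (simp add: powr_mult powr_diff)
        finally show ?thesis using True by (simp add: g1_def)
      qed (simp add: g1_def)
      then show "ennreal (g1 x) \<le> ennreal (\<kappa> powr (q - 1)) * ennreal (g x powr q)"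
        by (simp flip: ennreal_mult add: ennreal_leI)
    qed
    also have "\<dots> = ennreal (\<kappa> powr (q - 1)) * (\<integral>\<^sup>+x. ennreal (g x powr q) \<partial>lborel)"
      by (rule nn_integral_cmult) simp
    also have "\<dots> \<le> ennreal (\<kappa> powr (q - 1)) * ennreal A" by (intro mult_left_mono A) auto
    also have "2 * (ennreal (\<kappa> powr (q - 1)) * ennreal A) = ennreal (2 * (\<kappa> powr (q - 1) * A))"
      using A by (simp add: ennreal_mult)
    finally show ?thesis by (simp add: mult_left_mono)
  qed
  have tallq: "(\<integral>\<^sup>+x. ennreal (h1 x powr q) \<partial>lborel) \<le> ennreal (4 * A)"
  proof -
    have bd: "(\<integral>\<^sup>+x. ennreal (smooth c \<tau>1 x powr q) \<partial>lborel) \<le> ennreal A" if c: "0 < c" for c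
    proof -
      have "(\<integral>\<^sup>+x. ennreal (smooth c \<tau>1 x powr q) \<partial>lborel) \<le> (\<integral>\<^sup>+x. ennreal (g1 x powr q) \<partial>lborel)"
        unfolding \<tau>1_def using q' p by (intro nn_integral_smooth_powr_le[OF _ g12(1) int1 \<nu> c _ g12(4)]) auto
      also have "\<dots> \<le> (\<integral>\<^sup>+x. ennreal (g x powr q) \<partial>lborel)"
        using g12 q' p by (intro nn_integral_mono ennreal_leI powr_mono2) auto
      finally show ?thesis using A by (rule_tac order.trans)
    qed
    have "(\<integral>\<^sup>+x. ennreal (h1 x powr q) \<partial>lborel)
      \<le> (\<integral>\<^sup>+x. ennreal 2 * ennreal (smooth a \<tau>1 x powr q) + ennreal 2 * ennreal (smooth (3 * a) \<tau>1 x powr q) \<partial>lborel)"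
    proof (rule nn_integral_mono)
      fix x
      have "h1 x powr q \<le> (smooth a \<tau>1 x + smooth (3 * a) \<tau>1 x) powr q"
      proof (intro powr_mono2)
        show "h1 x \<le> smooth a \<tau>1 x + smooth (3 * a) \<tau>1 x"
          using smooth_nonneg[of a \<tau>1 x] smooth_nonneg[of "3 * a" \<tau>1 x] unfolding h1_def by linarith
      qed (use q' p h0 in auto)
      also have "\<dots> \<le> 2 powr (q - 1) * (smooth a \<tau>1 x powr q + smooth (3 * a) \<tau>1 x powr q)"
        using q' p by (intro add_powr_le) auto
      also have "\<dots> \<le> 2 powr 1 * (smooth a \<tau>1 x powr q + smooth (3 * a) \<tau>1 x powr q)"
        using q' by (intro mult_right_mono powr_mono) auto
      finally have "h1 x powr q \<le> 2 * smooth a \<tau>1 x powr q + 2 * smooth (3 * a) \<tau>1 x powr q" by simp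
      then show "ennreal (h1 x powr q) \<le> ennreal 2 * ennreal (smooth a \<tau>1 x powr q) + ennreal 2 * ennreal (smooth (3 * a) \<tau>1 x powr q)"
        by (simp flip: ennreal_mult ennreal_plus add: ennreal_leI del: ennreal_numeral)
    qed
    also have "\<dots> = ennreal 2 * (\<integral>\<^sup>+x. ennreal (smooth a \<tau>1 x powr q) \<partial>lborel) + ennreal 2 * (\<integral>\<^sup>+x. ennreal (smooth (3 * a) \<tau>1 x powr q) \<partial>lborel)"
      by (subst nn_integral_add) (auto simp: nn_integral_cmult)
    also have "\<dots> \<le> ennreal 2 * ennreal A + ennreal 2 * ennreal A"
      using a by (intro add_mono mult_left_mono bd) auto
    also have "\<dots> = ennreal (4 * A)" using A by (simp flip: ennreal_mult ennreal_plus del: ennreal_numeral)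
    finally show ?thesis .
  qed
  have tall: "(\<integral>\<^sup>+x. ennreal (h1 x powr p) \<partial>lborel) \<le> ennreal (4 * \<kappa> powr (q - p) * A)"
  proof -
    \<comment> \<open>The solution of \<open>\<theta> + q * (1 - \<theta>) = p\<close>:
      interpolation between \<open>L\<^sup>1\<close> and \<open>L\<^sup>q\<close>.\<close>
    define \<theta> where "\<theta> = (q - p) / (q - 1)"
    have \<theta>: "0 < \<theta>" "\<theta> < 1" using q' p by (auto simp: \<theta>_def field_simps)
    have \<theta>q: "(q - 1) * \<theta> = q - p" using q' p by (simp add: \<theta>_def)
    have \<theta>p: "\<theta> + q * (1 - \<theta>) = p" "(q - 1) * \<theta> = q - p" using \<theta>q by (auto simp: algebra_simps)
    have "(\<integral>\<^sup>+x. ennreal (h1 x powr \<theta> * (h1 x powr q) powr (1 - \<theta>)) \<partial>lborel)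
      \<le> ennreal ((2 * (\<kappa> powr (q - 1) * A)) powr \<theta> * (4 * A) powr (1 - \<theta>))"
      using A h0 by (intro nn_integral_powr_Hoelder tall1 tallq \<theta>) auto
    also have "(\<lambda>x. h1 x powr \<theta> * (h1 x powr q) powr (1 - \<theta>)) = (\<lambda>x. h1 x powr p)"
      by (rule ext) (simp add: powr_powr \<theta>p flip: powr_add)
    also have "(2 * (\<kappa> powr (q - 1) * A)) powr \<theta> * (4 * A) powr (1 - \<theta>)
      = (2 powr \<theta> * 4 powr (1 - \<theta>)) * (\<kappa> powr (q - p) * (A powr \<theta> * A powr (1 - \<theta>)))"
      using A by (simp add: powr_mult powr_powr \<theta>p)
    also have "A powr \<theta> * A powr (1 - \<theta>) = A" using A by (simp flip: powr_add)
    also have "(2 powr \<theta> * 4 powr (1 - \<theta>)) * (\<kappa> powr (q - p) * A) \<le> 4 * (\<kappa> powr (q - p) * A)"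
    proof (intro mult_right_mono)
      have "2 powr \<theta> * 4 powr (1 - \<theta>) \<le> 4 powr \<theta> * 4 powr (1 - \<theta>)"
        using \<theta> by (intro mult_right_mono powr_mono2) auto
      then show "2 powr \<theta> * 4 powr (1 - \<theta>) \<le> 4" by (simp flip: powr_add)
    qed (use A in auto)
    finally show ?thesis by (simp add: ennreal_leI mult.assoc)
  qed
  have short: "(\<integral>\<^sup>+x. ennreal (h2 x powr p) \<partial>lborel) \<le> ennreal (2 * \<kappa> powr (p - 1))"
  proof -
    have s1: "(\<integral>\<^sup>+x. ennreal (h2 x) \<partial>lborel) \<le> ennreal 2"
    proof -
      have "(\<integral>\<^sup>+x. ennreal (h2 x) \<partial>lborel) \<le> 2 * (\<integral>\<^sup>+x. ennreal (g2 x) \<partial>lborel)"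
        unfolding h2_def \<tau>2_def by (rule nn_integral_abs_smooth_diff_le[OF _ g12(2) int2 \<nu> a]) simp
      also have "\<dots> \<le> 2 * ennreal 1" by (intro mult_left_mono int2) auto
      finally show ?thesis by simp
    qed
    \<comment> \<open>The cut bounds \<open>g2\<close> by \<open>1 / \<kappa>\<close>, so the
      integral of its square is at most \<open>1 / \<kappa>\<close>, and the squared multiplier
      leaves \<open>\<kappa>\<^sup>2 / \<kappa> = \<kappa>\<close>.\<close>
    have s2: "(\<integral>\<^sup>+x. ennreal (h2 x powr 2) \<partial>lborel) \<le> ennreal \<kappa>"
    proof -
      have "(\<integral>\<^sup>+x. ennreal (h2 x powr 2) \<partial>lborel) = (\<integral>\<^sup>+x. ennreal ((smooth a \<tau>2 x - smooth (3 * a) \<tau>2 x)\<^sup>2) \<partial>lborel)"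
        by (intro nn_integral_cong) (simp add: h2_def)
      also have "\<dots> \<le> ennreal (\<kappa>\<^sup>2) * (\<integral>\<^sup>+x. ennreal ((g2 x)\<^sup>2) \<partial>lborel)"
        unfolding \<tau>2_def by (intro nn_integral_smooth_diff_le[OF _ g12(2) int2 \<nu> a \<kappa>]) auto
      also have "(\<integral>\<^sup>+x. ennreal ((g2 x)\<^sup>2) \<partial>lborel) \<le> (\<integral>\<^sup>+x. ennreal (1 / \<kappa>) * ennreal (g2 x) \<partial>lborel)"
      proof (rule nn_integral_mono)
        fix x
        have "g2 x \<le> 1 / \<kappa>" using \<kappa>0 by (auto simp: g2_def lev_def indicator_def not_less)
        then have "g2 x * g2 x \<le> 1 / \<kappa> * g2 x" using g12 by (intro mult_right_mono) auto
        then show "ennreal ((g2 x)\<^sup>2) \<le> ennreal (1 / \<kappa>) * ennreal (g2 x)"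
          using \<kappa>0 g12 by (simp add: power2_eq_square ennreal_leI flip: ennreal_mult del: times_divide_eq_left)
      qed
      also have "\<dots> = ennreal (1 / \<kappa>) * (\<integral>\<^sup>+x. ennreal (g2 x) \<partial>lborel)" by (rule nn_integral_cmult) simp
      also have "\<dots> \<le> ennreal (1 / \<kappa>) * ennreal 1" by (intro mult_left_mono int2) auto
      also have "ennreal (\<kappa>\<^sup>2) * (ennreal (1 / \<kappa>) * ennreal 1) = ennreal \<kappa>"
        using \<kappa>0 by (simp add: power2_eq_square flip: ennreal_mult)
      finally show ?thesis by (simp add: mult_left_mono)
    qed
    define \<theta> where "\<theta> = 2 - p"
    have \<theta>: "0 < \<theta>" "\<theta> < 1" using q' p by (auto simp: \<theta>_def)
    have \<theta>p: "\<theta> + 2 * (1 - \<theta>) = p" by (simp add: \<theta>_def)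
    have "(\<integral>\<^sup>+x. ennreal (h2 x powr \<theta> * (h2 x powr 2) powr (1 - \<theta>)) \<partial>lborel) \<le> ennreal (2 powr \<theta> * \<kappa> powr (1 - \<theta>))"
      using \<kappa>0 h0 by (intro nn_integral_powr_Hoelder s1 s2 \<theta>) auto
    also have "(\<lambda>x. h2 x powr \<theta> * (h2 x powr 2) powr (1 - \<theta>)) = (\<lambda>x. h2 x powr p)"
      using \<theta>p by (intro ext) (simp only: powr_powr powr_add[symmetric])
    also have "2 powr \<theta> * \<kappa> powr (1 - \<theta>) \<le> 2 powr 1 * \<kappa> powr (1 - \<theta>)"
      using \<theta> by (intro mult_right_mono powr_mono) auto
    finally show ?thesis by (simp add: ennreal_leI \<theta>_def)
  qed
  have "(\<integral>\<^sup>+x. ennreal (\<bar>smooth a \<tau> x - smooth (3 * a) \<tau> x\<bar> powr p) \<partial>lborel)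
    \<le> (\<integral>\<^sup>+x. ennreal 2 * ennreal (h1 x powr p) + ennreal 2 * ennreal (h2 x powr p) \<partial>lborel)"
    by (intro nn_integral_mono) (simp flip: ennreal_mult ennreal_plus add: ennreal_leI h_le del: ennreal_numeral)
  also have "\<dots> = ennreal 2 * (\<integral>\<^sup>+x. ennreal (h1 x powr p) \<partial>lborel) + ennreal 2 * (\<integral>\<^sup>+x. ennreal (h2 x powr p) \<partial>lborel)"
    by (subst nn_integral_add) (auto simp: nn_integral_cmult)
  also have "\<dots> \<le> ennreal 2 * ennreal (4 * \<kappa> powr (q - p) * A) + ennreal 2 * ennreal (2 * \<kappa> powr (p - 1))"
    by (intro add_mono mult_left_mono tall short) auto
  also have "\<dots> = ennreal (2 * (4 * \<kappa> powr (q - p) * A) + 2 * (2 * \<kappa> powr (p - 1)))"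
    using A by (simp flip: ennreal_mult ennreal_plus del: ennreal_numeral)
  also have "\<dots> \<le> ennreal (12 * \<kappa> powr e * A)"
  proof (rule ennreal_leI)
    have "\<kappa> powr (q - p) \<le> \<kappa> powr e" "\<kappa> powr (p - 1) \<le> \<kappa> powr e"
      using \<kappa>0 False by (auto simp: e_def intro!: powr_mono')
    then have "\<kappa> powr (q - p) * A \<le> \<kappa> powr e * A" "\<kappa> powr (p - 1) * 1 \<le> \<kappa> powr e * A"
      using A(1) by (intro mult_mono; simp)+
    then show "2 * (4 * \<kappa> powr (q - p) * A) + 2 * (2 * \<kappa> powr (p - 1)) \<le> 12 * \<kappa> powr e * A" by simp
  qed
  finally show ?thesis .
qed

text \<open>Convexity, with \<open>x + y\<close> written as the combination of \<open>x / w\<close>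
  and \<open>y / (1 - w)\<close> for \<open>w = 1 / (1 + t)\<close>. The coefficient of
  \<open>x powr p\<close> is as close to 1 as desired, so the inequality can be applied at
  infinitely many scales in succession.\<close>

lemma add_powr_le_weighted:
  fixes x y t p :: real
  assumes "0 \<le> x" "0 \<le> y" "0 < t" "1 < p" "p \<le> 2"
  shows "(x + y) powr p \<le> (1 + t) * x powr p + (1 + 1 / t) * y powr p"
proof -
  define w where "w = 1 / (1 + t)"
  have w: "0 < w" "w < 1" "1 - w = t / (1 + t)" using assms by (auto simp: w_def field_simps)
  show ?thesis
  proof (cases "x = 0 \<or> y = 0")
    case True
    have "x powr p \<le> (1 + t) * x powr p" "y powr p \<le> (1 + 1 / t) * y powr p"
      using assms by (auto simp: mult_le_cancel_right1)
    then show ?thesis using True assms by auto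
  next
    case False
    then have xy: "0 < x" "0 < y" using assms by auto
    have "convex_on {0<..} (\<lambda>x. x powr p)" using assms by (intro powr_convex) auto
    from convex_onD[OF this, of w "y / (1 - w)" "x / w"]
    have "(x + y) powr p \<le> w * (x / w) powr p + (1 - w) * (y / (1 - w)) powr p"
      using w(1,2) xy by (simp add: add.commute)
    also have "w * (x / w) powr p = (1 / w) powr (p - 1) * x powr p"
      using w xy by (simp add: powr_divide powr_diff field_simps)
    also have "(1 - w) * (y / (1 - w)) powr p = (1 / (1 - w)) powr (p - 1) * y powr p"
      using w xy by (simp add: powr_divide powr_diff field_simps)
    also have "1 / w = 1 + t" by (simp add: w_def)
    also have "1 / (1 - w) = 1 + 1 / t" using assms by (simp add: w(3) field_simps)
    also have "(1 + t) powr (p - 1) * x powr p + (1 + 1 / t) powr (p - 1) * y powr p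
      \<le> (1 + t) powr 1 * x powr p + (1 + 1 / t) powr 1 * y powr p"
      using assms by (intro add_mono mult_right_mono powr_mono) auto
    finally show ?thesis using assms by simp
  qed
qed

text \<open>Adding \<open>C\<close> makes the recursion purely multiplicative, and the product of
  the factors \<open>1 + t ^ k\<close> is bounded by the exponential of a geometric series.\<close>

lemma bounded_of_geometric_recursion:
  fixes I :: "nat \<Rightarrow> real"
  assumes t: "0 < t" "t < 1" and C: "0 \<le> C" and I: "\<And>n. 0 \<le> I n"
    and rec: "\<And>n. I (Suc n) \<le> (1 + t ^ n) * I n + C * t ^ n"
  shows "I n \<le> (I 0 + C) * exp (1 / (1 - t))"
proof -
  have "I n + C \<le> (I 0 + C) * exp (\<Sum>k<n. t ^ k)"
  proof (induction n)
    case (Suc n)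
    have "I (Suc n) + C \<le> (1 + t ^ n) * (I n + C)" using rec[of n] by (simp add: algebra_simps)
    also have "\<dots> \<le> exp (t ^ n) * ((I 0 + C) * exp (\<Sum>k<n. t ^ k))"
      using Suc I[of n] C t by (intro mult_mono exp_ge_add_one_self) auto
    finally show ?case by (simp add: exp_add mult_ac)
  qed simp
  also have "\<dots> \<le> (I 0 + C) * exp (1 / (1 - t))"
  proof (intro mult_left_mono)
    have "(\<Sum>k<n. t ^ k) \<le> 1 / (1 - t)"
      using t by (simp add: sum_gp_strict divide_right_mono)
    then show "exp (\<Sum>k<n. t ^ k) \<le> exp (1 / (1 - t))" by simp
  qed (use I[of 0] C in auto)
  finally show ?thesis using C by simp
qed

text \<open>In passing from variance \<open>4 * a\<close> to \<open>2 * a\<close>, the dimension of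
  \<open>\<eta>\<close> loses at most the factor \<open>a powr - (\<delta> / 2)\<close> and the
  decay of \<open>\<nu>\<close> gains \<open>a powr (\<sigma>' * e)\<close>, both up to constants.
  Over dyadic scales the increments are therefore geometrically small.\<close>

theorem smooth_powr_bounded:
  assumes \<eta>: "real_distribution \<eta>" and \<nu>: "real_distribution \<nu>"
    and C\<sigma>: "0 < C" "0 < \<sigma>" and decay: "\<And>t. t \<noteq> 0 \<Longrightarrow> cmod (char \<nu> t) \<le> C * \<bar>t\<bar> powr - \<sigma>"
    and p: "1 < p" "p \<le> 2" and q: "p < q \<and> q \<le> 2 \<or> p = 2 \<and> q = 2"
    and dim: "\<And>\<delta>. 0 < \<delta> \<Longrightarrow> \<delta> < q \<Longrightarrow> \<exists>B>0. \<forall>r. 0 < r \<longrightarrow> r \<le> 1 \<longrightarrow> ball_Lq q \<eta> r \<le> ennreal (B * r powr (q - \<delta>))"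
  shows "\<exists>S. \<forall>n. (\<integral>\<^sup>+x. ennreal (smooth ((1/2) ^ n) (lcomb 1 \<eta> \<nu>) x powr p) \<partial>lborel) \<le> ennreal S"
proof -
  interpret \<eta>: real_distribution \<eta> by (rule \<eta>)
  interpret \<nu>: real_distribution \<nu> by (rule \<nu>)
  have \<eta>f: "finite_borel_measure \<eta>" by (rule \<eta>.finite_borel_measure_M)
  have q1: "1 < q" "q \<le> 2" using p q by auto
  define \<zeta> where "\<zeta> = lcomb 1 \<eta> \<nu>"
  have \<zeta>: "real_distribution \<zeta>" unfolding \<zeta>_def by (intro real_distribution_lcomb \<eta> \<nu>)
  interpret \<zeta>: real_distribution \<zeta> by (rule \<zeta>)
  have \<zeta>f: "finite_borel_measure \<zeta>" by (rule \<zeta>.finite_borel_measure_M)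
  note [measurable] = borel_measurable_smooth[OF \<eta>f] borel_measurable_smooth[OF \<zeta>f]
  define e where "e = (if p = 2 then 1 else min (q - p) (p - 1))"
  have e: "0 < e" using p q by (auto simp: e_def)
  \<comment> \<open>Two regimes with threshold \<open>\<bar>t\<bar> = a powr (- 1/4)\<close>: below
    it the difference of Gaussians is at most \<open>a * t\<^sup>2 \<le> a powr (1/2)\<close>, above
    it the decay gives \<open>a powr (\<sigma> / 4)\<close>.\<close>
  define \<sigma>' where "\<sigma>' = min (1/2) (\<sigma> / 4)"
  have \<sigma>': "0 < \<sigma>'" "\<sigma>' \<le> 1/2" "\<sigma>' \<le> \<sigma> / 4" using C\<sigma> by (auto simp: \<sigma>'_def)
  define C' where "C' = max 1 C"
  have C': "1 \<le> C'" "C \<le> C'" by (auto simp: C'_def)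
  \<comment> \<open>The loss \<open>a powr - (\<delta> / 2)\<close> then consumes at most half of
    the gain \<open>a powr (\<sigma>' * e)\<close>.\<close>
  define \<delta> where "\<delta> = min 1 (\<sigma>' * e)"
  have \<delta>: "0 < \<delta>" "\<delta> < q" "\<delta> \<le> \<sigma>' * e" using \<sigma>' e q1 by (auto simp: \<delta>_def)
  obtain B where B: "0 < B" "\<And>r. 0 < r \<Longrightarrow> r \<le> 1 \<Longrightarrow> ball_Lq q \<eta> r \<le> ennreal (B * r powr (q - \<delta>))"
    using dim[OF \<delta>(1,2)] by blast
  define B' where "B' = max 1 (exp (1/4) powr q * B)"
  define \<kappa> where "\<kappa> a = min 1 (C' * a powr \<sigma>')" for a
  have mult: "cmod (char \<nu> t) * (exp (- (a * t\<^sup>2 / 4)) - exp (- (5 * a * t\<^sup>2 / 4))) \<le> \<kappa> a"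
    if a: "0 < a" "a \<le> 1" for a t
  proof -
    define \<psi> where "\<psi> = exp (- (a * t\<^sup>2 / 4)) - exp (- (5 * a * t\<^sup>2 / 4))"
    have \<psi>0: "0 \<le> \<psi>" using a by (simp add: \<psi>_def)
    have e1: "exp (- (a * t\<^sup>2 / 4)) \<le> 1" using a by simp
    then have \<psi>1: "\<psi> \<le> 1" unfolding \<psi>_def using exp_gt_zero[of "- (5 * a * t\<^sup>2 / 4)"] by linarith
    have "\<psi> = exp (- (a * t\<^sup>2 / 4)) * (1 - exp (- (a * t\<^sup>2)))"
      by (simp add: \<psi>_def right_diff_distrib flip: exp_add)
    also have "\<dots> \<le> 1 * (a * t\<^sup>2)"
      using e1 a exp_ge_add_one_self[of "- (a * t\<^sup>2)"] by (intro mult_mono) auto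
    finally have \<psi>2: "\<psi> \<le> a * t\<^sup>2" by simp
    have c1: "cmod (char \<nu> t) \<le> 1" by (rule \<nu>.cmod_char_le_1)
    have "cmod (char \<nu> t) * \<psi> \<le> 1 * 1" by (intro mult_mono c1 \<psi>1 \<psi>0) auto
    moreover have "cmod (char \<nu> t) * \<psi> \<le> C' * a powr \<sigma>'"
    proof (cases "\<bar>t\<bar> \<le> a powr (- 1/4)")
      case True
      have "t\<^sup>2 = \<bar>t\<bar>\<^sup>2" by simp
      also have "\<dots> \<le> (a powr (- 1/4))\<^sup>2" using True by (intro power_mono) auto
      also have "\<dots> = a powr (- 1/2)" using a by (simp add: power2_eq_square flip: powr_add)
      finally have "a * t\<^sup>2 \<le> a powr 1 * a powr (- 1/2)" using a by (simp add: mult_left_mono)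
      also have "\<dots> = a powr (1/2)" unfolding powr_add[symmetric] by simp
      also have "\<dots> \<le> a powr \<sigma>'" using a \<sigma>' by (intro powr_mono') auto
      finally have "a * t\<^sup>2 \<le> a powr \<sigma>'" .
      then have "cmod (char \<nu> t) * \<psi> \<le> 1 * a powr \<sigma>'" using \<psi>2 \<psi>0 by (intro mult_mono c1) auto
      also have "\<dots> \<le> C' * a powr \<sigma>'" using C' by (intro mult_right_mono) auto
      finally show ?thesis .
    next
      case False
      then have t: "t \<noteq> 0" "a powr (- 1/4) \<le> \<bar>t\<bar>" using a by auto
      have "cmod (char \<nu> t) * \<psi> \<le> C * \<bar>t\<bar> powr - \<sigma> * 1" using t \<psi>0 \<psi>1 C\<sigma> by (intro mult_mono decay) auto
      also have "\<dots> \<le> C' * a powr \<sigma>' * 1"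
      proof (intro mult_mono C')
        have "\<bar>t\<bar> powr - \<sigma> \<le> (a powr (- 1/4)) powr - \<sigma>" using t a C\<sigma> by (intro powr_mono2') auto
        also have "\<dots> = a powr (\<sigma> / 4)" by (simp add: powr_powr)
        also have "\<dots> \<le> a powr \<sigma>'" using a \<sigma>' by (intro powr_mono') auto
        finally show "\<bar>t\<bar> powr - \<sigma> \<le> a powr \<sigma>'" .
      qed (use C' in auto)
      finally show ?thesis by simp
    qed
    ultimately show ?thesis by (simp add: \<kappa>_def \<psi>_def)
  qed
  define D where "D = 12 * C' powr e * B'"
  have D0: "0 \<le> D" by (simp add: D_def B'_def)
  have inc: "(\<integral>\<^sup>+x. ennreal (\<bar>smooth (2 * a) \<zeta> x - smooth (4 * a) \<zeta> x\<bar> powr p) \<partial>lborel) \<le> ennreal (D * a powr (\<sigma>' * e / 2))"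
    if a: "0 < a" "a \<le> 1" for a
  proof -
    define g where "g = smooth a \<eta>"
    have [measurable]: "g \<in> borel_measurable borel" unfolding g_def by measurable
    have gint: "(\<integral>\<^sup>+x. ennreal (g x) \<partial>lborel) \<le> ennreal 1"
      using nn_integral_smooth[OF \<eta>f a(1)] \<eta>.emeasure_space_1 by (simp add: g_def)
    have gA: "(\<integral>\<^sup>+x. ennreal (g x powr q) \<partial>lborel) \<le> ennreal (B' * a powr - (\<delta> / 2))"
    proof -
      have "(\<integral>\<^sup>+x. ennreal (g x powr q) \<partial>lborel) \<le> ennreal ((exp (1/4) / sqrt a) powr q) * ball_Lq q \<eta> (sqrt a)"
        unfolding g_def by (rule nn_integral_smooth_powr_le_ball_Lq[OF \<eta> a(1) q1(1)])
      also have "\<dots> \<le> ennreal ((exp (1/4) / sqrt a) powr q) * ennreal (B * sqrt a powr (q - \<delta>))"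
        using a by (intro mult_left_mono B(2)) auto
      also have "\<dots> = ennreal (exp (1/4) powr q * B * (sqrt a powr (q - \<delta>) / sqrt a powr q))"
        using a B by (simp add: powr_divide flip: ennreal_mult)
      also have "sqrt a powr (q - \<delta>) / sqrt a powr q = a powr - (\<delta> / 2)"
        using a by (simp add: powr_half_sqrt[symmetric] powr_powr flip: powr_diff) (simp add: diff_divide_distrib)
      also have "ennreal (exp (1/4) powr q * B * a powr - (\<delta> / 2)) \<le> ennreal (B' * a powr - (\<delta> / 2))"
        by (intro ennreal_leI mult_right_mono) (auto simp: B'_def)
      finally show ?thesis .
    qed
    have A1: "1 \<le> B' * a powr - (\<delta> / 2)"
    proof -
      have "a powr 0 \<le> a powr - (\<delta> / 2)" using a \<delta> by (intro powr_mono') auto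
      then have "1 * 1 \<le> B' * a powr - (\<delta> / 2)" using a by (intro mult_mono) (auto simp: B'_def)
      then show ?thesis by simp
    qed
    have \<kappa>a: "0 < \<kappa> a" "\<kappa> a \<le> 1" using a C' by (auto simp: \<kappa>_def)
    have gb: "g x \<le> 1 / sqrt (2 * pi * a)" for x
      using smooth_le[OF \<eta>f a(1), of x] \<eta>.prob_space by (simp add: g_def)
    \<comment> \<open>One \<open>a\<close> of each variance is spent on forming \<open>g\<close>;
      the remainders \<open>a\<close> and \<open>3 * a\<close> are the two parameters in the
      difference estimates.\<close>
    have eq: "smooth (2 * a) \<zeta> x = smooth a (lcomb 1 (density lborel (\<lambda>x. ennreal (g x))) \<nu>) x"
      "smooth (4 * a) \<zeta> x = smooth (3 * a) (lcomb 1 (density lborel (\<lambda>x. ennreal (g x))) \<nu>) x" for x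
      using smooth_semigroup[OF \<eta> \<nu> a(1) a(1), of x] smooth_semigroup[OF \<eta> \<nu> a(1), of "3 * a" x] a
      by (simp_all add: g_def \<zeta>_def)
    have "(\<integral>\<^sup>+x. ennreal (\<bar>smooth (2 * a) \<zeta> x - smooth (4 * a) \<zeta> x\<bar> powr p) \<partial>lborel)
      \<le> ennreal (12 * \<kappa> a powr e * (B' * a powr - (\<delta> / 2)))"
      unfolding eq e_def
      by (rule nn_integral_smooth_diff_powr_le[OF _ _ gb gint \<nu> a(1) \<kappa>a mult[OF a] p q A1 gA]) (auto simp: g_def)
    also have "\<dots> \<le> ennreal (D * a powr (\<sigma>' * e / 2))"
    proof (rule ennreal_leI)
      have "\<kappa> a powr e \<le> (C' * a powr \<sigma>') powr e" using \<kappa>a e by (intro powr_mono2) (auto simp: \<kappa>_def)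
      also have "\<dots> = C' powr e * a powr (\<sigma>' * e)" using C' by (simp add: powr_mult powr_powr)
      finally have "12 * \<kappa> a powr e * (B' * a powr - (\<delta> / 2)) \<le> 12 * (C' powr e * a powr (\<sigma>' * e)) * (B' * a powr - (\<delta> / 2))"
        by (intro mult_right_mono mult_left_mono) (auto simp: B'_def)
      also have "\<dots> = D * a powr (\<sigma>' * e - \<delta> / 2)"
        by (simp add: D_def powr_add[symmetric] mult_ac)
      also have "\<dots> \<le> D * a powr (\<sigma>' * e / 2)"
        using a \<delta> D0 by (intro mult_left_mono powr_mono') auto
      finally show "12 * \<kappa> a powr e * (B' * a powr - (\<delta> / 2)) \<le> D * a powr (\<sigma>' * e / 2)" .
    qed
    finally show ?thesis .
  qed
  \<comment> \<open>The increment at step \<open>n\<close> is at most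
    \<open>D * t ^ n * t ^ n\<close>: one factor pays for the coefficient
    \<open>1 + 1 / t ^ n\<close> of the weighted inequality, the other makes the recursion
    geometric.\<close>
  define t where "t = (1/2) powr (\<sigma>' * e / 4)"
  have t: "0 < t" "t < 1"
  proof -
    have "(1/2) powr (\<sigma>' * e / 4) < (1/2::real) powr 0" using \<sigma>' e by (intro powr_less_mono') auto
    then show "0 < t" "t < 1" by (auto simp: t_def)
  qed
  define I where "I n = (\<integral>\<^sup>+x. ennreal (smooth ((1/2) ^ n) \<zeta> x powr p) \<partial>lborel)" for n :: nat
  have I0: "I 0 \<le> ennreal 1"
  proof -
    have "I 0 \<le> (\<integral>\<^sup>+x. ennreal (smooth 1 \<zeta> x) \<partial>lborel)"
      unfolding I_def
    proof (intro nn_integral_mono ennreal_leI)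
      fix x
      have "smooth 1 \<zeta> x \<le> 1 / sqrt (2 * pi * 1)" using smooth_le[OF \<zeta>f, of 1 x] \<zeta>.prob_space by simp
      also have "\<dots> \<le> 1" using pi_gt3 by simp
      finally have "smooth 1 \<zeta> x powr p \<le> smooth 1 \<zeta> x powr 1" using p by (intro powr_mono') auto
      then show "smooth ((1/2) ^ 0) \<zeta> x powr p \<le> smooth 1 \<zeta> x" by simp
    qed
    then show ?thesis using nn_integral_smooth[OF \<zeta>f, of 1] \<zeta>.emeasure_space_1 by simp
  qed
  have step: "I (Suc n) \<le> ennreal (1 + t ^ n) * I n + ennreal (2 * D * t ^ n)" for n
  proof -
    define a where "a = (1/2::real) ^ (n + 2)"
    have a: "0 < a" "a \<le> 1" unfolding a_def by (simp, intro power_le_one) auto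
    have a24: "(1/2) ^ Suc n = 2 * a" "(1/2) ^ n = 4 * a" by (auto simp: a_def)
    let ?h = "\<lambda>x. \<bar>smooth (2 * a) \<zeta> x - smooth (4 * a) \<zeta> x\<bar>"
    have tn: "0 < t ^ n" "t ^ n \<le> 1" using t by (auto intro: power_le_one)
    have "I (Suc n) \<le> (\<integral>\<^sup>+x. ennreal (1 + t ^ n) * ennreal (smooth (4 * a) \<zeta> x powr p) + ennreal (1 + 1 / t ^ n) * ennreal (?h x powr p) \<partial>lborel)"
      unfolding I_def a24
    proof (rule nn_integral_mono)
      fix x
      have "smooth (2 * a) \<zeta> x powr p \<le> (smooth (4 * a) \<zeta> x + ?h x) powr p" using p by (intro powr_mono2) auto
      also have "\<dots> \<le> (1 + t ^ n) * smooth (4 * a) \<zeta> x powr p + (1 + 1 / t ^ n) * ?h x powr p"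
        using tn p by (intro add_powr_le_weighted) auto
      finally show "ennreal (smooth (2 * a) \<zeta> x powr p)
        \<le> ennreal (1 + t ^ n) * ennreal (smooth (4 * a) \<zeta> x powr p) + ennreal (1 + 1 / t ^ n) * ennreal (?h x powr p)"
        using tn by (simp add: ennreal_leI flip: ennreal_mult ennreal_plus)
    qed
    also have "\<dots> = ennreal (1 + t ^ n) * I n + ennreal (1 + 1 / t ^ n) * (\<integral>\<^sup>+x. ennreal (?h x powr p) \<partial>lborel)"
      unfolding I_def a24 by (subst nn_integral_add) (auto simp: nn_integral_cmult)
    also have "\<dots> \<le> ennreal (1 + t ^ n) * I n + ennreal (1 + 1 / t ^ n) * ennreal (D * a powr (\<sigma>' * e / 2))"
      by (intro add_left_mono mult_left_mono inc a) auto
    also have "ennreal (1 + 1 / t ^ n) * ennreal (D * a powr (\<sigma>' * e / 2)) = ennreal ((1 + 1 / t ^ n) * (D * a powr (\<sigma>' * e / 2)))"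
      using tn D0 by (intro ennreal_mult[symmetric]) auto
    also have "\<dots> \<le> ennreal (2 * D * t ^ n)"
    proof (rule ennreal_leI)
      have "a powr (\<sigma>' * e / 2) \<le> ((1/2) ^ n) powr (\<sigma>' * e / 2)"
        using \<sigma>' e a24 a by (intro powr_mono2) auto
      also have "\<dots> = (1/2) powr (\<sigma>' * e / 4 * real n + \<sigma>' * e / 4 * real n)"
        by (simp add: powr_powr mult_ac flip: powr_realpow)
      also have "\<dots> = t ^ n * t ^ n"
        unfolding powr_add powr_powr[symmetric] t_def by (simp add: powr_realpow)
      finally have "(1 + 1 / t ^ n) * (D * a powr (\<sigma>' * e / 2)) \<le> (2 / t ^ n) * (D * (t ^ n * t ^ n))"
        using tn D0 by (intro mult_mono) (auto simp: field_simps)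
      also have "\<dots> = 2 * D * t ^ n" using tn by simp
      finally show "(1 + 1 / t ^ n) * (D * a powr (\<sigma>' * e / 2)) \<le> 2 * D * t ^ n" .
    qed
    finally show ?thesis by (simp add: add_left_mono)
  qed
  have fin: "I n < \<infinity>" for n
  proof (induction n)
    case 0
    then show ?case using I0 by (auto intro: le_less_trans)
  next
    case (Suc n)
    then have "ennreal (1 + t ^ n) * I n + ennreal (2 * D * t ^ n) < \<infinity>" by (simp add: ennreal_mult_less_top)
    then show ?case using step[of n] by (rule le_less_trans[rotated])
  qed
  define J where "J n = enn2real (I n)" for n
  have IJ: "I n = ennreal (J n)" for n using fin[of n] by (simp add: J_def)
  have J0: "0 \<le> J n" for n by (simp add: J_def)
  have "J (Suc n) \<le> (1 + t ^ n) * J n + 2 * D * t ^ n" for n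
  proof -
    have "ennreal (J (Suc n)) \<le> ennreal ((1 + t ^ n) * J n + 2 * D * t ^ n)"
      using step[of n] J0 t D0 unfolding IJ by (simp flip: ennreal_mult ennreal_plus)
    then show ?thesis using J0 t D0 by (subst (asm) ennreal_le_iff) (auto intro!: add_nonneg_nonneg)
  qed
  then have "J n \<le> (J 0 + 2 * D) * exp (1 / (1 - t))" for n
    using t D0 J0 by (intro bounded_of_geometric_recursion) auto
  then have "I n \<le> ennreal ((J 0 + 2 * D) * exp (1 / (1 - t)))" for n
    unfolding IJ by (rule ennreal_leI)
  then show ?thesis unfolding I_def \<zeta>_def by blast
qed

section \<open>Bilinear Fourier extension\<close>

lemma density_smooth:
  assumes \<tau>: "finite_borel_measure \<tau>" and v: "0 < v"
  shows "density lborel (\<lambda>x. ennreal (smooth v \<tau> x)) = lcomb 1 \<tau> (density lborel (gauss v))"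
proof (rule measure_eqI)
  interpret \<tau>: finite_borel_measure \<tau> by fact
  have [measurable_cong]: "sets \<tau> = sets borel" by (rule \<tau>.M_is_borel)
  note [measurable] = borel_measurable_smooth[OF \<tau>]
  interpret P: pair_sigma_finite lborel \<tau> ..
  fix X assume "X \<in> sets (density lborel (\<lambda>x. ennreal (smooth v \<tau> x)))"
  then have [measurable]: "X \<in> sets borel" by simp
  have "emeasure (density lborel (\<lambda>x. ennreal (smooth v \<tau> x))) X
    = (\<integral>\<^sup>+x. \<integral>\<^sup>+s. ennreal (gauss v (x - s)) * indicator X x \<partial>\<tau> \<partial>lborel)"
    by (simp add: emeasure_density ennreal_smooth[OF \<tau> v] nn_integral_multc)
  also have "\<dots> = (\<integral>\<^sup>+s. \<integral>\<^sup>+x. ennreal (gauss v (x - s)) * indicator X x \<partial>lborel \<partial>\<tau>)"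
    by (rule P.Fubini'[symmetric]) measurable
  also have "\<dots> = (\<integral>\<^sup>+s. \<integral>\<^sup>+y. indicator X (s + 1 * y) \<partial>density lborel (gauss v) \<partial>\<tau>)"
  proof (rule nn_integral_cong)
    fix s
    show "(\<integral>\<^sup>+x. ennreal (gauss v (x - s)) * indicator X x \<partial>lborel) = (\<integral>\<^sup>+y. indicator X (s + 1 * y) \<partial>density lborel (gauss v))"
      using nn_integral_real_affine[of "\<lambda>x. ennreal (gauss v (x - s)) * indicator X x" 1 s]
      by (simp add: nn_integral_density)
  qed
  also have "\<dots> = (\<integral>\<^sup>+z. indicator X z \<partial>lcomb 1 \<tau> (density lborel (gauss v)))"
    using v by (intro nn_integral_lcomb[symmetric] \<tau> real_distribution_imp_finite_borel real_distribution_gauss) auto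
  finally show "emeasure (density lborel (\<lambda>x. ennreal (smooth v \<tau> x))) X = emeasure (lcomb 1 \<tau> (density lborel (gauss v))) X"
    by simp
qed simp

lemma finite_borel_measure_density':
  assumes A: "real_distribution A" and f: "f \<in> borel_measurable borel" and fin: "(\<integral>\<^sup>+x. ennreal (f x) \<partial>A) < \<infinity>"
  shows "finite_borel_measure (density A (\<lambda>x. ennreal (f x)))"
proof -
  interpret real_distribution A by fact
  show ?thesis using f fin
    by (auto simp: finite_borel_measure_def finite_borel_measure_axioms_def emeasure_density intro!: finite_measureI)
qed

lemma nn_integral_smooth_lcomb_density:
  assumes A: "real_distribution A" and B: "real_distribution B"
    and f: "f \<in> borel_measurable borel" "(\<integral>\<^sup>+x. ennreal (f x) \<partial>A) < \<infinity>"
    and g: "g \<in> borel_measurable borel" "(\<integral>\<^sup>+x. ennreal (g x) \<partial>B) < \<infinity>" and v: "0 < v"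
  shows "ennreal (smooth v (lcomb 1 (density A (\<lambda>x. ennreal (f x))) (density B (\<lambda>x. ennreal (g x)))) z)
    = (\<integral>\<^sup>+p. ennreal (f (fst p)) * ennreal (g (snd p)) * ennreal (gauss v (z - (fst p + snd p))) \<partial>(A \<Otimes>\<^sub>M B))"
proof -
  interpret A: real_distribution A by fact
  interpret B: real_distribution B by fact
  note [measurable] = f(1) g(1)
  have Af: "finite_borel_measure (density A (\<lambda>x. ennreal (f x)))" and Bf: "finite_borel_measure (density B (\<lambda>x. ennreal (g x)))"
    by (intro finite_borel_measure_density' A B f g)+
  have "ennreal (smooth v (lcomb 1 (density A (\<lambda>x. ennreal (f x))) (density B (\<lambda>x. ennreal (g x)))) z)
    = (\<integral>\<^sup>+x. ennreal (f x) * (\<integral>\<^sup>+y. ennreal (g y) * ennreal (gauss v (z - (x + 1 * y))) \<partial>B) \<partial>A)"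
    unfolding ennreal_smooth[OF finite_borel_measure_lcomb[OF Af Bf] v]
    by (subst nn_integral_lcomb[OF Af Bf]) (auto simp: nn_integral_density)
  also have "\<dots> = (\<integral>\<^sup>+x. \<integral>\<^sup>+y. ennreal (f x) * ennreal (g y) * ennreal (gauss v (z - (x + y))) \<partial>B \<partial>A)"
    by (simp add: nn_integral_cmult[symmetric] mult.assoc)
  also have "\<dots> = (\<integral>\<^sup>+p. ennreal (f (fst p)) * ennreal (g (snd p)) * ennreal (gauss v (z - (fst p + snd p))) \<partial>(A \<Otimes>\<^sub>M B))"
    by (subst B.nn_integral_fst[symmetric]) auto
  finally show ?thesis .
qed

lemma nn_integral_le_1_plus_powr:
  assumes A: "real_distribution A" and f: "f \<in> borel_measurable borel" "\<And>x. 0 \<le> f x" and p: "1 < p"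
  shows "(\<integral>\<^sup>+x. ennreal (f x) \<partial>A) \<le> 1 + (\<integral>\<^sup>+x. ennreal (f x powr p) \<partial>A)"
proof -
  interpret A: real_distribution A by fact
  note [measurable] = f(1)
  have "f x \<le> 1 + f x powr p" for x
  proof (cases "f x \<le> 1")
    case False
    then have "f x powr 1 \<le> f x powr p" using p by (intro powr_mono) auto
    then show ?thesis using f(2)[of x] by simp
  qed (simp add: add_increasing2)
  then have "(\<integral>\<^sup>+x. ennreal (f x) \<partial>A) \<le> (\<integral>\<^sup>+x. 1 + ennreal (f x powr p) \<partial>A)"
    by (intro nn_integral_mono) (simp flip: ennreal_1 ennreal_plus add: ennreal_leI)
  also have "\<dots> = 1 + (\<integral>\<^sup>+x. ennreal (f x powr p) \<partial>A)"
    using A.emeasure_space_1 by (subst nn_integral_add) auto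
  finally show ?thesis .
qed

text \<open>Hoelder bounds the mollified \<open>\<tau>\<close> pointwise by the mollifications of
  \<open>\<tau>p\<close>, with known \<open>L\<^sup>1\<close> norm, and of
  \<open>lcomb 1 A B\<close>, with known norm of exponent \<open>p0\<close>. With \<open>r\<close>
  conjugate to \<open>q\<close>, interpolation with weight \<open>\<theta> = r / p\<close> requires
  \<open>p0 * (1 - \<theta>) = r * (1 - 1 / p)\<close>, and this equation determines
  \<open>p0\<close>.\<close>

theorem bilinear_extension_nonneg:
  assumes A: "real_distribution A" and B: "real_distribution B"
    and f: "f \<in> borel_measurable borel" "\<And>x. 0 \<le> f x" and g: "g \<in> borel_measurable borel" "\<And>x. 0 \<le> g x"
    and p: "1 < p" and q: "2 < q" and p0: "p0 = q * (p - 1) / (q * (p - 1) - p)" and qp: "p < q * (p - 1)"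
    and S: "0 < S" "\<And>n. (\<integral>\<^sup>+x. ennreal (smooth ((1/2) ^ n) (lcomb 1 A B) x powr p0) \<partial>lborel) \<le> ennreal S"
    and F: "0 < F" "(\<integral>\<^sup>+x. ennreal (f x powr p) \<partial>A) \<le> ennreal F"
    and G: "0 < G" "(\<integral>\<^sup>+x. ennreal (g x powr p) \<partial>B) \<le> ennreal G"
  defines "\<tau> \<equiv> lcomb 1 (density A (\<lambda>x. ennreal (f x))) (density B (\<lambda>x. ennreal (g x)))"
  shows "(\<integral>\<^sup>+t. ennreal (cmod (char \<tau> t) powr q) \<partial>lborel)
    \<le> ennreal (8 * pi * q * 2 powr (q - 2) / (q - 2) * S powr (q - 1 - q / p) * (F * G) powr (q / p))"
proof -
  interpret A: real_distribution A by fact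
  interpret B: real_distribution B by fact
  note [measurable] = f(1) g(1)
  have fint: "(\<integral>\<^sup>+x. ennreal (f x) \<partial>A) < \<infinity>" and gint: "(\<integral>\<^sup>+x. ennreal (g x) \<partial>B) < \<infinity>"
    using nn_integral_le_1_plus_powr[OF A f p] nn_integral_le_1_plus_powr[OF B g p] F(2) G(2)
    by (auto intro!: le_less_trans[where z = \<infinity>] order.trans simp: less_top[symmetric] top_unique)
  have fpint: "(\<integral>\<^sup>+x. ennreal (f x powr p) \<partial>A) < \<infinity>" and gpint: "(\<integral>\<^sup>+x. ennreal (g x powr p) \<partial>B) < \<infinity>"
    using F(2) G(2) by (auto intro: le_less_trans)
  have Af: "finite_borel_measure (density A (\<lambda>x. ennreal (f x)))" and Bf: "finite_borel_measure (density B (\<lambda>x. ennreal (g x)))"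
    by (intro finite_borel_measure_density' A B f g fint gint)+
  have Apf: "finite_borel_measure (density A (\<lambda>x. ennreal (f x powr p)))" and Bpf: "finite_borel_measure (density B (\<lambda>x. ennreal (g x powr p)))"
    by (intro finite_borel_measure_density' A B fpint gpint; measurable)+
  have \<tau>: "finite_borel_measure \<tau>" unfolding \<tau>_def by (intro finite_borel_measure_lcomb Af Bf)
  interpret \<tau>: finite_borel_measure \<tau> by (rule \<tau>)
  define \<tau>p where "\<tau>p = lcomb 1 (density A (\<lambda>x. ennreal (f x powr p))) (density B (\<lambda>x. ennreal (g x powr p)))"
  have \<tau>p: "finite_borel_measure \<tau>p" unfolding \<tau>p_def by (intro finite_borel_measure_lcomb Apf Bpf)
  define \<zeta> where "\<zeta> = lcomb 1 A B"
  have \<zeta>: "finite_borel_measure \<zeta>"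
    unfolding \<zeta>_def by (intro finite_borel_measure_lcomb A.finite_borel_measure_M B.finite_borel_measure_M)
  note [measurable] = borel_measurable_smooth[OF \<tau>] borel_measurable_smooth[OF \<tau>p] borel_measurable_smooth[OF \<zeta>]
  define r where "r = q / (q - 1)"
  define \<theta> where "\<theta> = r / p"
  have r: "1 < r" using q by (simp add: r_def field_simps)
  have \<theta>: "0 < \<theta>" "\<theta> < 1" using q p qp by (auto simp: \<theta>_def r_def field_simps)
  have den: "0 < q * (p - 1) - p" using qp by simp
  have ex: "p0 * (1 - \<theta>) = r * (1 - 1 / p)"
  proof -
    have "1 - \<theta> = (q * (p - 1) - p) / (p * (q - 1))" using q p by (simp add: \<theta>_def r_def field_simps)
    then have "p0 * (1 - \<theta>) = q * (p - 1) / (p * (q - 1))" using den p0 by simp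
    also have "\<dots> = r * (1 - 1 / p)" using p q by (simp add: r_def field_simps)
    finally show ?thesis .
  qed
  have \<theta>q: "\<theta> * (q - 1) = q / p" "(1 - \<theta>) * (q - 1) = q - 1 - q / p"
    using q p by (auto simp: \<theta>_def r_def field_simps)
  have point: "smooth v \<tau> z \<le> smooth v \<tau>p z powr (1 / p) * smooth v \<zeta> z powr (1 - 1 / p)" if v: "0 < v" for v z
  proof -
    define N where "N = density (A \<Otimes>\<^sub>M B) (\<lambda>w. ennreal (gauss v (z - (fst w + snd w))))"
    have "ennreal (smooth v \<tau> z) = (\<integral>\<^sup>+w. ennreal (f (fst w)) * ennreal (g (snd w)) * ennreal (gauss v (z - (fst w + snd w))) \<partial>(A \<Otimes>\<^sub>M B))"
      unfolding \<tau>_def by (intro nn_integral_smooth_lcomb_density A B f g fint gint v)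
    also have "\<dots> = (\<integral>\<^sup>+w. ennreal ((f (fst w) powr p * g (snd w) powr p) powr (1 / p) * 1 powr (1 - 1 / p)) \<partial>N)"
      unfolding N_def using f(2) g(2) p
      by (subst nn_integral_density) (auto intro!: nn_integral_cong simp: powr_mult powr_powr ennreal_mult mult_ac)
    also have "\<dots> \<le> ennreal (smooth v \<tau>p z powr (1 / p) * smooth v \<zeta> z powr (1 - 1 / p))"
    proof (rule nn_integral_powr_Hoelder)
      have "ennreal (smooth v \<tau>p z) = (\<integral>\<^sup>+w. ennreal (f (fst w) powr p) * ennreal (g (snd w) powr p) * ennreal (gauss v (z - (fst w + snd w))) \<partial>(A \<Otimes>\<^sub>M B))"
        unfolding \<tau>p_def by (intro nn_integral_smooth_lcomb_density A B fpint gpint v; measurable)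
      also have "\<dots> = (\<integral>\<^sup>+w. ennreal (f (fst w) powr p * g (snd w) powr p) \<partial>N)"
        unfolding N_def by (subst nn_integral_density) (auto intro!: nn_integral_cong simp: ennreal_mult mult_ac)
      finally show "(\<integral>\<^sup>+w. ennreal (f (fst w) powr p * g (snd w) powr p) \<partial>N) \<le> ennreal (smooth v \<tau>p z)" by simp
      have "ennreal (smooth v \<zeta> z) = (\<integral>\<^sup>+w. ennreal 1 * ennreal 1 * ennreal (gauss v (z - (fst w + snd w))) \<partial>(A \<Otimes>\<^sub>M B))"
        using nn_integral_smooth_lcomb_density[OF A B, of "\<lambda>_. 1" "\<lambda>_. 1" v z] v A.emeasure_space_1 B.emeasure_space_1
        unfolding \<zeta>_def by (simp add: density_1)
      also have "\<dots> = (\<integral>\<^sup>+w. ennreal 1 \<partial>N)"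
        unfolding N_def by (subst nn_integral_density) auto
      finally show "(\<integral>\<^sup>+w. ennreal 1 \<partial>N) \<le> ennreal (smooth v \<zeta> z)" by simp
    qed (use p in \<open>auto simp: N_def\<close>)
    finally show ?thesis by (subst (asm) ennreal_le_iff) auto
  qed
  have Ap: "(\<integral>\<^sup>+x. ennreal (smooth v \<tau>p x) \<partial>lborel) \<le> ennreal (F * G)" if v: "0 < v" for v
  proof -
    have "(\<integral>\<^sup>+x. ennreal (smooth v \<tau>p x) \<partial>lborel) = (\<integral>\<^sup>+x. ennreal (f x powr p) \<partial>A) * (\<integral>\<^sup>+x. ennreal (g x powr p) \<partial>B)"
      unfolding nn_integral_smooth[OF \<tau>p v] unfolding \<tau>p_def emeasure_lcomb_UNIV[OF Apf Bpf]
      by (simp add: emeasure_density)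
    also have "\<dots> \<le> ennreal F * ennreal G" by (intro mult_mono F G) auto
    finally show ?thesis using F G by (simp add: ennreal_mult)
  qed
  define I where "I = (F * G) powr \<theta> * S powr (1 - \<theta>)"
  have I0: "0 < I" using F G S by (simp add: I_def)
  define K where "K = 8 * pi * q * 2 powr (q - 2) / (q - 2)"
  have HY: "(\<integral>\<^sup>+t. ennreal ((cmod (char \<tau> t) * exp (- ((1/2) ^ n * t\<^sup>2 / 2))) powr q) \<partial>lborel) \<le> ennreal (K * I powr (q - 1))" for n
  proof -
    define v where "v = (1/2::real) ^ n"
    have v: "0 < v" by (simp add: v_def)
    have "(\<integral>\<^sup>+x. ennreal (smooth v \<tau> x powr r) \<partial>lborel) \<le> (\<integral>\<^sup>+x. ennreal (smooth v \<tau>p x powr \<theta> * (smooth v \<zeta> x powr p0) powr (1 - \<theta>)) \<partial>lborel)"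
    proof (intro nn_integral_mono ennreal_leI)
      fix x
      have "smooth v \<tau> x powr r \<le> (smooth v \<tau>p x powr (1 / p) * smooth v \<zeta> x powr (1 - 1 / p)) powr r"
        using r by (intro powr_mono2 point v) auto
      also have "\<dots> = smooth v \<tau>p x powr \<theta> * (smooth v \<zeta> x powr p0) powr (1 - \<theta>)"
        using ex unfolding \<theta>_def by (simp add: powr_mult powr_powr mult.commute[of _ r])
      finally show "smooth v \<tau> x powr r \<le> smooth v \<tau>p x powr \<theta> * (smooth v \<zeta> x powr p0) powr (1 - \<theta>)" .
    qed
    also have "\<dots> \<le> ennreal I"
      unfolding I_def using F G S S(2)[of n, folded v_def \<zeta>_def] Ap[OF v]
      by (intro nn_integral_powr_Hoelder \<theta>) auto
    finally have Fr: "(\<integral>\<^sup>+x. ennreal (smooth v \<tau> x powr r) \<partial>lborel) \<le> ennreal I" .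
    have F1: "(\<integral>\<^sup>+x. ennreal (smooth v \<tau> x) \<partial>lborel) < \<infinity>"
      unfolding nn_integral_smooth[OF \<tau> v] by (simp add: \<tau>.emeasure_eq_measure)
    have "(\<integral>\<^sup>+t. ennreal (cmod (char (density lborel (\<lambda>x. ennreal (smooth v \<tau> x))) t) powr q) \<partial>lborel) \<le> ennreal (K * I powr (q - 1))"
      unfolding K_def by (rule Hausdorff_Young[OF _ _ F1 q r_def I0 Fr]) auto
    moreover have "cmod (char (density lborel (\<lambda>x. ennreal (smooth v \<tau> x))) t) = cmod (char \<tau> t) * exp (- (v * t\<^sup>2 / 2))" for t
      unfolding density_smooth[OF \<tau> v]
      by (subst char_lcomb[OF \<tau> real_distribution_imp_finite_borel[OF real_distribution_gauss[OF v]]])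
         (simp add: char_gauss[OF v] norm_mult)
    ultimately show ?thesis by (simp add: v_def)
  qed
  \<comment> \<open>As the mollification is removed, the Gaussian factor of the transform tends to
    1, and Fatou's lemma keeps the bound.\<close>
  have lim: "(\<lambda>n. ennreal ((cmod (char \<tau> t) * exp (- ((1/2) ^ n * t\<^sup>2 / 2))) powr q)) \<longlonglongrightarrow> ennreal (cmod (char \<tau> t) powr q)" for t
  proof -
    have "(\<lambda>n. (1/2::real) ^ n) \<longlonglongrightarrow> 0" by (intro LIMSEQ_realpow_zero) auto
    then have "(\<lambda>n. (cmod (char \<tau> t) * exp (- ((1/2) ^ n * t\<^sup>2 / 2))) powr q) \<longlonglongrightarrow> (cmod (char \<tau> t) * exp (- (0 * t\<^sup>2 / 2))) powr q"
      using q by (intro tendsto_powr' tendsto_mult tendsto_exp tendsto_minus tendsto_divide tendsto_const) auto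
    then show ?thesis by (intro tendsto_ennrealI) simp
  qed
  have "(\<integral>\<^sup>+t. ennreal (cmod (char \<tau> t) powr q) \<partial>lborel)
    = (\<integral>\<^sup>+t. liminf (\<lambda>n. ennreal ((cmod (char \<tau> t) * exp (- ((1/2) ^ n * t\<^sup>2 / 2))) powr q)) \<partial>lborel)"
    by (intro nn_integral_cong lim_imp_Liminf[symmetric] lim) auto
  also have "\<dots> \<le> liminf (\<lambda>n. \<integral>\<^sup>+t. ennreal ((cmod (char \<tau> t) * exp (- ((1/2) ^ n * t\<^sup>2 / 2))) powr q) \<partial>lborel)"
    using \<tau>.borel_measurable_char by (intro nn_integral_liminf) auto
  also have "\<dots> \<le> liminf (\<lambda>n::nat. ennreal (K * I powr (q - 1)))"
    by (intro Liminf_mono always_eventually allI HY)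
  also have "\<dots> = ennreal (K * I powr (q - 1))" by (simp add: Liminf_const)
  also have "K * I powr (q - 1) = K * S powr (q - 1 - q / p) * (F * G) powr (q / p)"
    by (simp add: I_def powr_mult powr_powr \<theta>q)
  finally show ?thesis by (simp add: K_def)
qed

section \<open>Complex-valued functions and the Fourier normalisation\<close>

lemma fourier_eq_char_density:
  assumes A: "real_distribution A" and f: "f \<in> borel_measurable borel" "\<And>x. 0 \<le> f x"
  shows "fourier A (\<lambda>x. of_real (f x)) \<xi> = char (density A (\<lambda>x. ennreal (f x))) (- (2 * pi * \<xi>))"
proof -
  interpret A: real_distribution A by fact
  note [measurable] = f(1)
  have "char (density A (\<lambda>x. ennreal (f x))) (- (2 * pi * \<xi>)) = (\<integral>x. f x *\<^sub>R iexp (- (2 * pi * \<xi>) * x) \<partial>A)"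
    unfolding char_def using f(2) by (subst integral_density) auto
  then show ?thesis
    unfolding fourier_def by (simp add: scaleR_conv_of_real mult_ac)
qed

lemma borel_measurable_fourier:
  assumes A: "real_distribution A" and f: "f \<in> borel_measurable borel"
  shows "fourier A f \<in> borel_measurable borel"
proof -
  interpret A: real_distribution A by fact
  note [measurable] = f
  show ?thesis unfolding fourier_def[abs_def] by measurable
qed

lemma Lp_space_finite:
  assumes A: "real_distribution A" and p: "1 < p" and f: "f \<in> Lp_space (ennreal p) A"
  obtains F where "0 \<le> F" "f \<in> borel_measurable borel" "(\<integral>\<^sup>+x. ennreal (cmod (f x) powr p) \<partial>A) = ennreal F"
    "Lp_norm (ennreal p) A f = ennreal (F powr (1 / p))" "integrable A (\<lambda>x. cmod (f x))"
proof -
  interpret A: real_distribution A by fact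
  have fm [measurable]: "f \<in> borel_measurable borel" using f by (simp add: Lp_space_def cong: measurable_cong_sets)
  have fin: "Lp_norm (ennreal p) A f < \<infinity>" using f by (simp add: Lp_space_def)
  have pp: "enn2real (ennreal p) = p" using p by simp
  define I where "I = (\<integral>\<^sup>+x. ennreal (cmod (f x) powr p) \<partial>A)"
  have norm: "Lp_norm (ennreal p) A f = ennpowr I (1 / p)" using pp by (simp add: Lp_norm_def I_def)
  have "I \<noteq> \<infinity>" using fin unfolding norm by (auto simp: ennpowr_def)
  then obtain F where F: "0 \<le> F" "I = ennreal F" by (cases I) auto
  have "(\<integral>\<^sup>+x. ennreal (cmod (f x)) \<partial>A) \<le> 1 + I"
    unfolding I_def by (rule nn_integral_le_1_plus_powr[OF A _ _ p]) auto
  also have "\<dots> < \<infinity>" using F by simp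
  finally have "integrable A (\<lambda>x. cmod (f x))" by (intro integrableI_nonneg) auto
  moreover have "Lp_norm (ennreal p) A f = ennreal (F powr (1 / p))"
    unfolding norm F(2) using F(1) by (simp add: ennpowr_def)
  ultimately show ?thesis using that F fm unfolding I_def by blast
qed

text \<open>On a probability space the \<open>L\<^sup>1\<close> norm, which bounds the transform, is
  at most the \<open>L\<^sup>p\<close> norm.\<close>

lemma cmod_fourier_le:
  assumes A: "real_distribution A" and p: "1 < p" and f: "f \<in> Lp_space (ennreal p) A"
  shows "ennreal (cmod (fourier A f \<xi>)) \<le> Lp_norm (ennreal p) A f"
proof -
  interpret A: real_distribution A by fact
  obtain F where F: "0 \<le> F" "f \<in> borel_measurable borel" "(\<integral>\<^sup>+x. ennreal (cmod (f x) powr p) \<partial>A) = ennreal F"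
    "Lp_norm (ennreal p) A f = ennreal (F powr (1 / p))" "integrable A (\<lambda>x. cmod (f x))"
    using Lp_space_finite[OF A p f] .
  have "cmod (fourier A f \<xi>) \<le> (\<integral>x. cmod (f x * exp (- 2 * of_real pi * \<i> * of_real x * of_real \<xi>)) \<partial>A)"
    unfolding fourier_def by (rule integral_norm_bound)
  also have "\<dots> = (\<integral>x. cmod (f x) \<partial>A)" by (simp add: norm_mult)
  finally have le: "cmod (fourier A f \<xi>) \<le> (\<integral>x. cmod (f x) \<partial>A)" .
  have "ennreal ((\<integral>x. cmod (f x) \<partial>A) powr p) \<le> ennreal F"
    using powr_integral_le_nn_integral_powr[OF A.finite_measure_axioms F(5), of p] p F(3) A.prob_space by simp
  then have "(\<integral>x. cmod (f x) \<partial>A) powr p \<le> F" using F(1) by simp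
  then have "((\<integral>x. cmod (f x) \<partial>A) powr p) powr (1 / p) \<le> F powr (1 / p)"
    using p by (intro powr_mono2) auto
  then have "(\<integral>x. cmod (f x) \<partial>A) \<le> F powr (1 / p)" using p by (simp add: powr_powr integral_nonneg)
  then show ?thesis unfolding F(4) using le by (intro ennreal_leI) linarith
qed

lemma bilinear_extension_infinity:
  assumes A: "real_distribution A" and B: "real_distribution B" and p: "1 < p"
    and f: "f \<in> Lp_space (ennreal p) A" and g: "g \<in> Lp_space (ennreal p) B"
  shows "Lp_norm \<infinity> lborel (\<lambda>\<xi>. fourier A f \<xi> * fourier B g \<xi>) \<le> Lp_norm (ennreal p) A f * Lp_norm (ennreal p) B g"
proof -
  have "f \<in> borel_measurable borel" "g \<in> borel_measurable borel"
    using Lp_space_finite[OF A p f] Lp_space_finite[OF B p g] by metis+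
  note [measurable] = borel_measurable_fourier[OF A this(1)] borel_measurable_fourier[OF B this(2)]
  have "ennreal (cmod (fourier A f \<xi> * fourier B g \<xi>)) \<le> Lp_norm (ennreal p) A f * Lp_norm (ennreal p) B g" for \<xi>
    unfolding norm_mult by (subst ennreal_mult) (auto intro!: mult_mono cmod_fourier_le A B p f g)
  then show ?thesis unfolding Lp_norm_def by (auto intro!: esssup_I)
qed

text \<open>The positive part of the component of \<open>z\<close> in the direction
  \<open>\<i> ^ a\<close>: for \<open>a = 0, 1, 2, 3\<close> these are the positive parts of
  \<open>Re z\<close>, \<open>Im z\<close>, \<open>- Re z\<close> and \<open>- Im z\<close>.\<close>

definition quarter :: "nat \<Rightarrow> complex \<Rightarrow> real" where
  "quarter a z = max 0 (Re ((- \<i>) ^ a * z))"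

lemma quarter_nonneg [simp]: "0 \<le> quarter a z"
  by (simp add: quarter_def)

lemma quarter_le: "quarter a z \<le> cmod z"
proof -
  have "Re ((- \<i>) ^ a * z) \<le> cmod ((- \<i>) ^ a * z)" by (rule complex_Re_le_cmod)
  then show ?thesis by (simp add: quarter_def norm_mult norm_power)
qed

lemma sum_quarter: "(\<Sum>a<4. \<i> ^ a * of_real (quarter a z)) = z"
  by (simp add: quarter_def numeral_eq_Suc complex_eq_iff max_def)

lemma borel_measurable_quarter [measurable]: "quarter a \<in> borel_measurable borel"
  unfolding quarter_def[abs_def] by measurable

lemma fourier_sum_quarter:
  assumes A: "real_distribution A" and f: "f \<in> borel_measurable borel" and int: "integrable A (\<lambda>x. cmod (f x))"
  shows "fourier A f \<xi> = (\<Sum>a<4. \<i> ^ a * fourier A (\<lambda>x. of_real (quarter a (f x))) \<xi>)"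
proof -
  interpret A: real_distribution A by fact
  note [measurable] = f
  let ?e = "\<lambda>x. exp (- 2 * of_real pi * \<i> * of_real x * of_real \<xi>)"
  have ie: "integrable A (\<lambda>x. of_real (quarter a (f x)) * ?e x)" for a
    by (rule Bochner_Integration.integrable_bound[OF int]) (auto simp: norm_mult quarter_le)
  have "fourier A f \<xi> = (\<integral>x. (\<Sum>a<4. \<i> ^ a * (of_real (quarter a (f x)) * ?e x)) \<partial>A)"
    unfolding fourier_def
  proof (intro Bochner_Integration.integral_cong refl)
    fix x
    have "f x * ?e x = (\<Sum>a<4. \<i> ^ a * of_real (quarter a (f x))) * ?e x" unfolding sum_quarter ..
    then show "f x * ?e x = (\<Sum>a<4. \<i> ^ a * (of_real (quarter a (f x)) * ?e x))"
      by (simp only: sum_distrib_right mult.assoc)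
  qed
  also have "\<dots> = (\<Sum>a<4. \<i> ^ a * (\<integral>x. of_real (quarter a (f x)) * ?e x \<partial>A))"
    using ie by (subst Bochner_Integration.integral_sum) auto
  finally show ?thesis by (simp add: fourier_def)
qed

lemma ennpowr_le:
  assumes "x \<le> ennreal X" "0 \<le> X" "0 \<le> b"
  shows "ennpowr x b \<le> ennreal (X powr b)"
proof -
  obtain y where y: "x = ennreal y" "0 \<le> y" using assms(1) by (cases x) (auto simp: top_unique)
  then have "y \<le> X" using assms by simp
  then show ?thesis using y assms by (auto simp: ennpowr_def intro!: ennreal_leI powr_mono2)
qed

text \<open>Each function is a combination of four nonnegative functions with unimodular
  coefficients, so the nonnegative case is applied to sixteen pairs.\<close>

theorem bilinear_extension:
  assumes A: "real_distribution A" and B: "real_distribution B"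
    and p: "1 < p" and q: "2 < q" and p0: "p0 = q * (p - 1) / (q * (p - 1) - p)" and qp: "p < q * (p - 1)"
    and S: "\<And>n. (\<integral>\<^sup>+x. ennreal (smooth ((1/2) ^ n) (lcomb 1 A B) x powr p0) \<partial>lborel) \<le> ennreal S"
  shows "\<exists>C::real. C > 0 \<and> (\<forall>f \<in> Lp_space (ennreal p) A. \<forall>g \<in> Lp_space (ennreal p) B.
    Lp_norm (ennreal q) lborel (\<lambda>\<xi>. fourier A f \<xi> * fourier B g \<xi>)
      \<le> ennreal C * Lp_norm (ennreal p) A f * Lp_norm (ennreal p) B g)"
proof -
  define S' where "S' = max 1 S"
  have S': "0 < S'" "(\<integral>\<^sup>+x. ennreal (smooth ((1/2) ^ n) (lcomb 1 A B) x powr p0) \<partial>lborel) \<le> ennreal S'" for n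
    using S[of n] by (auto simp: S'_def intro: order.trans[OF _ ennreal_leI])
  define K where "K = 8 * pi * q * 2 powr (q - 2) / (q - 2) * S' powr (q - 1 - q / p)"
  have K: "0 < K" using q S' by (auto simp: K_def intro!: mult_pos_pos divide_pos_pos)
  define K' where "K' = 16 powr q * K"
  have K': "0 < K'" using K by (simp add: K'_def)
  have main: "Lp_norm (ennreal q) lborel (\<lambda>\<xi>. fourier A f \<xi> * fourier B g \<xi>)
      \<le> ennreal (K' powr (1 / q)) * Lp_norm (ennreal p) A f * Lp_norm (ennreal p) B g"
    if f: "f \<in> Lp_space (ennreal p) A" and g: "g \<in> Lp_space (ennreal p) B" for f g
  proof -
    obtain F where F: "0 \<le> F" "f \<in> borel_measurable borel" "(\<integral>\<^sup>+x. ennreal (cmod (f x) powr p) \<partial>A) = ennreal F"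
      "Lp_norm (ennreal p) A f = ennreal (F powr (1 / p))" "integrable A (\<lambda>x. cmod (f x))"
      using Lp_space_finite[OF A p f] .
    obtain G where G: "0 \<le> G" "g \<in> borel_measurable borel" "(\<integral>\<^sup>+x. ennreal (cmod (g x) powr p) \<partial>B) = ennreal G"
      "Lp_norm (ennreal p) B g = ennreal (G powr (1 / p))" "integrable B (\<lambda>x. cmod (g x))"
      using Lp_space_finite[OF B p g] .
    note [measurable] = F(2) G(2)
    define \<phi> where "\<phi> a \<xi> = fourier A (\<lambda>x. of_real (quarter a (f x))) \<xi>" for a \<xi>
    define \<psi> where "\<psi> b \<xi> = fourier B (\<lambda>x. of_real (quarter b (g x))) \<xi>" for b \<xi>
    have [measurable]: "\<phi> a \<in> borel_measurable borel" "\<psi> a \<in> borel_measurable borel" for a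
      unfolding \<phi>_def[abs_def] \<psi>_def[abs_def] by (intro borel_measurable_fourier A B; measurable)+
    have piece: "(\<integral>\<^sup>+\<xi>. ennreal (cmod (\<phi> a \<xi> * \<psi> b \<xi>) powr q) \<partial>lborel) \<le> ennreal (K * (F * G) powr (q / p))" for a b
    proof -
      define \<tau> where "\<tau> = lcomb 1 (density A (\<lambda>x. ennreal (quarter a (f x)))) (density B (\<lambda>x. ennreal (quarter b (g x))))"
      define h where "h t = ennreal (cmod (char \<tau> t) powr q)" for t
      have fa: "(\<integral>\<^sup>+x. ennreal (quarter a (f x) powr p) \<partial>A) \<le> ennreal F"
        unfolding F(3)[symmetric] using p by (intro nn_integral_mono ennreal_leI powr_mono2 quarter_le) auto
      have gb: "(\<integral>\<^sup>+x. ennreal (quarter b (g x) powr p) \<partial>B) \<le> ennreal G"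
        unfolding G(3)[symmetric] using p by (intro nn_integral_mono ennreal_leI powr_mono2 quarter_le) auto
      have fin: "(\<integral>\<^sup>+x. ennreal (quarter a (f x)) \<partial>A) < \<infinity>" "(\<integral>\<^sup>+x. ennreal (quarter b (g x)) \<partial>B) < \<infinity>"
      proof -
        have "(\<integral>\<^sup>+x. ennreal (quarter a (f x)) \<partial>A) \<le> 1 + (\<integral>\<^sup>+x. ennreal (quarter a (f x) powr p) \<partial>A)"
          by (rule nn_integral_le_1_plus_powr[OF A _ _ p]) auto
        also have "\<dots> \<le> 1 + ennreal F" by (intro add_left_mono fa)
        finally show "(\<integral>\<^sup>+x. ennreal (quarter a (f x)) \<partial>A) < \<infinity>" by (rule le_less_trans) simp
        have "(\<integral>\<^sup>+x. ennreal (quarter b (g x)) \<partial>B) \<le> 1 + (\<integral>\<^sup>+x. ennreal (quarter b (g x) powr p) \<partial>B)"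
          by (rule nn_integral_le_1_plus_powr[OF B _ _ p]) auto
        also have "\<dots> \<le> 1 + ennreal G" by (intro add_left_mono gb)
        finally show "(\<integral>\<^sup>+x. ennreal (quarter b (g x)) \<partial>B) < \<infinity>" by (rule le_less_trans) simp
      qed
      have Af: "finite_borel_measure (density A (\<lambda>x. ennreal (quarter a (f x))))"
        and Bf: "finite_borel_measure (density B (\<lambda>x. ennreal (quarter b (g x))))"
        by (intro finite_borel_measure_density' A B fin; measurable)+
      have \<tau>f: "finite_borel_measure \<tau>" unfolding \<tau>_def by (intro finite_borel_measure_lcomb Af Bf)
      have [measurable]: "h \<in> borel_measurable borel"
        unfolding h_def using finite_borel_measure.borel_measurable_char[OF \<tau>f] by measurable
      have eq: "ennreal (cmod (\<phi> a \<xi> * \<psi> b \<xi>) powr q) = h (0 + (- 2 * pi) * \<xi>)" for \<xi>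
        unfolding h_def \<tau>_def \<phi>_def \<psi>_def char_lcomb[OF Af Bf]
        by (simp add: fourier_eq_char_density A B)
      have "(\<integral>\<^sup>+\<xi>. ennreal (cmod (\<phi> a \<xi> * \<psi> b \<xi>) powr q) \<partial>lborel) = 1 * (\<integral>\<^sup>+\<xi>. h (0 + (- 2 * pi) * \<xi>) \<partial>lborel)"
        unfolding eq by simp
      \<comment> \<open>The substitution \<open>t = - 2 * pi * \<xi>\<close> has Jacobian at least
        1, so its factor may be inserted at the cost of an inequality.\<close>
      also have "\<dots> \<le> ennreal \<bar>- 2 * pi\<bar> * (\<integral>\<^sup>+\<xi>. h (0 + (- 2 * pi) * \<xi>) \<partial>lborel)"
        using pi_gt3 by (intro mult_right_mono) (auto simp flip: ennreal_1 intro!: ennreal_leI)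
      also have "\<dots> = (\<integral>\<^sup>+t. h t \<partial>lborel)"
        by (rule nn_integral_real_affine[symmetric]) auto
      finally have le: "(\<integral>\<^sup>+\<xi>. ennreal (cmod (\<phi> a \<xi> * \<psi> b \<xi>) powr q) \<partial>lborel) \<le> (\<integral>\<^sup>+t. h t \<partial>lborel)" .
      \<comment> \<open>The nonnegative case asks for positive bounds, so \<open>F\<close> and
        \<open>G\<close> are increased by \<open>1 / (n + 1)\<close> before passing to the
        limit.\<close>
      have eps: "(\<integral>\<^sup>+t. h t \<partial>lborel) \<le> ennreal (K * ((F + inverse (real (Suc n))) * (G + inverse (real (Suc n)))) powr (q / p))" for n
        unfolding h_def \<tau>_def K_def
      proof (rule bilinear_extension_nonneg[OF A B _ _ _ _ p q p0 qp S'(1) S'(2)])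
        show "0 < F + inverse (real (Suc n))" "0 < G + inverse (real (Suc n))" using F(1) G(1) by (auto intro!: add_nonneg_pos)
        show "(\<integral>\<^sup>+x. ennreal (quarter a (f x) powr p) \<partial>A) \<le> ennreal (F + inverse (real (Suc n)))"
          by (rule order.trans[OF fa]) (intro ennreal_leI, simp)
        show "(\<integral>\<^sup>+x. ennreal (quarter b (g x) powr p) \<partial>B) \<le> ennreal (G + inverse (real (Suc n)))"
          by (rule order.trans[OF gb]) (intro ennreal_leI, simp)
      qed auto
      have "(\<lambda>n. ((F + inverse (real (Suc n))) * (G + inverse (real (Suc n)))) powr (q / p)) \<longlonglongrightarrow> ((F + 0) * (G + 0)) powr (q / p)"
        using p q F(1) G(1)
        by (intro tendsto_powr' tendsto_mult tendsto_add tendsto_const LIMSEQ_inverse_real_of_nat)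
           (auto intro!: always_eventually mult_nonneg_nonneg add_nonneg_nonneg)
      then have "(\<lambda>n. ennreal (K * ((F + inverse (real (Suc n))) * (G + inverse (real (Suc n)))) powr (q / p))) \<longlonglongrightarrow> ennreal (K * (F * G) powr (q / p))"
        by (intro tendsto_ennrealI tendsto_mult_left) simp
      then have "(\<integral>\<^sup>+t. h t \<partial>lborel) \<le> ennreal (K * (F * G) powr (q / p))"
        using eps by (intro LIMSEQ_le_const) auto
      with le show ?thesis by (rule order.trans)
    qed
    have sum_le: "cmod (fourier A f \<xi> * fourier B g \<xi>) \<le> (\<Sum>(a, b)\<in>{..<4} \<times> {..<4}. cmod (\<phi> a \<xi> * \<psi> b \<xi>))" for \<xi>
    proof -
      have "cmod (fourier A f \<xi>) \<le> (\<Sum>a<4. cmod (\<phi> a \<xi>))"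
        unfolding fourier_sum_quarter[OF A F(2,5)] \<phi>_def
        by (rule order.trans[OF norm_sum]) (simp add: norm_mult norm_power)
      moreover have "cmod (fourier B g \<xi>) \<le> (\<Sum>b<4. cmod (\<psi> b \<xi>))"
        unfolding fourier_sum_quarter[OF B G(2,5)] \<psi>_def
        by (rule order.trans[OF norm_sum]) (simp add: norm_mult norm_power)
      ultimately have "cmod (fourier A f \<xi>) * cmod (fourier B g \<xi>) \<le> (\<Sum>a<4. cmod (\<phi> a \<xi>)) * (\<Sum>b<4. cmod (\<psi> b \<xi>))"
        by (intro mult_mono) (auto intro: sum_nonneg)
      then show ?thesis by (simp add: norm_mult sum_product sum.cartesian_product)
    qed
    have powr_le: "cmod (fourier A f \<xi> * fourier B g \<xi>) powr q
      \<le> 16 powr (q - 1) * (\<Sum>(a, b)\<in>{..<4} \<times> {..<4}. cmod (\<phi> a \<xi> * \<psi> b \<xi>) powr q)" for \<xi>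
    proof -
      have "cmod (fourier A f \<xi> * fourier B g \<xi>) powr q \<le> (\<Sum>z\<in>{..<4} \<times> {..<4}. case z of (a, b) \<Rightarrow> cmod (\<phi> a \<xi> * \<psi> b \<xi>)) powr q"
        using q sum_le[of \<xi>] by (intro powr_mono2) auto
      also have "\<dots> \<le> real (card ({..<4::nat} \<times> {..<4::nat})) powr (q - 1) * (\<Sum>z\<in>{..<4} \<times> {..<4}. (case z of (a, b) \<Rightarrow> cmod (\<phi> a \<xi> * \<psi> b \<xi>)) powr q)"
        using q by (intro sum_powr_le_card_powr) auto
      also have "(\<Sum>z\<in>{..<4} \<times> {..<4}. (case z of (a, b) \<Rightarrow> cmod (\<phi> a \<xi> * \<psi> b \<xi>)) powr q) = (\<Sum>(a, b)\<in>{..<4} \<times> {..<4}. cmod (\<phi> a \<xi> * \<psi> b \<xi>) powr q)"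
        by (intro sum.cong) auto
      finally show ?thesis by (simp add: card_cartesian_product)
    qed
    have "(\<integral>\<^sup>+\<xi>. ennreal (cmod (fourier A f \<xi> * fourier B g \<xi>) powr q) \<partial>lborel)
      \<le> (\<integral>\<^sup>+\<xi>. ennreal (16 powr (q - 1)) * (\<Sum>z\<in>{..<4} \<times> {..<4}. ennreal (cmod (\<phi> (fst z) \<xi> * \<psi> (snd z) \<xi>) powr q)) \<partial>lborel)"
    proof (rule nn_integral_mono)
      fix \<xi>
      have "ennreal (cmod (fourier A f \<xi> * fourier B g \<xi>) powr q)
        \<le> ennreal (16 powr (q - 1) * (\<Sum>z\<in>{..<4} \<times> {..<4}. cmod (\<phi> (fst z) \<xi> * \<psi> (snd z) \<xi>) powr q))"
        using powr_le[of \<xi>] by (intro ennreal_leI) (simp add: case_prod_beta)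
      then show "ennreal (cmod (fourier A f \<xi> * fourier B g \<xi>) powr q)
        \<le> ennreal (16 powr (q - 1)) * (\<Sum>z\<in>{..<4} \<times> {..<4}. ennreal (cmod (\<phi> (fst z) \<xi> * \<psi> (snd z) \<xi>) powr q))"
        by (simp add: ennreal_mult sum_nonneg)
    qed
    also have "\<dots> = ennreal (16 powr (q - 1)) * (\<Sum>z\<in>{..<4} \<times> {..<4}. \<integral>\<^sup>+\<xi>. ennreal (cmod (\<phi> (fst z) \<xi> * \<psi> (snd z) \<xi>) powr q) \<partial>lborel)"
      by (subst nn_integral_cmult) (auto simp: nn_integral_sum simp del: sum_ennreal)
    also have "\<dots> \<le> ennreal (16 powr (q - 1)) * (\<Sum>z\<in>{..<4::nat} \<times> {..<4::nat}. ennreal (K * (F * G) powr (q / p)))"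
      by (intro mult_left_mono sum_mono piece) auto
    also have "\<dots> = ennreal (16 powr (q - 1) * (\<Sum>z\<in>{..<4::nat} \<times> {..<4::nat}. K * (F * G) powr (q / p)))"
      using K by (subst sum_ennreal) (auto simp flip: ennreal_mult)
    also have "16 powr (q - 1) * (\<Sum>z\<in>{..<4::nat} \<times> {..<4::nat}. K * (F * G) powr (q / p)) = K' * (F * G) powr (q / p)"
      by (simp add: K'_def powr_diff card_cartesian_product)
    finally have int_le: "(\<integral>\<^sup>+\<xi>. ennreal (cmod (fourier A f \<xi> * fourier B g \<xi>) powr q) \<partial>lborel) \<le> ennreal (K' * (F * G) powr (q / p))" .
    have "Lp_norm (ennreal q) lborel (\<lambda>\<xi>. fourier A f \<xi> * fourier B g \<xi>)
      = ennpowr (\<integral>\<^sup>+\<xi>. ennreal (cmod (fourier A f \<xi> * fourier B g \<xi>) powr q) \<partial>lborel) (1 / q)"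
      using q by (simp add: Lp_norm_def)
    also have "\<dots> \<le> ennreal ((K' * (F * G) powr (q / p)) powr (1 / q))"
      using q K' by (intro ennpowr_le[OF int_le]) auto
    also have "(K' * (F * G) powr (q / p)) powr (1 / q) = K' powr (1 / q) * F powr (1 / p) * G powr (1 / p)"
      using q K' by (simp add: powr_mult powr_powr)
    also have "ennreal \<dots> = ennreal (K' powr (1 / q)) * Lp_norm (ennreal p) A f * Lp_norm (ennreal p) B g"
      unfolding F(4) G(4) by (simp add: ennreal_mult)
    finally show ?thesis .
  qed
  have "0 < K' powr (1 / q)" using K' by simp
  then show ?thesis using main by blast
qed

section \<open>Convolutions of separated self-similar measures\<close>

lemma char_digit_law:
  assumes "finite (set_pmf \<rho>)"
  shows "char (digit_law \<rho>) t = (\<Sum>x\<in>set_pmf \<rho>. of_real (pmf \<rho> x) * iexp (t * x))"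
proof -
  have "char (digit_law \<rho>) t = measure_pmf.expectation \<rho> (\<lambda>x. iexp (t * x))"
    unfolding char_def digit_law_def by (subst integral_distr) auto
  also have "\<dots> = (\<Sum>x\<in>set_pmf \<rho>. of_real (pmf \<rho> x) * iexp (t * x))"
    by (subst integral_measure_pmf[OF assms]) (auto simp: scaleR_conv_of_real)
  finally show ?thesis .
qed

lemma cos_le_if_int_dist_ge:
  assumes "0 \<le> \<delta>" "\<delta> \<le> int_dist x"
  shows "cos (2 * pi * x) \<le> cos (2 * pi * \<delta>)"
proof -
  define e where "e = x - of_int (round x)"
  have e: "\<bar>e\<bar> = int_dist x" "\<bar>e\<bar> \<le> 1/2"
    using of_int_round_abs_le[of x] by (auto simp: e_def int_dist_def abs_minus_commute)
  have x: "2 * pi * x = 2 * pi * e + 2 * pi * of_int (round x)" by (simp add: e_def algebra_simps)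
  have "cos (2 * pi * x) = cos (2 * pi * e)"
    unfolding x by (simp add: cos_add)
  also have "\<dots> = cos (2 * pi * \<bar>e\<bar>)" by (auto simp: abs_if)
  also have "\<dots> \<le> cos (2 * pi * \<delta>)"
    using assms e by (intro cos_monotone_0_pi_le) auto
  finally show ?thesis .
qed

text \<open>The digits \<open>d\<close> and \<open>d'\<close> carry weight at least \<open>c\<close>
  each, and their phases at \<open>t\<close> differ by \<open>2 * pi * x\<close> with
  \<open>x\<close> at distance at least \<open>\<delta>\<close> from the integers. Two such unit
  vectors have a sum of modulus at most \<open>s < 2\<close>, which takes \<open>c * (2 - s)\<close>
  off the trivial bound 1.\<close>

lemma char_digit_law_bound:
  assumes fin: "finite (set_pmf \<rho>)" and d: "d \<in> set_pmf \<rho>" "d' \<in> set_pmf \<rho>" "d \<noteq> d'" and \<delta>: "0 < \<delta>" "\<delta> < 1/2"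
  obtains \<theta> where "0 < \<theta>" "\<theta> < 1" "\<And>t. \<delta> \<le> int_dist ((d' - d) / (2 * pi) * t) \<Longrightarrow> cmod (char (digit_law \<rho>) t) \<le> \<theta>"
proof -
  define c where "c = min (pmf \<rho> d) (pmf \<rho> d')"
  have c: "0 < c" "c \<le> pmf \<rho> d" "c \<le> pmf \<rho> d'" using d by (auto simp: c_def pmf_positive)
  define s where "s = sqrt (2 + 2 * cos (2 * pi * \<delta>))"
  have "cos (2 * pi * \<delta>) < cos 0" using \<delta> by (intro cos_monotone_0_pi) auto
  then have "s < sqrt 4" unfolding s_def by (intro real_sqrt_less_mono) simp
  then have s2: "s < 2" by simp
  \<comment> \<open>The value 1/2 guarantees that \<open>\<theta>\<close> is positive.\<close>
  define \<theta> where "\<theta> = max (1/2) (1 - c * (2 - s))"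
  have "cmod (char (digit_law \<rho>) t) \<le> \<theta>" if t: "\<delta> \<le> int_dist ((d' - d) / (2 * pi) * t)" for t
  proof -
    let ?e = "\<lambda>x. of_real (pmf \<rho> x) * iexp (t * x)"
    let ?S = "set_pmf \<rho> - {d, d'}"
    have split: "(\<Sum>x\<in>set_pmf \<rho>. h x) = h d + h d' + (\<Sum>x\<in>?S. h x)" for h :: "real \<Rightarrow> 'b::comm_monoid_add"
      using fin d by (subst sum.remove[of _ d], simp, simp, subst sum.remove[of _ d'], simp, simp)
        (simp add: add.assoc Diff_insert2[symmetric] insert_commute)
    have one: "pmf \<rho> d + pmf \<rho> d' + (\<Sum>x\<in>?S. pmf \<rho> x) = 1"
      unfolding split[symmetric] using fin by (intro sum_pmf_eq_1) auto
    have "cmod (iexp (t * d) + iexp (t * d')) \<le> s"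
    proof -
      define x where "x = (d' - d) / (2 * pi) * t"
      have "iexp (t * d') = iexp (t * d) * cis (t * d' - t * d)"
        unfolding cis_conv_exp exp_add[symmetric] by (simp add: algebra_simps)
      also have "t * d' - t * d = 2 * pi * x" by (simp add: x_def field_simps)
      finally have "iexp (t * d) + iexp (t * d') = iexp (t * d) * (1 + cis (2 * pi * x))"
        by (simp add: distrib_left)
      then have "cmod (iexp (t * d) + iexp (t * d')) = cmod (1 + cis (2 * pi * x))"
        by (simp add: norm_mult)
      also have "\<dots> = sqrt (2 + 2 * cos (2 * pi * x))"
      proof -
        have "(1 + cos y)\<^sup>2 + (sin y)\<^sup>2 = 2 + 2 * cos y" for y :: real
          using sin_cos_squared_add[of y] by (simp add: power2_eq_square algebra_simps)
        then show ?thesis by (simp add: cmod_def)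
      qed
      also have "\<dots> \<le> s"
        unfolding s_def using cos_le_if_int_dist_ge[of \<delta> x] t \<delta> by (simp add: x_def)
      finally show ?thesis .
    qed
    then have pair: "c * cmod (iexp (t * d) + iexp (t * d')) \<le> c * s" using c by (intro mult_left_mono) auto
    have "?e d + ?e d' = of_real (pmf \<rho> d - c) * iexp (t * d) + of_real (pmf \<rho> d' - c) * iexp (t * d')
        + of_real c * (iexp (t * d) + iexp (t * d'))"
      by (simp add: algebra_simps)
    then have "cmod (?e d + ?e d') \<le> cmod (of_real (pmf \<rho> d - c) * iexp (t * d)) + cmod (of_real (pmf \<rho> d' - c) * iexp (t * d'))
        + cmod (of_real c * (iexp (t * d) + iexp (t * d')))"
      by (simp only:) (intro order.trans[OF norm_triangle_ineq] add_mono norm_triangle_ineq order_refl)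
    also have "\<dots> \<le> (pmf \<rho> d - c) + (pmf \<rho> d' - c) + c * s"
      using c pair by (simp only: norm_mult norm_of_real norm_exp_i_times) simp
    finally have de: "cmod (?e d + ?e d') \<le> pmf \<rho> d + pmf \<rho> d' - 2 * c + c * s" by simp
    have "cmod (\<Sum>x\<in>?S. ?e x) \<le> (\<Sum>x\<in>?S. pmf \<rho> x)"
      by (rule order.trans[OF norm_sum]) (simp only: norm_mult norm_of_real norm_exp_i_times, simp)
    then have "cmod (char (digit_law \<rho>) t) \<le> (pmf \<rho> d + pmf \<rho> d' - 2 * c + c * s) + (\<Sum>x\<in>?S. pmf \<rho> x)"
      unfolding char_digit_law[OF fin] split by (rule order.trans[OF norm_triangle_ineq add_mono[OF de]])
    also have "\<dots> = 1 - c * (2 - s)" using one by (simp add: algebra_simps)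
    finally show ?thesis by (simp add: \<theta>_def)
  qed
  moreover have "0 < \<theta>" "\<theta> < 1" using c s2 by (auto simp: \<theta>_def)
  ultimately show ?thesis using that by blast
qed

lemma exists_separated_self_similar:
  assumes lam: "0 < \<bar>lam\<bar>" "\<bar>lam\<bar> < 1" and att: "is_attractor lam a m K" and sep: "strong_separation lam a m K"
    and pv: "prob_vector m w" and ss: "self_similar_measure lam a m K w \<mu>"
  shows "\<exists>\<rho>. separated_self_similar lam K \<rho> \<mu> \<and> (AE x in \<mu>. x \<in> K)"
proof -
  define w' where "w' i = (if i \<in> {1..m} then w i else 0)" for i
  have w0: "0 \<le> w' i" for i using pv by (auto simp: w'_def prob_vector_def)
  have "(\<integral>\<^sup>+i. ennreal (w' i) \<partial>count_space UNIV) = (\<integral>\<^sup>+i. ennreal (w' i) * indicator {1..m} i \<partial>count_space UNIV)"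
    by (intro nn_integral_cong) (auto simp: w'_def indicator_def)
  also have "\<dots> = (\<integral>\<^sup>+i. ennreal (w' i) \<partial>count_space {1..m})"
    by (simp add: nn_integral_count_space_indicator)
  also have "\<dots> = (\<Sum>i=1..m. ennreal (w' i))" by (simp add: nn_integral_count_space_finite)
  also have "\<dots> = ennreal (\<Sum>i=1..m. w' i)" using w0 by simp
  also have "(\<Sum>i=1..m. w' i) = 1" using pv by (simp add: w'_def prob_vector_def)
  finally have w1: "(\<integral>\<^sup>+i. ennreal (w' i) \<partial>count_space UNIV) = 1" by simp
  define W where "W = embed_pmf w'"
  have pmfW: "pmf W i = w' i" for i unfolding W_def by (rule pmf_embed_pmf[OF w0 w1])
  have setW: "set_pmf W \<subseteq> {1..m}" by (auto simp: set_pmf_iff pmfW w'_def split: if_splits)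
  define \<rho> where "\<rho> = map_pmf a W"
  have \<mu>: "real_distribution \<mu>" using ss
    by (simp add: self_similar_measure_def real_distribution_def real_distribution_axioms_def)
  interpret \<mu>: real_distribution \<mu> by (rule \<mu>)
  have finW: "finite (set_pmf W)" by (rule finite_subset[OF setW]) simp
  have \<mu>_eq: "\<mu> = lcomb lam (digit_law \<rho>) \<mu>"
  proof (rule measure_eqI)
    fix A assume "A \<in> sets \<mu>"
    then have [measurable]: "A \<in> sets borel" by simp
    have [measurable]: "ifs_map lam a i \<in> borel_measurable borel" for i unfolding ifs_map_def by measurable
    have "emeasure \<mu> A = (\<Sum>i=1..m. ennreal (w i) * emeasure (distr \<mu> borel (ifs_map lam a i)) A)"
      using ss by (simp add: self_similar_measure_def)
    also have "\<dots> = (\<Sum>i=1..m. ennreal (pmf W i) * (\<integral>\<^sup>+x. indicator A (a i + lam * x) \<partial>\<mu>))"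
    proof (intro sum.cong refl)
      fix i assume i: "i \<in> {1..m}"
      have "emeasure (distr \<mu> borel (ifs_map lam a i)) A = (\<integral>\<^sup>+z. indicator A z \<partial>distr \<mu> borel (ifs_map lam a i))" by simp
      also have "\<dots> = (\<integral>\<^sup>+x. indicator A (a i + lam * x) \<partial>\<mu>)"
        by (subst nn_integral_distr) (auto simp: ifs_map_def add.commute)
      finally show "ennreal (w i) * emeasure (distr \<mu> borel (ifs_map lam a i)) A = ennreal (pmf W i) * (\<integral>\<^sup>+x. indicator A (a i + lam * x) \<partial>\<mu>)"
        using i by (simp add: pmfW w'_def)
    qed
    also have "\<dots> = (\<Sum>i\<in>set_pmf W. ennreal (pmf W i) * (\<integral>\<^sup>+x. indicator A (a i + lam * x) \<partial>\<mu>))"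
      using setW by (intro sum.mono_neutral_right) (auto simp: set_pmf_iff)
    also have "\<dots> = (\<integral>\<^sup>+i. (\<integral>\<^sup>+x. indicator A (a i + lam * x) \<partial>\<mu>) \<partial>measure_pmf W)"
      using finW by (simp add: nn_integral_measure_pmf_finite mult.commute)
    also have "\<dots> = (\<integral>\<^sup>+d. (\<integral>\<^sup>+x. indicator A (d + lam * x) \<partial>\<mu>) \<partial>digit_law \<rho>)"
      unfolding digit_law_def \<rho>_def by (subst nn_integral_distr) auto
    also have "\<dots> = (\<integral>\<^sup>+z. indicator A z \<partial>lcomb lam (digit_law \<rho>) \<mu>)"
      by (rule nn_integral_lcomb[symmetric]) (auto intro: real_distribution_imp_finite_borel real_distribution_digit_law \<mu>)
    finally show "emeasure \<mu> A = emeasure (lcomb lam (digit_law \<rho>) \<mu>) A" by simp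
  qed simp
  have K: "compact K" "K \<noteq> {}" and K_eq: "K = (\<Union>i\<in>{1..m}. ifs_map lam a i ` K)"
    using att by (auto simp: is_attractor_def)
  have "separated_self_similar lam K \<rho> \<mu>"
  proof (unfold_locales)
    show "finite (set_pmf \<rho>)" using finW by (simp add: \<rho>_def)
    fix d x assume "d \<in> set_pmf \<rho>" "x \<in> K"
    then obtain i where "i \<in> {1..m}" "d = a i" using setW by (auto simp: \<rho>_def)
    then have "d + lam * x = ifs_map lam a i x" "i \<in> {1..m}" by (auto simp: ifs_map_def)
    then have "d + lam * x \<in> (\<Union>i\<in>{1..m}. ifs_map lam a i ` K)" using \<open>x \<in> K\<close> by blast
    then show "d + lam * x \<in> K" unfolding K_eq[symmetric] .
  next
    fix d d' x x' assume d: "d \<in> set_pmf \<rho>" "d' \<in> set_pmf \<rho>" "d \<noteq> d'" and x: "x \<in> K" "x' \<in> K"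
    have "\<exists>i\<in>{1..m}. e = a i" if "e \<in> set_pmf \<rho>" for e using that setW by (auto simp: \<rho>_def)
    then obtain i j where ij: "i \<in> {1..m}" "d = a i" "j \<in> {1..m}" "d' = a j" using d(1,2) by blast
    then have "i \<noteq> j" using d(3) by auto
    then have "ifs_map lam a i ` K \<inter> ifs_map lam a j ` K = {}"
      using sep ij(1,3) unfolding strong_separation_def by blast
    moreover have "d + lam * x = ifs_map lam a i x" "d' + lam * x' = ifs_map lam a j x'"
      using ij by (auto simp: ifs_map_def)
    ultimately show "d + lam * x \<noteq> d' + lam * x'" using x by auto
  qed (rule lam \<mu> \<mu>_eq K)+
  moreover have "AE x in \<mu>. x \<in> K"
  proof (rule AE_I)
    show "emeasure \<mu> (- K) = 0" using ss by (simp add: self_similar_measure_def)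
    show "- K \<in> sets \<mu>" using K(1) by (simp add: compact_imp_closed borel_closed)
  qed auto
  ultimately show ?thesis by blast
qed

section \<open>Weights, scalings and the choice of energies\<close>

lemma power_sum_antimono:
  assumes "q \<le> q'"
  shows "power_sum q' \<rho> \<le> power_sum q \<rho>"
  unfolding power_sum_def using assms
  by (intro sum_mono powr_mono') (auto simp: pmf_le_1)

lemma two_digits_if_power_sum_less_1:
  assumes W: "power_sum q \<rho> < 1"
  obtains d d' where "d \<in> set_pmf \<rho>" "d' \<in> set_pmf \<rho>" "d \<noteq> d'"
proof -
  obtain d where d: "d \<in> set_pmf \<rho>" using set_pmf_not_empty[of \<rho>] by blast
  have "\<exists>d'\<in>set_pmf \<rho>. d' \<noteq> d"
  proof (rule ccontr)
    assume "\<not> ?thesis"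
    then have eq: "set_pmf \<rho> = {d}" using d by blast
    have "(\<Sum>x\<in>{d}. pmf \<rho> x) = 1" by (rule sum_pmf_eq_1) (simp_all add: eq)
    then show False using W unfolding power_sum_def eq by simp
  qed
  then show ?thesis using that d by blast
qed

lemma real_distribution_scale: "real_distribution M \<Longrightarrow> real_distribution (distr M borel (\<lambda>x. u * x))"
  unfolding real_distribution_def real_distribution_axioms_def
  by (auto intro!: prob_space.prob_space_distr cong: measurable_cong_sets)

lemma char_scale:
  assumes "real_distribution M"
  shows "char (distr M borel (\<lambda>x. u * x)) t = char M (u * t)"
proof -
  interpret real_distribution M by fact
  show ?thesis unfolding char_def by (subst integral_distr) (auto simp: mult_ac)
qed

lemma ball_moment_scale:
  assumes M: "real_distribution M" and u: "u \<noteq> 0"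
  shows "ball_moment q (distr M borel (\<lambda>x. u * x)) r = ball_moment q M (r / \<bar>u\<bar>)"
proof -
  interpret M: real_distribution M by fact
  let ?B = "distr M borel (\<lambda>x. u * x)"
  have Bf: "finite_borel_measure ?B" by (intro real_distribution_imp_finite_borel real_distribution_scale M)
  note [measurable] = borel_measurable_measure_cball[OF Bf]
  have "measure ?B (cball (u * x) r) = measure M (cball x (r / \<bar>u\<bar>))" for x
  proof -
    have "(\<lambda>x. u * x) -` cball (u * x) r = cball x (r / \<bar>u\<bar>)"
    proof -
      have "\<bar>u * x - u * y\<bar> \<le> r \<longleftrightarrow> \<bar>x - y\<bar> \<le> r / \<bar>u\<bar>" for y
        using u by (simp add: pos_le_divide_eq mult.commute flip: abs_mult right_diff_distrib)
      then show ?thesis by (auto simp: dist_real_def)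
    qed
    then show ?thesis by (subst measure_distr) auto
  qed
  then show ?thesis unfolding ball_moment_def by (subst nn_integral_distr) auto
qed

text \<open>The dimensions are suprema over exponents in \<open>{0..1}\<close> with finite energy,
  hence at most 1, and the strict inequality leaves room to choose such an exponent for each
  measure.\<close>

lemma Ls_dim_gt_1D:
  assumes s: "1 < s" and gt: "Ls_dim s \<mu>1 + Ls_dim s \<mu>2 > 1"
  obtains t1 t2 where "0 \<le> t1" "0 \<le> t2" "t1 \<le> 1" "t2 \<le> 1" "1 < t1 + t2"
    "(\<integral>\<^sup>+x. ennpowr (\<integral>\<^sup>+y. riesz_kernel t1 x y \<partial>\<mu>1) (s - 1) \<partial>\<mu>1) < \<infinity>"
    "(\<integral>\<^sup>+x. ennpowr (\<integral>\<^sup>+y. riesz_kernel t2 x y \<partial>\<mu>2) (s - 1) \<partial>\<mu>2) < \<infinity>"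
proof -
  define T where "T \<mu> = {t\<in>{0..1}. (\<integral>\<^sup>+x. ennpowr (\<integral>\<^sup>+y. riesz_kernel t x y \<partial>\<mu>) (s - 1) \<partial>\<mu>) < \<infinity>}" for \<mu> :: "real measure"
  have D: "Ls_dim s \<mu> = (SUP t\<in>T \<mu>. ereal t)" for \<mu> using s by (simp add: Ls_dim_def T_def)
  have le1: "Ls_dim s \<mu> \<le> 1" for \<mu> unfolding D by (intro SUP_least) (auto simp: T_def)
  have "1 - Ls_dim s \<mu>2 < Ls_dim s \<mu>1"
    using gt le1[of \<mu>2] le1[of \<mu>1] by (cases "Ls_dim s \<mu>1"; cases "Ls_dim s \<mu>2") (auto simp: one_ereal_def)
  then obtain t1 where t1: "t1 \<in> T \<mu>1" "1 - Ls_dim s \<mu>2 < ereal t1" unfolding D[of \<mu>1] less_SUP_iff by blast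
  have "ereal (1 - t1) < Ls_dim s \<mu>2"
    using t1(2) le1[of \<mu>2] by (cases "Ls_dim s \<mu>2") (auto simp: one_ereal_def)
  then obtain t2 where t2: "t2 \<in> T \<mu>2" "ereal (1 - t1) < ereal t2" unfolding D[of \<mu>2] less_SUP_iff by blast
  show ?thesis using that[of t1 t2] t1 t2 by (auto simp: T_def)
qed

lemma hausdorff_dim_empty: "hausdorff_dim ({} :: 'a::metric_space set) = 0"
proof -
  have 0: "hausdorff_measure s ({} :: 'a set) = 0" if "0 < s" for s
    by (rule hausdorff_measure_limsup_eq_0[where W = "\<lambda>_. {}" and d = "\<lambda>_. 0"]) (use that in auto)
  have le: "hausdorff_dim ({} :: 'a set) \<le> 0 + ennreal e" if "0 < e" for e
    unfolding hausdorff_dim_def using 0[OF that] that by (intro INF_lower2[of e]) auto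
  have "hausdorff_dim ({} :: 'a set) \<le> 0" by (rule ennreal_le_epsilon) (rule le)
  then show ?thesis by simp
qed

lemma convolution_smooth_bounded:
  assumes S1: "separated_self_similar lam1 K1 \<rho>1 \<mu>1" and K1: "AE x in \<mu>1. x \<in> K1"
    and S2: "separated_self_similar lam2 K2 \<rho>2 \<mu>2" and K2: "AE x in \<mu>2. x \<in> K2"
    and irr: "ln \<bar>lam2\<bar> / ln \<bar>lam1\<bar> \<notin> \<rat>" and s: "1 < s" "s \<le> 2" and dim: "Ls_dim s \<mu>1 + Ls_dim s \<mu>2 > 1"
  shows "\<exists>E :: real set. hausdorff_dim E = 0 \<and> (\<forall>u. u \<notin> E \<longrightarrow> (\<exists>S. \<forall>n.
    (\<integral>\<^sup>+x. ennreal (smooth ((1/2) ^ n) (lcomb 1 \<mu>1 (distr \<mu>2 borel (\<lambda>x. u * x))) x powr s) \<partial>lborel) \<le> ennreal S))"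
proof -
  interpret S1: separated_self_similar lam1 K1 \<rho>1 \<mu>1 by fact
  interpret S2: separated_self_similar lam2 K2 \<rho>2 \<mu>2 by fact
  note fin = real_distribution_imp_finite_borel
  obtain t1 t2 where t: "0 \<le> t1" "0 \<le> t2" "t1 \<le> 1" "t2 \<le> 1" "1 < t1 + t2"
    and E1: "(\<integral>\<^sup>+x. ennpowr (\<integral>\<^sup>+y. riesz_kernel t1 x y \<partial>\<mu>1) (s - 1) \<partial>\<mu>1) < \<infinity>"
    and E2: "(\<integral>\<^sup>+x. ennpowr (\<integral>\<^sup>+y. riesz_kernel t2 x y \<partial>\<mu>2) (s - 1) \<partial>\<mu>2) < \<infinity>"
    using Ls_dim_gt_1D[OF s(1) dim] .
  define T where "T = t1 + t2"
  have T: "1 < T" "T \<le> 2" "0 < t1" "0 < t2" using t by (auto simp: T_def)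
  \<comment> \<open>Half of the excess \<open>T - 1\<close> is spent on raising the exponent from
    \<open>s\<close> to \<open>q\<close>; the other half covers the subsampling loss. The cap 2 is
    what the averaging over slopes allows, and for \<open>s = 2\<close> it forces
    \<open>q = 2\<close>.\<close>
  define q where "q = min 2 (s + (s - 1) * (T - 1) / 2)"
  have gap: "0 < (s - 1) * (T - 1) / 2" using s T by simp
  have q: "1 < q" "q \<le> 2" "s < q \<and> q \<le> 2 \<or> s = 2 \<and> q = 2" "s \<le> q"
    using s gap by (auto simp: q_def min_def)
  have q_le: "q - 1 \<le> (s - 1) * ((T + 1) / 2)"
  proof -
    have "q - 1 \<le> s + (s - 1) * (T - 1) / 2 - 1" by (simp add: q_def)
    also have "\<dots> = (s - 1) * ((T + 1) / 2)" by (simp add: field_simps)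
    finally show ?thesis .
  qed
  obtain k0 :: nat where k0: "2 * T / (T - 1) < real k0" using reals_Archimedean2 by blast
  \<comment> \<open>Even, so that \<open>lam1 ^ k\<close> and \<open>lam2 ^ k\<close> are positive
    whatever the signs of the ratios; large, so that \<open>T * (k - 1) / k\<close> exceeds
    \<open>(T + 1) / 2\<close>.\<close>
  define k where "k = 2 * (k0 + 1)"
  have k: "1 \<le> k" "even k" "0 < real k" by (auto simp: k_def)
  have kT: "(T + 1) / 2 < T * (real (k - 1) / real k)"
  proof -
    have "2 * T / (T - 1) < real k" using k0 by (simp add: k_def)
    then have "2 * T < real k * (T - 1)" using T by (simp add: field_simps)
    then have "(T + 1) * real k < 2 * T * (real k - 1)" by (simp add: algebra_simps)
    then show ?thesis using k by (simp add: of_nat_diff field_simps)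
  qed
  define a1 where "a1 = t1 * (s - 1)"
  define a2 where "a2 = t2 * (s - 1)"
  define b1 where "b1 = a1 * real (k - 1) / real k"
  define b2 where "b2 = a2 * real (k - 1) / real k"
  have a0: "0 < a1" "0 < a2" using T s by (auto simp: a1_def a2_def)
  have b12: "q - 1 < b1 + b2"
  proof -
    have "(s - 1) * ((T + 1) / 2) < (s - 1) * (T * (real (k - 1) / real k))"
      using kT s by (intro mult_strict_left_mono) auto
    also have "\<dots> = b1 + b2" by (simp add: b1_def b2_def a1_def a2_def T_def add_divide_distrib algebra_simps)
    finally show ?thesis using q_le by linarith
  qed
  have W1s: "power_sum s \<rho>1 \<le> \<bar>lam1\<bar> powr a1" unfolding a1_def by (intro S1.power_sum_le E1 t s K1)
  have W2s: "power_sum s \<rho>2 \<le> \<bar>lam2\<bar> powr a2" unfolding a2_def by (intro S2.power_sum_le E2 t s K2)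
  \<comment> \<open>Raising the exponent only decreases power sums, so the energies at exponent
    \<open>s\<close> serve for \<open>q\<close> as well.\<close>
  have W1: "power_sum q \<rho>1 \<le> \<bar>lam1\<bar> powr a1" using power_sum_antimono[OF q(4)] W1s by (rule order.trans)
  have W2: "power_sum q \<rho>2 \<le> \<bar>lam2\<bar> powr a2" using power_sum_antimono[OF q(4)] W2s by (rule order.trans)
  have lt1: "\<bar>lam1\<bar> powr a1 < 1" "\<bar>lam2\<bar> powr a2 < 1"
    using powr_less_mono'[of "\<bar>lam1\<bar>" 0 a1] powr_less_mono'[of "\<bar>lam2\<bar>" 0 a2] S1.c S2.c a0 by auto
  obtain \<mu>1' \<nu>1 D1 R1 C1 where \<mu>1': "real_distribution \<mu>1'" and \<nu>1: "real_distribution \<nu>1" and D1: "real_distribution D1"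
    and ch1: "\<And>t. char \<mu>1 t = char \<mu>1' t * char \<nu>1 t" and \<nu>1_eq: "\<nu>1 = lcomb (lam1 ^ k) (digit_law \<rho>1) \<nu>1"
    and \<mu>1'_eq: "\<mu>1' = lcomb (lam1 ^ k) D1 \<mu>1'" and R1: "AE x in \<mu>1'. \<bar>x\<bar> \<le> R1" and C1: "0 < C1"
    and m1: "\<And>r. 0 < r \<Longrightarrow> ball_moment q \<mu>1' r \<le> ennreal (C1 * r powr b1)"
    using S1.subsampling[OF q(1) less_imp_le[OF a0(1)] W1 k(1)] unfolding b1_def by blast
  obtain \<mu>2' \<nu>2 D2 R2 C2 where \<mu>2': "real_distribution \<mu>2'" and \<nu>2: "real_distribution \<nu>2" and D2: "real_distribution D2"
    and ch2: "\<And>t. char \<mu>2 t = char \<mu>2' t * char \<nu>2 t" and \<nu>2_eq: "\<nu>2 = lcomb (lam2 ^ k) (digit_law \<rho>2) \<nu>2"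
    and \<mu>2'_eq: "\<mu>2' = lcomb (lam2 ^ k) D2 \<mu>2'" and R2: "AE x in \<mu>2'. \<bar>x\<bar> \<le> R2" and C2: "0 < C2"
    and m2: "\<And>r. 0 < r \<Longrightarrow> ball_moment q \<mu>2' r \<le> ennreal (C2 * r powr b2)"
    using S2.subsampling[OF q(1) less_imp_le[OF a0(2)] W2 k(1)] unfolding b2_def by blast
  define \<alpha> where "\<alpha> = lam1 ^ k"
  define \<beta> where "\<beta> = lam2 ^ k"
  have \<alpha>_abs: "\<alpha> = \<bar>lam1\<bar> ^ k" and \<beta>_abs: "\<beta> = \<bar>lam2\<bar> ^ k"
    using k(2) by (auto simp: \<alpha>_def \<beta>_def power_even_abs)
  have \<alpha>: "0 < \<alpha>" "\<alpha> < 1" and \<beta>: "0 < \<beta>" "\<beta> < 1"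
    using S1.c S2.c k(1) unfolding \<alpha>_abs \<beta>_abs by (auto simp: power_less_one_iff)
  \<comment> \<open>With this choice \<open>2 * \<delta>1 * (1 / \<alpha> + 1) = 1/2\<close>, half
    of what the covering argument allows.\<close>
  define \<delta>1 where "\<delta>1 = 1 / (4 * (1 / \<alpha> + 1))"
  define \<delta>2 where "\<delta>2 = 1 / (4 * (1 / \<beta> + 1))"
  have \<delta>1: "0 < \<delta>1" "\<delta>1 < 1/2" "2 * \<delta>1 * (1 / \<alpha> + 1) < 1"
    and \<delta>2: "0 < \<delta>2" "\<delta>2 < 1/2" "2 * \<delta>2 * (1 / \<beta> + 1) < 1"
  proof -
    have "1 < 1 / \<alpha> + 1" "1 < 1 / \<beta> + 1" using \<alpha> \<beta> by auto
    moreover have "0 < 1 / (4 * y)" "1 / (4 * y) < 1/2" "2 * (1 / (4 * y)) * y < 1" if "1 < y" for y :: real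
      using that by (auto simp: divide_less_eq)
    ultimately show "0 < \<delta>1" "\<delta>1 < 1/2" "2 * \<delta>1 * (1 / \<alpha> + 1) < 1" "0 < \<delta>2" "\<delta>2 < 1/2" "2 * \<delta>2 * (1 / \<beta> + 1) < 1"
      unfolding \<delta>1_def \<delta>2_def by blast+
  qed
  \<comment> \<open>A single digit would have power sum 1. So each measure has two digits, whose
    interference produces the decay.\<close>
  have W_lt: "power_sum q \<rho>1 < 1" "power_sum q \<rho>2 < 1" using W1 W2 lt1 by linarith+
  obtain d1 d1' where d1: "d1 \<in> set_pmf \<rho>1" "d1' \<in> set_pmf \<rho>1" "d1 \<noteq> d1'"
    using two_digits_if_power_sum_less_1[OF W_lt(1)] .
  obtain d2 d2' where d2: "d2 \<in> set_pmf \<rho>2" "d2' \<in> set_pmf \<rho>2" "d2 \<noteq> d2'"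
    using two_digits_if_power_sum_less_1[OF W_lt(2)] .
  obtain \<theta>1 where \<theta>1: "0 < \<theta>1" "\<theta>1 < 1" "\<And>t. \<delta>1 \<le> int_dist ((d1' - d1) / (2 * pi) * t) \<Longrightarrow> cmod (char (digit_law \<rho>1) t) \<le> \<theta>1"
    using char_digit_law_bound[OF S1.fin d1 \<delta>1(1,2)] by blast
  obtain \<theta>2 where \<theta>2: "0 < \<theta>2" "\<theta>2 < 1" "\<And>t. \<delta>2 \<le> int_dist ((d2' - d2) / (2 * pi) * t) \<Longrightarrow> cmod (char (digit_law \<rho>2) t) \<le> \<theta>2"
    using char_digit_law_bound[OF S2.fin d2 \<delta>2(1,2)] by blast
  have char_\<nu>1: "char \<nu>1 t = char (digit_law \<rho>1) t * char \<nu>1 (\<alpha> * t)" for t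
    unfolding \<alpha>_def by (subst \<nu>1_eq) (rule char_lcomb[OF fin[OF real_distribution_digit_law] fin[OF \<nu>1]])
  have char_\<nu>2: "char \<nu>2 t = char (digit_law \<rho>2) t * char \<nu>2 (\<beta> * t)" for t
    unfolding \<beta>_def by (subst \<nu>2_eq) (rule char_lcomb[OF fin[OF real_distribution_digit_law] fin[OF \<nu>2]])
  interpret EK: Erdos_Kahane "char \<nu>1" "char \<nu>2" "char (digit_law \<rho>1)" "char (digit_law \<rho>2)" \<alpha> \<beta>
    "(d1' - d1) / (2 * pi)" "(d2' - d2) / (2 * pi)" \<delta>1 \<delta>2 "max \<theta>1 \<theta>2"
  proof (unfold_locales)
    show "char \<nu>1 t = char (digit_law \<rho>1) t * char \<nu>1 (\<alpha> * t)" for t by (rule char_\<nu>1)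
    show "char \<nu>2 t = char (digit_law \<rho>2) t * char \<nu>2 (\<beta> * t)" for t by (rule char_\<nu>2)
    show "cmod (char (digit_law \<rho>1) t) \<le> max \<theta>1 \<theta>2" if "\<delta>1 \<le> int_dist ((d1' - d1) / (2 * pi) * t)" for t
      using \<theta>1(3)[OF that] by simp
    show "cmod (char (digit_law \<rho>2) t) \<le> max \<theta>1 \<theta>2" if "\<delta>2 \<le> int_dist ((d2' - d2) / (2 * pi) * t)" for t
      using \<theta>2(3)[OF that] by simp
    show "0 < max \<theta>1 \<theta>2" "max \<theta>1 \<theta>2 < 1" using \<theta>1 \<theta>2 by auto
    show "(d1' - d1) / (2 * pi) \<noteq> 0" "(d2' - d2) / (2 * pi) \<noteq> 0" using d1 d2 by auto
    show "cmod (char \<nu>1 t) \<le> 1" "cmod (char \<nu>2 t) \<le> 1"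
      "cmod (char (digit_law \<rho>1) t) \<le> 1" "cmod (char (digit_law \<rho>2) t) \<le> 1" for t
      by (rule real_distribution.cmod_char_le_1, rule \<nu>1 \<nu>2 real_distribution_digit_law)+
  qed (rule \<alpha> \<beta> \<delta>1 \<delta>2)+
  obtain E where E: "0 \<in> E" "hausdorff_dim E = 0" "\<And>u. u \<notin> E \<Longrightarrow> EK.decays u"
    using EK.exists_hausdorff_dim_0 by blast
  have "\<exists>S. \<forall>n. (\<integral>\<^sup>+x. ennreal (smooth ((1/2) ^ n) (lcomb 1 \<mu>1 (distr \<mu>2 borel (\<lambda>x. u * x))) x powr s) \<partial>lborel) \<le> ennreal S"
    if u: "u \<notin> E" for u
  proof -
    have u0: "u \<noteq> 0" using E(1) u by auto
    define B where "B = distr \<mu>2' borel (\<lambda>x. u * x)"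
    define DB where "DB = distr D2 borel (\<lambda>x. u * x)"
    have B: "real_distribution B" and DB: "real_distribution DB"
      unfolding B_def DB_def by (intro real_distribution_scale \<mu>2' D2)+
    have char_B: "char B t = char \<mu>2' (u * t)" for t unfolding B_def by (rule char_scale[OF \<mu>2'])
    have B_eq: "B = lcomb \<beta> DB B"
    proof (rule Levy_uniqueness[OF B real_distribution_lcomb[OF DB B]], rule ext)
      fix t
      have "char B t = char (lcomb (lam2 ^ k) D2 \<mu>2') (u * t)" using char_B \<mu>2'_eq by simp
      also have "\<dots> = char D2 (u * t) * char \<mu>2' (lam2 ^ k * (u * t))" by (rule char_lcomb[OF fin[OF D2] fin[OF \<mu>2']])
      also have "\<dots> = char DB t * char B (\<beta> * t)"
        unfolding DB_def char_scale[OF D2] char_B by (simp add: \<beta>_def mult_ac)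
      also have "\<dots> = char (lcomb \<beta> DB B) t" by (rule char_lcomb[OF fin[OF DB] fin[OF B], symmetric])
      finally show "char B t = char (lcomb \<beta> DB B) t" .
    qed
    define R where "R = max 1 (max R1 (\<bar>u\<bar> * R2))"
    have bdA: "AE x in \<mu>1'. \<bar>x\<bar> \<le> R" using R1 by eventually_elim (simp add: R_def)
    have bdB: "AE x in B. \<bar>x\<bar> \<le> R"
    proof -
      interpret M2: real_distribution \<mu>2' by (rule \<mu>2')
      have "AE x in \<mu>2'. \<bar>u * x\<bar> \<le> R"
        using R2
      proof eventually_elim
        case (elim x)
        then have "\<bar>u * x\<bar> \<le> \<bar>u\<bar> * R2" unfolding abs_mult by (rule mult_left_mono) simp
        then show ?case by (simp add: R_def)
      qed
      then show ?thesis unfolding B_def by (subst AE_distr_iff) auto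
    qed
    define C2' where "C2' = C2 * (1 / \<bar>u\<bar>) powr b2"
    have mB: "ball_moment q B r \<le> ennreal (C2' * r powr b2)" if "0 < r" for r
    proof -
      have "ball_moment q B r = ball_moment q \<mu>2' (r / \<bar>u\<bar>)" unfolding B_def by (rule ball_moment_scale[OF \<mu>2' u0])
      also have "\<dots> \<le> ennreal (C2 * (r / \<bar>u\<bar>) powr b2)" using that u0 by (intro m2) auto
      also have "C2 * (r / \<bar>u\<bar>) powr b2 = C2' * r powr b2" using that u0 by (simp add: C2'_def powr_divide)
      finally show ?thesis .
    qed
    have irr': "ln \<alpha> / ln \<beta> \<notin> \<rat>"
    proof
      assume "ln \<alpha> / ln \<beta> \<in> \<rat>"
      then have "1 / (ln \<alpha> / ln \<beta>) \<in> \<rat>" by (rule Rats_divide[OF Rats_1])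
      moreover have "1 / (ln \<alpha> / ln \<beta>) = ln \<bar>lam2\<bar> / ln \<bar>lam1\<bar>"
        unfolding \<alpha>_abs \<beta>_abs using S1.c S2.c k by (simp add: ln_realpow)
      ultimately show False using irr by simp
    qed
    have dimB: "\<exists>C>0. \<forall>r. 0 < r \<longrightarrow> r \<le> 1 \<longrightarrow> ball_Lq q (lcomb 1 \<mu>1' B) r \<le> ennreal (C * r powr (q - \<delta>))"
      if "0 < \<delta>" "\<delta> < q" for \<delta>
    proof (rule ball_Lq_convolution_bound[OF \<alpha> \<beta> irr' \<mu>1' D1 _ B DB B_eq bdA bdB _ q(1,2) _ m1 _ mB b12 that])
      show "\<mu>1' = lcomb \<alpha> D1 \<mu>1'" unfolding \<alpha>_def by (rule \<mu>1'_eq)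
      show "1 \<le> R" by (simp add: R_def)
      show "0 \<le> C1" "0 \<le> C2'" using C1 C2 by (auto simp: C2'_def)
    qed
    define \<nu> where "\<nu> = lcomb u \<nu>1 \<nu>2"
    have \<nu>: "real_distribution \<nu>" unfolding \<nu>_def by (intro real_distribution_lcomb \<nu>1 \<nu>2)
    have char_\<nu>: "char \<nu> t = char \<nu>1 t * char \<nu>2 (u * t)" for t
      unfolding \<nu>_def by (rule char_lcomb[OF fin[OF \<nu>1] fin[OF \<nu>2]])
    obtain C \<sigma> where C\<sigma>: "0 < C" "0 < \<sigma>" and dec: "\<And>t. t \<noteq> 0 \<Longrightarrow> cmod (char \<nu> t) \<le> C * \<bar>t\<bar> powr - \<sigma>"
      using E(3)[OF u] unfolding EK.decays_def char_\<nu> by blast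
    have \<eta>: "real_distribution (lcomb 1 \<mu>1' B)" by (intro real_distribution_lcomb \<mu>1' B)
    have U: "real_distribution (distr \<mu>2 borel (\<lambda>x. u * x))" by (intro real_distribution_scale S2.\<mu>)
    \<comment> \<open>\<open>\<mu>1'\<close> and \<open>B\<close> carry the dimension,
      \<open>\<nu>\<close> the decay; the factorisations \<open>ch1\<close> and \<open>ch2\<close>
      reassemble the whole convolution.\<close>
    have "lcomb 1 \<mu>1 (distr \<mu>2 borel (\<lambda>x. u * x)) = lcomb 1 (lcomb 1 \<mu>1' B) \<nu>"
    proof (rule Levy_uniqueness[OF real_distribution_lcomb[OF S1.\<mu> U] real_distribution_lcomb[OF \<eta> \<nu>]], rule ext)
      fix t
      show "char (lcomb 1 \<mu>1 (distr \<mu>2 borel (\<lambda>x. u * x))) t = char (lcomb 1 (lcomb 1 \<mu>1' B) \<nu>) t"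
        unfolding char_lcomb[OF fin[OF S1.\<mu>] fin[OF U]] char_lcomb[OF fin[OF \<eta>] fin[OF \<nu>]] char_lcomb[OF fin[OF \<mu>1'] fin[OF B]]
          char_scale[OF S2.\<mu>] char_B char_\<nu> using ch1[of t] ch2[of "u * t"] by simp
    qed
    then show ?thesis
      using smooth_powr_bounded[OF \<eta> \<nu> C\<sigma> dec s q(3) dimB] by simp
  qed
  then show ?thesis using E(2) by blast
qed

theorem corollary3p6:
  fixes lam1 lam2 :: real and a1 a2 :: "nat \<Rightarrow> real" and m1 m2 :: nat
    and K1 K2 :: "real set" and w1 w2 :: "nat \<Rightarrow> real"
    and \<mu>1 \<mu>2 :: "real measure"
    and p :: real and q :: ennreal
  assumes "0 < \<bar>lam1\<bar>" "\<bar>lam1\<bar> < 1" "0 < \<bar>lam2\<bar>" "\<bar>lam2\<bar> < 1"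
    and "m1 \<ge> 1" "m2 \<ge> 1"
    and "is_attractor lam1 a1 m1 K1" "is_attractor lam2 a2 m2 K2"
    and "strong_separation lam1 a1 m1 K1" "strong_separation lam2 a2 m2 K2"
    and "ln \<bar>lam2\<bar> / ln \<bar>lam1\<bar> \<notin> \<rat>"
    and "ln (real m1) / \<bar>ln \<bar>lam1\<bar>\<bar> + ln (real m2) / \<bar>ln \<bar>lam2\<bar>\<bar> > 1"
    and "prob_vector m1 w1" "prob_vector m2 w2"
    and "self_similar_measure lam1 a1 m1 K1 w1 \<mu>1" "self_similar_measure lam2 a2 m2 K2 w2 \<mu>2"
    and "p > 1" "q \<ge> ennreal (2 * hoelder_conj p)"
    and "Ls_dim (crit_exponent p q) \<mu>1 + Ls_dim (crit_exponent p q) \<mu>2 > 1"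
  shows "\<exists>E :: real set. hausdorff_dim E = 0 \<and>
    (\<forall>u. u \<notin> E \<longrightarrow>
      (\<exists>C::real. C > 0 \<and>
        (\<forall>f \<in> Lp_space (ennreal p) \<mu>1.
          \<forall>g \<in> Lp_space (ennreal p) (distr \<mu>2 borel (\<lambda>x. u * x)).
            Lp_norm q lborel
              (\<lambda>\<xi>. fourier \<mu>1 f \<xi> * fourier (distr \<mu>2 borel (\<lambda>x. u * x)) g \<xi>)
            \<le> ennreal C * Lp_norm (ennreal p) \<mu>1 f
                * Lp_norm (ennreal p) (distr \<mu>2 borel (\<lambda>x. u * x)) g)))"
proof -
  have lam: "0 < \<bar>lam1\<bar>" "\<bar>lam1\<bar> < 1" "0 < \<bar>lam2\<bar>" "\<bar>lam2\<bar> < 1" and p: "p > 1"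
    and irr: "ln \<bar>lam2\<bar> / ln \<bar>lam1\<bar> \<notin> \<rat>" and qp: "q \<ge> ennreal (2 * hoelder_conj p)"
    by (rule assms)+
  obtain \<rho>1 where S1: "separated_self_similar lam1 K1 \<rho>1 \<mu>1" "AE x in \<mu>1. x \<in> K1"
    using exists_separated_self_similar[OF lam(1,2) assms(7,9,13,15)] by blast
  obtain \<rho>2 where S2: "separated_self_similar lam2 K2 \<rho>2 \<mu>2" "AE x in \<mu>2. x \<in> K2"
    using exists_separated_self_similar[OF lam(3,4) assms(8,10,14,16)] by blast
  have \<mu>1: "real_distribution \<mu>1" and \<mu>2: "real_distribution \<mu>2"
    using S1(1) S2(1) by (auto simp: separated_self_similar_def)
  show ?thesis
  proof (cases "q = \<infinity>")
    case True
    \<comment> \<open>Both transforms are bounded pointwise by the norms of the functions, so the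
      constant 1 works for every slope.\<close>
    have "Lp_norm q lborel (\<lambda>\<xi>. fourier \<mu>1 f \<xi> * fourier (distr \<mu>2 borel (\<lambda>x. u * x)) g \<xi>)
      \<le> ennreal 1 * Lp_norm (ennreal p) \<mu>1 f * Lp_norm (ennreal p) (distr \<mu>2 borel (\<lambda>x. u * x)) g"
      if "f \<in> Lp_space (ennreal p) \<mu>1" "g \<in> Lp_space (ennreal p) (distr \<mu>2 borel (\<lambda>x. u * x))" for u f g
      using bilinear_extension_infinity[OF \<mu>1 real_distribution_scale[OF \<mu>2] p that] by (simp add: True)
    then show ?thesis using hausdorff_dim_empty zero_less_one by (intro exI[of _ "{}"]) blast
  next
    case False
    define r where "r = enn2real q"
    have r: "q = ennreal r" "0 \<le> r" using False by (auto simp: r_def top.not_eq_extremum)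
    then have r2: "2 * (p / (p - 1)) \<le> r" using qp p by (simp add: hoelder_conj_def)
    then have rp: "2 * p \<le> r * (p - 1)" using p by (simp add: pos_divide_le_eq)
    have pr: "p < r * (p - 1)" using rp p by linarith
    have "2 < 2 * (p / (p - 1))" using p by (simp add: field_simps)
    then have r_gt: "2 < r" using r2 by linarith
    define s where "s = crit_exponent p q"
    have s_eq: "s = r * (p - 1) / (r * (p - 1) - p)"
      using False by (simp add: s_def crit_exponent_def r_def)
    have s: "1 < s" "s \<le> 2"
      using crit_exponent_bounds[OF p qp] pr p by (auto simp: s_def[symmetric] s_eq less_divide_eq)
    obtain E :: "real set" where E: "hausdorff_dim E = 0" and bd: "\<And>u. u \<notin> E \<Longrightarrow> \<exists>S. \<forall>n.
      (\<integral>\<^sup>+x. ennreal (smooth ((1/2) ^ n) (lcomb 1 \<mu>1 (distr \<mu>2 borel (\<lambda>x. u * x))) x powr s) \<partial>lborel) \<le> ennreal S"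
      using convolution_smooth_bounded[OF S1 S2 irr s] assms(19) unfolding s_def by blast
    have "\<exists>C::real. C > 0 \<and> (\<forall>f \<in> Lp_space (ennreal p) \<mu>1. \<forall>g \<in> Lp_space (ennreal p) (distr \<mu>2 borel (\<lambda>x. u * x)).
        Lp_norm q lborel (\<lambda>\<xi>. fourier \<mu>1 f \<xi> * fourier (distr \<mu>2 borel (\<lambda>x. u * x)) g \<xi>)
        \<le> ennreal C * Lp_norm (ennreal p) \<mu>1 f * Lp_norm (ennreal p) (distr \<mu>2 borel (\<lambda>x. u * x)) g)"
      if u: "u \<notin> E" for u
    proof -
      obtain S where "\<And>n. (\<integral>\<^sup>+x. ennreal (smooth ((1/2) ^ n) (lcomb 1 \<mu>1 (distr \<mu>2 borel (\<lambda>x. u * x))) x powr s) \<partial>lborel) \<le> ennreal S"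
        using bd[OF u] by blast
      then show ?thesis
        unfolding r(1) by (intro bilinear_extension[OF \<mu>1 real_distribution_scale[OF \<mu>2] p r_gt s_eq pr])
    qed
    then show ?thesis using E by blast
  qed
qed

end
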